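(* Let $\pi_{XY}:Y\to X$ be a finite-dimensional fiber bundle over an oriented $(n+1)$-dimensional manifold $X$, let $\mathcal L:J^1Y\to\Lambda^{n+1}X$ be a Lagrangian density, and let $\mathcal G$ be a Lie group (perhaps infinite-dimensional) with Lie algebra $\mathfrak g$ acting on $Y$ by $\pi_{XY}$-bundle automorphisms. Assume that the action of $\mathcal G$ on $Y$ is vertically transitive and that $\mathcal L$ is $\mathcal G$-equivariant. Then a local section $\phi$ of $Y$ is a solution to the Euler–Lagrange equations of $\mathcal L$ if and only if it satisfies the Noether conservation law $$\mathbf{d}\left[(j^1\phi)^*J^{\mathcal L}(\xi)\right]=0\qquad\text{for all }\xi\in\mathfrak g.$$
   Context: All manifolds and maps are $C^\infty$; $\lrcorner$ and $\mathbf{i}$ denote the interior product. $V_yY=\ker T_y\pi_{XY}$. The first jet bundle $J^1Y\to Y$ is the affine bundle whose fiber $J^1_yY$ over $y\in Y_x=\pi_{XY}^{-1}(x)$ is the set of linear maps $\gamma:T_xX\to T_yY$ with $T\pi_{XY}\circ\gamma=\mathrm{Id}$. Coordinates $x^\mu$ ($\mu=0,\dots,n$) on $X$ and fiber coordinates $y^A$ on $Y$ induce coordinates $(x^\mu,y^A,v^A{}_\mu)$ on $J^1Y$. For a (local) section $\phi$ of $Y$, $j^1\phi$ is $x\mapsto T_x\phi\in J^1_{\phi(x)}Y$. $Z\subset\Lambda^{n+1}Y$ is the subbundle over $Y$ with fibers $Z_y=\{z\mid\mathbf{i}_v\mathbf{i}_wz=0\ \forall v,w\in V_yY\}$ and projection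 $\pi_{YZ}$; its canonical $(n+1)$-form is $\Theta(z)(u_1,\dots,u_{n+1})=z(T\pi_{YZ}u_1,\dots,T\pi_{YZ}u_{n+1})$. $Z$ is identified with the bundle $J^1Y^\star$ whose fiber over $y\in Y_x$ is the space of affine maps $J^1_yY\to\Lambda^{n+1}_xX$, by $\langle z,\gamma\rangle=\gamma^*z$. A Lagrangian density is a smooth bundle map $\mathcal L:J^1Y\to\Lambda^{n+1}X$ over $X$; in coordinates $\mathcal L=L(x^\mu,y^A,v^A{}_\mu)\,d^{n+1}x$. The covariant Legendre transformation $\mathbb F\mathcal L:J^1Y\to J^1Y^\star\cong Z$ is $\langle\mathbb F\mathcal L(\gamma),\gamma'\rangle=\mathcal L(\gamma)+\frac{d}{d\varepsilon}\mathcal L(\gamma+\varepsilon(\gamma'-\gamma))|_{\varepsilon=0}$ for $\gamma,\gamma'\in J^1_yY$. The Euler–Lagrange equations for a local section $\phi$ are, in coordinates, $\frac{\partial L}{\partial y^A}(j^1\phi)-\frac{\partial}{\partial x^\mu}\left(\frac{\partial L}{\partial v^A{}_\mu}(j^1\phi)\right)=0$ for all $A$. $\eta\in\mathcal G$ acts on $Y$ by a bundle automorphism $\eta_Y$ covering a diffeomorphism $\eta_X$ of $X$. The lifted actions are $\eta_{J^1Y}(\gamma)=T\eta_Y\circ\gamma\circ T\eta_X^{-1}$ on $J^1Y$ and $\eta_Z(z)=(\eta_Y^{-1})^*z$ on $Z$; $\xi_X,\xi_Y,\xi_Z$ are the infinitesimal generators of $\xi\in\mathfrak g$ on $X$, $Y$,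 $Z$ (vector fields whose flows are the actions of $\exp(\lambda\xi)$). $J(\xi)=\mathbf{i}_{\xi_Z}\Theta$, and $J^{\mathcal L}(\xi)=\mathbb F\mathcal L^*J(\xi)$, an $n$-form on $J^1Y$. $\mathcal L$ is $\mathcal G$-equivariant if $\mathcal L(\eta_{J^1Y}(\gamma))=(\eta_X^{-1})^*\mathcal L(\gamma)$ for all $\eta\in\mathcal G$, $\gamma\in J^1Y$. The Lie derivative of a (local) section $\phi$ along $\xi\in\mathfrak g$ is $\pounds_\xi\phi=T\phi\circ\xi_X-\xi_Y\circ\phi$, so $(\pounds_\xi\phi)(x)\in V_{\phi(x)}Y$. The $\mathcal G$-action is vertically transitive if for each $x\in X$, each $y\in Y_x$ and each (local) section $\phi$ with $\phi(x)=y$, $\{(\pounds_\xi\phi)(x)\mid\xi\in\mathfrak g\}=V_yY$. *)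

theory Defs
  imports "HOL-Analysis.Analysis" "HOL-Algebra.Group_Action"
begin

section \<open>Smooth maps\<close>

text \<open>Smoothness is taken in the sense of Michal and Bastiani: all iterated directional derivatives
  exist and are jointly continuous in the base point and the directions. Between finite-dimensional
  spaces this is the usual \<open>C\<^sup>\<infinity>\<close>; between locally convex spaces it is Milnor's notion used for
  infinite-dimensional Lie groups. In \<open>iter_dirderiv k f w\<close> only the directions
  \<open>w 0, \<dots>, w (k - 1)\<close> are used.\<close>

definition dirderiv :: "('a::real_vector \<Rightarrow> 'b::{real_vector,t2_space}) \<Rightarrow> 'a \<Rightarrow> 'a \<Rightarrow> 'b" where
  "dirderiv f x v = Lim (at 0) (\<lambda>t::real. (1 / t) *\<^sub>R (f (x + t *\<^sub>R v) - f x))"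

lemma dirderiv_eq_has_derivative:
  fixes f :: "'a::real_normed_vector \<Rightarrow> 'b::real_normed_vector"
  assumes "(f has_derivative f') (at x)"
  shows "dirderiv f x v = f' v"
proof -
  interpret bounded_linear f' using assms by (rule has_derivative_bounded_linear)
  have "((\<lambda>t::real. f (x + t *\<^sub>R v)) has_vector_derivative f' v) (at 0)"
  proof -
    have "((\<lambda>t::real. x + t *\<^sub>R v) has_derivative (\<lambda>t. t *\<^sub>R v)) (at 0)"
      by (auto intro!: derivative_eq_intros)
    moreover have "(f has_derivative f') (at (x + 0 *\<^sub>R v))" using assms by simp
    ultimately have "((\<lambda>t::real. f (x + t *\<^sub>R v)) has_derivative (\<lambda>t. f' (t *\<^sub>R v))) (at 0)"
      by (rule has_derivative_compose)
    then show ?thesis by (simp add: has_vector_derivative_def scaleR)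
  qed
  then have "((\<lambda>t::real. (1 / t) *\<^sub>R (f (x + t *\<^sub>R v) - f x)) \<longlongrightarrow> f' v) (at 0)"
  proof -
    have "norm ((1 / t) *\<^sub>R (f (x + t *\<^sub>R v) - f x) - f' v) =
        norm (f (x + t *\<^sub>R v) - f x - t *\<^sub>R f' v) / norm t" if "t \<noteq> 0" for t :: real
    proof -
      have "(1 / t) *\<^sub>R (f (x + t *\<^sub>R v) - f x) - f' v =
          (1 / t) *\<^sub>R (f (x + t *\<^sub>R v) - f x - t *\<^sub>R f' v)"
        using that by (simp add: scaleR_diff_right)
      then show ?thesis by simp
    qed
    moreover have "((\<lambda>t. norm (f (x + t *\<^sub>R v) - f x - t *\<^sub>R f' v) / norm t) \<longlongrightarrow> 0) (at (0::real))"
      using \<open>(_ has_vector_derivative _) _\<close> by (simp add: has_vector_derivative_def has_derivative_at)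
    ultimately have "((\<lambda>t. norm ((1 / t) *\<^sub>R (f (x + t *\<^sub>R v) - f x) - f' v)) \<longlongrightarrow> 0) (at (0::real))"
      by (subst Lim_cong_within[where g = "\<lambda>t. norm (f (x + t *\<^sub>R v) - f x - t *\<^sub>R f' v) / norm t"]) auto
    then show ?thesis by (simp add: tendsto_norm_zero_iff LIM_zero_iff)
  qed
  then show ?thesis
    unfolding dirderiv_def by (intro tendsto_Lim) auto
qed

primrec iter_dirderiv ::
    "nat \<Rightarrow> ('a::real_vector \<Rightarrow> 'b::{real_vector,t2_space}) \<Rightarrow> (nat \<Rightarrow> 'a) \<Rightarrow> 'a \<Rightarrow> 'b" where
  "iter_dirderiv 0 f w = f"
| "iter_dirderiv (Suc k) f w = (\<lambda>x. dirderiv (iter_dirderiv k f w) x (w k))"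

definition smooth_on ::
    "'a::{real_vector,topological_space} set \<Rightarrow> ('a \<Rightarrow> 'b::{real_vector,t2_space}) \<Rightarrow> bool" where
  "smooth_on S f \<longleftrightarrow> open S \<and>
     (\<forall>k. (\<forall>x\<in>S. \<forall>w. \<exists>l. ((\<lambda>t::real. (1 / t) *\<^sub>R
              (iter_dirderiv k f w (x + t *\<^sub>R w k) - iter_dirderiv k f w x)) \<longlongrightarrow> l) (at 0)) \<and>
          continuous_on (S \<times> UNIV) (\<lambda>(x, w). iter_dirderiv k f w x))"


section \<open>Manifolds\<close>

text \<open>A manifold is given by an atlas; its points are those covered by the charts, and its topology is
  the one induced by the charts.\<close>

type_synonym ('x, 'e) chart = "'x set \<times> ('x \<Rightarrow> 'e)"
type_synonym ('x, 'e) atlas = "('x, 'e) chart set"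

definition cinv :: "('x, 'e) chart \<Rightarrow> 'e \<Rightarrow> 'x" where
  "cinv c = inv_into (fst c) (snd c)"

definition mpoints :: "('x, 'e) atlas \<Rightarrow> 'x set" where
  "mpoints A = \<Union> (fst ` A)"

definition smooth_atlas :: "('x, 'e::{real_vector,t2_space}) atlas \<Rightarrow> bool" where
  "smooth_atlas A \<longleftrightarrow>
     (\<forall>c\<in>A. inj_on (snd c) (fst c) \<and> open (snd c ` fst c)) \<and>
     (\<forall>c\<in>A. \<forall>d\<in>A. smooth_on (snd c ` (fst c \<inter> fst d)) (snd d \<circ> cinv c))"

definition mopen :: "('x, 'e::topological_space) atlas \<Rightarrow> 'x set \<Rightarrow> bool" where
  "mopen A W \<longleftrightarrow> W \<subseteq> mpoints A \<and> (\<forall>c\<in>A. open (snd c ` (fst c \<inter> W)))"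

lemma istopology_mopen:
  assumes "smooth_atlas A"
  shows "istopology (mopen A)"
  unfolding istopology_def
proof (intro conjI allI impI)
  fix S T assume S: "mopen A S" and T: "mopen A T"
  have "open (snd c ` (fst c \<inter> (S \<inter> T)))" if c: "c \<in> A" for c
  proof -
    have "inj_on (snd c) (fst c)" using assms c by (auto simp: smooth_atlas_def)
    then have "snd c ` (fst c \<inter> (S \<inter> T)) = snd c ` (fst c \<inter> S) \<inter> snd c ` (fst c \<inter> T)"
      by (subst inj_on_image_Int[symmetric]) (auto intro: arg_cong[where f = "image (snd c)"])
    then show ?thesis using S T c by (simp add: mopen_def open_Int)
  qed
  then show "mopen A (S \<inter> T)" using S by (auto simp: mopen_def)
next
  fix K assume K: "\<forall>S\<in>K. mopen A S"
  have "snd c ` (fst c \<inter> \<Union>K) = (\<Union>S\<in>K. snd c ` (fst c \<inter> S))" for c :: "('a, 'b) chart" by auto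
  with K show "mopen A (\<Union>K)" by (auto simp: mopen_def intro!: open_UN)
qed

definition hausdorff_manifold :: "('x, 'e::{real_vector,t2_space}) atlas \<Rightarrow> bool" where
  "hausdorff_manifold A \<longleftrightarrow> smooth_atlas A \<and> Hausdorff_space (topology (mopen A))"

definition manifold :: "('x, 'e::{real_vector,t2_space}) atlas \<Rightarrow> bool" where
  "manifold A \<longleftrightarrow> hausdorff_manifold A \<and> second_countable (topology (mopen A))"

definition max_atlas :: "('x, 'e::{real_vector,t2_space}) atlas \<Rightarrow> ('x, 'e) atlas" where
  "max_atlas A = {c. fst c \<subseteq> mpoints A \<and> smooth_atlas (insert c A)}"

definition euc :: "('e, 'e) atlas" where
  "euc = {(UNIV, id)}"

definition prod_atlas :: "('x, 'e) atlas \<Rightarrow> ('y, 'f) atlas \<Rightarrow> ('x \<times> 'y, 'e \<times> 'f) atlas" where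
  "prod_atlas A B = {(fst c \<times> fst d, map_prod (snd c) (snd d)) | c d. c \<in> A \<and> d \<in> B}"

definition smooth_map_on ::
    "('x, 'e::{real_vector,t2_space}) atlas \<Rightarrow> ('y, 'h::{real_vector,t2_space}) atlas
      \<Rightarrow> 'x set \<Rightarrow> ('x \<Rightarrow> 'y) \<Rightarrow> bool" where
  "smooth_map_on A B W f \<longleftrightarrow> mopen A W \<and> f ` W \<subseteq> mpoints B \<and>
     (\<forall>c\<in>A. \<forall>d\<in>B. smooth_on (snd c ` (fst c \<inter> W \<inter> f -` fst d)) (snd d \<circ> f \<circ> cinv c))"

definition diffeo :: "('x, 'e::{real_vector,t2_space}) atlas \<Rightarrow> ('x \<Rightarrow> 'x) \<Rightarrow> bool" where
  "diffeo A h \<longleftrightarrow> bij_betw h (mpoints A) (mpoints A) \<and> smooth_map_on A A (mpoints A) h \<and>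
     smooth_map_on A A (mpoints A) (inv_into (mpoints A) h)"

text \<open>The tangent space at a point \<open>p\<close> is represented by the model space: a tangent vector is given by
  its components in one fixed preferred chart \<open>chart_at A p\<close> of the atlas around \<open>p\<close>.\<close>

definition chart_at :: "('x, 'e) atlas \<Rightarrow> 'x \<Rightarrow> ('x, 'e) chart" where
  "chart_at A p = (SOME c. c \<in> A \<and> p \<in> fst c)"

definition tmap ::
    "('x, 'e::real_vector) atlas \<Rightarrow> ('y, 'h::{real_vector,t2_space}) atlas
      \<Rightarrow> ('x \<Rightarrow> 'y) \<Rightarrow> 'x \<Rightarrow> 'e \<Rightarrow> 'h" where
  "tmap A B f p = dirderiv (snd (chart_at B (f p)) \<circ> f \<circ> cinv (chart_at A p)) (snd (chart_at A p) p)"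

definition velocity :: "('x, 'e::{real_vector,t2_space}) atlas \<Rightarrow> (real \<Rightarrow> 'x) \<Rightarrow> real \<Rightarrow> 'e" where
  "velocity A \<gamma> t = tmap euc A \<gamma> t 1"

text \<open>The base manifold has dimension \<open>n + 1 = CARD('m)\<close>. An orientation is given by taking the atlas
  to consist of positively oriented charts.\<close>

definition oriented_manifold :: "('x, real^'m::finite) atlas \<Rightarrow> bool" where
  "oriented_manifold X \<longleftrightarrow> manifold X \<and>
     (\<forall>c\<in>X. \<forall>d\<in>X. \<forall>p \<in> snd c ` (fst c \<inter> fst d).
        det (matrix (dirderiv (snd d \<circ> cinv c) p)) > 0)"


section \<open>Differential forms\<close>

text \<open>A \<open>k\<close>-form on a vector space is a function of the list of its arguments, zero on lists of length
  other than \<open>k\<close>.\<close>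

definition alt_form :: "nat \<Rightarrow> ('v::real_vector list \<Rightarrow> real) set" where
  "alt_form k = {\<omega>. (\<forall>vs. length vs \<noteq> k \<longrightarrow> \<omega> vs = 0) \<and>
     (\<forall>vs i. length vs = k \<and> i < k \<longrightarrow> linear (\<lambda>v. \<omega> (vs[i := v]))) \<and>
     (\<forall>vs i j. length vs = k \<and> i < j \<and> j < k \<and> vs ! i = vs ! j \<longrightarrow> \<omega> vs = 0)}"

definition iprod :: "'v \<Rightarrow> ('v list \<Rightarrow> real) \<Rightarrow> 'v list \<Rightarrow> real" where
  "iprod v \<omega> = (\<lambda>vs. \<omega> (v # vs))"

definition pull :: "('v \<Rightarrow> 'w) \<Rightarrow> ('w list \<Rightarrow> real) \<Rightarrow> 'v list \<Rightarrow> real" where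
  "pull T \<omega> = (\<lambda>vs. \<omega> (map T vs))"

definition pullback_form ::
    "('x, 'e::real_vector) atlas \<Rightarrow> ('y, 'h::{real_vector,t2_space}) atlas \<Rightarrow> ('x \<Rightarrow> 'y)
      \<Rightarrow> ('y \<Rightarrow> 'h list \<Rightarrow> real) \<Rightarrow> 'x \<Rightarrow> 'e list \<Rightarrow> real" where
  "pullback_form A B f \<omega> = (\<lambda>x. pull (tmap A B f x) (\<omega> (f x)))"

text \<open>The exterior derivative at \<open>x\<close>, computed in the preferred chart at \<open>x\<close>:
  \<open>d\<omega>(v\<^sub>0,\<dots>,v\<^sub>k) = \<Sum>\<^sub>i (-1)\<^sup>i D\<omega>[v\<^sub>i](v\<^sub>0,\<dots>,v\<^sub>i\<^sub>-\<^sub>1,v\<^sub>i\<^sub>+\<^sub>1,\<dots>,v\<^sub>k)\<close>.\<close>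

definition extd ::
    "('x, 'e::{real_vector,t2_space}) atlas \<Rightarrow> ('x \<Rightarrow> 'e list \<Rightarrow> real) \<Rightarrow> 'x \<Rightarrow> 'e list \<Rightarrow> real" where
  "extd A \<omega> x vs = (let c = chart_at A x; \<omega>c = pullback_form euc A (cinv c) \<omega> in
     \<Sum>i<length vs. (-1) ^ i *
       dirderiv (\<lambda>p. \<omega>c p (take i vs @ drop (Suc i) vs)) (snd c x) (vs ! i))"


section \<open>Fiber bundles and fibered coordinates\<close>

text \<open>\<open>F\<close> is the typical fiber. Its model space \<open>'f\<close> is any normed space, so that fiber dimension zero is
  not excluded; finite-dimensionality is expressed by a finite basis of \<open>'f\<close>.\<close>

definition fiber_bundle ::
    "('x, real^'m::finite) atlas \<Rightarrow> ('y, (real^'m) \<times> 'f::real_normed_vector) atlas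
      \<Rightarrow> ('p, 'f) atlas \<Rightarrow> ('y \<Rightarrow> 'x) \<Rightarrow> bool" where
  "fiber_bundle X Y F \<pi> \<longleftrightarrow> manifold X \<and> manifold Y \<and> manifold F \<and>
     smooth_map_on Y X (mpoints Y) \<pi> \<and> \<pi> ` mpoints Y = mpoints X \<and>
     (\<forall>x \<in> mpoints X. \<exists>U \<psi>. x \<in> U \<and> mopen X U \<and>
        (let E = {y \<in> mpoints Y. \<pi> y \<in> U}; \<Psi> = (\<lambda>y. (\<pi> y, \<psi> y)) in
           bij_betw \<Psi> E (U \<times> mpoints F) \<and>
           smooth_map_on Y (prod_atlas X F) E \<Psi> \<and>
           smooth_map_on (prod_atlas X F) Y (U \<times> mpoints F) (inv_into E \<Psi>)))"

text \<open>Pairs of a chart \<open>x\<^sup>\<mu>\<close> of \<open>X\<close> and a chart of \<open>Y\<close> of the form \<open>(x\<^sup>\<mu>, y\<^sup>A)\<close>.\<close>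

definition fib_charts ::
    "('x, real^'m::finite) atlas \<Rightarrow> ('y, (real^'m) \<times> 'f::real_normed_vector) atlas \<Rightarrow> ('y \<Rightarrow> 'x)
      \<Rightarrow> (('x, real^'m) chart \<times> ('y, (real^'m) \<times> 'f) chart) set" where
  "fib_charts X Y \<pi> = {(c, \<psi>). c \<in> max_atlas X \<and> \<psi> \<in> max_atlas Y \<and> \<pi> ` fst \<psi> \<subseteq> fst c \<and>
     (\<forall>y \<in> fst \<psi>. fst (snd \<psi> y) = snd c (\<pi> y))}"

definition vertical ::
    "('x, 'e::{real_vector,t2_space}) atlas \<Rightarrow> ('y, 'h::real_vector) atlas \<Rightarrow> ('y \<Rightarrow> 'x)
      \<Rightarrow> 'y \<Rightarrow> 'h set" where
  "vertical X Y \<pi> y = {v. tmap Y X \<pi> y v = 0}"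

definition local_section ::
    "('x, 'e::{real_vector,t2_space}) atlas \<Rightarrow> ('y, 'h::{real_vector,t2_space}) atlas \<Rightarrow> ('y \<Rightarrow> 'x)
      \<Rightarrow> 'x set \<Rightarrow> ('x \<Rightarrow> 'y) \<Rightarrow> bool" where
  "local_section X Y \<pi> W \<phi> \<longleftrightarrow> smooth_map_on X Y W \<phi> \<and> (\<forall>x\<in>W. \<pi> (\<phi> x) = x)"

text \<open>An enumeration of the coordinate indices, fixing \<open>d\<^sup>n\<^sup>+\<^sup>1x = dx\<^sup>0 \<and> \<dots> \<and> dx\<^sup>n\<close>.\<close>

definition coord_indices :: "'m::finite list" where
  "coord_indices = (SOME l. distinct l \<and> set l = UNIV)"


section \<open>The first jet bundle\<close>

type_synonym ('m, 'y, 'f) jet = "'y \<times> (real^'m \<Rightarrow> (real^'m) \<times> 'f)"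

text \<open>In jet coordinates \<open>(x\<^sup>\<mu>, y\<^sup>A, v\<^sup>A\<^sub>\<mu>)\<close> the component \<open>v\<^sub>\<mu>\<close> is a vector in the model space \<open>'f\<close> of
  the fiber.\<close>

type_synonym ('m, 'f) jmodel = "(real^'m) \<times> 'f \<times> ('f^'m)"

definition jets ::
    "('x, real^'m::finite) atlas \<Rightarrow> ('y, (real^'m) \<times> 'f::real_normed_vector) atlas \<Rightarrow> ('y \<Rightarrow> 'x)
      \<Rightarrow> ('m, 'y, 'f) jet set" where
  "jets X Y \<pi> = {(y, \<gamma>). y \<in> mpoints Y \<and> linear \<gamma> \<and> tmap Y X \<pi> y \<circ> \<gamma> = id}"

definition jet_chart ::
    "('x, real^'m::finite) atlas \<Rightarrow> ('y, (real^'m) \<times> 'f::real_normed_vector) atlas \<Rightarrow> ('y \<Rightarrow> 'x)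
      \<Rightarrow> ('x, real^'m) chart \<times> ('y, (real^'m) \<times> 'f) chart
      \<Rightarrow> (('m, 'y, 'f) jet, ('m, 'f) jmodel) chart" where
  "jet_chart X Y \<pi> = (\<lambda>(c, \<psi>).
     ({(y, \<gamma>) \<in> jets X Y \<pi>. y \<in> fst \<psi>},
      \<lambda>(y, \<gamma>). (fst (snd \<psi> y), snd (snd \<psi> y),
        \<chi> \<mu>. snd (tmap Y euc (snd \<psi>) y (\<gamma> (tmap euc X (cinv c) (snd c (\<pi> y)) (axis \<mu> 1)))))))"

definition jet_atlas ::
    "('x, real^'m::finite) atlas \<Rightarrow> ('y, (real^'m) \<times> 'f::real_normed_vector) atlas \<Rightarrow> ('y \<Rightarrow> 'x)
      \<Rightarrow> (('m, 'y, 'f) jet, ('m, 'f) jmodel) atlas" where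
  "jet_atlas X Y \<pi> = jet_chart X Y \<pi> ` fib_charts X Y \<pi>"

definition jet_prolong ::
    "('x, real^'m::finite) atlas \<Rightarrow> ('y, (real^'m) \<times> 'f::real_normed_vector) atlas \<Rightarrow> ('x \<Rightarrow> 'y)
      \<Rightarrow> 'x \<Rightarrow> ('m, 'y, 'f) jet" where
  "jet_prolong X Y \<phi> = (\<lambda>x. (\<phi> x, tmap X Y \<phi> x))"


section \<open>The bundle of top-degree forms and Lagrangian densities\<close>

definition top_chart ::
    "('x, real^'m::finite) atlas \<Rightarrow> ('x, real^'m) chart
      \<Rightarrow> ('x \<times> ((real^'m) list \<Rightarrow> real), (real^'m) \<times> real) chart" where
  "top_chart X c = ({(x, \<omega>). x \<in> fst c \<and> \<omega> \<in> alt_form CARD('m)},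
     \<lambda>(x, \<omega>). (snd c x,
       \<omega> (map (\<lambda>\<mu>. tmap euc X (cinv c) (snd c x) (axis \<mu> 1)) coord_indices)))"

definition top_atlas ::
    "('x, real^'m::finite) atlas \<Rightarrow> ('x \<times> ((real^'m) list \<Rightarrow> real), (real^'m) \<times> real) atlas" where
  "top_atlas X = top_chart X ` max_atlas X"

definition lagrangian_density ::
    "('x, real^'m::finite) atlas \<Rightarrow> ('y, (real^'m) \<times> 'f::real_normed_vector) atlas \<Rightarrow> ('y \<Rightarrow> 'x)
      \<Rightarrow> (('m, 'y, 'f) jet \<Rightarrow> (real^'m) list \<Rightarrow> real) \<Rightarrow> bool" where
  "lagrangian_density X Y \<pi> L \<longleftrightarrow>
     smooth_map_on (jet_atlas X Y \<pi>) (top_atlas X) (jets X Y \<pi>) (\<lambda>j. (\<pi> (fst j), L j))"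

text \<open>The coordinate function \<open>L(x\<^sup>\<mu>, y\<^sup>A, v\<^sup>A\<^sub>\<mu>)\<close> in \<open>\<L> = L d\<^sup>n\<^sup>+\<^sup>1x\<close>.\<close>

definition lagrangian_coord ::
    "('x, real^'m::finite) atlas \<Rightarrow> ('y, (real^'m) \<times> 'f::real_normed_vector) atlas \<Rightarrow> ('y \<Rightarrow> 'x)
      \<Rightarrow> (('m, 'y, 'f) jet \<Rightarrow> (real^'m) list \<Rightarrow> real)
      \<Rightarrow> ('x, real^'m) chart \<times> ('y, (real^'m) \<times> 'f) chart \<Rightarrow> ('m, 'f) jmodel \<Rightarrow> real" where
  "lagrangian_coord X Y \<pi> L k q =
     (let j = cinv (jet_chart X Y \<pi> k) q in snd (snd (top_chart X (fst k)) (\<pi> (fst j), L j)))"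

text \<open>\<open>B\<close> is the basis \<open>\<partial>/\<partial>y\<^sup>A\<close> of the fiber model space defining the coordinates \<open>y\<^sup>A\<close>. Thus
  \<open>\<partial>/\<partial>y\<^sup>A\<close> is differentiation in direction \<open>(0, b, 0)\<close> and \<open>\<partial>/\<partial>v\<^sup>A\<^sub>\<mu>\<close> in direction
  \<open>(0, 0, axis \<mu> b)\<close>.\<close>

definition euler_lagrange ::
    "('x, real^'m::finite) atlas \<Rightarrow> ('y, (real^'m) \<times> 'f::real_normed_vector) atlas \<Rightarrow> ('y \<Rightarrow> 'x)
      \<Rightarrow> 'f set \<Rightarrow> (('m, 'y, 'f) jet \<Rightarrow> (real^'m) list \<Rightarrow> real) \<Rightarrow> 'x set \<Rightarrow> ('x \<Rightarrow> 'y) \<Rightarrow> bool" where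
  "euler_lagrange X Y \<pi> B L W \<phi> \<longleftrightarrow>
     (\<forall>(c, \<psi>) \<in> fib_charts X Y \<pi>. \<forall>x\<in>W. \<phi> x \<in> fst \<psi> \<longrightarrow> (\<forall>b\<in>B.
        let Lc = lagrangian_coord X Y \<pi> L (c, \<psi>);
            s = snd (jet_chart X Y \<pi> (c, \<psi>)) \<circ> jet_prolong X Y \<phi> \<circ> cinv c
        in dirderiv Lc (s (snd c x)) (0, b, 0) -
           (\<Sum>\<mu>\<in>UNIV. dirderiv (\<lambda>p. dirderiv Lc (s p) (0, 0, axis \<mu> b)) (snd c x) (axis \<mu> 1)) = 0))"


section \<open>Covariant phase space and the Legendre transformation\<close>

type_synonym ('m, 'y, 'f) mom = "'y \<times> (((real^'m) \<times> 'f) list \<Rightarrow> real)"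

text \<open>Coordinates \<open>(x\<^sup>\<mu>, y\<^sup>A, p\<^sub>A\<^sup>\<mu>, p)\<close> for
  \<open>z = p d\<^sup>n\<^sup>+\<^sup>1x + p\<^sub>A\<^sup>\<mu> dy\<^sup>A \<and> (\<partial>\<^sub>\<mu> \<lrcorner> d\<^sup>n\<^sup>+\<^sup>1x)\<close>; the component \<open>p\<^sup>\<mu>\<close> is a linear functional on \<open>'f\<close>.\<close>

type_synonym ('m, 'f) zmodel = "(real^'m) \<times> 'f \<times> (('f \<Rightarrow>\<^sub>L real)^'m) \<times> real"

definition mom_points ::
    "('x, real^'m::finite) atlas \<Rightarrow> ('y, (real^'m) \<times> 'f::real_normed_vector) atlas \<Rightarrow> ('y \<Rightarrow> 'x)
      \<Rightarrow> ('m, 'y, 'f) mom set" where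
  "mom_points X Y \<pi> = {(y, z). y \<in> mpoints Y \<and> z \<in> alt_form CARD('m) \<and>
     (\<forall>v \<in> vertical X Y \<pi> y. \<forall>w \<in> vertical X Y \<pi> y. iprod v (iprod w z) = (\<lambda>_. 0))}"

definition mom_chart ::
    "('x, real^'m::finite) atlas \<Rightarrow> ('y, (real^'m) \<times> 'f::real_normed_vector) atlas \<Rightarrow> ('y \<Rightarrow> 'x)
      \<Rightarrow> ('y, (real^'m) \<times> 'f) chart \<Rightarrow> (('m, 'y, 'f) mom, ('m, 'f) zmodel) chart" where
  "mom_chart X Y \<pi> \<psi> =
     ({(y, z) \<in> mom_points X Y \<pi>. y \<in> fst \<psi>},
      \<lambda>(y, z). let z' = pull (tmap euc Y (cinv \<psi>) (snd \<psi> y)) z in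
        (fst (snd \<psi> y), snd (snd \<psi> y),
         (\<chi> \<mu>. Blinfun (\<lambda>b. z' (map (\<lambda>\<nu>. if \<nu> = \<mu> then (0, b) else (axis \<nu> 1, 0)) coord_indices))),
         z' (map (\<lambda>\<nu>. (axis \<nu> 1, 0)) coord_indices)))"

definition mom_atlas ::
    "('x, real^'m::finite) atlas \<Rightarrow> ('y, (real^'m) \<times> 'f::real_normed_vector) atlas \<Rightarrow> ('y \<Rightarrow> 'x)
      \<Rightarrow> (('m, 'y, 'f) mom, ('m, 'f) zmodel) atlas" where
  "mom_atlas X Y \<pi> = mom_chart X Y \<pi> ` snd ` fib_charts X Y \<pi>"

definition canonical_form ::
    "('x, real^'m::finite) atlas \<Rightarrow> ('y, (real^'m) \<times> 'f::real_normed_vector) atlas \<Rightarrow> ('y \<Rightarrow> 'x)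
      \<Rightarrow> ('m, 'y, 'f) mom \<Rightarrow> ('m, 'f) zmodel list \<Rightarrow> real" where
  "canonical_form X Y \<pi> = (\<lambda>z. pull (tmap (mom_atlas X Y \<pi>) Y fst z) (snd z))"

text \<open>An affine map \<open>J\<^sup>1\<^sub>yY \<rightarrow> \<Lambda>\<^sup>n\<^sup>+\<^sup>1\<^sub>xX\<close> is identified with the unique \<open>z\<close> such that it sends \<open>\<gamma>'\<close>
  to the pullback of \<open>z\<close> by \<open>\<gamma>'\<close>.\<close>

definition legendre ::
    "('x, real^'m::finite) atlas \<Rightarrow> ('y, (real^'m) \<times> 'f::real_normed_vector) atlas \<Rightarrow> ('y \<Rightarrow> 'x)
      \<Rightarrow> (('m, 'y, 'f) jet \<Rightarrow> (real^'m) list \<Rightarrow> real) \<Rightarrow> ('m, 'y, 'f) jet \<Rightarrow> ('m, 'y, 'f) mom" where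
  "legendre X Y \<pi> L = (\<lambda>(y, \<gamma>). (y, THE z. (y, z) \<in> mom_points X Y \<pi> \<and>
     (\<forall>\<gamma>'. (y, \<gamma>') \<in> jets X Y \<pi> \<longrightarrow>
        pull \<gamma>' z = (\<lambda>vs. L (y, \<gamma>) vs +
          deriv (\<lambda>\<epsilon>. L (y, \<lambda>u. \<gamma> u + \<epsilon> *\<^sub>R (\<gamma>' u - \<gamma> u)) vs) 0))))"


section \<open>Lie groups and their actions\<close>

definition locally_convex_tvs :: "'k::{real_vector,topological_ab_group_add,t2_space} itself \<Rightarrow> bool" where
  "locally_convex_tvs _ \<longleftrightarrow>
     continuous_on UNIV (\<lambda>(r::real, v::'k). r *\<^sub>R v) \<and>
     (\<forall>U::'k set. open U \<and> 0 \<in> U \<longrightarrow> (\<exists>V. open V \<and> convex V \<and> 0 \<in> V \<and> V \<subseteq> U))"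

text \<open>A Lie group modelled on a Hausdorff locally convex space \<open>'k\<close> of arbitrary dimension. Its Lie
  algebra, the tangent space at the identity, is represented by \<open>'k\<close> through the preferred chart.\<close>

definition lie_group ::
    "('g, 'z) monoid_scheme \<Rightarrow> ('g, 'k::{real_vector,topological_ab_group_add,t2_space}) atlas \<Rightarrow> bool"
  where
  "lie_group G A \<longleftrightarrow> locally_convex_tvs TYPE('k) \<and> group G \<and> hausdorff_manifold A \<and>
     mpoints A = carrier G \<and>
     smooth_map_on (prod_atlas A A) A (carrier G \<times> carrier G) (\<lambda>(g, h). g \<otimes>\<^bsub>G\<^esub> h) \<and>
     smooth_map_on A A (carrier G) (\<lambda>g. inv\<^bsub>G\<^esub> g)"

text \<open>\<open>t \<mapsto> Exp (t \<xi>)\<close> is the smooth one-parameter subgroup with initial velocity \<open>\<xi>\<close>.\<close>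

definition exponential_map ::
    "('g, 'z) monoid_scheme \<Rightarrow> ('g, 'k::{real_vector,topological_ab_group_add,t2_space}) atlas
      \<Rightarrow> ('k \<Rightarrow> 'g) \<Rightarrow> bool" where
  "exponential_map G A Exp \<longleftrightarrow> (\<forall>\<xi>.
     smooth_map_on euc A UNIV (\<lambda>t::real. Exp (t *\<^sub>R \<xi>)) \<and>
     (\<forall>s t. Exp ((s + t) *\<^sub>R \<xi>) = Exp (s *\<^sub>R \<xi>) \<otimes>\<^bsub>G\<^esub> Exp (t *\<^sub>R \<xi>)) \<and>
     velocity A (\<lambda>t. Exp (t *\<^sub>R \<xi>)) 0 = \<xi>)"

text \<open>A smooth action \<open>\<eta>\<^sub>Y = actY \<eta>\<close> on \<open>Y\<close> by bundle automorphisms covering \<open>\<eta>\<^sub>X = actX \<eta>\<close>.\<close>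

definition bundle_action ::
    "('x, real^'m::finite) atlas \<Rightarrow> ('y, (real^'m) \<times> 'f::real_normed_vector) atlas \<Rightarrow> ('y \<Rightarrow> 'x)
      \<Rightarrow> ('g, 'z) monoid_scheme \<Rightarrow> ('g, 'k::{real_vector,topological_ab_group_add,t2_space}) atlas
      \<Rightarrow> ('g \<Rightarrow> 'x \<Rightarrow> 'x) \<Rightarrow> ('g \<Rightarrow> 'y \<Rightarrow> 'y) \<Rightarrow> bool" where
  "bundle_action X Y \<pi> G A actX actY \<longleftrightarrow>
     group_action G (mpoints Y) actY \<and>
     smooth_map_on (prod_atlas A Y) Y (carrier G \<times> mpoints Y) (\<lambda>(g, y). actY g y) \<and>
     (\<forall>g \<in> carrier G. diffeo Y (actY g) \<and> diffeo X (actX g) \<and>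
        (\<forall>y \<in> mpoints Y. \<pi> (actY g y) = actX g (\<pi> y)))"

definition jet_lift ::
    "('x, real^'m::finite) atlas \<Rightarrow> ('y, (real^'m) \<times> 'f::real_normed_vector) atlas \<Rightarrow> ('y \<Rightarrow> 'x)
      \<Rightarrow> ('x \<Rightarrow> 'x) \<Rightarrow> ('y \<Rightarrow> 'y) \<Rightarrow> ('m, 'y, 'f) jet \<Rightarrow> ('m, 'y, 'f) jet" where
  "jet_lift X Y \<pi> hX hY = (\<lambda>(y, \<gamma>).
     (hY y, tmap Y Y hY y \<circ> \<gamma> \<circ> tmap X X (inv_into (mpoints X) hX) (hX (\<pi> y))))"

definition mom_lift ::
    "('y, (real^'m::finite) \<times> 'f::real_normed_vector) atlas \<Rightarrow> ('y \<Rightarrow> 'y)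
      \<Rightarrow> ('m, 'y, 'f) mom \<Rightarrow> ('m, 'y, 'f) mom" where
  "mom_lift Y hY = (\<lambda>(y, z). (hY y, pull (tmap Y Y (inv_into (mpoints Y) hY) (hY y)) z))"

definition equivariant ::
    "('x, real^'m::finite) atlas \<Rightarrow> ('y, (real^'m) \<times> 'f::real_normed_vector) atlas \<Rightarrow> ('y \<Rightarrow> 'x)
      \<Rightarrow> ('g, 'z) monoid_scheme \<Rightarrow> ('g \<Rightarrow> 'x \<Rightarrow> 'x) \<Rightarrow> ('g \<Rightarrow> 'y \<Rightarrow> 'y)
      \<Rightarrow> (('m, 'y, 'f) jet \<Rightarrow> (real^'m) list \<Rightarrow> real) \<Rightarrow> bool" where
  "equivariant X Y \<pi> G actX actY L \<longleftrightarrow>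
     (\<forall>g \<in> carrier G. \<forall>j \<in> jets X Y \<pi>.
        L (jet_lift X Y \<pi> (actX g) (actY g) j) =
          pull (tmap X X (inv_into (mpoints X) (actX g)) (actX g (\<pi> (fst j)))) (L j))"

definition generator ::
    "('q, 'e::{real_vector,t2_space}) atlas \<Rightarrow> ('k::real_vector \<Rightarrow> 'g) \<Rightarrow> ('g \<Rightarrow> 'q \<Rightarrow> 'q) \<Rightarrow> 'k \<Rightarrow> 'q \<Rightarrow> 'e"
  where
  "generator M Exp act \<xi> q = velocity M (\<lambda>t. act (Exp (t *\<^sub>R \<xi>)) q) 0"

definition lie_deriv_section ::
    "('x, real^'m::finite) atlas \<Rightarrow> ('y, (real^'m) \<times> 'f::real_normed_vector) atlas \<Rightarrow> ('k::real_vector \<Rightarrow> 'g)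
      \<Rightarrow> ('g \<Rightarrow> 'x \<Rightarrow> 'x) \<Rightarrow> ('g \<Rightarrow> 'y \<Rightarrow> 'y) \<Rightarrow> 'k \<Rightarrow> ('x \<Rightarrow> 'y) \<Rightarrow> 'x \<Rightarrow> (real^'m) \<times> 'f" where
  "lie_deriv_section X Y Exp actX actY \<xi> \<phi> x =
     tmap X Y \<phi> x (generator X Exp actX \<xi> x) - generator Y Exp actY \<xi> (\<phi> x)"

definition vertically_transitive ::
    "('x, real^'m::finite) atlas \<Rightarrow> ('y, (real^'m) \<times> 'f::real_normed_vector) atlas \<Rightarrow> ('y \<Rightarrow> 'x)
      \<Rightarrow> ('k::real_vector \<Rightarrow> 'g) \<Rightarrow> ('g \<Rightarrow> 'x \<Rightarrow> 'x) \<Rightarrow> ('g \<Rightarrow> 'y \<Rightarrow> 'y) \<Rightarrow> bool" where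
  "vertically_transitive X Y \<pi> Exp actX actY \<longleftrightarrow>
     (\<forall>x \<in> mpoints X. \<forall>y \<in> mpoints Y. \<pi> y = x \<longrightarrow>
        (\<forall>W \<phi>. local_section X Y \<pi> W \<phi> \<and> x \<in> W \<and> \<phi> x = y \<longrightarrow>
           range (\<lambda>\<xi>. lie_deriv_section X Y Exp actX actY \<xi> \<phi> x) = vertical X Y \<pi> y))"


section \<open>Momentum maps\<close>

definition cov_momentum ::
    "('x, real^'m::finite) atlas \<Rightarrow> ('y, (real^'m) \<times> 'f::real_normed_vector) atlas \<Rightarrow> ('y \<Rightarrow> 'x)
      \<Rightarrow> ('k::real_vector \<Rightarrow> 'g) \<Rightarrow> ('g \<Rightarrow> 'y \<Rightarrow> 'y) \<Rightarrow> 'k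
      \<Rightarrow> ('m, 'y, 'f) mom \<Rightarrow> ('m, 'f) zmodel list \<Rightarrow> real" where
  "cov_momentum X Y \<pi> Exp actY \<xi> = (\<lambda>z.
     iprod (generator (mom_atlas X Y \<pi>) Exp (\<lambda>g. mom_lift Y (actY g)) \<xi> z) (canonical_form X Y \<pi> z))"

definition lagrangian_momentum ::
    "('x, real^'m::finite) atlas \<Rightarrow> ('y, (real^'m) \<times> 'f::real_normed_vector) atlas \<Rightarrow> ('y \<Rightarrow> 'x)
      \<Rightarrow> (('m, 'y, 'f) jet \<Rightarrow> (real^'m) list \<Rightarrow> real) \<Rightarrow> ('k::real_vector \<Rightarrow> 'g) \<Rightarrow> ('g \<Rightarrow> 'y \<Rightarrow> 'y) \<Rightarrow> 'k
      \<Rightarrow> ('m, 'y, 'f) jet \<Rightarrow> ('m, 'f) jmodel list \<Rightarrow> real" where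
  "lagrangian_momentum X Y \<pi> L Exp actY \<xi> =
     pullback_form (jet_atlas X Y \<pi>) (mom_atlas X Y \<pi>) (legendre X Y \<pi> L)
       (cov_momentum X Y \<pi> Exp actY \<xi>)"

end

(*
  Fix a local section phi and xi in the Lie algebra, and work in fibered coordinates.  The pulled-back
  momentum map is the contraction of d^{n+1}x with the vector field
    P^mu = L xi^mu + dL/dv^A_mu (xi^A - xi^nu d_nu phi^A),
  so its exterior derivative is (div P) d^{n+1}x.  Differentiating the equivariance of L along the flow
  of xi gives the infinitesimal invariance of L d^{n+1}x, and with the symmetry of second derivatives
  this turns div P into - E_A w^A, where E_A is the Euler-Lagrange expression and
  w^A = xi^A - xi^nu d_nu phi^A are the components of minus the Lie derivative of phi.  Hence the
  Euler-Lagrange equations imply conservation; conversely, vertical transitivity makes w at a given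
  point arbitrary as xi varies, so conservation for all xi forces E_A = 0.
*)

theory Submission
  imports Defs
begin

text \<open>Tangent vectors are components in a chart that \<open>chart_at\<close> picks separately
  at every point and that need not be fibered. Computations are therefore done in one fibered chart
  and carried over by \<open>frame\<close> and \<open>coframe\<close>; since \<open>extd\<close>
  differentiates in the preferred chart, second derivatives of a transition map appear and have to
  cancel. \<open>dirderiv\<close> and \<open>tmap\<close> are total, so a chain rule holds only
  where derivatives are known to exist. The canonical form is pulled back from \<open>Y\<close>, so
  the generator on \<open>Z\<close> matters only through its projection to \<open>Y\<close>; but
  taking this projection requires the lifted flow, the Legendre transformation and the jet
  prolongation to be differentiable in the charts of their bundles. The model space of the group
  need not carry a norm. The calculus starts from jointly continuous directional derivatives and
  passes to Frechet derivatives once the group variable is restricted to a one-parameter subgroup.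
  Symmetry of second derivatives in group and bundle coordinates then shows that the time derivative
  of the tangent flow is the derivative of the infinitesimal generator.\<close>

section \<open>Differential calculus in the sense of Michal and Bastiani\<close>

text \<open>The model space of the group need not be normed, and its products with coordinate spaces
  occur as well; joint continuity of the operations is a property that passes to such
  products.\<close>

definition tvs :: "'a::{real_vector,topological_space} itself \<Rightarrow> bool" where
  "tvs _ \<longleftrightarrow> continuous_on UNIV (\<lambda>(x::'a, y). x + y) \<and> continuous_on UNIV (\<lambda>(r::real, x::'a). r *\<^sub>R x)"

lemma tvs_tendsto_add:
  fixes f g :: "'b \<Rightarrow> 'a::{real_vector,topological_space}"
  assumes "tvs TYPE('a)" "(f \<longlongrightarrow> a) F" "(g \<longlongrightarrow> b) F"
  shows "((\<lambda>x. f x + g x) \<longlongrightarrow> a + b) F"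
proof -
  have "continuous_on UNIV (\<lambda>(x::'a, y). x + y)" using assms by (simp add: tvs_def)
  then have "((\<lambda>z. (case (f z, g z) of (x, y) \<Rightarrow> x + y)) \<longlongrightarrow> (case (a, b) of (x, y) \<Rightarrow> x + y)) F"
    by (rule continuous_on_tendsto_compose) (auto intro!: tendsto_Pair assms)
  then show ?thesis by simp
qed

lemma tvs_tendsto_scaleR:
  fixes f :: "'b \<Rightarrow> 'a::{real_vector,topological_space}"
  assumes "tvs TYPE('a)" "(r \<longlongrightarrow> s) F" "(f \<longlongrightarrow> a) F"
  shows "((\<lambda>x. r x *\<^sub>R f x) \<longlongrightarrow> s *\<^sub>R a) F"
proof -
  have "continuous_on UNIV (\<lambda>(r::real, x::'a). r *\<^sub>R x)" using assms by (simp add: tvs_def)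
  then have "((\<lambda>z. (case (r z, f z) of (x, y) \<Rightarrow> x *\<^sub>R y)) \<longlongrightarrow> (case (s, a) of (x, y) \<Rightarrow> x *\<^sub>R y)) F"
    by (rule continuous_on_tendsto_compose) (auto intro!: tendsto_Pair assms)
  then show ?thesis by simp
qed

lemma tvs_normed: "tvs TYPE('a::real_normed_vector)"
  unfolding tvs_def case_prod_unfold by (auto intro!: continuous_intros)

lemma tvs_prod:
  assumes "tvs TYPE('a::{real_vector,topological_space})" "tvs TYPE('b::{real_vector,topological_space})"
  shows "tvs TYPE('a \<times> 'b)"
  unfolding tvs_def case_prod_unfold plus_prod_def scaleR_prod_def
  unfolding continuous_on_def
  by (safe intro!: tendsto_Pair tvs_tendsto_add[OF assms(1)]
      tvs_tendsto_add[OF assms(2)] tvs_tendsto_scaleR[OF assms(1)] tvs_tendsto_scaleR[OF assms(2)]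
      tendsto_fst tendsto_snd tendsto_ident_at)

lemma locally_convex_tvs_imp_tvs:
  assumes "locally_convex_tvs TYPE('k::{real_vector,topological_ab_group_add,t2_space})"
  shows "tvs TYPE('k)"
  using assms unfolding tvs_def locally_convex_tvs_def case_prod_unfold
  by (auto intro!: continuous_intros)

lemma tendsto_fst_nhds: "(fst \<longlongrightarrow> a) (nhds (a, b))"
  using tendsto_fst[OF filterlim_ident[of "nhds (a, b)"]] by simp

lemma tendsto_snd_nhds: "(snd \<longlongrightarrow> b) (nhds (a, b))"
  using tendsto_snd[OF filterlim_ident[of "nhds (a, b)"]] by simp

lemma tvs_line:
  assumes "tvs TYPE('a::{real_vector,topological_space})"
  shows "((\<lambda>t::real. x + t *\<^sub>R v) \<longlongrightarrow> (x::'a)) (at 0)"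
  using tvs_tendsto_add[OF assms tendsto_const[of x] tvs_tendsto_scaleR[OF assms tendsto_ident_at[of 0 UNIV] tendsto_const[of v]]]
  by simp

text \<open>\<open>dirderiv\<close> has a value even where the limit does not exist; this predicate
  records existence together with the value.\<close>

definition has_dirderiv :: "('a::real_vector \<Rightarrow> 'b::{real_vector,t2_space}) \<Rightarrow> 'a \<Rightarrow> 'a \<Rightarrow> 'b \<Rightarrow> bool" where
  "has_dirderiv f x v l \<longleftrightarrow> ((\<lambda>t::real. (1 / t) *\<^sub>R (f (x + t *\<^sub>R v) - f x)) \<longlongrightarrow> l) (at 0)"

lemma has_dirderivD: "has_dirderiv f x v l \<Longrightarrow> dirderiv f x v = l"
  unfolding has_dirderiv_def dirderiv_def by (intro tendsto_Lim) auto

lemma has_dirderiv_cong: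
  fixes f g :: "'a::{real_vector,topological_space} \<Rightarrow> 'b::{real_vector,t2_space}"
  assumes "tvs TYPE('a)" "open S" "x \<in> S" "\<And>y. y \<in> S \<Longrightarrow> f y = g y" "has_dirderiv f x v l"
  shows "has_dirderiv g x v l"
proof -
  have "\<forall>\<^sub>F t in at 0. x + t *\<^sub>R v \<in> S"
    using tvs_line[OF assms(1)] assms(2,3) by (rule topological_tendstoD)
  then have "\<forall>\<^sub>F t in at 0. (1 / t) *\<^sub>R (f (x + t *\<^sub>R v) - f x) = (1 / t) *\<^sub>R (g (x + t *\<^sub>R v) - g x)"
    by eventually_elim (use assms in auto)
  then show ?thesis using assms(5) unfolding has_dirderiv_def by (rule tendsto_cong[THEN iffD1])
qed

text \<open>No differentiability is assumed: \<open>Lim\<close> depends only on which points are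
  limits, and that is determined by the germ of the function.\<close>

lemma dirderiv_cong_ev:
  fixes f g :: "'a::{real_vector,topological_space} \<Rightarrow> 'b::{real_vector,t2_space}"
  assumes "tvs TYPE('a)" "\<forall>\<^sub>F y in nhds x. f y = g y"
  shows "dirderiv f x v = dirderiv g x v"
proof -
  obtain S where S: "open S" "x \<in> S" "\<And>y. y \<in> S \<Longrightarrow> f y = g y"
    using assms(2) by (auto simp: eventually_nhds)
  have "\<forall>\<^sub>F t in at 0. x + t *\<^sub>R v \<in> S"
    using tvs_line[OF assms(1)] S(1,2) by (rule topological_tendstoD)
  then have "\<forall>\<^sub>F t in at 0. (1 / t) *\<^sub>R (f (x + t *\<^sub>R v) - f x) = (1 / t) *\<^sub>R (g (x + t *\<^sub>R v) - g x)"
    by eventually_elim (use S in auto)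
  then have *: "((\<lambda>t::real. (1 / t) *\<^sub>R (f (x + t *\<^sub>R v) - f x)) \<longlongrightarrow> l) (at 0) \<longleftrightarrow>
      ((\<lambda>t::real. (1 / t) *\<^sub>R (g (x + t *\<^sub>R v) - g x)) \<longlongrightarrow> l) (at 0)" for l
    by (rule tendsto_cong)
  show ?thesis unfolding dirderiv_def Topological_Spaces.Lim_def * ..
qed

lemma dirderiv_cong_open:
  fixes f g :: "'a::{real_vector,topological_space} \<Rightarrow> 'b::{real_vector,t2_space}"
  assumes "tvs TYPE('a)" "open S" "x \<in> S" "\<And>y. y \<in> S \<Longrightarrow> f y = g y"
  shows "dirderiv f x v = dirderiv g x v"
  using assms(2-4) by (intro dirderiv_cong_ev[OF assms(1)]) (auto intro: eventually_nhds_in_open[THEN eventually_mono])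

lemma has_dirderiv_scaleR:
  assumes "has_dirderiv f x v l"
  shows "has_dirderiv (f :: 'a::real_vector \<Rightarrow> 'b::real_normed_vector) x (c *\<^sub>R v) (c *\<^sub>R l)"
proof (cases "c = 0")
  case True then show ?thesis by (simp add: has_dirderiv_def)
next
  case False
  have "filterlim (\<lambda>t. c * t) (at 0) (at (0::real))"
    using False tendsto_mult[OF tendsto_const[of c] tendsto_ident_at[of "0::real" UNIV]]
    by (simp add: filterlim_at eventually_at_filter)
  from filterlim_compose[OF assms[unfolded has_dirderiv_def] this]
  have "((\<lambda>t. c *\<^sub>R ((1 / (c * t)) *\<^sub>R (f (x + (c * t) *\<^sub>R v) - f x))) \<longlongrightarrow> c *\<^sub>R l) (at 0)"
    by (intro tendsto_intros)
  then show ?thesis using False by (simp add: has_dirderiv_def mult.commute)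
qed

text \<open>The mean value inequality for \<open>g s - s *\<^sub>R l\<close>: if all derivatives are
  close to \<open>l\<close>, so is the difference quotient. The segment may run to a negative
  \<open>t\<close>.\<close>

lemma mean_value_bound:
  fixes g :: "real \<Rightarrow> 'b::real_normed_vector"
  assumes "\<And>s. \<bar>s\<bar> \<le> \<bar>t\<bar> \<Longrightarrow> (g has_vector_derivative g' s) (at s)"
    and "\<And>s. \<bar>s\<bar> \<le> \<bar>t\<bar> \<Longrightarrow> norm (g' s - l) \<le> e"
  shows "norm (g t - g 0 - t *\<^sub>R l) \<le> e * \<bar>t\<bar>"
proof -
  define h where "h s = g s - s *\<^sub>R l" for s
  have "norm (h t - h 0) \<le> e * norm (t - 0)"
  proof (rule differentiable_bound)
    show "convex (closed_segment 0 t)" by simp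
    fix s assume "s \<in> closed_segment 0 t"
    then have s: "\<bar>s\<bar> \<le> \<bar>t\<bar>" by (auto simp: closed_segment_eq_real_ivl split: if_splits)
    have "(h has_vector_derivative (g' s - l)) (at s)"
      unfolding h_def by (auto intro!: derivative_eq_intros assms(1) s)
    then show "(h has_derivative (\<lambda>r. r *\<^sub>R (g' s - l))) (at s within closed_segment 0 t)"
      by (auto simp: has_vector_derivative_def intro: has_derivative_at_withinI)
    have "0 \<le> e" using norm_ge_zero assms(2)[OF s] by (rule order_trans)
    then show "onorm (\<lambda>r. r *\<^sub>R (g' s - l)) \<le> e"
      using assms(2)[OF s] by (intro onorm_le) (auto simp: mult.commute[of e] mult_left_mono)
  qed auto
  then show ?thesis by (simp add: h_def algebra_simps)
qed

lemma has_dirderiv_vector: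
  fixes f :: "'a::real_vector \<Rightarrow> 'b::real_normed_vector"
  assumes "has_dirderiv f (x + s *\<^sub>R v) v l"
  shows "((\<lambda>s::real. f (x + s *\<^sub>R v)) has_vector_derivative l) (at s)"
proof -
  have "((\<lambda>h. norm ((1 / h) *\<^sub>R (f (x + s *\<^sub>R v + h *\<^sub>R v) - f (x + s *\<^sub>R v)) - l)) \<longlongrightarrow> 0) (at 0)"
    using assms unfolding has_dirderiv_def by (intro tendsto_norm_zero LIM_zero)
  moreover have "\<forall>\<^sub>F h in at 0. norm ((1 / h) *\<^sub>R (f (x + s *\<^sub>R v + h *\<^sub>R v) - f (x + s *\<^sub>R v)) - l) =
       norm (f (x + (s + h) *\<^sub>R v) - f (x + s *\<^sub>R v) - h *\<^sub>R l) / norm h"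
    using eventually_neq_at_within[of 0]
  proof eventually_elim
    fix h :: real assume h: "h \<noteq> 0"
    have "(1 / h) *\<^sub>R (f (x + s *\<^sub>R v + h *\<^sub>R v) - f (x + s *\<^sub>R v)) - l =
        (1/h) *\<^sub>R (f (x + (s + h) *\<^sub>R v) - f (x + s *\<^sub>R v) - h *\<^sub>R l)"
      using h by (simp add: scaleR_diff_right scaleR_add_left add.assoc)
    then show "norm ((1 / h) *\<^sub>R (f (x + s *\<^sub>R v + h *\<^sub>R v) - f (x + s *\<^sub>R v)) - l) =
       norm (f (x + (s + h) *\<^sub>R v) - f (x + s *\<^sub>R v) - h *\<^sub>R l) / norm h" by simp
  qed
  ultimately have "((\<lambda>h. norm (f (x + (s + h) *\<^sub>R v) - f (x + s *\<^sub>R v) - h *\<^sub>R l) / norm h) \<longlongrightarrow> 0) (at 0)"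
    by (rule Lim_transform_eventually)
  then show ?thesis
    unfolding has_vector_derivative_def has_derivative_at by (simp add: bounded_linear_scaleR_left)
qed

section \<open>Class C^1: linearity and the chain rule\<close>

text \<open>Class \<open>C\<^sup>1\<close> in the sense of Michal and Bastiani. On a finite-dimensional space it implies Frechet
  differentiability (\<open>BC1_has_derivative\<close>), which links \<^const>\<open>smooth_on\<close> to \<open>has_derivative\<close>; the Lie group
  may be infinite-dimensional, so there only directional derivatives are available.\<close>

definition BC1 :: "'a::{real_vector,topological_space} set \<Rightarrow> ('a \<Rightarrow> 'b::{real_vector,t2_space}) \<Rightarrow> bool" where
  "BC1 S f \<longleftrightarrow> open S \<and> continuous_on S f \<and> (\<forall>x\<in>S. \<forall>v. has_dirderiv f x v (dirderiv f x v)) \<and>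
     continuous_on (S \<times> UNIV) (\<lambda>(x, v). dirderiv f x v)"

lemma BC1_open: "BC1 S f \<Longrightarrow> open S" and BC1_cont: "BC1 S f \<Longrightarrow> continuous_on S f"
  and BC1_dirderiv: "BC1 S f \<Longrightarrow> x \<in> S \<Longrightarrow> has_dirderiv f x v (dirderiv f x v)"
  and BC1_cont_dirderiv: "BC1 S f \<Longrightarrow> continuous_on (S \<times> UNIV) (\<lambda>(x, v). dirderiv f x v)"
  by (auto simp: BC1_def)

text \<open>Base point and direction may move with \<open>t\<close>: joint continuity controls the
  derivative on a whole short segment, and the mean value bound does the rest. This strict form
  stands in for Frechet remainders, which make no sense without a norm on \<open>'a\<close>.\<close>

lemma BC1_strict:
  fixes f :: "'a::{real_vector,topological_space} \<Rightarrow> 'b::real_normed_vector"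
  assumes tvs: "tvs TYPE('a)" and f: "BC1 S f" and x: "x \<in> S"
    and a: "(a \<longlongrightarrow> x) (at 0)" and d: "(d \<longlongrightarrow> v) (at 0)"
  shows "((\<lambda>t::real. (1 / t) *\<^sub>R (f (a t + t *\<^sub>R d t) - f (a t))) \<longlongrightarrow> dirderiv f x v) (at 0)"
proof (rule tendstoI)
  fix e :: real assume e: "e > 0"
  define A where "A = {(y, w). y \<in> S \<and> dist (dirderiv f y w) (dirderiv f x v) < e / 2}"
  have "open (S \<times> (UNIV :: 'a set))" using f by (auto simp: BC1_def intro: open_Times)
  moreover have "A = (\<lambda>(x, v). dirderiv f x v) -` ball (dirderiv f x v) (e/2) \<inter> (S \<times> UNIV)"
    by (auto simp: A_def dist_commute)
  ultimately have A: "open A"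
    using continuous_on_open_vimage[of "S \<times> UNIV" "\<lambda>(x, v). dirderiv f x v"] f
    by (auto simp: BC1_def)
  \<comment> \<open>Near \<open>(0, x, v)\<close> the point \<open>y + s *\<^sub>R w\<close> stays
    in the open set \<open>A\<close> for all small \<open>s\<close> at once, so whole segments lie
    inside.\<close>
  have "((\<lambda>(s, y, w). (y + s *\<^sub>R w, w)) \<longlongrightarrow> (x + 0 *\<^sub>R v, v)) (nhds (0, x, v))"
    unfolding case_prod_unfold
    by (intro tendsto_Pair tvs_tendsto_add[OF tvs] tvs_tendsto_scaleR[OF tvs]
        tendsto_fst_nhds tendsto_snd_nhds filterlim_compose[OF tendsto_fst_nhds tendsto_snd_nhds]
        filterlim_compose[OF tendsto_snd_nhds tendsto_snd_nhds])
  then have "\<forall>\<^sub>F z in nhds (0, x, v). (case z of (s, y, w) \<Rightarrow> (y + s *\<^sub>R w, w)) \<in> A"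
    by (rule topological_tendstoD) (use A x e in \<open>auto simp: A_def\<close>)
  then have "\<forall>\<^sub>F z in nhds (0::real) \<times>\<^sub>F (nhds (x, v)). (case z of (s, y, w) \<Rightarrow> (y + s *\<^sub>R w, w)) \<in> A"
    by (simp add: nhds_prod)
  then obtain P Q where P: "eventually P (nhds (0::real))" and Q: "eventually Q (nhds (x, v))"
    and PQ: "\<And>s y w. P s \<Longrightarrow> Q (y, w) \<Longrightarrow> (y + s *\<^sub>R w, w) \<in> A"
    unfolding eventually_prod_filter by auto
  obtain \<delta> where \<delta>: "\<delta> > 0" "\<And>s. \<bar>s\<bar> < \<delta> \<Longrightarrow> P s"
    using P unfolding eventually_nhds_metric by (auto simp: dist_real_def)
  have "((\<lambda>t. (a t, d t)) \<longlongrightarrow> (x, v)) (at 0)" using a d by (rule tendsto_Pair)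
  then have ev: "\<forall>\<^sub>F t in at 0. Q (a t, d t)" using Q by (rule eventually_compose_filterlim[rotated])
  have "\<forall>\<^sub>F t in at (0::real). \<bar>t\<bar> < \<delta> \<and> t \<noteq> 0"
    using \<delta>(1) by (auto simp: eventually_at dist_real_def)
  with ev show "\<forall>\<^sub>F t in at 0. dist ((1 / t) *\<^sub>R (f (a t + t *\<^sub>R d t) - f (a t))) (dirderiv f x v) < e"
  proof eventually_elim
    case (elim t)
    have inA: "(a t + s *\<^sub>R d t, d t) \<in> A" if "\<bar>s\<bar> \<le> \<bar>t\<bar>" for s
      using PQ[of s "a t" "d t"] \<delta>(2)[of s] that elim by auto
    have *: "norm (f (a t + t *\<^sub>R d t) - f (a t + 0 *\<^sub>R d t) - t *\<^sub>R dirderiv f x v) \<le> e/2 * \<bar>t\<bar>"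
    proof (rule mean_value_bound)
      fix s assume s: "\<bar>s\<bar> \<le> \<bar>t\<bar>"
      show "((\<lambda>s. f (a t + s *\<^sub>R d t)) has_vector_derivative dirderiv f (a t + s *\<^sub>R d t) (d t)) (at s)"
        using inA[OF s] f by (intro has_dirderiv_vector) (auto simp: A_def BC1_def)
      show "norm (dirderiv f (a t + s *\<^sub>R d t) (d t) - dirderiv f x v) \<le> e / 2"
        using inA[OF s] by (auto simp: A_def dist_norm)
    qed
    have "(1 / t) *\<^sub>R (f (a t + t *\<^sub>R d t) - f (a t)) - dirderiv f x v =
        (1/t) *\<^sub>R (f (a t + t *\<^sub>R d t) - f (a t) - t *\<^sub>R dirderiv f x v)"
      using elim by (simp add: scaleR_diff_right)
    then have "norm ((1 / t) *\<^sub>R (f (a t + t *\<^sub>R d t) - f (a t)) - dirderiv f x v) =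
        (1 / \<bar>t\<bar>) * norm (f (a t + t *\<^sub>R d t) - f (a t) - t *\<^sub>R dirderiv f x v)" by simp
    also have "\<dots> \<le> (1 / \<bar>t\<bar>) * (e/2 * \<bar>t\<bar>)" using * by (intro mult_left_mono) auto
    also have "\<dots> = e / 2" using elim by simp
    finally have "norm ((1 / t) *\<^sub>R (f (a t + t *\<^sub>R d t) - f (a t)) - dirderiv f x v) \<le> e / 2" .
    then show ?case using e by (simp add: dist_norm)
  qed
qed

text \<open>The increment along \<open>v + w\<close> splits into a step along \<open>v\<close> and a
  step along \<open>w\<close> from the moving point \<open>x + t *\<^sub>R v\<close>; the latter is
  a case of \<open>BC1_strict\<close>.\<close>

lemma BC1_linear:
  fixes f :: "'a::{real_vector,topological_space} \<Rightarrow> 'b::real_normed_vector"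
  assumes tvs: "tvs TYPE('a)" and f: "BC1 S f" and x: "x \<in> S"
  shows "linear (dirderiv f x)"
proof
  fix v w :: 'a
  have "((\<lambda>t::real. (1 / t) *\<^sub>R (f ((x + t *\<^sub>R v) + t *\<^sub>R w) - f (x + t *\<^sub>R v))
       + (1 / t) *\<^sub>R (f (x + t *\<^sub>R v) - f x)) \<longlongrightarrow> dirderiv f x w + dirderiv f x v) (at 0)"
    using BC1_dirderiv[OF f x, of v] unfolding has_dirderiv_def
    by (intro tendsto_add BC1_strict[OF tvs f x] tvs_line[OF tvs] tendsto_const)
  then have "has_dirderiv f x (v + w) (dirderiv f x w + dirderiv f x v)"
    unfolding has_dirderiv_def by (simp add: scaleR_add_right[symmetric] add.assoc)
  then show "dirderiv f x (v + w) = dirderiv f x v + dirderiv f x w"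
    by (simp add: has_dirderivD add.commute)
next
  fix c v show "dirderiv f x (c *\<^sub>R v) = c *\<^sub>R dirderiv f x v"
    using has_dirderivD[OF has_dirderiv_scaleR[OF BC1_dirderiv[OF f x]]] .
qed

text \<open>The difference quotient of \<open>u\<close> serves as the moving direction in
  \<open>BC1_strict\<close>.\<close>

lemma BC1_compose:
  fixes f :: "'a::{real_vector,t2_space} \<Rightarrow> 'b::real_normed_vector"
    and u :: "'c::{real_vector,topological_space} \<Rightarrow> 'a"
  assumes tvs: "tvs TYPE('a)" and f: "BC1 S f" and u: "BC1 T u" and uT: "u ` T \<subseteq> S"
  shows "BC1 T (\<lambda>x. f (u x))"
    and "\<And>x v. x \<in> T \<Longrightarrow> dirderiv (\<lambda>x. f (u x)) x v = dirderiv f (u x) (dirderiv u x v)"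
proof -
  have *: "has_dirderiv (\<lambda>x. f (u x)) x v (dirderiv f (u x) (dirderiv u x v))" if x: "x \<in> T" for x v
  proof -
    have "((\<lambda>t::real. (1 / t) *\<^sub>R (u (x + t *\<^sub>R v) - u x)) \<longlongrightarrow> dirderiv u x v) (at 0)"
      using BC1_dirderiv[OF u x] by (simp add: has_dirderiv_def)
    then have "((\<lambda>t::real. (1 / t) *\<^sub>R (f (u x + t *\<^sub>R ((1 / t) *\<^sub>R (u (x + t *\<^sub>R v) - u x))) - f (u x))) \<longlongrightarrow>
       dirderiv f (u x) (dirderiv u x v)) (at 0)"
      using x uT by (intro BC1_strict[OF tvs f]) auto
    moreover have "\<forall>\<^sub>F t in at (0::real). (1 / t) *\<^sub>R (f (u x + t *\<^sub>R ((1 / t) *\<^sub>R (u (x + t *\<^sub>R v) - u x))) - f (u x)) =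
      (1 / t) *\<^sub>R (f (u (x + t *\<^sub>R v)) - f (u x))"
      by (rule eventually_mono[OF eventually_neq_at_within[of 0]]) (auto simp: )
    ultimately show ?thesis unfolding has_dirderiv_def by (rule Lim_transform_eventually)
  qed
  then show **: "\<And>x v. x \<in> T \<Longrightarrow> dirderiv (\<lambda>x. f (u x)) x v = dirderiv f (u x) (dirderiv u x v)"
    by (rule has_dirderivD)
  have "continuous_on (T \<times> UNIV) (\<lambda>z. (\<lambda>(x, v). dirderiv f x v) (u (fst z), dirderiv u (fst z) (snd z)))"
    using uT BC1_cont_dirderiv[OF u] unfolding case_prod_unfold
    by (intro continuous_on_compose2[OF BC1_cont_dirderiv[OF f, unfolded case_prod_unfold]] continuous_on_Pair
        continuous_on_compose2[OF BC1_cont[OF u]] continuous_on_fst continuous_on_id) auto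
  then have "continuous_on (T \<times> UNIV) (\<lambda>(x, v). dirderiv (\<lambda>x. f (u x)) x v)"
    by (rule continuous_on_cong[THEN iffD1, rotated -1]) (auto simp: **)
  moreover have "continuous_on T (\<lambda>x. f (u x))"
    using continuous_on_compose2[OF BC1_cont[OF f] BC1_cont[OF u] uT] .
  ultimately show "BC1 T (\<lambda>x. f (u x))"
    using BC1_open[OF u] * ** by (auto simp: BC1_def)
qed

lemma BC1_cong:
  fixes f g :: "'a::{real_vector,topological_space} \<Rightarrow> 'b::{real_vector,t2_space}"
  assumes "tvs TYPE('a)" "BC1 S f" "\<And>x. x \<in> S \<Longrightarrow> f x = g x"
  shows "BC1 S g"
proof -
  have *: "dirderiv f x v = dirderiv g x v" if "x \<in> S" for x v
    using dirderiv_cong_open[OF assms(1) BC1_open[OF assms(2)] that] assms(3) by blast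
  have "has_dirderiv g x v (dirderiv g x v)" if "x \<in> S" for x v
    using has_dirderiv_cong[OF assms(1) BC1_open[OF assms(2)] that assms(3) BC1_dirderiv[OF assms(2) that]]
    by (simp add: *[OF that, symmetric])
  moreover have "continuous_on (S \<times> UNIV) (\<lambda>(x, v). dirderiv g x v)"
    using BC1_cont_dirderiv[OF assms(2)] by (rule continuous_on_cong[THEN iffD1, rotated -1]) (auto simp: *)
  moreover have "continuous_on S g"
    using BC1_cont[OF assms(2)] by (rule continuous_on_cong[THEN iffD1, rotated -1]) (auto simp: assms(3))
  ultimately show ?thesis using assms(2) by (simp add: BC1_def)
qed

lemma BC1_subset: "BC1 S f \<Longrightarrow> open T \<Longrightarrow> T \<subseteq> S \<Longrightarrow> BC1 T f"
  unfolding BC1_def using continuous_on_subset[of S f T]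
    continuous_on_subset[of "S \<times> UNIV" "\<lambda>(x, v). dirderiv f x v" "T \<times> UNIV"] by blast

lemma has_dirderiv_Pair:
  "has_dirderiv f x v l \<Longrightarrow> has_dirderiv g x v m \<Longrightarrow> has_dirderiv (\<lambda>x. (f x, g x)) x v (l, m)"
  unfolding has_dirderiv_def by (simp add: tendsto_Pair)

lemma BC1_Pair:
  assumes "BC1 S f" "BC1 S g"
  shows "BC1 S (\<lambda>x. (f x, g x))"
    and "x \<in> S \<Longrightarrow> dirderiv (\<lambda>x. (f x, g x)) x v = (dirderiv f x v, dirderiv g x v)"
proof -
  have *: "has_dirderiv (\<lambda>x. (f x, g x)) x v (dirderiv f x v, dirderiv g x v)" if "x \<in> S" for x v
    using that assms by (intro has_dirderiv_Pair BC1_dirderiv)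
  note ** = has_dirderivD[OF *]
  then show "x \<in> S \<Longrightarrow> dirderiv (\<lambda>x. (f x, g x)) x v = (dirderiv f x v, dirderiv g x v)" by simp
  have "continuous_on (S \<times> UNIV) (\<lambda>z. (dirderiv f (fst z) (snd z), dirderiv g (fst z) (snd z)))"
    using BC1_cont_dirderiv[OF assms(1)] BC1_cont_dirderiv[OF assms(2)] unfolding case_prod_unfold
    by (rule continuous_on_Pair)
  then have "continuous_on (S \<times> UNIV) (\<lambda>(x, v). dirderiv (\<lambda>x. (f x, g x)) x v)"
    by (rule continuous_on_cong[THEN iffD1, rotated -1]) (auto simp: **)
  then show "BC1 S (\<lambda>x. (f x, g x))"
    using assms * ** by (auto simp: BC1_def intro: continuous_on_Pair)
qed

lemma BC1_linear_map:
  fixes f :: "'a::{real_vector,topological_space} \<Rightarrow> 'b::{real_vector,t2_space}"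
  assumes "linear f" "continuous_on UNIV f" "open S"
  shows "BC1 S f" "dirderiv f x v = f v"
proof -
  have h: "has_dirderiv f x v (f v)" for x v
  proof -
    have "\<forall>\<^sub>F t in at (0::real). (1 / t) *\<^sub>R (f (x + t *\<^sub>R v) - f x) = f v"
      by (rule eventually_mono[OF eventually_neq_at_within[of 0]])
         (auto simp: linear_add[OF assms(1)] linear_cmul[OF assms(1)])
    then show ?thesis unfolding has_dirderiv_def by (rule tendsto_eventually)
  qed
  then show d: "dirderiv f x v = f v" for x v by (rule has_dirderivD)
  show "BC1 S f"
    using assms h continuous_on_subset[OF assms(2)] continuous_on_compose2[OF assms(2), of "S \<times> UNIV" snd]
    unfolding BC1_def d case_prod_unfold by (simp add: continuous_on_snd)
qed

lemma BC1_const: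
  fixes c :: "'b::{real_vector,t2_space}"
  assumes "open S" shows "BC1 S (\<lambda>x::'a::{real_vector,topological_space}. c)" "dirderiv (\<lambda>x::'a. c) x v = 0"
proof -
  have h: "has_dirderiv (\<lambda>x::'a. c) x v 0" for x v by (simp add: has_dirderiv_def)
  then show d: "dirderiv (\<lambda>x::'a. c) x v = 0" for x v by (rule has_dirderivD)
  show "BC1 S (\<lambda>x::'a. c)"
    using assms h unfolding BC1_def d by (auto simp: case_prod_unfold)
qed

section \<open>Class C^2 and its relation to smoothness\<close>

definition C2on :: "'a::{real_vector,topological_space} set \<Rightarrow> ('a \<Rightarrow> 'b::{real_vector,t2_space}) \<Rightarrow> bool" where
  "C2on S f \<longleftrightarrow> BC1 S f \<and> BC1 (S \<times> UNIV) (\<lambda>(x, v). dirderiv f x v)"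

lemma smooth_on_BC1:
  fixes f :: "'a::{real_vector,topological_space} \<Rightarrow> 'b::{real_vector,t2_space}"
  assumes "smooth_on S f"
  shows "BC1 S f"
proof -
  have "has_dirderiv f x v (dirderiv f x v)" if x: "x \<in> S" for x v
  proof -
    obtain l where "has_dirderiv f x v l"
      using assms[unfolded smooth_on_def, THEN conjunct2, rule_format, of 0, THEN conjunct1, rule_format,
          of x "\<lambda>_. v"] x by (auto simp: has_dirderiv_def)
    with has_dirderivD[OF this] show ?thesis by simp
  qed
  moreover have "continuous_on S f"
  proof -
    have "continuous_on (S \<times> UNIV) (\<lambda>(x, w :: nat \<Rightarrow> 'a). f x)"
      using assms[unfolded smooth_on_def, THEN conjunct2, rule_format, of 0] by simp
    moreover have "continuous_on S (\<lambda>x. (x, \<lambda>_::nat. 0::'a))"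
      by (intro continuous_on_Pair continuous_on_id continuous_on_const)
    ultimately show ?thesis
      using continuous_on_compose2[of "S \<times> UNIV" _ S "\<lambda>x. (x, \<lambda>_::nat. 0::'a)"] by force
  qed
  moreover have "continuous_on (S \<times> UNIV) (\<lambda>(x, v). dirderiv f x v)"
  proof -
    have "continuous_on (S \<times> UNIV) (\<lambda>(x, w). iter_dirderiv (Suc 0) f w x)"
      using assms[unfolded smooth_on_def, THEN conjunct2, rule_format, of "Suc 0"] by blast
    moreover have "continuous_on (S \<times> UNIV) (\<lambda>z :: 'a \<times> 'a. (fst z, \<lambda>_::nat. snd z))"
      by (intro continuous_on_Pair continuous_on_fst continuous_on_snd continuous_on_id
          continuous_on_coordinatewise_then_product)
    moreover have "(\<lambda>z :: 'a \<times> 'a. (fst z, \<lambda>_::nat. snd z)) ` (S \<times> UNIV) \<subseteq> S \<times> UNIV" by auto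
    ultimately show ?thesis
      using continuous_on_compose2[of "S \<times> UNIV" "\<lambda>(x, w). iter_dirderiv (Suc 0) f w x" "S \<times> UNIV"
          "\<lambda>z :: 'a \<times> 'a. (fst z, \<lambda>_::nat. snd z)"] by (simp add: case_prod_unfold)
  qed
  ultimately show ?thesis using assms by (auto simp: BC1_def smooth_on_def)
qed

text \<open>Smoothness supplies derivatives in the base point with the direction held fixed;
  linearity of \<open>dirderiv f x\<close> supplies the derivative in the direction.\<close>

lemma smooth_on_C2on:
  fixes f :: "'a::{real_vector,topological_space} \<Rightarrow> 'b::real_normed_vector"
  assumes tvs: "tvs TYPE('a)" and f: "smooth_on S f"
  shows "C2on S f"
proof -
  note B = smooth_on_BC1[OF f]
  define f2 where "f2 x v w = dirderiv (\<lambda>y. dirderiv f y v) x w" for x v w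
  have h2: "has_dirderiv (\<lambda>y. dirderiv f y v) x w (f2 x v w)" if x: "x \<in> S" for x v w
  proof -
    obtain l where "has_dirderiv (\<lambda>y. dirderiv f y v) x w l"
      using f[unfolded smooth_on_def, THEN conjunct2, rule_format, of "Suc 0", THEN conjunct1, rule_format,
          of x "\<lambda>i. if i = 0 then v else w"] x by (auto simp: has_dirderiv_def)
    with has_dirderivD[OF this] show ?thesis by (simp add: f2_def)
  qed
  have c2: "continuous_on (S \<times> UNIV \<times> UNIV) (\<lambda>(x, v, w). f2 x v w)"
  proof -
    have "continuous_on (S \<times> UNIV) (\<lambda>(x, w). iter_dirderiv (Suc (Suc 0)) f w x)"
      using f[unfolded smooth_on_def, THEN conjunct2, rule_format, of "Suc (Suc 0)"] by blast
    \<comment> \<open>At order two only the first two entries of a direction sequence matter, so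
      pairs of directions embed continuously into sequences.\<close>
    from continuous_on_compose2[OF this, of "S \<times> UNIV \<times> UNIV" "\<lambda>(x, v, w). (x, \<lambda>i. if i = 0 then v else w)"]
    have "continuous_on (S \<times> UNIV \<times> UNIV) (\<lambda>z. case (case z of (x, v, w) \<Rightarrow> (x, \<lambda>i. if i = 0 then v else w)) of (x, w) \<Rightarrow> iter_dirderiv (Suc (Suc 0)) f w x)"
    proof (rule meta_mp)
      have "continuous_on (S \<times> UNIV \<times> UNIV) (\<lambda>z::'a \<times> 'a \<times> 'a. if i = 0 then fst (snd z) else snd (snd z))" for i :: nat
        by (cases "i = 0") (auto intro!: continuous_on_fst continuous_on_snd continuous_on_id)
      then show "continuous_on (S \<times> UNIV \<times> UNIV) (\<lambda>(x, v, w). (x :: 'a, \<lambda>i::nat. if i = 0 then v else w :: 'a))"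
        by (auto simp: case_prod_unfold intro!: continuous_on_Pair continuous_on_fst continuous_on_id continuous_on_coordinatewise_then_product)
    qed auto
    then show ?thesis by (auto simp: f2_def case_prod_unfold)
  qed
  have hd: "has_dirderiv (\<lambda>(x, v). dirderiv f x v) (x, v) (w, u) (f2 x v w + dirderiv f x u)" if x: "x \<in> S" for x v w u
  proof -
    have ev: "\<forall>\<^sub>F t in at (0::real). x + t *\<^sub>R w \<in> S \<and> t \<noteq> 0"
      using tvs_line[OF tvs, THEN topological_tendstoD, OF BC1_open[OF B] x]
      by (intro eventually_conj eventually_neq_at_within)
    have "((\<lambda>t. dirderiv f (x + t *\<^sub>R w) u) \<longlongrightarrow> dirderiv f x u) (at 0)"
      using continuous_on_tendsto_compose[OF BC1_cont_dirderiv[OF B], of "\<lambda>t. (x + t *\<^sub>R w, u)" "(x, u)" "at 0"]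
        tendsto_Pair[OF tvs_line[OF tvs, of x w] tendsto_const[of u]] ev x by (simp add: eventually_conj_iff)
    then have "((\<lambda>t. (1 / t) *\<^sub>R (dirderiv f (x + t *\<^sub>R w) v - dirderiv f x v) + dirderiv f (x + t *\<^sub>R w) u)
        \<longlongrightarrow> f2 x v w + dirderiv f x u) (at 0)"
      using h2[OF x] unfolding has_dirderiv_def by (intro tendsto_add)
    moreover have "\<forall>\<^sub>F t in at (0::real).
        (1 / t) *\<^sub>R (dirderiv f (x + t *\<^sub>R w) v - dirderiv f x v) + dirderiv f (x + t *\<^sub>R w) u =
        (1 / t) *\<^sub>R ((\<lambda>(x, v). dirderiv f x v) ((x, v) + t *\<^sub>R (w, u)) - (\<lambda>(x, v). dirderiv f x v) (x, v))"
      using ev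
    proof eventually_elim
      case (elim t)
      then have "linear (dirderiv f (x + t *\<^sub>R w))" using BC1_linear[OF tvs B] by blast
      from linear_add[OF this] linear_cmul[OF this] elim show ?case
        by (simp add: scaleR_diff_right scaleR_add_right)
    qed
    ultimately show ?thesis unfolding has_dirderiv_def by (rule Lim_transform_eventually)
  qed
  have eq: "dirderiv (\<lambda>(x, v). dirderiv f x v) (x, v) (w, u) = f2 x v w + dirderiv f x u" if "x \<in> S" for x v w u
    using hd[OF that] by (rule has_dirderivD)
  have "continuous_on ((S \<times> UNIV) \<times> UNIV) (\<lambda>z. (\<lambda>(x, v, w). f2 x v w) (fst (fst z), snd (fst z), fst (snd z)) +
      (\<lambda>(x, v). dirderiv f x v) (fst (fst z), snd (snd z)))"
    by (intro continuous_on_add continuous_on_compose2[OF c2] continuous_on_compose2[OF BC1_cont_dirderiv[OF B]]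
        continuous_on_Pair continuous_on_fst continuous_on_snd continuous_on_id) auto
  then have "continuous_on ((S \<times> UNIV) \<times> UNIV) (\<lambda>(z, w). dirderiv (\<lambda>(x, v). dirderiv f x v) z w)"
    by (rule continuous_on_cong[THEN iffD1, rotated -1]) (auto simp: eq)
  moreover have "open (S \<times> (UNIV :: 'a set))" using BC1_open[OF B] by (auto intro: open_Times)
  ultimately have "BC1 (S \<times> UNIV) (\<lambda>(x, v). dirderiv f x v)"
    using hd BC1_cont_dirderiv[OF B] eq unfolding BC1_def by auto
  with B show ?thesis by (simp add: C2on_def)
qed

section \<open>Finite-dimensional normed spaces\<close>

text \<open>The model fiber may be zero-dimensional, so the class \<open>euclidean_space\<close> is not available for it.\<close>

definition findim :: "'a::real_normed_vector itself \<Rightarrow> bool" where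
  "findim _ \<longleftrightarrow> (\<exists>B::'a set. finite B \<and> span B = UNIV)"

lemma findim_basis:
  assumes "findim TYPE('a::real_normed_vector)"
  obtains B :: "'a::real_normed_vector set" where "finite B" "independent B" "span B = UNIV"
proof -
  obtain S :: "'a set" where S: "finite S" "span S = UNIV" using assms by (auto simp: findim_def)
  obtain B where B: "B \<subseteq> S" "independent B" "S \<subseteq> span B" using maximal_independent_subset[of S] by metis
  have "span B = UNIV" using S(2) span_minimal[OF B(3) subspace_span] by auto
  with B S that show ?thesis using finite_subset by blast
qed

lemma compact_box_combinations:
  fixes B :: "'a::real_normed_vector set"
  assumes "finite B"
  shows "compact {\<Sum>b\<in>B. c b *\<^sub>R b | c. \<forall>b\<in>B. \<bar>c b\<bar> \<le> (1::real)}" (is "compact (?K B)")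
  using assms
proof (induction B)
  case empty then show ?case by simp
next
  case (insert a B)
  have "?K (insert a B) = {x + y | x y. x \<in> (\<lambda>r. r *\<^sub>R a) ` {-1..1} \<and> y \<in> ?K B}"
  proof safe
    fix c :: "'a \<Rightarrow> real" assume c: "\<forall>b\<in>insert a B. \<bar>c b\<bar> \<le> 1"
    have "(\<Sum>b\<in>insert a B. c b *\<^sub>R b) = c a *\<^sub>R a + (\<Sum>b\<in>B. c b *\<^sub>R b)"
      using insert by simp
    moreover have "c a *\<^sub>R a \<in> (\<lambda>r. r *\<^sub>R a) ` {-1..1}" using c by (intro imageI) (auto simp: abs_le_iff)
    moreover have "(\<Sum>b\<in>B. c b *\<^sub>R b) \<in> ?K B" using c by auto
    ultimately show "\<exists>x y. (\<Sum>b\<in>insert a B. c b *\<^sub>R b) = x + y \<and> x \<in> (\<lambda>r. r *\<^sub>R a) ` {-1..1} \<and> y \<in> ?K B" by blast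
  next
    fix c :: "'a \<Rightarrow> real" and r :: real assume c: "\<forall>b\<in>B. \<bar>c b\<bar> \<le> 1" and r: "r \<in> {-1..1}"
    have "r *\<^sub>R a + (\<Sum>b\<in>B. c b *\<^sub>R b) = (\<Sum>b\<in>insert a B. (c(a := r)) b *\<^sub>R b)"
    proof -
      have "(\<Sum>b\<in>B. (c(a := r)) b *\<^sub>R b) = (\<Sum>b\<in>B. c b *\<^sub>R b)"
        using insert.hyps by (intro sum.cong) auto
      then show ?thesis using insert.hyps by simp
    qed
    moreover have "\<forall>b\<in>insert a B. \<bar>(c(a := r)) b\<bar> \<le> 1" using c r by auto
    ultimately show "\<exists>ca. r *\<^sub>R a + (\<Sum>b\<in>B. c b *\<^sub>R b) = (\<Sum>b\<in>insert a B. ca b *\<^sub>R b) \<and> (\<forall>b\<in>insert a B. \<bar>ca b\<bar> \<le> 1)"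
      by blast
  qed
  also have "compact \<dots>"
    by (intro compact_sums insert.IH compact_continuous_image continuous_intros) auto
  finally show ?case .
qed

text \<open>Coordinates are bounded because a vector whose largest coordinate is \<open>1\<close>
  cannot come close to \<open>0\<close>: it lies in a translate of a compact box spanned by the
  other basis vectors, and this compact set misses \<open>0\<close> by independence.\<close>

lemma bounded_linear_representation:
  fixes B :: "'a::real_normed_vector set"
  assumes B: "finite B" "independent B" "span B = UNIV"
  shows "bounded_linear (\<lambda>x. representation B x b)"
proof -
  have rep: "(\<Sum>b\<in>B. representation B x b *\<^sub>R b) = x" for x
    using sum_representation_eq[OF B(2) _ B(1), of x] B(3) by simp
  have "\<exists>\<delta>>0. \<forall>c. (\<forall>b\<in>B. \<bar>c b\<bar> \<le> 1) \<and> c a = 1 \<longrightarrow> \<delta> \<le> norm (\<Sum>b\<in>B. c b *\<^sub>R b)" if a: "a \<in> B" for a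
  proof -
    define K where "K = {\<Sum>b\<in>B - {a}. c b *\<^sub>R b | c. \<forall>b\<in>B - {a}. \<bar>c b\<bar> \<le> (1::real)}"
    have "compact ((\<lambda>y. a + y) ` K)"
      unfolding K_def using B(1) by (intro compact_translation compact_box_combinations) simp
    then have cl: "closed ((\<lambda>y. a + y) ` K)" by (rule compact_imp_closed)
    have "0 \<notin> (\<lambda>y. a + y) ` K"
    proof
      assume "0 \<in> (\<lambda>y. a + y) ` K"
      then obtain c where "a + (\<Sum>b\<in>B - {a}. c b *\<^sub>R b) = 0" by (auto simp: K_def)
      then have "a = - (\<Sum>b\<in>B - {a}. c b *\<^sub>R b)" by (simp add: eq_neg_iff_add_eq_0)
      also have "\<dots> \<in> span (B - {a})" by (intro span_neg span_sum span_scale span_base)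
      finally show False using B(2) a by (auto simp: dependent_def)
    qed
    then obtain d where "d > 0" "ball 0 d \<subseteq> - (\<lambda>y. a + y) ` K"
      using open_contains_ball_eq[of "- (\<lambda>y. a + y) ` K" 0] cl by (auto simp: open_Compl)
    then have d: "d > 0" "\<And>y. y \<in> (\<lambda>y. a + y) ` K \<Longrightarrow> d \<le> dist 0 y"
      by (auto simp: subset_iff not_less[symmetric])
    show ?thesis
    proof (intro exI[of _ d] conjI allI impI d(1))
      fix c :: "'a \<Rightarrow> real" assume c: "(\<forall>b\<in>B. \<bar>c b\<bar> \<le> 1) \<and> c a = 1"
      then have "(\<Sum>b\<in>B. c b *\<^sub>R b) = a + (\<Sum>b\<in>B - {a}. c b *\<^sub>R b)"
        using B(1) a by (subst sum.remove[of _ a]) auto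
      also have "\<dots> \<in> (\<lambda>y. a + y) ` K" using c by (auto simp: K_def)
      finally show "d \<le> norm (\<Sum>b\<in>B. c b *\<^sub>R b)" using d(2) by (metis dist_0_norm)
    qed
  qed
  then obtain \<delta> where \<delta>: "\<And>a. a \<in> B \<Longrightarrow> \<delta> a > 0"
    "\<And>a c. a \<in> B \<Longrightarrow> (\<forall>b\<in>B. \<bar>c b\<bar> \<le> 1) \<Longrightarrow> c a = 1 \<Longrightarrow> \<delta> a \<le> norm (\<Sum>b\<in>B. c b *\<^sub>R b)"
    by metis
  \<comment> \<open>The extra \<open>1\<close> keeps the minimum defined for an empty basis.\<close>
  define D where "D = Min (insert 1 (\<delta> ` B))"
  have D: "D > 0" "\<And>a. a \<in> B \<Longrightarrow> D \<le> \<delta> a" using B(1) \<delta>(1) by (auto simp: D_def)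
  have bound: "\<bar>representation B x b\<bar> \<le> norm x * (1 / D)" for x b
  proof (cases "b \<in> B")
    case False
    then have "representation B x b = 0" using representation_ne_zero by blast
    then show ?thesis using D by simp
  next
    case True
    let ?r = "representation B x"
    \<comment> \<open>Division by the coordinate of largest modulus brings \<open>x\<close> into the
      position covered by \<open>\<delta>\<close>.\<close>
    define m where "m = Max ((\<lambda>b. \<bar>?r b\<bar>) ` B)"
    obtain a where a: "a \<in> B" "\<bar>?r a\<bar> = m"
      using Max_in[of "(\<lambda>b. \<bar>?r b\<bar>) ` B"] B(1) True unfolding m_def by fastforce
    have le: "\<bar>?r b\<bar> \<le> \<bar>?r a\<bar>" if "b \<in> B" for b using a that B(1) by (simp add: m_def)
    show ?thesis
    proof (cases "?r a = 0")
      case True with le[OF \<open>b \<in> B\<close>] D show ?thesis by simp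
    next
      case False
      have "\<delta> a \<le> norm (\<Sum>b\<in>B. (?r b / ?r a) *\<^sub>R b)"
        using le False by (intro \<delta>(2)[OF a(1)]) auto
      also have "(\<Sum>b\<in>B. (?r b / ?r a) *\<^sub>R b) = (1 / ?r a) *\<^sub>R (\<Sum>b\<in>B. ?r b *\<^sub>R b)"
        by (simp add: scaleR_sum_right)
      also have "norm \<dots> = norm x / \<bar>?r a\<bar>" by (simp add: rep)
      finally have "D \<le> norm x / \<bar>?r a\<bar>" using D(2)[OF a(1)] by simp
      then have "\<bar>?r a\<bar> \<le> norm x * (1 / D)" using False D(1) by (simp add: field_simps)
      with le[OF \<open>b \<in> B\<close>] show ?thesis by simp
    qed
  qed
  show ?thesis
    using bound B by (intro bounded_linear_intro[where K = "1 / D"])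
      (auto simp: representation_add representation_scale)
qed

lemma findim_linear_bounded:
  fixes f :: "'a::real_normed_vector \<Rightarrow> 'b::real_normed_vector"
  assumes "findim TYPE('a)" "linear f"
  shows "bounded_linear f"
proof -
  obtain B :: "'a set" where B: "finite B" "independent B" "span B = UNIV"
    using findim_basis[OF assms(1)] .
  have "f x = (\<Sum>b\<in>B. representation B x b *\<^sub>R f b)" for x
  proof -
    have "f x = f (\<Sum>b\<in>B. representation B x b *\<^sub>R b)"
      using sum_representation_eq[OF B(2) _ B(1), of x] B(3) by simp
    then show ?thesis using assms(2) by (simp add: linear_sum linear_cmul)
  qed
  then have "f = (\<lambda>x. \<Sum>b\<in>B. representation B x b *\<^sub>R f b)" by blast
  moreover have "bounded_linear (\<lambda>x. \<Sum>b\<in>B. representation B x b *\<^sub>R f b)"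
    by (intro bounded_linear_sum bounded_linear_scaleR_const[THEN bounded_linear_compose]
        bounded_linear_representation B bounded_linear_compose[OF bounded_linear_scaleR_left])
  ultimately show ?thesis by simp
qed

lemma findim_euclidean: "findim TYPE('a::euclidean_space)"
  unfolding findim_def by (intro exI[of _ Basis]) (simp add: span_Basis)

lemma findim_prod:
  assumes "findim TYPE('a::real_normed_vector)" "findim TYPE('b::real_normed_vector)"
  shows "findim TYPE('a \<times> 'b)"
proof -
  obtain A :: "'a set" and B :: "'b set" where AB: "finite A" "span A = UNIV" "finite B" "span B = UNIV"
    using assms by (auto simp: findim_def)
  have "span (A \<times> {0} \<union> {0} \<times> B) = UNIV"
  proof -
    have "z \<in> span (A \<times> {0} \<union> {0} \<times> B)" for z :: "'a \<times> 'b"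
    proof -
    have 1: "(\<lambda>x::'a. (x, 0::'b)) ` span A \<subseteq> span (A \<times> {0} \<union> {0} \<times> B)"
      by (subst linear_span_image[symmetric]) (auto intro!: linearI span_mono)
    have 2: "(\<lambda>y::'b. (0::'a, y)) ` span B \<subseteq> span (A \<times> {0} \<union> {0} \<times> B)"
      by (subst linear_span_image[symmetric]) (auto intro!: linearI span_mono)
    have "(fst z, 0) + (0, snd z) \<in> span (A \<times> {0} \<union> {0} \<times> B)"
      by (intro span_add subsetD[OF 1] subsetD[OF 2]) (auto simp: AB)
    then show ?thesis by simp
    qed
    then show ?thesis by blast
  qed
  with AB show ?thesis unfolding findim_def by (intro exI[of _ "A \<times> {0} \<union> {0} \<times> B"]) simp
qed

lemma findim_vec:
  assumes "findim TYPE('a::real_normed_vector)"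
  shows "findim TYPE('a ^ 'n::finite)"
proof -
  obtain A :: "'a set" where A: "finite A" "span A = UNIV" using assms by (auto simp: findim_def)
  let ?S = "(\<lambda>(i, a). axis i a) ` (UNIV \<times> A) :: ('a ^ 'n) set"
  have "span ?S = UNIV"
  proof -
    have "z \<in> span ?S" for z :: "'a ^ 'n"
    proof -
    have 1: "axis i ` span A \<subseteq> span ?S" for i
    proof (subst linear_span_image[symmetric])
      show "linear (axis i :: 'a \<Rightarrow> 'a ^ 'n)" by (auto intro!: linearI simp: vec_eq_iff axis_def)
      show "span (axis i ` A) \<subseteq> span ?S" by (intro span_mono) auto
    qed
    have "(\<Sum>i\<in>UNIV. axis i (z $ i)) \<in> span ?S"
      by (intro span_sum subsetD[OF 1]) (auto simp: A)
    moreover have "(\<Sum>i\<in>UNIV. axis i (z $ i)) = z"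
      by (simp add: vec_eq_iff axis_def if_distrib sum.delta cong: if_cong)
    ultimately show ?thesis by simp
    qed
    then show ?thesis by blast
  qed
  with A show ?thesis unfolding findim_def by (intro exI[of _ ?S]) simp
qed

text \<open>Continuity of the derivative in each of finitely many basis directions makes
  \<open>dirderiv f y\<close> uniformly close to \<open>dirderiv f x\<close> on the unit ball; the
  mean value bound along \<open>y - x\<close> then gives the Frechet remainder.\<close>

lemma BC1_has_derivative:
  fixes f :: "'a::real_normed_vector \<Rightarrow> 'b::real_normed_vector"
  assumes fd: "findim TYPE('a)" and f: "BC1 S f" and x: "x \<in> S"
  shows "(f has_derivative dirderiv f x) (at x)"
  unfolding has_derivative_at2
proof (intro conjI)
  have lin: "linear (dirderiv f y)" if "y \<in> S" for y using BC1_linear[OF tvs_normed f that] .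
  show "bounded_linear (dirderiv f x)" by (rule findim_linear_bounded[OF fd lin[OF x]])
  obtain B :: "'a set" where B: "finite B" "independent B" "span B = UNIV"
    using findim_basis[OF fd] .
  define r where "r h b = representation B h b" for h b
  have rep: "(\<Sum>b\<in>B. r x b *\<^sub>R b) = x" for x
    using sum_representation_eq[OF B(2) _ B(1), of x] B(3) by (simp add: r_def)
  have "\<exists>K>0. \<forall>h. \<bar>r h b\<bar> \<le> norm h * K" for b
    using bounded_linear.pos_bounded[OF bounded_linear_representation[OF B, of b]] by (simp add: r_def)
  then obtain K where K: "\<And>b. K b > 0" "\<And>b h. \<bar>r h b\<bar> \<le> norm h * K b" by metis
  define M where "M = 1 + sum K B"
  have M: "M > 0" "(\<Sum>b\<in>B. \<bar>r h b\<bar>) \<le> norm h * M" for h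
  proof -
    show "M > 0" using sum_nonneg[of B K] K(1) by (simp add: M_def add_pos_nonneg less_imp_le)
    have "(\<Sum>b\<in>B. \<bar>r h b\<bar>) \<le> (\<Sum>b\<in>B. norm h * K b)" using K(2) by (intro sum_mono)
    then show "(\<Sum>b\<in>B. \<bar>r h b\<bar>) \<le> norm h * M"
      by (simp add: M_def sum_distrib_left distrib_left) (smt (verit) norm_ge_zero)
  qed
  show "((\<lambda>y. (1 / norm (y - x)) *\<^sub>R (f y - (f x + dirderiv f x (y - x)))) \<longlongrightarrow> 0) (at x)"
  proof (rule tendstoI)
    fix e :: real assume e: "e > 0"
    define e' where "e' = e / (2 * M)"
    have e': "e' > 0" using e M by (simp add: e'_def)
    have "\<forall>\<^sub>F y in nhds x. dist (dirderiv f y b) (dirderiv f x b) < e'" for b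
    proof -
      have "continuous_on S (\<lambda>y. dirderiv f y b)"
        using continuous_on_compose2[OF BC1_cont_dirderiv[OF f], of S "\<lambda>y. (y, b)"]
        by (simp add: continuous_on_Pair image_subset_iff)
      then have "isCont (\<lambda>y. dirderiv f y b) x"
        using BC1_open[OF f] x continuous_on_eq_continuous_at by blast
      then have "((\<lambda>y. dirderiv f y b) \<longlongrightarrow> dirderiv f x b) (nhds x)"
        unfolding isCont_def by (rule tendsto_at_iff_tendsto_nhds[THEN iffD1])
      then show ?thesis using e' by (rule tendstoD)
    qed
    then have "\<forall>\<^sub>F y in nhds x. \<forall>b\<in>B. dist (dirderiv f y b) (dirderiv f x b) < e'"
      using B(1) by (simp add: eventually_ball_finite)
    moreover have "\<forall>\<^sub>F y in nhds x. y \<in> S" using BC1_open[OF f] x by (rule eventually_nhds_in_open)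
    ultimately have "\<forall>\<^sub>F y in nhds x. y \<in> S \<and> (\<forall>b\<in>B. dist (dirderiv f y b) (dirderiv f x b) < e')"
      by (rule eventually_conj[rotated])
    then obtain d where d: "d > 0"
      "\<And>y. dist y x < d \<Longrightarrow> y \<in> S \<and> (\<forall>b\<in>B. dist (dirderiv f y b) (dirderiv f x b) < e')"
      unfolding eventually_nhds_metric by blast
    have "dist ((1 / norm (y - x)) *\<^sub>R (f y - (f x + dirderiv f x (y - x)))) 0 < e"
      if y: "y \<noteq> x" "dist y x < d" for y
    proof -
      define h where "h = y - x"
      have hd: "dist (x + s *\<^sub>R h) x < d" if "\<bar>s\<bar> \<le> \<bar>1\<bar>" for s
      proof -
        have "dist (x + s *\<^sub>R h) x = \<bar>s\<bar> * norm h" by (simp add: dist_norm)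
        also have "\<dots> \<le> 1 * norm h" using that by (intro mult_right_mono) auto
        also have "\<dots> < d" using y by (simp add: h_def dist_norm)
        finally show ?thesis .
      qed
      have "norm (f (x + 1 *\<^sub>R h) - f (x + 0 *\<^sub>R h) - 1 *\<^sub>R dirderiv f x h) \<le> (e' * (M * norm h)) * \<bar>1\<bar>"
      proof (rule mean_value_bound)
        fix s :: real assume s: "\<bar>s\<bar> \<le> \<bar>1\<bar>"
        note ds = d(2)[OF hd[OF s]]
        show "((\<lambda>s. f (x + s *\<^sub>R h)) has_vector_derivative dirderiv f (x + s *\<^sub>R h) h) (at s)"
          using ds by (intro has_dirderiv_vector BC1_dirderiv[OF f]) auto
        have exp: "dirderiv f z h = (\<Sum>b\<in>B. r h b *\<^sub>R dirderiv f z b)" if "z \<in> S" for z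
        proof -
          have "dirderiv f z h = dirderiv f z (\<Sum>b\<in>B. r h b *\<^sub>R b)" by (simp add: rep)
          then show ?thesis using lin[OF that] by (simp add: linear_sum linear_cmul)
        qed
        have "norm (dirderiv f (x + s *\<^sub>R h) h - dirderiv f x h) =
            norm (\<Sum>b\<in>B. r h b *\<^sub>R (dirderiv f (x + s *\<^sub>R h) b - dirderiv f x b))"
          using ds x by (simp add: exp sum_subtractf scaleR_diff_right)
        also have "\<dots> \<le> (\<Sum>b\<in>B. \<bar>r h b\<bar> * e')"
          using ds by (intro sum_norm_le) (simp add: dist_norm mult_left_mono less_imp_le)
        also have "\<dots> = (\<Sum>b\<in>B. \<bar>r h b\<bar>) * e'" by (simp add: sum_distrib_right)
        also have "\<dots> \<le> (norm h * M) * e'" using M(2) e' by (intro mult_right_mono) auto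
        finally show "norm (dirderiv f (x + s *\<^sub>R h) h - dirderiv f x h) \<le> e' * (M * norm h)"
          by (simp add: mult_ac)
      qed
      then have *: "norm (f y - (f x + dirderiv f x h)) \<le> (e / 2) * norm h"
        using M(1) by (simp add: h_def e'_def algebra_simps)
      have "norm h > 0" using y by (simp add: h_def)
      then have "norm (f y - (f x + dirderiv f x h)) / norm h \<le> e / 2"
        using * by (simp add: divide_le_eq)
      then have "norm (f y - (f x + dirderiv f x h)) / norm h < e" using e by linarith
      then show ?thesis by (simp add: h_def)
    qed
    then show "\<forall>\<^sub>F y in at x. dist ((1 / norm (y - x)) *\<^sub>R (f y - (f x + dirderiv f x (y - x)))) 0 < e"
      unfolding eventually_at using d(1) by (intro exI[of _ d]) auto
  qed
qed

lemma BC1_compose_linear: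
  fixes u :: "'a::{real_vector,topological_space} \<Rightarrow> 'b::{real_vector,t2_space}"
    and l :: "'c::{real_vector,topological_space} \<Rightarrow> 'a"
  assumes u: "BC1 S u" and l: "linear l" "continuous_on UNIV l" and T: "open T" "l ` T \<subseteq> S"
  shows "BC1 T (\<lambda>x. u (l x))" and "x \<in> T \<Longrightarrow> dirderiv (\<lambda>x. u (l x)) x v = dirderiv u (l x) (l v)"
proof -
  have *: "has_dirderiv (\<lambda>x. u (l x)) x v (dirderiv u (l x) (l v))" if "x \<in> T" for x v
    using BC1_dirderiv[OF u, of "l x" "l v"] T that
    by (auto simp: has_dirderiv_def linear_add[OF l(1)] linear_cmul[OF l(1)])
  note ** = has_dirderivD[OF *]
  then show "x \<in> T \<Longrightarrow> dirderiv (\<lambda>x. u (l x)) x v = dirderiv u (l x) (l v)" by simp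
  have "continuous_on (T \<times> UNIV) (\<lambda>z. (\<lambda>(x, v). dirderiv u x v) (l (fst z), l (snd z)))"
    using T(2) by (intro continuous_on_compose2[OF BC1_cont_dirderiv[OF u]] continuous_on_Pair
        continuous_on_compose2[OF l(2)] continuous_on_fst continuous_on_snd continuous_on_id) auto
  then have "continuous_on (T \<times> UNIV) (\<lambda>(x, v). dirderiv (\<lambda>x. u (l x)) x v)"
    by (rule continuous_on_cong[THEN iffD1, rotated -1]) (auto simp: **)
  moreover have "continuous_on T (\<lambda>x. u (l x))"
    using continuous_on_compose2[OF BC1_cont[OF u] continuous_on_subset[OF l(2)] T(2)] by simp
  ultimately show "BC1 T (\<lambda>x. u (l x))" using T(1) * ** by (simp add: BC1_def)
qed

lemma continuous_on_fst_UNIV: "continuous_on UNIV (fst :: 'a::topological_space \<times> 'b::topological_space \<Rightarrow> 'a)"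
  and continuous_on_snd_UNIV: "continuous_on UNIV (snd :: 'a \<times> 'b \<Rightarrow> 'b)"
  by (intro continuous_on_fst continuous_on_snd continuous_on_id)+

lemma linear_fst': "linear fst" and linear_snd': "linear snd"
  by (auto intro: linearI)

text \<open>\<open>C2on\<close> asks the whole tangent map, direction included, to be of class
  \<open>BC1\<close>. The chain rule for \<open>BC1\<close>, applied to the maps and to their
  tangent maps, is then all that composition needs.\<close>

lemma C2on_compose:
  fixes f :: "'a::{real_vector,t2_space} \<Rightarrow> 'b::real_normed_vector"
    and u :: "'c::{real_vector,topological_space} \<Rightarrow> 'a"
  assumes tvs: "tvs TYPE('a)" "tvs TYPE('c)" and f: "C2on S f" and u: "C2on T u" and uT: "u ` T \<subseteq> S"
  shows "C2on T (\<lambda>x. f (u x))"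
proof -
  have f1: "BC1 S f" and f2: "BC1 (S \<times> UNIV) (\<lambda>(x, v). dirderiv f x v)"
    and u1: "BC1 T u" and u2: "BC1 (T \<times> UNIV) (\<lambda>(x, v). dirderiv u x v)"
    using f u by (auto simp: C2on_def)
  have T: "open (T \<times> (UNIV::'c set))" using BC1_open[OF u1] by (auto intro: open_Times)
  have "BC1 (T \<times> UNIV) (\<lambda>z. (u (fst z), (\<lambda>(x, v). dirderiv u x v) z))"
    by (intro BC1_Pair u2 BC1_compose_linear[OF u1] linear_fst' continuous_on_fst_UNIV T) auto
  from BC1_compose(1)[OF tvs_prod[OF tvs(1) tvs(1)] f2 this]
  have "BC1 (T \<times> UNIV) (\<lambda>z. (\<lambda>(x, v). dirderiv f x v) (u (fst z), (\<lambda>(x, v). dirderiv u x v) z))"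
    using uT by (auto simp: image_subset_iff)
  then have "BC1 (T \<times> UNIV) (\<lambda>(x, v). dirderiv (\<lambda>x. f (u x)) x v)"
    by (rule BC1_cong[OF tvs_prod[OF tvs(2) tvs(2)]]) (auto simp: BC1_compose(2)[OF tvs(1) f1 u1 uT])
  with BC1_compose(1)[OF tvs(1) f1 u1 uT] show ?thesis by (simp add: C2on_def)
qed

lemma C2on_subset: "C2on S f \<Longrightarrow> open T \<Longrightarrow> T \<subseteq> S \<Longrightarrow> C2on T f"
  unfolding C2on_def using BC1_subset[of S f T]
    BC1_subset[of "S \<times> UNIV" "\<lambda>(x, v). dirderiv f x v" "T \<times> UNIV"] open_Times[OF _ open_UNIV, of T]
  by blast

lemma C2on_cong:
  fixes f g :: "'a::{real_vector,topological_space} \<Rightarrow> 'b::{real_vector,t2_space}"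
  assumes "tvs TYPE('a)" "C2on S f" "\<And>x. x \<in> S \<Longrightarrow> f x = g x"
  shows "C2on S g"
proof -
  have *: "dirderiv f x v = dirderiv g x v" if "x \<in> S" for x v
    using dirderiv_cong_open[OF assms(1) BC1_open that] assms(2,3) unfolding C2on_def by blast
  have "BC1 (S \<times> UNIV) (\<lambda>(x, v). dirderiv g x v)"
    by (rule BC1_cong[OF tvs_prod[OF assms(1) assms(1)], of _ "\<lambda>(x, v). dirderiv f x v"])
      (use assms(2) * in \<open>auto simp: C2on_def\<close>)
  with BC1_cong[OF assms(1) _ assms(3)] assms(2) show ?thesis by (auto simp: C2on_def)
qed

lemma C2on_Pair:
  fixes f :: "'a::{real_vector,topological_space} \<Rightarrow> 'b::{real_vector,t2_space}"
    and g :: "'a \<Rightarrow> 'c::{real_vector,t2_space}"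
  assumes "tvs TYPE('a)" "C2on S f" "C2on S g"
  shows "C2on S (\<lambda>x. (f x, g x))"
proof -
  have *: "BC1 S f" "BC1 S g" "BC1 (S \<times> UNIV) (\<lambda>(x, v). dirderiv f x v)" "BC1 (S \<times> UNIV) (\<lambda>(x, v). dirderiv g x v)"
    using assms by (auto simp: C2on_def)
  have "BC1 (S \<times> UNIV) (\<lambda>z. ((\<lambda>(x, v). dirderiv f x v) z, (\<lambda>(x, v). dirderiv g x v) z))"
    by (intro BC1_Pair *)
  then have "BC1 (S \<times> UNIV) (\<lambda>(x, v). dirderiv (\<lambda>x. (f x, g x)) x v)"
    by (rule BC1_cong[OF tvs_prod[OF assms(1) assms(1)]]) (auto simp: BC1_Pair(2)[OF *(1,2)])
  with BC1_Pair(1)[OF *(1,2)] show ?thesis by (simp add: C2on_def)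
qed

lemma C2on_compose_linear:
  fixes u :: "'a::{real_vector,topological_space} \<Rightarrow> 'b::{real_vector,t2_space}"
    and l :: "'c::{real_vector,topological_space} \<Rightarrow> 'a"
  assumes tvs: "tvs TYPE('c)" and u: "C2on S u" and l: "linear l" "continuous_on UNIV l" and T: "open T" "l ` T \<subseteq> S"
  shows "C2on T (\<lambda>x. u (l x))"
proof -
  have u1: "BC1 S u" and u2: "BC1 (S \<times> UNIV) (\<lambda>(x, v). dirderiv u x v)" using u by (auto simp: C2on_def)
  have lin: "linear (\<lambda>z. (l (fst z), l (snd z)))"
    by (intro linearI) (auto simp: linear_add[OF l(1)] linear_cmul[OF l(1)])
  have cont: "continuous_on UNIV (\<lambda>z. (l (fst z), l (snd z)))"
    by (intro continuous_on_Pair continuous_on_compose2[OF l(2)] continuous_on_fst continuous_on_snd continuous_on_id) auto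
  have "BC1 (T \<times> UNIV) (\<lambda>z. (\<lambda>(x, v). dirderiv u x v) (l (fst z), l (snd z)))"
    using T by (intro BC1_compose_linear(1)[OF u2 lin cont]) (auto intro: open_Times)
  then have "BC1 (T \<times> UNIV) (\<lambda>(x, v). dirderiv (\<lambda>x. u (l x)) x v)"
    by (rule BC1_cong[OF tvs_prod[OF tvs tvs]]) (auto simp: BC1_compose_linear(2)[OF u1 l T])
  with BC1_compose_linear(1)[OF u1 l T] show ?thesis by (simp add: C2on_def)
qed

lemma C2on_linear:
  fixes f :: "'a::{real_vector,topological_space} \<Rightarrow> 'b::{real_vector,t2_space}"
  assumes "tvs TYPE('a)" "linear f" "continuous_on UNIV f" "open S"
  shows "C2on S f"
proof -
  have S: "open (S \<times> (UNIV::'a set))" using assms(4) by (intro open_Times) auto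
  have "BC1 (S \<times> UNIV) (\<lambda>z::'a \<times> 'a. f (snd z))"
    by (intro BC1_compose_linear(1)[OF BC1_linear_map(1)[OF assms(2,3) open_UNIV]] linear_snd' continuous_on_snd_UNIV S) auto
  then have "BC1 (S \<times> UNIV) (\<lambda>(x, v). dirderiv f x v)"
    by (simp add: BC1_linear_map(2)[OF assms(2-4)] case_prod_unfold)
  with BC1_linear_map(1)[OF assms(2-4)] show ?thesis by (simp add: C2on_def)
qed

section \<open>Second derivatives and their symmetry\<close>

definition d2 :: "('a::real_vector \<Rightarrow> 'b::{real_vector,t2_space}) \<Rightarrow> 'a \<Rightarrow> 'a \<Rightarrow> 'a \<Rightarrow> 'b" where
  "d2 f x v w = dirderiv (\<lambda>y. dirderiv f y v) x w"

text \<open>The tangent map has both partial derivatives. It is linear in the direction slot, so the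
  partial derivative there is \<open>dirderiv f x u\<close>; the two add up by linearity of the
  total derivative.\<close>

lemma C2on_d2:
  fixes f :: "'a::{real_vector,t2_space} \<Rightarrow> 'b::real_normed_vector"
  assumes tvs: "tvs TYPE('a)" and f: "C2on S f" and x: "x \<in> S"
  shows "has_dirderiv (\<lambda>y. dirderiv f y v) x w (d2 f x v w)"
    and "dirderiv (\<lambda>(x, v). dirderiv f x v) (x, v) (w, u) = d2 f x v w + dirderiv f x u"
proof -
  let ?F = "\<lambda>(x, v). dirderiv f x v"
  have f1: "BC1 S f" and f2: "BC1 (S \<times> UNIV) ?F" using f by (auto simp: C2on_def)
  have xv: "(x, v) \<in> S \<times> UNIV" using x by simp
  have "has_dirderiv (\<lambda>y. dirderiv f y v) x w (dirderiv ?F (x, v) (w, 0))"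
    using BC1_dirderiv[OF f2 xv, of "(w, 0)"] by (simp add: has_dirderiv_def)
  then show 1: "has_dirderiv (\<lambda>y. dirderiv f y v) x w (d2 f x v w)"
    using has_dirderivD[of "\<lambda>y. dirderiv f y v"] by (simp add: d2_def)
  then have 2: "dirderiv ?F (x, v) (w, 0) = d2 f x v w"
    using \<open>has_dirderiv (\<lambda>y. dirderiv f y v) x w (dirderiv ?F (x, v) (w, 0))\<close> has_dirderivD by (metis)
  have lin: "linear (dirderiv f x)" by (rule BC1_linear[OF tvs f1 x])
  have "has_dirderiv (dirderiv f x) v u (dirderiv ?F (x, v) (0, u))"
    using BC1_dirderiv[OF f2 xv, of "(0, u)"] by (simp add: has_dirderiv_def)
  moreover have "has_dirderiv (dirderiv f x) v u (dirderiv f x u)"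
  proof -
    have "\<forall>\<^sub>F t in at (0::real). (1 / t) *\<^sub>R (dirderiv f x (v + t *\<^sub>R u) - dirderiv f x v) = dirderiv f x u"
      by (rule eventually_mono[OF eventually_neq_at_within[of 0]])
         (auto simp: linear_add[OF lin] linear_cmul[OF lin])
    then show ?thesis unfolding has_dirderiv_def by (rule tendsto_eventually)
  qed
  ultimately have 3: "dirderiv ?F (x, v) (0, u) = dirderiv f x u" using has_dirderivD by metis
  have "(w, u) = (w, 0) + (0, u)" by simp
  then show "dirderiv ?F (x, v) (w, u) = d2 f x v w + dirderiv f x u"
    using linear_add[OF BC1_linear[OF tvs_prod[OF tvs tvs] f2 xv]] 2 3 by metis
qed

lemma C2on_has_derivative:
  fixes f :: "'a::real_normed_vector \<Rightarrow> 'b::real_normed_vector"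
  assumes fd: "findim TYPE('a)" and f: "C2on S f" and x: "x \<in> S"
  shows "(f has_derivative dirderiv f x) (at x)"
    and "((\<lambda>(x, v). dirderiv f x v) has_derivative (\<lambda>(w, u). d2 f x v w + dirderiv f x u)) (at (x, v))"
proof -
  have f1: "BC1 S f" and f2: "BC1 (S \<times> UNIV) (\<lambda>(x, v). dirderiv f x v)" using f by (auto simp: C2on_def)
  show "(f has_derivative dirderiv f x) (at x)" by (rule BC1_has_derivative[OF fd f1 x])
  have "dirderiv (\<lambda>(x, v). dirderiv f x v) (x, v) = (\<lambda>(w, u). d2 f x v w + dirderiv f x u)"
    using C2on_d2(2)[OF tvs_normed f x] by auto
  with BC1_has_derivative[OF findim_prod[OF fd fd] f2, of "(x, v)"] x
  show "((\<lambda>(x, v). dirderiv f x v) has_derivative (\<lambda>(w, u). d2 f x v w + dirderiv f x u)) (at (x, v))"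
    by simp
qed

text \<open>The mixed second difference is symmetric in \<open>v\<close> and \<open>w\<close>, while
  two nested mean value estimates, along \<open>v\<close> and then along \<open>w\<close>, compare
  it with \<open>d2 f x v w\<close>. Division by \<open>h * h\<close> yields
  \<open>d2_commute\<close>.\<close>

lemma second_difference:
  fixes f :: "'a::{real_vector,t2_space} \<Rightarrow> 'b::real_normed_vector"
  assumes tvs: "tvs TYPE('a)" and f: "C2on S f" and x: "x \<in> S" and e: "e > 0"
  shows "\<forall>\<^sub>F h in at_right 0. norm (f (x + h *\<^sub>R v + h *\<^sub>R w) - f (x + h *\<^sub>R v) - f (x + h *\<^sub>R w) + f x
      - (h * h) *\<^sub>R d2 f x v w) \<le> e * (h * h)"
proof -
  let ?F = "\<lambda>(x, v). dirderiv f x v"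
  have f1: "BC1 S f" and f2: "BC1 (S \<times> UNIV) ?F" using f by (auto simp: C2on_def)
  have "continuous_on S (\<lambda>y. (\<lambda>(z, u). dirderiv ?F z u) ((y, v), (w, 0)))"
    by (rule continuous_on_compose2[OF BC1_cont_dirderiv[OF f2]])
       (auto intro!: continuous_on_Pair continuous_on_id continuous_on_const)
  then have "continuous_on S (\<lambda>y. d2 f y v w)"
    by (rule continuous_on_cong[THEN iffD1, rotated -1])
       (use C2on_d2(2)[OF tvs f] linear_0[OF BC1_linear[OF tvs f1]] in auto)
  then have "open ((\<lambda>y. d2 f y v w) -` ball (d2 f x v w) e \<inter> S)"
    using continuous_on_open_vimage[OF BC1_open[OF f1]] by blast
  moreover have "x \<in> (\<lambda>y. d2 f y v w) -` ball (d2 f x v w) e \<inter> S" using x e by simp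
  moreover have "((\<lambda>z. x + fst z *\<^sub>R v + snd z *\<^sub>R w) \<longlongrightarrow> x + 0 *\<^sub>R v + 0 *\<^sub>R w) (nhds (0::real, 0::real))"
    by (intro tvs_tendsto_add[OF tvs] tvs_tendsto_scaleR[OF tvs] tendsto_const tendsto_fst_nhds tendsto_snd_nhds)
  ultimately have "\<forall>\<^sub>F z in nhds (0::real, 0::real). x + fst z *\<^sub>R v + snd z *\<^sub>R w \<in> (\<lambda>y. d2 f y v w) -` ball (d2 f x v w) e \<inter> S"
    using topological_tendstoD[of "\<lambda>z. x + fst z *\<^sub>R v + snd z *\<^sub>R w" x "nhds (0, 0)"
      "(\<lambda>y. d2 f y v w) -` ball (d2 f x v w) e \<inter> S"] unfolding scaleR_zero_left add_0_right by blast
  then obtain P Q where P: "eventually P (nhds (0::real))" and Q: "eventually Q (nhds (0::real))"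
    and PQ: "\<And>s t. P s \<Longrightarrow> Q t \<Longrightarrow> x + s *\<^sub>R v + t *\<^sub>R w \<in> (\<lambda>y. d2 f y v w) -` ball (d2 f x v w) e \<inter> S"
    unfolding nhds_prod eventually_prod_filter by auto
  have "eventually (\<lambda>t. P t \<and> Q t) (nhds 0)" using P Q by (rule eventually_conj)
  then obtain \<delta> where \<delta>: "\<delta> > 0" "\<And>s. \<bar>s\<bar> < \<delta> \<Longrightarrow> P s \<and> Q s"
    unfolding eventually_nhds_metric by (auto simp: dist_real_def)
  have main: "norm (f (x + h *\<^sub>R v + h *\<^sub>R w) - f (x + h *\<^sub>R v) - f (x + h *\<^sub>R w) + f x
      - (h * h) *\<^sub>R d2 f x v w) \<le> e * (h * h)" if h: "0 < h" "h < \<delta>" for h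
  proof -
    have inS: "x + s *\<^sub>R v + t *\<^sub>R w \<in> S" "norm (d2 f (x + s *\<^sub>R v + t *\<^sub>R w) v w - d2 f x v w) \<le> e"
      if "\<bar>s\<bar> \<le> \<bar>h\<bar>" "\<bar>t\<bar> \<le> \<bar>h\<bar>" for s t
      using PQ[of s t] \<delta>(2)[of s] \<delta>(2)[of t] that h by (auto simp: dist_norm norm_minus_commute)
    have 0: "\<bar>0\<bar> \<le> \<bar>h\<bar>" "\<bar>h\<bar> \<le> \<bar>h\<bar>" by auto
    have inner: "norm (dirderiv f (x + s *\<^sub>R v + h *\<^sub>R w) v - dirderiv f (x + s *\<^sub>R v + 0 *\<^sub>R w) v - h *\<^sub>R d2 f x v w) \<le> e * \<bar>h\<bar>"
      if s: "\<bar>s\<bar> \<le> \<bar>h\<bar>" for s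
      by (rule mean_value_bound[where g = "\<lambda>t. dirderiv f (x + s *\<^sub>R v + t *\<^sub>R w) v"
            and g' = "\<lambda>t. d2 f (x + s *\<^sub>R v + t *\<^sub>R w) v w"])
         (use inS[OF s] in \<open>auto intro!: has_dirderiv_vector C2on_d2(1)[OF tvs f]\<close>)
    let ?k = "\<lambda>s. f ((x + h *\<^sub>R w) + s *\<^sub>R v) - f (x + s *\<^sub>R v)"
    have "norm (?k h - ?k 0 - h *\<^sub>R (h *\<^sub>R d2 f x v w)) \<le> (e * \<bar>h\<bar>) * \<bar>h\<bar>"
    proof (rule mean_value_bound)
      fix s assume s: "\<bar>s\<bar> \<le> \<bar>h\<bar>"
      have A: "x + h *\<^sub>R w + s *\<^sub>R v \<in> S" "x + s *\<^sub>R v \<in> S"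
        using inS(1)[OF s 0(2)] inS(1)[OF s 0(1)] by (simp_all add: add_ac)
      show "(?k has_vector_derivative dirderiv f (x + h *\<^sub>R w + s *\<^sub>R v) v - dirderiv f (x + s *\<^sub>R v) v) (at s)"
        by (intro has_vector_derivative_diff has_dirderiv_vector BC1_dirderiv[OF f1] A)
      show "norm (dirderiv f (x + h *\<^sub>R w + s *\<^sub>R v) v - dirderiv f (x + s *\<^sub>R v) v - h *\<^sub>R d2 f x v w) \<le> e * \<bar>h\<bar>"
        using inner[OF s] by (simp add: add_ac)
    qed
    moreover have "?k h - ?k 0 - h *\<^sub>R (h *\<^sub>R d2 f x v w) =
       f (x + h *\<^sub>R v + h *\<^sub>R w) - f (x + h *\<^sub>R v) - f (x + h *\<^sub>R w) + f x - (h * h) *\<^sub>R d2 f x v w"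
      by (simp add: algebra_simps)
    ultimately show ?thesis using h by (simp only: abs_of_pos mult.assoc)
  qed
  show ?thesis unfolding eventually_at_right_field using main \<delta>(1) by blast
qed

lemma d2_commute:
  fixes f :: "'a::{real_vector,t2_space} \<Rightarrow> 'b::real_normed_vector"
  assumes tvs: "tvs TYPE('a)" and f: "C2on S f" and x: "x \<in> S"
  shows "d2 f x v w = d2 f x w v"
proof -
  have "norm (d2 f x v w - d2 f x w v) \<le> 0 + e" if e: "e > 0" for e
  proof -
    have e2: "e / 2 > 0" using e by simp
    have "\<forall>\<^sub>F h in at_right (0::real). h > 0" by (simp add: eventually_at_right_less)
    then have "\<forall>\<^sub>F h in at_right (0::real). norm (d2 f x v w - d2 f x w v) \<le> e"
      using second_difference[OF assms e2, of v w] second_difference[OF assms e2, of w v]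
    proof eventually_elim
      case (elim h)
      let ?D = "f (x + h *\<^sub>R v + h *\<^sub>R w) - f (x + h *\<^sub>R v) - f (x + h *\<^sub>R w) + f x"
      have "norm (?D - (h * h) *\<^sub>R d2 f x v w) \<le> e / 2 * (h * h)" using elim by simp
      moreover have "norm (?D - (h * h) *\<^sub>R d2 f x w v) \<le> e / 2 * (h * h)"
        using elim by (simp add: algebra_simps)
      ultimately have "norm ((?D - (h * h) *\<^sub>R d2 f x w v) - (?D - (h * h) *\<^sub>R d2 f x v w)) \<le> e * (h * h)"
        using norm_triangle_ineq4[of "?D - (h * h) *\<^sub>R d2 f x w v" "?D - (h * h) *\<^sub>R d2 f x v w"] by simp
      then have "norm ((h * h) *\<^sub>R (d2 f x v w - d2 f x w v)) \<le> (h * h) * e"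
        by (simp add: scaleR_diff_right mult.commute)
      then show ?case using elim(1) by simp
    qed
    then show ?thesis by (simp add: eventually_const_iff trivial_limit_at_right_real)
  qed
  then have "norm (d2 f x v w - d2 f x w v) \<le> 0" by (rule field_le_epsilon)
  then show ?thesis by simp
qed

section \<open>Alternating forms\<close>

lemma alt_formD_length: "\<omega> \<in> alt_form k \<Longrightarrow> length vs \<noteq> k \<Longrightarrow> \<omega> vs = 0"
  and alt_formD_linear: "\<omega> \<in> alt_form k \<Longrightarrow> length vs = k \<Longrightarrow> i < k \<Longrightarrow> linear (\<lambda>v. \<omega> (vs[i := v]))"
  and alt_formD_eq: "\<omega> \<in> alt_form k \<Longrightarrow> length vs = k \<Longrightarrow> i < j \<Longrightarrow> j < k \<Longrightarrow> vs ! i = vs ! j \<Longrightarrow> \<omega> vs = 0"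
  unfolding alt_form_def by blast+

lemma alt_formI:
  assumes "\<And>vs. length vs \<noteq> k \<Longrightarrow> \<omega> vs = 0"
    and "\<And>vs i. length vs = k \<Longrightarrow> i < k \<Longrightarrow> linear (\<lambda>v. \<omega> (vs[i := v]))"
    and "\<And>vs i j. length vs = k \<Longrightarrow> i < j \<Longrightarrow> j < k \<Longrightarrow> vs ! i = vs ! j \<Longrightarrow> \<omega> vs = 0"
  shows "\<omega> \<in> alt_form k"
  using assms by (auto simp: alt_form_def)

lemma alt_form_eq_zero:
  assumes "\<omega> \<in> alt_form k" "i \<noteq> j" "i < length vs" "j < length vs" "vs ! i = vs ! j"
  shows "\<omega> vs = 0"
  using assms alt_formD_length[OF assms(1)] alt_formD_eq[OF assms(1), of vs i j] alt_formD_eq[OF assms(1), of vs j i]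
  by (metis nat_neq_iff)

lemma alt_form_not_distinct: "\<omega> \<in> alt_form k \<Longrightarrow> \<not> distinct vs \<Longrightarrow> \<omega> vs = 0"
  by (metis alt_form_eq_zero distinct_conv_nth)

lemma alt_form_zero_entry:
  assumes "\<omega> \<in> alt_form k" "i < length vs" "vs ! i = 0"
  shows "\<omega> vs = 0"
proof (cases "length vs = k")
  case True
  then have "\<omega> (vs[i := 0]) = 0" using linear_0[OF alt_formD_linear[OF assms(1) True]] assms(2) by simp
  moreover have "vs[i := 0] = vs" using assms(3) by (metis list_update_id)
  ultimately show ?thesis by simp
qed (rule alt_formD_length[OF assms(1)])

lemma alt_form_swap:
  assumes w: "\<omega> \<in> alt_form k" and ij: "i \<noteq> j" "i < length vs" "j < length vs"
  shows "\<omega> (vs[i := a, j := b]) = - \<omega> (vs[i := b, j := a])"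
proof (cases "length vs = k")
  case True
  note L = alt_formD_linear[OF w]
  have add1: "\<omega> (us[l := c + d]) = \<omega> (us[l := c]) + \<omega> (us[l := d])" if "length us = k" "l < k" for us l c d
    using linear_add[OF L[OF that]] .
  have z: "\<omega> (vs[i := c, j := c]) = 0" for c
    by (rule alt_form_eq_zero[OF w ij(1)]) (use ij in auto)
  have "0 = \<omega> (vs[i := a + b, j := a + b])" by (simp add: z)
  also have "\<dots> = \<omega> (vs[i := a + b, j := a]) + \<omega> (vs[i := a + b, j := b])"
    using True ij by (intro add1) auto
  also have "\<omega> (vs[i := a + b, j := a]) = \<omega> (vs[i := a, j := a]) + \<omega> (vs[i := b, j := a])"
    using True ij add1[of "vs[j := a]" i a b] by (simp add: list_update_swap[OF ij(1)])
  also have "\<omega> (vs[i := a + b, j := b]) = \<omega> (vs[i := a, j := b]) + \<omega> (vs[i := b, j := b])"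
    using True ij add1[of "vs[j := b]" i a b] by (simp add: list_update_swap[OF ij(1)])
  finally show ?thesis by (simp add: z)
qed (simp add: alt_formD_length[OF w])

text \<open>Only vanishing is transferred, so it suffices to follow absolute values along
  transpositions, and no sign of a permutation has to be computed.\<close>

lemma alt_form_mset:
  assumes w: "\<omega> \<in> alt_form k" and "mset vs = mset ws" "\<omega> ws = 0"
  shows "\<omega> vs = 0"
proof -
  obtain p where p: "p permutes {..<length ws}" "permute_list p ws = vs"
    using mset_eq_permutation[OF assms(2)] by blast
  have "\<forall>xs. length xs = length ws \<longrightarrow> \<bar>\<omega> (permute_list p xs)\<bar> = \<bar>\<omega> xs\<bar>"
    using p(1) finite_lessThan
  proof (induction rule: permutes_induct)
    case id then show ?case by simp
  next
    case (swap a b p)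
    show ?case
    proof (intro allI impI)
      fix xs :: "'a list" assume l: "length xs = length ws"
      have ab: "a < length xs" "b < length xs" using swap l by auto
      let ?t = "Transposition.transpose a b"
      have "permute_list ?t xs = xs[a := xs ! b, b := xs ! a]"
        by (rule nth_equalityI) (use ab in \<open>auto simp: permute_list_def Transposition.transpose_def nth_list_update\<close>)
      moreover have "\<omega> (xs[a := xs ! b, b := xs ! a]) = - \<omega> (xs[a := xs ! a, b := xs ! b])"
        by (rule alt_form_swap[OF w]) (use swap ab in auto)
      ultimately have t: "\<bar>\<omega> (permute_list ?t xs)\<bar> = \<bar>\<omega> xs\<bar>" by simp
      have "permute_list (?t \<circ> p) xs = permute_list p (permute_list ?t xs)"
        using swap l by (intro permute_list_compose) simp
      with t swap l show "\<bar>\<omega> (permute_list (?t \<circ> p) xs)\<bar> = \<bar>\<omega> xs\<bar>" by simp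
    qed
  qed
  with p(2) assms(3) show ?thesis by force
qed

text \<open>The slots are freed one at a time: \<open>j\<close> counts the leading slots that may
  hold arbitrary vectors, and linearity in slot \<open>j\<close> passes from \<open>S\<close> to its
  span.\<close>

lemma alt_form_zero_on_span:
  assumes w: "\<omega> \<in> alt_form k" and S: "span S = UNIV"
    and z: "\<And>ws. length ws = k \<Longrightarrow> set ws \<subseteq> S \<Longrightarrow> \<omega> ws = 0"
  shows "\<omega> vs = 0"
proof (cases "length vs = k")
  case True
  have "\<forall>vs. length vs = k \<and> (\<forall>i. j \<le> i \<and> i < k \<longrightarrow> vs ! i \<in> S) \<longrightarrow> \<omega> vs = 0" if "j \<le> k" for j
    using that
  proof (induction j)
    case 0 then show ?case using z by (auto simp: set_conv_nth subset_iff)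
  next
    case (Suc j)
    show ?case
    proof (intro allI impI, elim conjE)
      fix vs :: "'a list" assume l: "length vs = k" and vs: "\<forall>i. Suc j \<le> i \<and> i < k \<longrightarrow> vs ! i \<in> S"
      have lin: "linear (\<lambda>v. \<omega> (vs[j := v]))" using alt_formD_linear[OF w l] Suc.prems by simp
      have "\<omega> (vs[j := v]) = 0" if "v \<in> S" for v
      proof -
        have "\<forall>i. j \<le> i \<and> i < k \<longrightarrow> vs[j := v] ! i \<in> S"
          using vs that l by (auto simp: nth_list_update)
        then show ?thesis using Suc l by simp
      qed
      then have "\<omega> (vs[j := vs ! j]) = 0"
        using linear_eq_0_on_span[OF lin, of S "vs ! j"] S by simp
      then show "\<omega> vs = 0" by simp
    qed
  qed
  from this[of k] True show ?thesis using leD by blast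
qed (rule alt_formD_length[OF w])

lemma alt_form_diff:
  assumes "\<omega> \<in> alt_form k" "\<eta> \<in> alt_form k"
  shows "(\<lambda>vs. \<omega> vs - c * \<eta> vs) \<in> alt_form k"
proof (rule alt_formI)
  fix vs :: "'a list" and i assume i: "length vs = k" "i < k"
  note l = alt_formD_linear[OF assms(1) i] alt_formD_linear[OF assms(2) i]
  show "linear (\<lambda>v. \<omega> (vs[i := v]) - c * \<eta> (vs[i := v]))"
    by (rule linearI) (simp_all add: linear_add[OF l(1)] linear_add[OF l(2)] linear_cmul[OF l(1)] linear_cmul[OF l(2)] algebra_simps)
qed (auto simp: alt_formD_length[OF assms(1)] alt_formD_length[OF assms(2)]
    alt_formD_eq[OF assms(1)] alt_formD_eq[OF assms(2)])

lemma alt_form_pull: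
  fixes T :: "'v::real_vector \<Rightarrow> 'w::real_vector"
  assumes "\<omega> \<in> alt_form k" "linear T"
  shows "pull T \<omega> \<in> alt_form k"
proof (rule alt_formI)
  fix vs :: "'v list" and i assume "length vs = k" "i < k"
  then show "linear (\<lambda>v. pull T \<omega> (vs[i := v]))"
    unfolding pull_def map_update
    using linear_compose[OF assms(2) alt_formD_linear[OF assms(1), of "map T vs" i]] by (simp add: o_def)
qed (use assms in \<open>auto simp: pull_def alt_formD_length intro: alt_formD_eq\<close>)

text \<open>Moving \<open>v\<close> from the front to slot \<open>i\<close> takes \<open>i\<close>
  transpositions; the resulting sign is the one in \<open>extd\<close>.\<close>

lemma alt_form_insert:
  assumes w: "\<omega> \<in> alt_form k" and "i < length us"
  shows "(-1) ^ i * \<omega> (v # take i us @ drop (Suc i) us) = \<omega> (us[i := v])"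
  using assms(2)
proof (induction i arbitrary: us)
  case 0 then show ?case by (cases us) auto
next
  case (Suc i)
  let ?u = "us[Suc i := us ! i]"
  have "\<omega> (us[i := us ! i, Suc i := v]) = - \<omega> (us[i := v, Suc i := us ! i])"
    by (rule alt_form_swap[OF w]) (use Suc.prems in auto)
  also have "us[i := v, Suc i := us ! i] = ?u[i := v]" by (simp add: list_update_swap)
  also have "\<omega> (?u[i := v]) = (-1) ^ i * \<omega> (v # take i ?u @ drop (Suc i) ?u)"
    by (rule Suc.IH[symmetric]) (use Suc.prems in simp)
  also have "take i ?u @ drop (Suc i) ?u = take (Suc i) us @ drop (Suc (Suc i)) us"
  proof -
    have "drop (Suc i) ?u = us ! i # drop (Suc (Suc i)) us"
      using Suc.prems by (metis Cons_nth_drop_Suc drop_update_cancel length_list_update lessI nth_list_update_eq)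
    then show ?thesis using Suc.prems by (simp add: take_Suc_conv_app_nth)
  qed
  finally show ?case by simp
qed

lemma alt_form_bounded_entry:
  fixes \<omega> :: "'v::real_normed_vector list \<Rightarrow> real"
  assumes "\<omega> \<in> alt_form k" "span B = UNIV" "independent B" "finite B" "length vs = k" "i < k"
  shows "\<omega> (vs[i := v]) = (\<Sum>b\<in>B. representation B v b * \<omega> (vs[i := b]))"
proof -
  have "\<omega> (vs[i := v]) = \<omega> (vs[i := \<Sum>b\<in>B. representation B v b *\<^sub>R b])"
    using sum_representation_eq[OF assms(3) _ assms(4), of v] assms(2) by simp
  then show ?thesis
    using linear_sum[OF alt_formD_linear[OF assms(1,5,6)], of "\<lambda>b. representation B v b *\<^sub>R b" B]
      linear_cmul[OF alt_formD_linear[OF assms(1,5,6)]] by simp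
qed

text \<open>The slots are made variable one after another: in \<open>E j cs x\<close> the entries
  before \<open>j\<close> depend on \<open>x\<close>, the others are constants. Expanding slot
  \<open>j\<close> in a basis reduces each step to products of real functions.\<close>

lemma alt_form_has_derivative:
  fixes \<omega> :: "'v::real_normed_vector list \<Rightarrow> real" and u :: "nat \<Rightarrow> 'a::real_normed_vector \<Rightarrow> 'v"
  assumes fd: "findim TYPE('v)" and w: "\<omega> \<in> alt_form k"
    and u: "\<And>i. i < k \<Longrightarrow> (u i has_derivative u' i) (at x)"
  shows "((\<lambda>x. \<omega> (map (\<lambda>i. u i x) [0..<k])) has_derivative
    (\<lambda>h. \<Sum>i<k. \<omega> ((map (\<lambda>i. u i x) [0..<k])[i := u' i h]))) (at x)"
proof -
  obtain B :: "'v set" where B: "finite B" "independent B" "span B = UNIV"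
    using findim_basis[OF fd] .
  define E where "E j cs x = map (\<lambda>i. if i < j then u i x else cs ! i) [0..<k]" for j and cs :: "'v list" and x
  have len: "length (E j cs x) = k" for j cs x by (simp add: E_def)
  have "\<forall>cs. ((\<lambda>x. \<omega> (E j cs x)) has_derivative (\<lambda>h. \<Sum>i<j. \<omega> ((E j cs x)[i := u' i h]))) (at x)" if "j \<le> k" for j
    using that
  proof (induction j)
    case 0 then show ?case by (simp add: E_def)
  next
    case (Suc j)
    then have j: "j < k" "j \<le> k" by auto
    note exp = alt_form_bounded_entry[OF w B(3,2,1) len j(1)]
    show ?case
    proof
      fix cs :: "'v list"
      have upd: "E (Suc j) cs y = (E j cs y)[j := u j y]" for y
        by (rule nth_equalityI) (use j in \<open>auto simp: E_def nth_list_update less_Suc_eq\<close>)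
      have upd2: "(E j cs y)[j := b] = E j (map (\<lambda>i. if i = j then b else cs ! i) [0..<k]) y" for b y
        by (rule nth_equalityI) (use j in \<open>auto simp: E_def nth_list_update\<close>)
      have eq: "\<omega> (E (Suc j) cs y) = (\<Sum>b\<in>B. representation B (u j y) b * \<omega> ((E j cs y)[j := b]))" for y
        unfolding upd by (rule exp)
      have d: "((\<lambda>y. \<omega> ((E j cs y)[j := b])) has_derivative (\<lambda>h. \<Sum>i<j. \<omega> ((E j cs x)[j := b, i := u' i h]))) (at x)" for b
        using Suc.IH[OF j(2)] by (simp add: upd2)
      have "((\<lambda>y. \<Sum>b\<in>B. representation B (u j y) b * \<omega> ((E j cs y)[j := b])) has_derivative
         (\<lambda>h. \<Sum>b\<in>B. representation B (u j x) b * (\<Sum>i<j. \<omega> ((E j cs x)[j := b, i := u' i h])) +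
           representation B (u' j h) b * \<omega> ((E j cs x)[j := b]))) (at x)"
        by (intro has_derivative_sum has_derivative_mult d
            bounded_linear.has_derivative[OF bounded_linear_representation[OF B]] u j)
      moreover have "(\<Sum>b\<in>B. representation B (u j x) b * (\<Sum>i<j. \<omega> ((E j cs x)[j := b, i := u' i h])) +
           representation B (u' j h) b * \<omega> ((E j cs x)[j := b])) = (\<Sum>i<Suc j. \<omega> ((E (Suc j) cs x)[i := u' i h]))" for h
      proof -
        have 1: "(\<Sum>b\<in>B. representation B (u' j h) b * \<omega> ((E j cs x)[j := b])) = \<omega> ((E (Suc j) cs x)[j := u' j h])"
          using exp[of j cs x "u' j h"] by (simp add: upd)
        have 2: "(\<Sum>b\<in>B. representation B (u j x) b * \<omega> ((E j cs x)[j := b, i := u' i h])) =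
            \<omega> ((E (Suc j) cs x)[i := u' i h])" if "i < j" for i
          using alt_form_bounded_entry[OF w B(3,2,1) _ j(1), of "(E j cs x)[i := u' i h]" "u j x"] that
          by (simp add: upd len list_update_swap[of i j])
        have "(\<Sum>b\<in>B. representation B (u j x) b * (\<Sum>i<j. \<omega> ((E j cs x)[j := b, i := u' i h]))) =
            (\<Sum>i<j. \<omega> ((E (Suc j) cs x)[i := u' i h]))"
          unfolding sum_distrib_left by (subst sum.swap) (simp add: 2)
        with 1 show ?thesis by (simp add: sum.distrib)
      qed
      ultimately show "((\<lambda>x. \<omega> (E (Suc j) cs x)) has_derivative (\<lambda>h. \<Sum>i<Suc j. \<omega> ((E (Suc j) cs x)[i := u' i h]))) (at x)"
        by (simp add: eq)
    qed
  qed
  from this[of k] have "((\<lambda>x. \<omega> (E k [] x)) has_derivative (\<lambda>h. \<Sum>i<k. \<omega> ((E k [] x)[i := u' i h]))) (at x)" by simp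
  moreover have "E k [] y = map (\<lambda>i. u i y) [0..<k]" for y by (simp add: E_def cong: map_cong)
  ultimately show ?thesis by simp
qed

section \<open>The coordinate volume form and the trace\<close>

lemma coord_indices: "distinct (coord_indices :: 'm::finite list)" "set (coord_indices :: 'm list) = UNIV"
proof -
  have "\<exists>l :: 'm list. distinct l \<and> set l = UNIV" using finite_distinct_list[of "UNIV :: 'm set"] by auto
  from someI_ex[OF this] show "distinct (coord_indices :: 'm list)" "set (coord_indices :: 'm list) = UNIV"
    unfolding coord_indices_def by auto
qed

lemma length_coord_indices [simp]: "length (coord_indices :: 'm::finite list) = CARD('m)"
  using distinct_card[OF coord_indices(1)[where 'm = 'm]] by (simp add: coord_indices(2))

definition coord_pos :: "'m::finite \<Rightarrow> nat" where
  "coord_pos i = (SOME k. k < CARD('m) \<and> coord_indices ! k = i)"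

lemma coord_pos: "coord_pos (i::'m::finite) < CARD('m)" "coord_indices ! coord_pos i = i"
proof -
  have "i \<in> set coord_indices" by (simp add: coord_indices(2))
  then have "\<exists>k. k < CARD('m) \<and> coord_indices ! k = i" by (metis in_set_conv_nth length_coord_indices)
  from someI_ex[OF this] show "coord_pos i < CARD('m)" "coord_indices ! coord_pos i = i"
    unfolding coord_pos_def by auto
qed

lemma coord_pos_nth: "k < CARD('m) \<Longrightarrow> coord_pos (coord_indices ! k :: 'm::finite) = k"
  using coord_pos[of "coord_indices ! k :: 'm"] coord_indices(1)[where 'm = 'm]
  by (metis distinct_conv_nth length_coord_indices)

lemma sum_coord_indices: "(\<Sum>k<CARD('m). f (coord_indices ! k :: 'm::finite)) = (\<Sum>i\<in>UNIV. f i)"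
proof -
  have "bij_betw (\<lambda>k. coord_indices ! k :: 'm) {..<CARD('m)} UNIV"
    using bij_betw_nth[OF coord_indices(1)[where 'm = 'm], of "{..<CARD('m)}" UNIV] by (simp add: coord_indices(2))
  then show ?thesis by (rule sum.reindex_bij_betw)
qed

definition axes :: "(real^'m::finite) list" where
  "axes = map (\<lambda>\<mu>. axis \<mu> 1) coord_indices"

lemma length_axes [simp]: "length (axes :: (real^'m::finite) list) = CARD('m)"
  by (simp add: axes_def)

lemma nth_axes: "k < CARD('m) \<Longrightarrow> (axes :: (real^'m::finite) list) ! k = axis (coord_indices ! k) 1"
  by (simp add: axes_def)

text \<open>This is \<open>dx\<^sup>0 \<and> \<dots> \<and> dx\<^sup>n\<close> in the order fixed by
  \<open>coord_indices\<close>. Matrix rows are indexed by coordinates rather than positions, hence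
  \<open>coord_pos\<close>; membership in \<open>alt_form\<close> dictates the value
  \<open>0\<close> on lists of the wrong length.\<close>

definition vol :: "(real^'m::finite) list \<Rightarrow> real" where
  "vol us = (if length us = CARD('m) then det (\<chi> i. us ! coord_pos i) else 0)"

lemma vol_alt_form: "(vol :: (real^'m::finite) list \<Rightarrow> real) \<in> alt_form CARD('m)"
proof (rule alt_formI)
  fix us :: "(real^'m) list" assume "length us \<noteq> CARD('m)" then show "vol us = 0" by (simp add: vol_def)
next
  fix us :: "(real^'m) list" and k assume k: "length us = CARD('m)" "k < CARD('m)"
  have *: "vol (us[k := v]) = det (\<chi> i::'m. if i = coord_indices ! k then v else us ! coord_pos i)" for v
  proof -
    have "us[k := v] ! coord_pos i = (if i = coord_indices ! k then v else us ! coord_pos i)" for i :: 'm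
      using k coord_pos[of i] coord_pos_nth[OF k(2)] by (auto simp: nth_list_update)
    then show ?thesis using k by (simp add: vol_def)
  qed
  show "linear (\<lambda>v. vol (us[k := v]))"
    unfolding * by (rule linearI) (auto simp: det_row_add det_row_mul[where 'a = real, unfolded scalar_mult_eq_scaleR])
next
  fix us :: "(real^'m) list" and i j assume ij: "length us = CARD('m)" "i < j" "j < CARD('m)" "us ! i = us ! j"
  have "coord_indices ! i \<noteq> (coord_indices ! j :: 'm)"
    using ij coord_pos_nth[of i, where 'm = 'm] coord_pos_nth[of j, where 'm = 'm] by auto
  moreover have "row (coord_indices ! i) (\<chi> i::'m. us ! coord_pos i) = row (coord_indices ! j) (\<chi> i::'m. us ! coord_pos i)"
    using ij coord_pos_nth[of i, where 'm = 'm] coord_pos_nth[of j, where 'm = 'm]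
    by (simp add: row_def vec_eq_iff)
  ultimately show "vol us = 0" using ij det_identical_rows by (auto simp: vol_def)
qed

lemma vol_axes [simp]: "vol (axes :: (real^'m::finite) list) = 1"
proof -
  have "(\<chi> i. (axes :: (real^'m) list) ! coord_pos i) = mat 1"
    by (simp add: nth_axes coord_pos mat_def vec_eq_iff axis_def)
  then show ?thesis by (simp add: vol_def)
qed

lemma axes_mset:
  assumes "length ws = CARD('m)" "set ws \<subseteq> range (\<lambda>i. axis i 1)" "distinct ws"
  shows "mset ws = mset (axes :: (real^'m::finite) list)"
proof -
  have inj: "inj (\<lambda>i::'m. axis i (1::real))" by (auto simp: inj_def axis_eq_axis)
  have "distinct (axes :: (real^'m) list)"
    unfolding axes_def distinct_map using coord_indices inj by (auto intro: inj_on_subset)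
  moreover have sa: "set (axes :: (real^'m) list) = range (\<lambda>i. axis i 1)" by (auto simp: axes_def coord_indices)
  moreover have "set ws = range (\<lambda>i. axis i 1)"
  proof (rule card_subset_eq)
    show "card (set ws) = card (range (\<lambda>i::'m. axis i (1::real)))"
      using assms distinct_card[OF assms(3)] by (simp add: card_image[OF inj])
  qed (use assms in auto)
  ultimately show ?thesis using assms(3) set_eq_iff_mset_eq_distinct by metis
qed

lemma span_axes: "span (range (\<lambda>i::'m::finite. axis i (1::real))) = UNIV"
proof -
  have "range (\<lambda>i::'m. axis i (1::real)) = Basis" by (auto simp: Basis_vec_def)
  then show ?thesis by (simp add: span_Basis)
qed

text \<open>The difference of the two sides vanishes on lists of axis vectors: a repeated vector
  gives \<open>0\<close>, and a list without repetition is a rearrangement of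
  \<open>axes\<close>.\<close>

lemma top_form_eq:
  fixes \<omega> :: "(real^'m::finite) list \<Rightarrow> real"
  assumes w: "\<omega> \<in> alt_form CARD('m)"
  shows "\<omega> us = \<omega> axes * vol us"
proof -
  have w': "(\<lambda>vs. \<omega> vs - \<omega> axes * vol vs) \<in> alt_form CARD('m)"
    by (rule alt_form_diff[OF w vol_alt_form])
  have "\<omega> us - \<omega> axes * vol us = 0"
  proof (rule alt_form_zero_on_span[OF w' span_axes])
    fix ws :: "(real^'m) list" assume ws: "length ws = CARD('m)" "set ws \<subseteq> range (\<lambda>i. axis i 1)"
    show "\<omega> ws - \<omega> axes * vol ws = 0"
    proof (cases "distinct ws")
      case True
      show ?thesis using alt_form_mset[OF w' axes_mset[OF ws True]] by simp
    qed (rule alt_form_not_distinct[OF w'])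
  qed
  then show ?thesis by simp
qed

lemma vol_map_linear:
  fixes M :: "real^'m::finite \<Rightarrow> real^'m"
  assumes "linear M"
  shows "vol (map M us) = vol (map M axes) * vol us"
  using top_form_eq[OF alt_form_pull[OF vol_alt_form assms], of us] by (simp add: pull_def)

lemma axis_expansion: "(\<Sum>i\<in>UNIV. a $ i *\<^sub>R axis i 1) = (a :: real^'m::finite)"
  using basis_expansion[of a] by (simp add: scalar_mult_eq_scaleR)

lemma vol_axes_update:
  assumes "k < CARD('m)"
  shows "vol ((axes :: (real^'m::finite) list)[k := a]) = a $ (coord_indices ! k)"
proof -
  let ?f = "\<lambda>v. vol ((axes :: (real^'m) list)[k := v])"
  have lin: "linear ?f" using alt_formD_linear[OF vol_alt_form _ assms] by simp
  have *: "?f (axis i 1) = (if i = coord_indices ! k then 1 else 0)" for i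
  proof (cases "i = coord_indices ! k")
    case True
    then have "axes[k := axis i 1] = (axes :: (real^'m) list)" using nth_axes[OF assms] by (metis list_update_id)
    then show ?thesis using True by simp
  next
    case False
    have "axes[k := axis i 1] ! coord_pos i = (axes[k := axis i 1] ! k :: real^'m)"
      using False coord_pos[of i] assms coord_pos_nth[OF assms] by (auto simp: nth_list_update nth_axes)
    then have "?f (axis i 1) = 0"
      using alt_form_eq_zero[OF vol_alt_form, of "coord_pos i" k "axes[k := axis i 1]"] coord_pos[of i] False assms
      by (metis length_axes length_list_update)
    then show ?thesis using False by simp
  qed
  have "?f a = ?f (\<Sum>i\<in>UNIV. a $ i *\<^sub>R axis i 1)" by (simp add: axis_expansion)
  also have "\<dots> = (\<Sum>i\<in>UNIV. a $ i * ?f (axis i 1))"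
    using linear_sum[OF lin, of "\<lambda>i. a $ i *\<^sub>R axis i 1" UNIV] linear_cmul[OF lin] by simp
  also have "\<dots> = a $ (coord_indices ! k)" by (simp add: * if_distrib cong: if_cong)
  finally show ?thesis .
qed

definition tr :: "(real^'m \<Rightarrow> real^'m) \<Rightarrow> real" where
  "tr A = (\<Sum>i\<in>(UNIV::'m::finite set). A (axis i 1) $ i)"

lemma vol_axes_trace:
  "(\<Sum>k<CARD('m). vol ((axes :: (real^'m::finite) list)[k := A (axes ! k)])) = tr A"
  by (simp add: vol_axes_update nth_axes tr_def sum_coord_indices[symmetric])

text \<open>Multiplying all arguments by \<open>1 + t A\<close> multiplies \<open>vol\<close> by a
  determinant, its value on \<open>axes\<close>. Differentiation at \<open>t = 0\<close> turns this
  into the claim, since on \<open>axes\<close> the sum of replacements is the trace.\<close>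

lemma vol_trace:
  fixes A :: "real^'m::finite \<Rightarrow> real^'m"
  assumes A: "linear A" and l: "length us = CARD('m)"
  shows "(\<Sum>k<CARD('m). vol (us[k := A (us ! k)])) = tr A * vol us"
proof -
  have d: "((\<lambda>t::real. vol (map (\<lambda>v. v + t *\<^sub>R A v) us)) has_derivative
      (\<lambda>h. \<Sum>k<CARD('m). vol (us[k := h *\<^sub>R A (us ! k)]))) (at 0)" if l: "length us = CARD('m)" for us
  proof -
    have "((\<lambda>t::real. vol (map (\<lambda>i. us ! i + t *\<^sub>R A (us ! i)) [0..<CARD('m)])) has_derivative
      (\<lambda>h. \<Sum>k<CARD('m). vol ((map (\<lambda>i. us ! i + 0 *\<^sub>R A (us ! i)) [0..<CARD('m)])[k := h *\<^sub>R A (us ! k)]))) (at 0)"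
      by (rule alt_form_has_derivative[OF findim_euclidean vol_alt_form]) (auto intro!: derivative_eq_intros)
    moreover have "map (\<lambda>i. us ! i + t *\<^sub>R A (us ! i)) [0..<CARD('m)] = map (\<lambda>v. v + t *\<^sub>R A v) us" for t :: real
      by (rule nth_equalityI) (use l in auto)
    moreover have "map ((!) us) [0..<CARD('m)] = us" using l by (metis map_nth)
    ultimately show ?thesis by simp
  qed
  have lin: "linear (\<lambda>v. v + t *\<^sub>R A v)" for t :: real
    using A by (auto intro!: linearI simp: linear_add linear_cmul scaleR_add_right)
  have eq: "vol (map (\<lambda>v. v + t *\<^sub>R A v) us) = vol (map (\<lambda>v. v + t *\<^sub>R A v) axes) * vol us" for t :: real
    by (rule vol_map_linear[OF lin])
  have "((\<lambda>t::real. vol (map (\<lambda>v. v + t *\<^sub>R A v) us)) has_derivative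
      (\<lambda>h. (\<Sum>k<CARD('m). vol (axes[k := h *\<^sub>R A (axes ! k)])) * vol us)) (at 0)"
    unfolding eq by (intro has_derivative_mult_left d) simp
  from has_derivative_unique[OF d[OF l] this]
  have "(\<Sum>k<CARD('m). vol (us[k := 1 *\<^sub>R A (us ! k)])) = (\<Sum>k<CARD('m). vol (axes[k := 1 *\<^sub>R A (axes ! k)])) * vol us"
    by (rule fun_cong)
  then show ?thesis by (simp add: vol_axes_trace)
qed

section \<open>Semibasic forms: the fibers of Z in coordinates\<close>

text \<open>The form \<open>p d\<^sup>n\<^sup>+\<^sup>1x + p\<^sub>A\<^sup>\<mu> dy\<^sup>A \<and> (\<partial>\<^sub>\<mu> \<lrcorner> d\<^sup>n\<^sup>+\<^sup>1x)\<close> with \<open>P b = (p\<^sub>A\<^sup>\<mu> b\<^sup>A)\<^sub>\<mu>\<close>.\<close>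

definition zform :: "real \<Rightarrow> ('f::real_vector \<Rightarrow> real^'m::finite) \<Rightarrow> ((real^'m) \<times> 'f) list \<Rightarrow> real" where
  "zform p P us = p * vol (map fst us) + (\<Sum>i<CARD('m). vol ((map fst us)[i := P (snd (us ! i))]))"

text \<open>For two equal arguments only the summands that replace one of these two can survive, and
  a swap shows that they cancel.\<close>

lemma zform_alt_form:
  fixes P :: "'f::real_vector \<Rightarrow> real^'m::finite"
  assumes P: "linear P"
  shows "zform p P \<in> alt_form CARD('m)"
proof (rule alt_formI)
  fix us :: "((real^'m) \<times> 'f) list" assume "length us \<noteq> CARD('m)"
  then show "zform p P us = 0" by (simp add: zform_def vol_def)
next
  fix us :: "((real^'m) \<times> 'f) list" and k assume k: "length us = CARD('m)" "k < CARD('m)"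
  have lv: "linear (\<lambda>v. vol (ws[k := v]))" if "length ws = CARD('m)" for ws :: "(real^'m) list"
    using alt_formD_linear[OF vol_alt_form that k(2)] .
  have fst: "linear (fst :: (real^'m) \<times> 'f \<Rightarrow> _)" and snd: "linear (snd :: (real^'m) \<times> 'f \<Rightarrow> _)"
    by (auto intro: linearI)
  have 0: "linear (\<lambda>u :: (real^'m) \<times> 'f. vol ((map fst us)[k := fst u]))"
    using linear_compose[OF fst lv[of "map fst us"]] k by (simp add: o_def)
  have 1: "linear (\<lambda>u :: (real^'m) \<times> 'f. p * vol ((map fst us)[k := fst u]))"
    by (intro linearI) (simp_all only: linear_add[OF 0] linear_cmul[OF 0] distrib_left real_scaleR_def mult.left_commute)
  have 2: "linear (\<lambda>u. vol ((map fst us)[k := fst u, i := P (snd (us[k := u] ! i))]))" if i: "i < CARD('m)" for i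
  proof (cases "i = k")
    case True
    then show ?thesis
      using linear_compose[OF linear_compose[OF snd P] lv[of "map fst us"]] k by (simp add: o_def)
  next
    case False
    then show ?thesis
      using linear_compose[OF fst lv[of "(map fst us)[i := P (snd (us ! i))]"]] k
      by (simp add: o_def list_update_swap)
  qed
  have "linear (\<lambda>u. p * vol ((map fst us)[k := fst u]) +
      (\<Sum>i<CARD('m). vol ((map fst us)[k := fst u, i := P (snd (us[k := u] ! i))])))"
    by (intro linear_compose_add 1 linear_compose_sum) (use 2 in auto)
  then show "linear (\<lambda>u. zform p P (us[k := u]))"
    by (simp add: zform_def map_update)
next
  fix us :: "((real^'m) \<times> 'f) list" and i j
  assume ij: "length us = CARD('m)" "i < j" "j < CARD('m)" "us ! i = us ! j"
  let ?A = "map fst us" let ?t = "\<lambda>l. vol (?A[l := P (snd (us ! l))])"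
  have A: "?A ! i = ?A ! j" "length ?A = CARD('m)" using ij by auto
  have "?t l = 0" if "l \<noteq> i" "l \<noteq> j" for l
    by (rule alt_formD_eq[OF vol_alt_form, of _ i j]) (use ij that in auto)
  then have "(\<Sum>l<CARD('m). ?t l) = (\<Sum>l\<in>{i, j}. ?t l)"
    using ij by (intro sum.mono_neutral_right) auto
  also have "\<dots> = ?t i + ?t j" using ij by simp
  also have "?t i = - ?t j"
  proof -
    let ?q = "P (snd (us ! j))"
    have "vol (?A[i := ?q, j := ?A ! j]) = - vol (?A[i := ?A ! j, j := ?q])"
      by (rule alt_form_swap[OF vol_alt_form]) (use ij in auto)
    moreover have "?A[i := ?q, j := ?A ! j] = ?A[i := ?q]"
      using ij by (metis list_update_id list_update_swap less_irrefl)
    moreover have "?A[i := ?A ! j] = ?A" using A(1) by (metis list_update_id)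
    ultimately show ?thesis using ij by simp
  qed
  finally have "(\<Sum>l<CARD('m). ?t l) = 0" by simp
  moreover have "vol ?A = 0" by (rule alt_formD_eq[OF vol_alt_form A(2) ij(2,3) A(1)])
  ultimately show "zform p P us = 0" by (simp add: zform_def)
qed

lemma vol_zero_entry: "i < length us \<Longrightarrow> us ! i = 0 \<Longrightarrow> vol us = 0"
  by (rule alt_form_zero_entry[OF vol_alt_form])

text \<open>Each summand replaces at most one of the two vanishing base components, so a zero entry
  always remains.\<close>

lemma zform_semibasic:
  fixes P :: "'f::real_vector \<Rightarrow> real^'m::finite"
  shows "zform p P ((0, b) # (0, b') # us) = 0"
proof -
  let ?A = "map fst ((0, b) # (0, b') # us) :: (real^'m) list"
  have "vol (?A[i := a]) = 0" for i and a :: "real^'m"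
    by (cases i) (auto intro: vol_zero_entry[of 1] vol_zero_entry[of 0])
  moreover have "vol ?A = 0" by (rule vol_zero_entry[of 0]) auto
  ultimately show ?thesis by (simp add: zform_def)
qed

text \<open>On a graph the replaced entries become \<open>P (v a)\<close>, so the sum is the one in
  \<open>vol_trace\<close>. This is the pairing of a momentum with a jet; the trace is the
  contraction of \<open>p\<^sub>A\<^sup>\<mu>\<close> with
  \<open>v\<^sup>A\<^sub>\<mu>\<close>.\<close>

lemma zform_graph:
  fixes P :: "'f::real_vector \<Rightarrow> real^'m::finite"
  assumes P: "linear P" and v: "linear v"
  shows "zform p P (map (\<lambda>a. (a, v a)) as) = (p + tr (\<lambda>a. P (v a))) * vol as"
proof (cases "length as = CARD('m)")
  case True
  have "linear (\<lambda>a. P (v a))" using linear_compose[OF v P] by (simp add: o_def)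
  from vol_trace[OF this True] True show ?thesis by (simp add: zform_def o_def distrib_right)
qed (simp add: zform_def vol_def)

lemma zform_vertical_graph:
  fixes P :: "'f::real_vector \<Rightarrow> real^'m::finite"
  assumes l: "Suc (length as) = CARD('m)"
  shows "zform p P ((0, w) # map (\<lambda>a. (a, v a)) as) = vol (P w # as)"
proof -
  let ?us = "(0, w) # map (\<lambda>a. (a, v a)) as"
  have m: "map fst ?us = 0 # as" by (simp add: o_def)
  have "vol ((0 # as)[i := P (snd (?us ! i))]) = (if i = 0 then vol (P w # as) else 0)" if "i < CARD('m)" for i
    using that l by (cases i) (auto intro!: vol_zero_entry[of 0])
  then have "(\<Sum>i<CARD('m). vol ((0 # as)[i := P (snd (?us ! i))])) = (\<Sum>i<CARD('m). if i = 0 then vol (P w # as) else 0)"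
    by (intro sum.cong) auto
  also have "\<dots> = vol (P w # as)" using l by (simp add: sum.delta)
  finally show ?thesis using vol_zero_entry[of 0 "0 # as"] unfolding zform_def m by simp
qed

lemma vol_Cons_linear:
  assumes "Suc (length as) = CARD('m)"
  shows "linear (\<lambda>a. vol (a # as :: (real^'m::finite) list))"
  using alt_formD_linear[OF vol_alt_form, of "undefined # as" 0] assms by simp

text \<open>The vector \<open>(a, b)\<close> is split into \<open>(a, v a)\<close>, tangent to the
  graph, and the vertical rest \<open>(0, b - v a)\<close>. For the Legendre image of a jet the
  resulting vector is the current.\<close>

lemma zform_contract:
  fixes P :: "'f::real_vector \<Rightarrow> real^'m::finite"
  assumes P: "linear P" and v: "linear v" and l: "Suc (length as) = CARD('m)"
  shows "zform p P ((a, b) # map (\<lambda>a. (a, v a)) as) =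
    vol (((p + tr (\<lambda>a. P (v a))) *\<^sub>R a + P (b - v a)) # as)"
proof -
  have lin: "linear (\<lambda>u. zform p P (u # map (\<lambda>a. (a, v a)) as))"
    using alt_formD_linear[OF zform_alt_form[OF P], of "undefined # map (\<lambda>a. (a, v a)) as" 0] l by simp
  have "(a, b) = (a, v a) + (0, b - v a)" by simp
  then have "zform p P ((a, b) # map (\<lambda>a. (a, v a)) as) =
     zform p P (map (\<lambda>a. (a, v a)) (a # as)) + zform p P ((0, b - v a) # map (\<lambda>a. (a, v a)) as)"
    using linear_add[OF lin, of "(a, v a)" "(0, b - v a)"] by simp
  also have "\<dots> = (p + tr (\<lambda>a. P (v a))) * vol (a # as) + vol (P (b - v a) # as)"
    unfolding zform_graph[OF P v] zform_vertical_graph[OF l] ..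
  finally show ?thesis
    by (simp add: linear_add[OF vol_Cons_linear[OF l]] linear_cmul[OF vol_Cons_linear[OF l]])
qed

text \<open>Together with \<open>zmom\<close> this reads off the coordinates \<open>p\<close> and
  \<open>p\<^sub>A\<^sup>\<mu>\<close>, by the same argument lists as in
  \<open>mom_chart\<close>.\<close>

definition zbase :: "(((real^'m::finite) \<times> 'f::real_vector) list \<Rightarrow> real) \<Rightarrow> real" where
  "zbase z = z (map (\<lambda>\<nu>. (axis \<nu> 1, 0)) coord_indices)"

definition zmom :: "(((real^'m::finite) \<times> 'f::real_vector) list \<Rightarrow> real) \<Rightarrow> 'f \<Rightarrow> 'm \<Rightarrow> real" where
  "zmom z b \<mu> = z (map (\<lambda>\<nu>. if \<nu> = \<mu> then (0, b) else (axis \<nu> 1, 0)) coord_indices)"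

lemma zbase_zform:
  fixes P :: "'f::real_vector \<Rightarrow> real^'m::finite"
  assumes P: "linear P"
  shows "zbase (zform p P) = p"
proof -
  have "(map (\<lambda>\<nu>. (axis \<nu> 1, 0)) coord_indices :: ((real^'m) \<times> 'f) list) = map (\<lambda>a. (a, (\<lambda>_. 0) a)) axes"
    by (simp add: axes_def o_def)
  moreover have "linear (\<lambda>_::real^'m. 0::'f)" by (auto intro: linearI)
  ultimately show ?thesis unfolding zbase_def using zform_graph[OF P, of "\<lambda>_. 0" p axes] linear_0[OF P]
    by (simp add: tr_def)
qed

lemma zmom_eq_update:
  "map (\<lambda>\<nu>. if \<nu> = \<mu> then (0, b) else (axis \<nu> 1, 0)) coord_indices =
    (map (\<lambda>\<nu>. (axis \<nu> (1::real), 0)) coord_indices)[coord_pos (\<mu>::'m::finite) := (0, b)]"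
proof (rule nth_equalityI)
  fix i assume "i < length (map (\<lambda>\<nu>. if \<nu> = \<mu> then (0, b) else (axis \<nu> (1::real), 0)) coord_indices)"
  then have i: "i < CARD('m)" by simp
  then show "map (\<lambda>\<nu>. if \<nu> = \<mu> then (0, b) else (axis \<nu> 1, 0)) coord_indices ! i =
     (map (\<lambda>\<nu>. (axis \<nu> 1, 0)) coord_indices)[coord_pos \<mu> := (0, b)] ! i"
    using coord_pos[of \<mu>] coord_pos_nth[OF i] by (auto simp: nth_list_update)
qed simp

lemma zmom_zform:
  fixes P :: "'f::real_vector \<Rightarrow> real^'m::finite"
  assumes P: "linear P"
  shows "zmom (zform p P) b \<mu> = P b $ \<mu>"
proof -
  let ?k = "coord_pos \<mu>" let ?us = "(map (\<lambda>\<nu>. (axis \<nu> (1::real), 0)) coord_indices)[?k := (0, b)] :: ((real^'m) \<times> 'f) list"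
  have k: "?k < CARD('m)" by (rule coord_pos)
  have m: "map fst ?us = axes[?k := 0]" by (simp add: map_update axes_def o_def)
  have "vol ((axes[?k := 0])[i := P (snd (?us ! i))]) = (if i = ?k then P b $ \<mu> else 0)" if "i < CARD('m)" for i
  proof (cases "i = ?k")
    case True
    then show ?thesis using k coord_pos(2)[of \<mu>] by (simp add: vol_axes_update)
  next
    case False
    then show ?thesis using k by (auto intro!: vol_zero_entry[of ?k])
  qed
  then have "(\<Sum>i<CARD('m). vol ((axes[?k := 0])[i := P (snd (?us ! i))])) = (\<Sum>i<CARD('m). if i = ?k then P b $ \<mu> else 0)"
    by (intro sum.cong) auto
  also have "\<dots> = P b $ \<mu>" using k by (simp add: sum.delta)
  finally show ?thesis
    using vol_zero_entry[of ?k "axes[?k := 0] :: (real^'m) list"] k unfolding zmom_def zmom_eq_update zform_def m by simp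
qed

text \<open>It suffices to test lists made of horizontal axis vectors and vertical vectors. Up to
  order they have no vertical entry, where \<open>zbase\<close> decides, exactly one, where
  \<open>zmom\<close> decides, or at least two, where semibasicity decides.\<close>

lemma zform_unique:
  fixes z :: "((real^'m::finite) \<times> 'f::real_vector) list \<Rightarrow> real"
  assumes z: "z \<in> alt_form CARD('m)" and sb: "\<And>b b' us. z ((0, b) # (0, b') # us) = 0"
    and 0: "zbase z = 0" "\<And>b \<mu>. zmom z b \<mu> = 0"
  shows "z us = 0"
proof (rule alt_form_zero_on_span[OF z])
  let ?H = "range (\<lambda>i::'m. (axis i (1::real), 0::'f))" let ?V = "range (\<lambda>b::'f. (0::real^'m, b))"
  show "span (?H \<union> ?V) = UNIV"
  proof -
    have "u \<in> span (?H \<union> ?V)" for u :: "(real^'m) \<times> 'f"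
    proof -
      have "(\<Sum>i\<in>UNIV. fst u $ i *\<^sub>R (axis i (1::real), 0::'f)) + (0, snd u) \<in> span (?H \<union> ?V)"
        by (intro span_add span_sum span_scale span_base) auto
      moreover have "(\<Sum>i\<in>UNIV. fst u $ i *\<^sub>R (axis i (1::real), 0::'f)) = (fst u, 0)"
        by (rule prod_eqI) (simp_all add: fst_sum snd_sum axis_expansion)
      ultimately show ?thesis by simp
    qed
    then show ?thesis by blast
  qed
  fix ws :: "((real^'m) \<times> 'f) list" assume ws: "length ws = CARD('m)" "set ws \<subseteq> ?H \<union> ?V"
  show "z ws = 0"
  proof (cases "distinct ws")
    case False then show ?thesis by (rule alt_form_not_distinct[OF z])
  next
    case dist: True
    have injH: "inj (\<lambda>i::'m. (axis i (1::real), 0::'f))" by (auto simp: inj_def axis_eq_axis)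
    have dH: "distinct (map (\<lambda>\<nu>. (axis \<nu> (1::real), 0::'f)) (coord_indices :: 'm list))"
      unfolding distinct_map using coord_indices injH by (auto intro: inj_on_subset)
    have ax: "axis i (1::real) \<noteq> (0::real^'m)" for i by (simp add: axis_eq_0_iff)
    show ?thesis
    proof (cases "set ws \<subseteq> ?H")
      case True
      have "set ws = ?H"
        using True distinct_card[OF dist] ws by (intro card_subset_eq) (auto simp: card_image[OF injH])
      then have "mset ws = mset (map (\<lambda>\<nu>. (axis \<nu> 1, 0)) coord_indices)"
        using dist dH by (subst set_eq_iff_mset_eq_distinct[symmetric]) (auto simp: coord_indices)
      then show ?thesis by (rule alt_form_mset[OF z]) (use 0(1) in \<open>simp add: zbase_def\<close>)
    next
      case False
      then obtain b where b: "(0, b) \<in> set ws" using ws(2) by blast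
      then obtain rs where rs: "mset ws = mset ((0, b) # rs)"
        by (metis mset.simps(2) ex_mset insert_DiffM set_mset_mset)
      then have lr: "Suc (length rs) = CARD('m)" "distinct ((0, b) # rs)" "set ((0, b) # rs) = set ws"
        using ws(1) dist by (metis mset_eq_length length_Cons, metis mset_eq_imp_distinct_iff, metis set_mset_mset)
      show ?thesis
      proof (cases "set rs \<subseteq> ?H")
        case True
        \<comment> \<open>The horizontal entries are distinct and one fewer than the coordinates, so
          exactly one index is missing; the vertical vector takes its place.\<close>
        define I where "I = {i. (axis i (1::real), 0::'f) \<in> set rs}"
        have rI: "set rs = (\<lambda>i. (axis i 1, 0)) ` I" using True by (auto simp: I_def)
        have "card I = card (set rs)" unfolding rI by (rule card_image[symmetric]) (rule inj_on_subset[OF injH], simp)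
        also have "\<dots> < CARD('m)" using lr distinct_card[of rs] by simp
        finally have "I \<noteq> UNIV" by auto
        then obtain \<mu> where \<mu>: "\<mu> \<notin> I" by blast
        have "card I = card (UNIV - {\<mu>})" using \<open>card I = card (set rs)\<close> lr distinct_card[of rs] by simp
        then have I: "I = UNIV - {\<mu>}" using \<mu> by (intro card_subset_eq) auto
        let ?L = "map (\<lambda>\<nu>. if \<nu> = \<mu> then (0, b) else (axis \<nu> 1, 0)) coord_indices :: ((real^'m) \<times> 'f) list"
        have "set ws = set ?L" unfolding lr(3)[symmetric] by (auto simp: rI I coord_indices)
        moreover have "distinct ?L"
          unfolding distinct_map using coord_indices ax
          by (auto simp: inj_on_def axis_eq_axis split: if_splits)
        ultimately have "mset ws = mset ?L" using dist set_eq_iff_mset_eq_distinct by blast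
        then show ?thesis by (rule alt_form_mset[OF z]) (use 0(2) in \<open>simp add: zmom_def\<close>)
      next
        case False
        then obtain u where u: "u \<in> set rs" "u \<notin> ?H" by blast
        then have "u \<in> ?H \<union> ?V" using lr(3) ws(2) by auto
        then obtain b' where b': "(0, b') \<in> set rs" using u by blast
        then obtain ss where "mset rs = mset ((0, b') # ss)"
          by (metis mset.simps(2) ex_mset insert_DiffM set_mset_mset)
        then have "mset ws = mset ((0, b) # (0, b') # ss)" using rs by simp
        then show ?thesis by (rule alt_form_mset[OF z]) (rule sb)
      qed
    qed
  qed
qed

lemma zform_representation:
  fixes z :: "((real^'m::finite) \<times> 'f::real_vector) list \<Rightarrow> real"
  assumes z: "z \<in> alt_form CARD('m)" and sb: "\<And>b b' us. z ((0, b) # (0, b') # us) = 0"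
  shows "linear (\<lambda>b. \<chi> \<mu>. zmom z b \<mu>)" "z = zform (zbase z) (\<lambda>b. \<chi> \<mu>. zmom z b \<mu>)"
proof -
  have L: "linear (\<lambda>b. zmom z b \<mu>)" for \<mu>
  proof -
    have "linear (\<lambda>v. z ((map (\<lambda>\<nu>. (axis \<nu> 1, 0)) coord_indices)[coord_pos \<mu> := v]))"
      by (rule alt_formD_linear[OF z]) (simp_all add: coord_pos)
    moreover have "linear (\<lambda>b::'f. (0::real^'m, b))" by (auto intro: linearI)
    ultimately show ?thesis unfolding zmom_def zmom_eq_update
      using linear_compose[of "\<lambda>b::'f. (0::real^'m, b)" "\<lambda>v. z ((map (\<lambda>\<nu>. (axis \<nu> 1, 0)) coord_indices)[coord_pos \<mu> := v])"]
      by (simp add: o_def)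
  qed
  show P: "linear (\<lambda>b. \<chi> \<mu>. zmom z b \<mu>)"
    by (intro linearI) (simp_all add: vec_eq_iff linear_add[OF L] linear_cmul[OF L])
  let ?z = "zform (zbase z) (\<lambda>b. \<chi> \<mu>. zmom z b \<mu>)"
  have "(\<lambda>us. z us - 1 * ?z us) us = 0" for us
  proof (rule zform_unique)
    show "(\<lambda>us. z us - 1 * ?z us) \<in> alt_form CARD('m)"
      by (intro alt_form_diff z zform_alt_form P)
    show "zbase (\<lambda>us. z us - 1 * ?z us) = 0" using zbase_zform[OF P] by (simp add: zbase_def)
    show "zmom (\<lambda>us. z us - 1 * ?z us) b \<mu> = 0" for b \<mu> using zmom_zform[OF P] by (simp add: zmom_def)
  qed (simp add: sb zform_semibasic)
  then show "z = ?z" by auto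
qed

text \<open>Evaluation at \<open>v = 0\<close> isolates \<open>p\<close>, evaluation at
  \<open>axis \<mu> b\<close> a single momentum component. This is the injectivity of the
  identification of momenta with affine maps on jets.\<close>

lemma zform_eq_on_graphs:
  fixes P P' :: "'f::real_vector \<Rightarrow> real^'m::finite"
  assumes P: "linear P" "linear P'"
    and eq: "\<And>v::'f^'m. p + (\<Sum>\<mu>\<in>UNIV. P (v $ \<mu>) $ \<mu>) = p' + (\<Sum>\<mu>\<in>UNIV. P' (v $ \<mu>) $ \<mu>)"
  shows "p = p'" "P = P'"
proof -
  show p: "p = p'" using eq[of 0] linear_0[OF P(1)] linear_0[OF P(2)] by simp
  have "P b $ \<mu> = P' b $ \<mu>" for b \<mu>
  proof -
    have "(\<Sum>\<nu>\<in>UNIV. Q (axis \<mu> b $ \<nu>) $ \<nu>) = Q b $ \<mu>" if "linear Q" for Q :: "'f \<Rightarrow> real^'m"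
    proof -
      have "(\<Sum>\<nu>\<in>UNIV. Q (axis \<mu> b $ \<nu>) $ \<nu>) = (\<Sum>\<nu>\<in>UNIV. if \<nu> = \<mu> then Q b $ \<mu> else 0)"
        using linear_0[OF that] by (intro sum.cong) (auto simp: axis_def)
      then show ?thesis by simp
    qed
    from this[OF P(1)] this[OF P(2)] show ?thesis using eq[of "axis \<mu> b"] p by simp
  qed
  then show "P = P'" by (auto simp: vec_eq_iff)
qed

section \<open>Tangent maps in charts\<close>

lemma has_derivative_cong_nhds:
  assumes "(f has_derivative f') (at x)" "\<forall>\<^sub>F y in nhds x. f y = g y"
  shows "(g has_derivative f') (at x)"
proof (rule has_derivative_transform_eventually[OF assms(1)])
  show "\<forall>\<^sub>F y in at x. f y = g y" using assms(2) by (simp add: eventually_at_filter eventually_mono)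
qed (use eventually_nhds_x_imp_x[OF assms(2)] in auto)

lemma C2on_open: "C2on S f \<Longrightarrow> open S" and C2on_cont: "C2on S f \<Longrightarrow> continuous_on S f"
  unfolding C2on_def by (elim conjE, erule BC1_open) (elim conjE, erule BC1_cont)

lemma C2on_preimage:
  assumes "C2on S f" "open T" shows "open (f -` T \<inter> S)"
  using continuous_on_open_vimage[OF C2on_open[OF assms(1)], THEN iffD1, OF C2on_cont[OF assms(1)]] assms(2) by blast

lemma C2on_isCont:
  assumes "C2on S f" "x \<in> S" shows "isCont f x"
  using continuous_on_eq_continuous_at[OF C2on_open[OF assms(1)], THEN iffD1, OF C2on_cont[OF assms(1)]] assms(2) by blast

lemma BC1_local:
  fixes f :: "'a::{real_vector,topological_space} \<Rightarrow> 'b::{real_vector,t2_space}"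
  assumes "\<And>x. x \<in> T \<Longrightarrow> \<exists>U. x \<in> U \<and> U \<subseteq> T \<and> BC1 U f"
  shows "BC1 T f"
proof -
  have "\<forall>x\<in>T. \<exists>U. x \<in> U \<and> U \<subseteq> T \<and> BC1 U f" using assms by blast
  from bchoice[OF this] obtain U where U: "\<forall>x\<in>T. x \<in> U x \<and> U x \<subseteq> T \<and> BC1 (U x) f" by blast
  have T: "\<Union> (U ` T) = T" "\<Union> ((\<lambda>x. U x \<times> (UNIV::'a set)) ` T) = T \<times> UNIV" using U by blast+
  have o: "open (U x)" "continuous_on (U x) f" "continuous_on (U x \<times> UNIV) (\<lambda>(x, v). dirderiv f x v)" if "x \<in> T" for x
    using U that BC1_open BC1_cont BC1_cont_dirderiv by blast+
  have "open (\<Union> (U ` T))" by (rule open_UN) (use o in blast)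
  moreover have "continuous_on (\<Union> (U ` T)) f"
    by (rule continuous_on_open_Union) (use o in blast)+
  moreover have "continuous_on (\<Union> ((\<lambda>x. U x \<times> UNIV) ` T)) (\<lambda>(x, v). dirderiv f x v)"
  proof (rule continuous_on_open_Union)
    fix S assume "S \<in> (\<lambda>x. U x \<times> (UNIV :: 'a set)) ` T"
    then obtain x where x: "x \<in> T" "S = U x \<times> UNIV" by blast
    show "open S" unfolding x(2) by (rule open_Times[OF o(1)[OF x(1)] open_UNIV])
    show "continuous_on S (\<lambda>(x, v). dirderiv f x v)" unfolding x(2) by (rule o(3)[OF x(1)])
  qed
  moreover have "has_dirderiv f x v (dirderiv f x v)" if "x \<in> T" for x v
    using bspec[OF U that] BC1_dirderiv by blast
  ultimately show ?thesis unfolding T by (simp add: BC1_def)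
qed

lemma C2on_local:
  fixes f :: "'a::{real_vector,topological_space} \<Rightarrow> 'b::{real_vector,t2_space}"
  assumes "\<And>x. x \<in> T \<Longrightarrow> \<exists>U. x \<in> U \<and> U \<subseteq> T \<and> C2on U f"
  shows "C2on T f"
proof -
  have 1: "BC1 T f"
  proof (rule BC1_local)
    fix x assume "x \<in> T"
    from assms[OF this] obtain U where U: "x \<in> U" "U \<subseteq> T" "C2on U f" by (elim exE conjE)
    from U(3) have "BC1 U f" by (simp only: C2on_def)
    with U(1,2) show "\<exists>U. x \<in> U \<and> U \<subseteq> T \<and> BC1 U f" by (intro exI conjI)
  qed
  have 2: "BC1 (T \<times> UNIV) (\<lambda>(x, v). dirderiv f x v)"
  proof (rule BC1_local)
    fix z assume "z \<in> T \<times> (UNIV :: 'a set)"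
    then have "fst z \<in> T" by (rule SigmaE) simp
    from assms[OF this] obtain U where U: "fst z \<in> U" "U \<subseteq> T" "C2on U f" by (elim exE conjE)
    from U(3) have "BC1 (U \<times> UNIV) (\<lambda>(x, v). dirderiv f x v)" by (simp only: C2on_def)
    moreover have "z \<in> U \<times> UNIV" using U(1) by (simp add: mem_Times_iff)
    moreover have "U \<times> UNIV \<subseteq> T \<times> (UNIV :: 'a set)" using U(2) by (rule Sigma_mono) simp
    ultimately show "\<exists>U. z \<in> U \<and> U \<subseteq> T \<times> UNIV \<and> BC1 U (\<lambda>(x, v). dirderiv f x v)" by (intro exI conjI)
  qed
  from 1 2 show ?thesis by (simp only: C2on_def)
qed

section \<open>Charts of the maximal atlas\<close>

lemma chart_at:
  assumes "p \<in> mpoints A" shows "chart_at A p \<in> A \<and> p \<in> fst (chart_at A p)"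
proof -
  from assms obtain c where "c \<in> A \<and> p \<in> fst c" unfolding mpoints_def by (elim UnionE imageE) simp
  then show ?thesis unfolding chart_at_def by (rule someI[of "\<lambda>c. c \<in> A \<and> p \<in> fst c"])
qed

lemma cinv_chart: "inj_on (snd c) (fst c) \<Longrightarrow> p \<in> fst c \<Longrightarrow> cinv c (snd c p) = p"
  by (simp add: cinv_def)

lemma chart_cinv: "q \<in> snd c ` fst c \<Longrightarrow> snd c (cinv c q) = q" "q \<in> snd c ` fst c \<Longrightarrow> cinv c q \<in> fst c"
  unfolding cinv_def by (erule f_inv_into_f, erule inv_into_into)

lemma smooth_atlas_chart: "smooth_atlas A \<Longrightarrow> c \<in> A \<Longrightarrow> inj_on (snd c) (fst c) \<and> open (snd c ` fst c)"
  and smooth_atlas_transition: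
    "smooth_atlas A \<Longrightarrow> c \<in> A \<Longrightarrow> d \<in> A \<Longrightarrow> smooth_on (snd c ` (fst c \<inter> fst d)) (snd d \<circ> cinv c)"
  unfolding smooth_atlas_def by blast+

lemma max_atlasD:
  assumes "c \<in> max_atlas A"
  shows "inj_on (snd c) (fst c)" "open (snd c ` fst c)" "fst c \<subseteq> mpoints A"
    "a \<in> A \<Longrightarrow> smooth_on (snd c ` (fst c \<inter> fst a)) (snd a \<circ> cinv c)"
    "a \<in> A \<Longrightarrow> smooth_on (snd a ` (fst a \<inter> fst c)) (snd c \<circ> cinv a)"
proof -
  have c: "fst c \<subseteq> mpoints A \<and> smooth_atlas (insert c A)"
    using assms unfolding max_atlas_def by (rule CollectD)
  show "fst c \<subseteq> mpoints A" by (rule conjunct1[OF c])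
  have ci: "c \<in> insert c A" by (rule insertI1)
  note * = smooth_atlas_chart[OF conjunct2[OF c] ci]
  show "inj_on (snd c) (fst c)" by (rule conjunct1[OF *])
  show "open (snd c ` fst c)" by (rule conjunct2[OF *])
  show "a \<in> A \<Longrightarrow> smooth_on (snd c ` (fst c \<inter> fst a)) (snd a \<circ> cinv c)"
    by (rule smooth_atlas_transition[OF conjunct2[OF c] ci insertI2])
  show "a \<in> A \<Longrightarrow> smooth_on (snd a ` (fst a \<inter> fst c)) (snd c \<circ> cinv a)"
    by (rule smooth_atlas_transition[OF conjunct2[OF c] insertI2 ci])
qed

lemma chart_subset_mpoints: "c \<in> A \<Longrightarrow> fst c \<subseteq> mpoints A"
  unfolding mpoints_def by (rule Union_upper) (rule imageI)

lemma atlas_max_atlas: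
  assumes "smooth_atlas A" "c \<in> A" shows "c \<in> max_atlas A"
  unfolding max_atlas_def mem_Collect_eq insert_absorb[OF assms(2)]
  using assms(1) chart_subset_mpoints[OF assms(2)] by (intro conjI)

lemma chart_at_max: "smooth_atlas A \<Longrightarrow> p \<in> mpoints A \<Longrightarrow> chart_at A p \<in> max_atlas A"
  by (rule atlas_max_atlas, assumption, rule conjunct1[OF chart_at])

text \<open>\<open>smooth_map_on\<close> speaks of charts of the given atlases. Near each point a
  representative in charts of the maximal atlases factors through such charts, and being
  \<open>C2on\<close> is a local property.\<close>

lemma C2on_smooth_map:
  fixes A :: "('x, 'e::real_normed_vector) atlas" and B :: "('y, 'h::real_normed_vector) atlas"
  assumes A: "smooth_atlas A" and B: "smooth_atlas B" and f: "smooth_map_on A B W f"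
    and c: "c \<in> max_atlas A" and d: "d \<in> max_atlas B"
  shows "C2on (snd c ` (fst c \<inter> W \<inter> f -` fst d)) (snd d \<circ> f \<circ> cinv c)" (is "C2on ?T ?g")
proof (rule C2on_local)
  fix x assume "x \<in> ?T"
  then obtain p where p: "p \<in> fst c" "p \<in> W" "f p \<in> fst d" "x = snd c p"
    by (elim imageE IntE vimageE) simp
  define a where "a = chart_at A p"
  define b where "b = chart_at B (f p)"
  have pA: "p \<in> mpoints A" "f p \<in> mpoints B" using p max_atlasD(3)[OF c] max_atlasD(3)[OF d] by auto
  have a: "a \<in> A" "p \<in> fst a" and b: "b \<in> B" "f p \<in> fst b"
    using chart_at[OF pA(1)] chart_at[OF pA(2)] by (auto simp: a_def b_def)
  have ia: "inj_on (snd a) (fst a)" and ib: "inj_on (snd b) (fst b)"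
    using smooth_atlas_chart[OF A a(1)] smooth_atlas_chart[OF B b(1)] by auto
  note ic = max_atlasD(1)[OF c] and id = max_atlasD(1)[OF d]
  let ?h = "snd a \<circ> cinv c" let ?F = "snd b \<circ> f \<circ> cinv a" let ?k = "snd d \<circ> cinv b"
  let ?V1 = "snd c ` (fst c \<inter> fst a)" let ?V2 = "snd a ` (fst a \<inter> W \<inter> f -` fst b)"
  let ?V3 = "snd b ` (fst b \<inter> fst d)"
  have h: "C2on ?V1 ?h" by (rule smooth_on_C2on[OF tvs_normed max_atlasD(4)[OF c a(1)]])
  have F: "C2on ?V2 ?F"
    using f a(1) b(1) by (intro smooth_on_C2on[OF tvs_normed]) (simp add: smooth_map_on_def)
  have k: "C2on ?V3 ?k" by (rule smooth_on_C2on[OF tvs_normed max_atlasD(5)[OF d b(1)]])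
  define V2 where "V2 = ?F -` ?V3 \<inter> ?V2"
  define U where "U = ?h -` V2 \<inter> ?V1"
  have oV2: "open V2"
    unfolding V2_def by (rule C2on_preimage[OF F C2on_open[OF k]])
  have oU: "open U"
    unfolding U_def by (rule C2on_preimage[OF h oV2])
  have "C2on U (\<lambda>x. ?k (?F (?h x)))"
  proof (rule C2on_compose[OF tvs_normed tvs_normed k])
    show "C2on U (\<lambda>x. ?F (?h x))"
      by (rule C2on_compose[OF tvs_normed tvs_normed F C2on_subset[OF h oU]])
        (simp_all add: U_def V2_def image_subset_iff)
    show "(\<lambda>x. ?F (?h x)) ` U \<subseteq> ?V3" by (simp add: U_def V2_def image_subset_iff)
  qed
  moreover have U: "\<exists>p'. y = snd c p' \<and> p' \<in> fst c \<and> p' \<in> fst a \<and> p' \<in> W \<and> f p' \<in> fst b \<and> f p' \<in> fst d" if "y \<in> U" for y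
  proof -
    from \<open>y \<in> U\<close> have y: "?h y \<in> V2" "y \<in> ?V1" unfolding U_def by simp_all
    from y(2) obtain p' where p': "y = snd c p'" "p' \<in> fst c" "p' \<in> fst a" by (elim imageE IntE)
    have "snd a p' \<in> V2" using y(1) p' by (simp add: cinv_chart[OF ic])
    then have 0: "?F (snd a p') \<in> ?V3" "snd a p' \<in> ?V2" unfolding V2_def by simp_all
    have "p' \<in> fst a \<inter> W \<inter> f -` fst b"
      using 0(2) by (subst (asm) inj_on_image_mem_iff[OF ia p'(3)]) auto
    then have 1: "p' \<in> W" "f p' \<in> fst b" by simp_all
    have "snd b (f p') \<in> ?V3" using 0(1) p' by (simp add: cinv_chart[OF ia])
    then have "f p' \<in> fst b \<inter> fst d"
      by (subst (asm) inj_on_image_mem_iff[OF ib 1(2)]) simp_all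
    then have "f p' \<in> fst d" by simp
    with p' 1 show ?thesis by blast
  qed
  have "?k (?F (?h y)) = ?g y" if "y \<in> U" for y
  proof -
    from U[OF that] obtain p' where "y = snd c p'" "p' \<in> fst c" "p' \<in> fst a" "f p' \<in> fst b" by (elim exE conjE)
    then show ?thesis by (simp add: cinv_chart[OF ic] cinv_chart[OF ia] cinv_chart[OF ib])
  qed
  ultimately have "C2on U ?g" by (rule C2on_cong[OF tvs_normed])
  moreover have "x \<in> U"
  proof -
    have 1: "?h x = snd a p" "?F (snd a p) = snd b (f p)"
      using p a by (simp_all add: cinv_chart[OF ic] cinv_chart[OF ia])
    have 2: "x \<in> ?V1" "snd a p \<in> ?V2" "snd b (f p) \<in> ?V3" using p a b by blast+
    then have "snd a p \<in> V2" unfolding V2_def using 1(2) by simp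
    then show ?thesis unfolding U_def using 1(1) 2(1) by simp
  qed
  moreover have "U \<subseteq> ?T"
  proof
    fix y assume "y \<in> U"
    from U[OF this] obtain p' where "y = snd c p'" "p' \<in> fst c" "p' \<in> W" "f p' \<in> fst d" by (elim exE conjE)
    then show "y \<in> ?T" by simp
  qed
  ultimately show "\<exists>U. x \<in> U \<and> U \<subseteq> ?T \<and> C2on U ?g" by blast
qed

text \<open>Members of \<open>max_atlas\<close> are compatible with the atlas by definition; their
  mutual compatibility is \<open>C2on_smooth_map\<close> for the identity map.\<close>

lemma C2on_transition:
  fixes A :: "('x, 'e::real_normed_vector) atlas"
  assumes A: "smooth_atlas A" and c: "c \<in> max_atlas A" and d: "d \<in> max_atlas A"
  shows "C2on (snd c ` (fst c \<inter> fst d)) (snd d \<circ> cinv c)"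
proof -
  have "open (snd b ` (fst b \<inter> mpoints A))" if "b \<in> A" for b
  proof -
    have "fst b \<inter> mpoints A = fst b" using chart_subset_mpoints[OF that] by blast
    then show ?thesis using smooth_atlas_chart[OF A that] by simp
  qed
  moreover have "smooth_on (snd b ` (fst b \<inter> mpoints A \<inter> (\<lambda>x. x) -` fst b')) (snd b' \<circ> (\<lambda>x. x) \<circ> cinv b)"
    if "b \<in> A" "b' \<in> A" for b b'
  proof -
    have "fst b \<inter> mpoints A \<inter> (\<lambda>x. x) -` fst b' = fst b \<inter> fst b'" using chart_subset_mpoints[OF that(1)] by blast
    then show ?thesis using smooth_atlas_transition[OF A that] by (simp add: o_def)
  qed
  ultimately have "smooth_map_on A A (mpoints A) (\<lambda>x. x)"
    unfolding smooth_map_on_def mopen_def by blast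
  from C2on_smooth_map[OF A A this c d]
  have "C2on (snd c ` (fst c \<inter> mpoints A \<inter> (\<lambda>x. x) -` fst d)) (snd d \<circ> (\<lambda>x. x) \<circ> cinv c)" .
  moreover have "fst c \<inter> mpoints A \<inter> (\<lambda>x. x) -` fst d = fst c \<inter> fst d" using max_atlasD(3)[OF c] by auto
  ultimately show ?thesis by (simp add: o_def)
qed

section \<open>Derivatives of maps between manifolds\<close>

definition has_mderiv :: "('x, 'e::real_normed_vector) atlas \<Rightarrow> ('y, 'h::real_normed_vector) atlas
    \<Rightarrow> ('x \<Rightarrow> 'y) \<Rightarrow> ('e \<Rightarrow> 'h) \<Rightarrow> 'x \<Rightarrow> bool" where
  "has_mderiv A B f f' p \<longleftrightarrow> p \<in> mpoints A \<and> f p \<in> mpoints B \<and>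
     (\<forall>\<^sub>F q in nhds (snd (chart_at A p) p). f (cinv (chart_at A p) q) \<in> fst (chart_at B (f p))) \<and>
     ((snd (chart_at B (f p)) \<circ> f \<circ> cinv (chart_at A p)) has_derivative f') (at (snd (chart_at A p) p))"

text \<open>Maps into and out of the jet and momentum bundles are only differentiated in the preferred charts, so
  injectivity of the charts suffices there and smooth compatibility of those charts is never needed.\<close>

definition inj_atlas :: "('x, 'e) atlas \<Rightarrow> bool" where
  "inj_atlas A \<longleftrightarrow> (\<forall>c\<in>A. inj_on (snd c) (fst c))"

lemma smooth_inj_atlas: "smooth_atlas A \<Longrightarrow> inj_atlas A"
  unfolding inj_atlas_def using smooth_atlas_chart by blast

lemma inj_atlas_chart: "inj_atlas A \<Longrightarrow> p \<in> mpoints A \<Longrightarrow> cinv (chart_at A p) (snd (chart_at A p) p) = p"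
  using chart_at[of p A] cinv_chart[of "chart_at A p" p] by (auto simp: inj_atlas_def)

lemma has_mderiv_tmap: "has_mderiv A B f f' p \<Longrightarrow> tmap A B f p = f'"
  unfolding has_mderiv_def tmap_def by (intro ext) (elim conjE, erule dirderiv_eq_has_derivative)

lemma has_mderiv_linear: "has_mderiv A B f f' p \<Longrightarrow> linear f'"
  unfolding has_mderiv_def using has_derivative_linear by blast

text \<open>The condition that nearby points land in the preferred chart at \<open>f p\<close> makes
  the two representatives composable; it plays the part of continuity of \<open>f\<close>.\<close>

lemma has_mderiv_compose:
  assumes A: "inj_atlas A" and B: "inj_atlas B"
    and f: "has_mderiv A B f f' p" and g: "has_mderiv B C g g' (f p)"
  shows "has_mderiv A C (\<lambda>x. g (f x)) (\<lambda>v. g' (f' v)) p"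
proof -
  define c where "c = chart_at A p" define d where "d = chart_at B (f p)" define e where "e = chart_at C (g (f p))"
  have p: "p \<in> mpoints A" "f p \<in> mpoints B" "g (f p) \<in> mpoints C"
    and fd: "\<forall>\<^sub>F q in nhds (snd c p). f (cinv c q) \<in> fst d"
    and F: "((snd d \<circ> f \<circ> cinv c) has_derivative f') (at (snd c p))"
    and ge: "\<forall>\<^sub>F r in nhds (snd d (f p)). g (cinv d r) \<in> fst e"
    and G: "((snd e \<circ> g \<circ> cinv d) has_derivative g') (at (snd d (f p)))"
    using f g by (auto simp: has_mderiv_def c_def d_def e_def)
  have cp: "cinv c (snd c p) = p" using inj_atlas_chart[OF A p(1)] by (simp add: c_def)
  have id: "inj_on (snd d) (fst d)" using B chart_at[OF p(2)] by (auto simp: inj_atlas_def d_def)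
  have G': "((snd e \<circ> g \<circ> cinv d) has_derivative g') (at ((snd d \<circ> f \<circ> cinv c) (snd c p)))"
    using G by (simp add: cp)
  have "((\<lambda>q. (snd e \<circ> g \<circ> cinv d) ((snd d \<circ> f \<circ> cinv c) q)) has_derivative (\<lambda>v. g' (f' v))) (at (snd c p))"
    by (rule has_derivative_compose[OF F G'])
  moreover have eq: "\<forall>\<^sub>F q in nhds (snd c p). cinv d ((snd d \<circ> f \<circ> cinv c) q) = f (cinv c q)"
    using fd by eventually_elim (simp add: cinv_chart[OF id])
  then have "\<forall>\<^sub>F q in nhds (snd c p). (snd e \<circ> g \<circ> cinv d) ((snd d \<circ> f \<circ> cinv c) q) = (snd e \<circ> (\<lambda>x. g (f x)) \<circ> cinv c) q"
    by eventually_elim simp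
  ultimately have "((snd e \<circ> (\<lambda>x. g (f x)) \<circ> cinv c) has_derivative (\<lambda>v. g' (f' v))) (at (snd c p))"
    by (rule has_derivative_cong_nhds)
  moreover have "\<forall>\<^sub>F q in nhds (snd c p). g (f (cinv c q)) \<in> fst e"
  proof -
    have "isCont (snd d \<circ> f \<circ> cinv c) (snd c p)" using F by (rule has_derivative_continuous)
    then have "filterlim (snd d \<circ> f \<circ> cinv c) (nhds (snd d (f p))) (nhds (snd c p))"
      unfolding isCont_def tendsto_at_iff_tendsto_nhds by (simp add: cp)
    from eventually_compose_filterlim[OF ge this] eq show ?thesis by eventually_elim simp
  qed
  ultimately show ?thesis using p by (simp add: has_mderiv_def c_def e_def)
qed

lemma has_mderiv_cong:
  assumes A: "inj_atlas A" and f: "has_mderiv A B f f' p"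
    and eq: "\<forall>\<^sub>F q in nhds (snd (chart_at A p) p). f (cinv (chart_at A p) q) = g (cinv (chart_at A p) q)"
  shows "has_mderiv A B g f' p"
proof -
  have "f p = g p"
    using eventually_nhds_x_imp_x[OF eq] f inj_atlas_chart[OF A] by (simp add: has_mderiv_def)
  moreover have "\<forall>\<^sub>F q in nhds (snd (chart_at A p) p). g (cinv (chart_at A p) q) \<in> fst (chart_at B (f p))"
    using f[unfolded has_mderiv_def] eq by (auto elim: eventually_elim2)
  moreover have "((snd (chart_at B (f p)) \<circ> g \<circ> cinv (chart_at A p)) has_derivative f') (at (snd (chart_at A p) p))"
    using f[unfolded has_mderiv_def] eq
    by (auto intro!: has_derivative_cong_nhds[of "snd (chart_at B (f p)) \<circ> f \<circ> cinv (chart_at A p)"] elim: eventually_mono)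
  ultimately show ?thesis using f by (auto simp: has_mderiv_def)
qed

lemma euc_simps [simp]: "chart_at euc x = (UNIV, id)" "cinv (UNIV, id) = id" "mpoints euc = UNIV" "inj_atlas euc"
  by (auto simp: chart_at_def euc_def cinv_def mpoints_def inj_atlas_def)

lemma has_mderiv_euc: "has_mderiv euc euc f f' x \<longleftrightarrow> (f has_derivative f') (at x)"
  by (simp add: has_mderiv_def o_def)

lemma has_mderiv_cinv:
  fixes A :: "('x, 'e::real_normed_vector) atlas"
  assumes fd: "findim TYPE('e)" and A: "smooth_atlas A" and d: "d \<in> max_atlas A" and p: "p \<in> fst d"
  shows "has_mderiv euc A (cinv d) (tmap euc A (cinv d) (snd d p)) (snd d p)"
    and "has_mderiv A euc (snd d) (tmap A euc (snd d) p) p"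
proof -
  have pA: "p \<in> mpoints A" using p max_atlasD(3)[OF d] by auto
  define a where "a = chart_at A p"
  have a: "a \<in> A" "p \<in> fst a" "a \<in> max_atlas A" using chart_at[OF pA] atlas_max_atlas[OF A] by (auto simp: a_def)
  note id = max_atlasD(1)[OF d] and ia = max_atlasD(1)[OF a(3)]
  have dp: "cinv d (snd d p) = p" by (rule cinv_chart[OF id p])
  note C1 = C2on_transition[OF A d a(3)] and C2 = C2on_transition[OF A a(3) d]
  have p1: "snd d p \<in> snd d ` (fst d \<inter> fst a)" and p2: "snd a p \<in> snd a ` (fst a \<inter> fst d)" using p a by auto
  have "\<forall>\<^sub>F q in nhds (snd d p). q \<in> snd d ` (fst d \<inter> fst a)"
    by (rule eventually_nhds_in_open[OF C2on_open[OF C1] p1])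
  then have e1: "\<forall>\<^sub>F q in nhds (snd d p). cinv d q \<in> fst a"
    by eventually_elim (auto simp: cinv_chart[OF id])
  have "has_mderiv euc A (cinv d) (dirderiv (snd a \<circ> cinv d) (snd d p)) (snd d p)"
    using C2on_has_derivative(1)[OF fd C1 p1] e1 dp pA by (simp add: has_mderiv_def a_def)
  with has_mderiv_tmap[OF this] show "has_mderiv euc A (cinv d) (tmap euc A (cinv d) (snd d p)) (snd d p)" by simp
  have "has_mderiv A euc (snd d) (dirderiv (snd d \<circ> cinv a) (snd a p)) p"
    using C2on_has_derivative(1)[OF fd C2 p2] pA by (simp add: has_mderiv_def a_def)
  with has_mderiv_tmap[OF this] show "has_mderiv A euc (snd d) (tmap A euc (snd d) p) p" by simp
qed

text \<open>Translates a property holding near \<open>p\<close> from the chart \<open>d\<close> to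
  the preferred chart, in which \<open>has_mderiv\<close> is stated.\<close>

lemma eventually_chart:
  fixes A :: "('x, 'e::real_normed_vector) atlas"
  assumes A: "smooth_atlas A" and p: "p \<in> mpoints A" and d: "d \<in> max_atlas A" and pd: "p \<in> fst d"
    and P: "\<forall>\<^sub>F q in nhds (snd d p). P (cinv d q)"
  shows "\<forall>\<^sub>F q in nhds (snd (chart_at A p) p). cinv (chart_at A p) q \<in> fst d \<and> P (cinv (chart_at A p) q)"
proof -
  define a where "a = chart_at A p"
  have a: "a \<in> A" "p \<in> fst a" "a \<in> max_atlas A" using chart_at[OF p] atlas_max_atlas[OF A] by (auto simp: a_def)
  note id = max_atlasD(1)[OF d] and ia = max_atlasD(1)[OF a(3)]
  note C2 = C2on_transition[OF A a(3) d]
  have p2: "snd a p \<in> snd a ` (fst a \<inter> fst d)" using pd a by auto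
  have op: "open (snd a ` (fst a \<inter> fst d))" by (rule C2on_open[OF C2])
  have "isCont (snd d \<circ> cinv a) (snd a p)"
    by (rule C2on_isCont[OF C2 p2])
  then have "filterlim (snd d \<circ> cinv a) (nhds (snd d p)) (nhds (snd a p))"
    unfolding isCont_def tendsto_at_iff_tendsto_nhds by (simp add: cinv_chart[OF ia a(2)])
  from eventually_compose_filterlim[OF P this] eventually_nhds_in_open[OF op p2]
  have "\<forall>\<^sub>F q in nhds (snd a p). cinv a q \<in> fst d \<and> P (cinv a q)"
  proof eventually_elim
    case (elim q)
    from elim(2) obtain r where r: "q = snd a r" "r \<in> fst a" "r \<in> fst d" by (elim imageE IntE)
    with elim(1) show ?case by (simp add: cinv_chart[OF ia] cinv_chart[OF id])
  qed
  then show ?thesis by (simp add: a_def)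
qed

section \<open>Frames attached to a chart\<close>

text \<open>\<open>frame A d p\<close> turns components of a tangent vector at \<open>p\<close> in the chart \<open>d\<close> into components in the preferred
  chart, \<open>coframe A d p\<close> goes back.\<close>

definition frame :: "('x, 'e::{real_vector,t2_space}) atlas \<Rightarrow> ('x, 'e) chart \<Rightarrow> 'x \<Rightarrow> 'e \<Rightarrow> 'e" where
  "frame A d p = tmap euc A (cinv d) (snd d p)"

definition coframe :: "('x, 'e::{real_vector,t2_space}) atlas \<Rightarrow> ('x, 'e) chart \<Rightarrow> 'x \<Rightarrow> 'e \<Rightarrow> 'e" where
  "coframe A d p = tmap A euc (snd d) p"

text \<open>The chain rule for \<open>snd d\<close> and \<open>cinv d\<close>, which are inverse to
  each other near the point.\<close>

lemma
  fixes A :: "('x, 'e::real_normed_vector) atlas"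
  assumes fd: "findim TYPE('e)" and A: "smooth_atlas A" and d: "d \<in> max_atlas A" and p: "p \<in> fst d"
  shows frame_linear: "linear (frame A d p)" and coframe_linear: "linear (coframe A d p)"
    and coframe_frame: "coframe A d p (frame A d p v) = v"
    and frame_coframe: "frame A d p (coframe A d p v) = v"
proof -
  note * = has_mderiv_cinv[OF assms]
  note id = max_atlasD(1)[OF d]
  have pA: "p \<in> mpoints A" using p max_atlasD(3)[OF d] by auto
  show "linear (frame A d p)" "linear (coframe A d p)"
    unfolding frame_def coframe_def by (rule has_mderiv_linear[OF *(1)], rule has_mderiv_linear[OF *(2)])
  have dp: "cinv d (snd d p) = p" by (rule cinv_chart[OF id p])
  have "has_mderiv euc euc (\<lambda>q. snd d (cinv d q)) (\<lambda>v. coframe A d p (frame A d p v)) (snd d p)"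
    unfolding frame_def coframe_def
    by (rule has_mderiv_compose[OF euc_simps(4) smooth_inj_atlas[OF A] *(1)]) (simp only: dp *(2))
  then have 1: "((\<lambda>q. snd d (cinv d q)) has_derivative (\<lambda>v. coframe A d p (frame A d p v))) (at (snd d p))"
    by (simp add: has_mderiv_euc)
  have "\<forall>\<^sub>F q in nhds (snd d p). q \<in> snd d ` fst d" using max_atlasD(2)[OF d] p by (intro eventually_nhds_in_open) auto
  then have "\<forall>\<^sub>F q in nhds (snd d p). snd d (cinv d q) = q" by eventually_elim (rule chart_cinv)
  from has_derivative_cong_nhds[OF 1 this] have "((\<lambda>q. q) has_derivative (\<lambda>v. coframe A d p (frame A d p v))) (at (snd d p))" .
  from has_derivative_unique[OF this has_derivative_ident] show "coframe A d p (frame A d p v) = v" by (rule fun_cong)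
  have "has_mderiv A A (\<lambda>q. cinv d (snd d q)) (\<lambda>v. frame A d p (coframe A d p v)) p"
    unfolding frame_def coframe_def
    by (rule has_mderiv_compose[OF smooth_inj_atlas[OF A] euc_simps(4) *(2) *(1)])
  moreover have "\<forall>\<^sub>F q in nhds (snd (chart_at A p) p). cinv (chart_at A p) q \<in> fst d \<and> True"
    by (rule eventually_chart[OF A pA d p]) simp
  then have "\<forall>\<^sub>F q in nhds (snd (chart_at A p) p). cinv d (snd d (cinv (chart_at A p) q)) = cinv (chart_at A p) q"
    by eventually_elim (simp add: cinv_chart[OF id])
  ultimately have "has_mderiv A A (\<lambda>q. q) (\<lambda>v. frame A d p (coframe A d p v)) p"
    by (rule has_mderiv_cong[OF smooth_inj_atlas[OF A]])
  then have 2: "((snd (chart_at A p) \<circ> (\<lambda>q. q) \<circ> cinv (chart_at A p)) has_derivative (\<lambda>v. frame A d p (coframe A d p v)))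
      (at (snd (chart_at A p) p))" by (simp add: has_mderiv_def)
  have a: "chart_at A p \<in> max_atlas A" "p \<in> fst (chart_at A p)" using chart_at_max[OF A pA] chart_at[OF pA] by auto
  have "\<forall>\<^sub>F q in nhds (snd (chart_at A p) p). q \<in> snd (chart_at A p) ` fst (chart_at A p)"
    using max_atlasD(2)[OF a(1)] a(2) by (intro eventually_nhds_in_open) auto
  then have "\<forall>\<^sub>F q in nhds (snd (chart_at A p) p). (snd (chart_at A p) \<circ> (\<lambda>q. q) \<circ> cinv (chart_at A p)) q = q"
    by eventually_elim (simp add: chart_cinv)
  from has_derivative_cong_nhds[OF 2 this]
  have "((\<lambda>q. q) has_derivative (\<lambda>v. frame A d p (coframe A d p v))) (at (snd (chart_at A p) p))" .
  from has_derivative_unique[OF this has_derivative_ident] show "frame A d p (coframe A d p v) = v" by (rule fun_cong)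
qed

text \<open>Near \<open>p\<close> the map is \<open>cinv d\<close> after its representative after
  \<open>snd c\<close>, so \<open>tmap\<close> can be computed in any charts of the maximal atlases
  instead of the preferred ones.\<close>

lemma has_mderiv_coord:
  fixes A :: "('x, 'e::real_normed_vector) atlas" and B :: "('y, 'h::real_normed_vector) atlas"
  assumes fd: "findim TYPE('e)" "findim TYPE('h)" and A: "smooth_atlas A" and B: "smooth_atlas B"
    and c: "c \<in> max_atlas A" "p \<in> fst c" and d: "d \<in> max_atlas B" "f p \<in> fst d"
    and D: "((snd d \<circ> f \<circ> cinv c) has_derivative D) (at (snd c p))"
    and ev: "\<forall>\<^sub>F q in nhds (snd c p). f (cinv c q) \<in> fst d"
  shows "has_mderiv A B f (\<lambda>v. frame B d (f p) (D (coframe A c p v))) p"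
proof -
  have pA: "p \<in> mpoints A" using c max_atlasD(3)[OF c(1)] by auto
  note ic = max_atlasD(1)[OF c(1)] and id = max_atlasD(1)[OF d(1)]
  have F: "(snd d \<circ> f \<circ> cinv c) (snd c p) = snd d (f p)" by (simp add: cinv_chart[OF ic c(2)])
  have 1: "has_mderiv A euc (snd c) (coframe A c p) p"
    unfolding coframe_def by (rule has_mderiv_cinv(2)[OF fd(1) A c])
  have 2: "has_mderiv euc euc (snd d \<circ> f \<circ> cinv c) D (snd c p)" using D by (simp add: has_mderiv_euc)
  have 3: "has_mderiv euc B (cinv d) (frame B d (f p)) ((snd d \<circ> f \<circ> cinv c) (snd c p))"
    unfolding F unfolding frame_def by (rule has_mderiv_cinv(1)[OF fd(2) B d])
  have "has_mderiv A euc (\<lambda>q. (snd d \<circ> f \<circ> cinv c) (snd c q)) (\<lambda>v. D (coframe A c p v)) p"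
    by (rule has_mderiv_compose[OF smooth_inj_atlas[OF A] _ 1 2]) simp
  from has_mderiv_compose[OF smooth_inj_atlas[OF A] _ this 3]
  have "has_mderiv A B (\<lambda>q. cinv d ((snd d \<circ> f \<circ> cinv c) (snd c q))) (\<lambda>v. frame B d (f p) (D (coframe A c p v))) p"
    by simp
  moreover have "\<forall>\<^sub>F q in nhds (snd (chart_at A p) p). cinv (chart_at A p) q \<in> fst c \<and> f (cinv (chart_at A p) q) \<in> fst d"
    by (rule eventually_chart[OF A pA c ev])
  then have "\<forall>\<^sub>F q in nhds (snd (chart_at A p) p).
      cinv d ((snd d \<circ> f \<circ> cinv c) (snd c (cinv (chart_at A p) q))) = f (cinv (chart_at A p) q)"
    by eventually_elim (simp add: cinv_chart[OF ic] cinv_chart[OF id])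
  ultimately show ?thesis by (rule has_mderiv_cong[OF smooth_inj_atlas[OF A]])
qed

lemma tmap_coord:
  fixes A :: "('x, 'e::real_normed_vector) atlas" and B :: "('y, 'h::real_normed_vector) atlas"
  assumes "findim TYPE('e)" "findim TYPE('h)" "smooth_atlas A" "smooth_atlas B"
    "c \<in> max_atlas A" "p \<in> fst c" "d \<in> max_atlas B" "f p \<in> fst d"
    "((snd d \<circ> f \<circ> cinv c) has_derivative D) (at (snd c p))"
    "\<forall>\<^sub>F q in nhds (snd c p). f (cinv c q) \<in> fst d"
  shows "tmap A B f p = (\<lambda>v. frame B d (f p) (D (coframe A c p v)))"
  by (rule has_mderiv_tmap[OF has_mderiv_coord[OF assms]])

section \<open>Existence of fibered charts\<close>

lemma iter_dirderiv_cong: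
  fixes f g :: "'a::{real_vector,topological_space} \<Rightarrow> 'b::{real_vector,t2_space}"
  assumes "tvs TYPE('a)" "open S" "\<And>x. x \<in> S \<Longrightarrow> f x = g x" "x \<in> S"
  shows "iter_dirderiv k f w x = iter_dirderiv k g w x"
  using assms(4)
proof (induction k arbitrary: x)
  case (Suc k)
  show ?case unfolding iter_dirderiv.simps
    by (rule dirderiv_cong_open[OF assms(1,2) Suc.prems]) (rule Suc.IH)
qed (simp add: assms(3))

lemma smooth_on_cong:
  fixes f g :: "'a::{real_vector,topological_space} \<Rightarrow> 'b::{real_vector,t2_space}"
  assumes tvs: "tvs TYPE('a)" and f: "smooth_on S f" and eq: "\<And>x. x \<in> S \<Longrightarrow> f x = g x"
  shows "smooth_on S g"
proof -
  have S: "open S" using f by (simp add: smooth_on_def)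
  note c = iter_dirderiv_cong[where f = f and g = g, OF tvs S eq]
  show ?thesis
    unfolding smooth_on_def
  proof (intro conjI allI ballI S)
    fix k x and w :: "nat \<Rightarrow> 'a" assume x: "x \<in> S"
    obtain l where "has_dirderiv (iter_dirderiv k f w) x (w k) l"
      using f x unfolding smooth_on_def has_dirderiv_def by blast
    then have "has_dirderiv (iter_dirderiv k g w) x (w k) l"
      by (rule has_dirderiv_cong[where f = "iter_dirderiv k f w", OF tvs S x, rotated]) (rule c)
    then show "\<exists>l. ((\<lambda>t. (1 / t) *\<^sub>R (iter_dirderiv k g w (x + t *\<^sub>R w k) - iter_dirderiv k g w x)) \<longlongrightarrow> l) (at 0)"
      unfolding has_dirderiv_def by (rule exI)
  next
    fix k
    have "continuous_on (S \<times> UNIV) (\<lambda>(x, w). iter_dirderiv k f w x)" using f unfolding smooth_on_def by simp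
    moreover have "(case z of (x, w) \<Rightarrow> iter_dirderiv k f w x) = (case z of (x, w) \<Rightarrow> iter_dirderiv k g w x)"
      if "z \<in> S \<times> UNIV" for z :: "'a \<times> (nat \<Rightarrow> 'a)"
      using that c[of "fst z" k "snd z"] by (cases z) simp
    ultimately show "continuous_on (S \<times> UNIV) (\<lambda>(x, w). iter_dirderiv k g w x)"
      using continuous_on_cong[OF refl, of "S \<times> UNIV"] by blast
  qed
qed

lemma iter_dirderiv_id:
  "iter_dirderiv k (\<lambda>x::'a::real_normed_vector. x) w =
    (if k = 0 then (\<lambda>x. x) else if k = 1 then (\<lambda>x. w 0) else (\<lambda>x. 0))"
proof (induction k)
  case (Suc k)
  have "dirderiv (\<lambda>x::'a. x) x v = v" for x v by (rule dirderiv_eq_has_derivative[OF has_derivative_ident])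
  moreover have "dirderiv (\<lambda>x::'a. a::'a) x v = 0" for a x v by (rule dirderiv_eq_has_derivative[OF has_derivative_const])
  ultimately show ?case unfolding iter_dirderiv.simps Suc by (auto simp: fun_eq_iff)
qed simp

text \<open>Serves the transition of a newly built chart with itself.\<close>

lemma smooth_on_id:
  assumes "open (S :: 'a::real_normed_vector set)"
  shows "smooth_on S (\<lambda>x. x)"
  unfolding smooth_on_def
proof (intro conjI allI ballI assms)
  fix k x and w :: "nat \<Rightarrow> 'a"
  have i: "has_dirderiv (\<lambda>x::'a. x) x v v" for v
    using BC1_dirderiv[OF BC1_linear_map(1)[OF linear_id[unfolded id_def] continuous_on_id open_UNIV], of x v]
      BC1_linear_map(2)[OF linear_id[unfolded id_def] continuous_on_id open_UNIV, of x v] by simp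
  have c: "has_dirderiv (\<lambda>x::'a. a::'a) x v 0" for a v by (simp add: has_dirderiv_def)
  have "\<exists>l. has_dirderiv (iter_dirderiv k (\<lambda>x. x) w) x (w k) l"
    unfolding iter_dirderiv_id using i c by auto
  then show "\<exists>l. ((\<lambda>t. (1 / t) *\<^sub>R (iter_dirderiv k (\<lambda>x. x) w (x + t *\<^sub>R w k) - iter_dirderiv k (\<lambda>x. x) w x)) \<longlongrightarrow> l) (at 0)"
    unfolding has_dirderiv_def .
next
  fix k
  have "continuous_on (S \<times> UNIV) (\<lambda>z::'a \<times> (nat \<Rightarrow> 'a). snd z 0)"
    by (rule continuous_on_compose2[OF continuous_on_product_coordinates continuous_on_snd[OF continuous_on_id]]) simp
  moreover have "continuous_on (S \<times> UNIV) (\<lambda>z::'a \<times> (nat \<Rightarrow> 'a). fst z)" by (intro continuous_intros)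
  ultimately show "continuous_on (S \<times> UNIV) (\<lambda>(x::'a, w). iter_dirderiv k (\<lambda>x. x) w x)"
    unfolding iter_dirderiv_id case_prod_unfold by (cases "k = 0"; cases "k = 1"; simp)
qed

text \<open>A local trivialization followed by a product of charts of \<open>X\<close> and
  \<open>F\<close> is fibered. It lies in the maximal atlas, whose definition asks for smooth
  transitions of all orders, so \<open>C2on\<close> is not enough here.\<close>

lemma fib_chart_exists:
  fixes X :: "('x, real^'m::finite) atlas" and Y :: "('y, (real^'m) \<times> 'f::real_normed_vector) atlas"
    and F :: "('p, 'f) atlas"
  assumes fb: "fiber_bundle X Y F \<pi>" and y0: "y0 \<in> mpoints Y"
  shows "\<exists>c \<psi>. (c, \<psi>) \<in> fib_charts X Y \<pi> \<and> y0 \<in> fst \<psi>"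
proof -
  have X: "smooth_atlas X" and Y: "smooth_atlas Y" and Fa: "smooth_atlas F" and surj: "\<pi> ` mpoints Y = mpoints X"
    using fb unfolding fiber_bundle_def manifold_def hausdorff_manifold_def by blast+
  have x0: "\<pi> y0 \<in> mpoints X" using surj y0 by blast
  have "\<exists>U \<psi>. \<pi> y0 \<in> U \<and> mopen X U \<and> bij_betw (\<lambda>y. (\<pi> y, \<psi> y)) {y \<in> mpoints Y. \<pi> y \<in> U} (U \<times> mpoints F) \<and>
      smooth_map_on Y (prod_atlas X F) {y \<in> mpoints Y. \<pi> y \<in> U} (\<lambda>y. (\<pi> y, \<psi> y)) \<and>
      smooth_map_on (prod_atlas X F) Y (U \<times> mpoints F) (inv_into {y \<in> mpoints Y. \<pi> y \<in> U} (\<lambda>y. (\<pi> y, \<psi> y)))"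
    using fb x0 unfolding fiber_bundle_def Let_def by simp
  then obtain U \<psi> where U: "\<pi> y0 \<in> U" "mopen X U"
    and b: "bij_betw (\<lambda>y. (\<pi> y, \<psi> y)) {y \<in> mpoints Y. \<pi> y \<in> U} (U \<times> mpoints F)"
    and s1: "smooth_map_on Y (prod_atlas X F) {y \<in> mpoints Y. \<pi> y \<in> U} (\<lambda>y. (\<pi> y, \<psi> y))"
    and s2: "smooth_map_on (prod_atlas X F) Y (U \<times> mpoints F) (inv_into {y \<in> mpoints Y. \<pi> y \<in> U} (\<lambda>y. (\<pi> y, \<psi> y)))"
    by (elim exE conjE)
  define E where "E = {y \<in> mpoints Y. \<pi> y \<in> U}"
  define T where "T = (\<lambda>y. (\<pi> y, \<psi> y))"
  note b = b[folded E_def T_def] and s1 = s1[folded E_def T_def] and s2 = s2[folded E_def T_def]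
  have inj: "inj_on T E" and im: "T ` E = U \<times> mpoints F" using b by (simp_all add: bij_betw_def)
  have y0E: "y0 \<in> E" using y0 U(1) by (simp add: E_def)
  then have "T y0 \<in> U \<times> mpoints F" using im by blast
  then have "\<psi> y0 \<in> mpoints F" by (simp add: T_def)
  then obtain d where d: "d \<in> F" "\<psi> y0 \<in> fst d" unfolding mpoints_def by blast
  obtain c where c: "c \<in> X" "\<pi> y0 \<in> fst c" using x0 unfolding mpoints_def by blast
  note ci = smooth_atlas_chart[OF X c(1)] and di = smooth_atlas_chart[OF Fa d(1)]
  define e :: "('x \<times> 'p, (real^'m) \<times> 'f) chart" where "e = (fst c \<times> fst d, map_prod (snd c) (snd d))"
  have e: "e \<in> prod_atlas X F" unfolding prod_atlas_def e_def using c(1) d(1) by blast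
  have ei: "inj_on (snd e) (fst e)" unfolding e_def using ci di by (auto simp: inj_on_def)
  define \<theta> where "\<theta> = (E \<inter> T -` fst e, snd e \<circ> T)"
  have fe: "T y \<in> fst e \<longleftrightarrow> \<pi> y \<in> fst c \<and> \<psi> y \<in> fst d" for y by (simp add: T_def e_def)
  have \<theta>i: "inj_on (snd \<theta>) (fst \<theta>)"
    unfolding \<theta>_def fst_conv snd_conv
    by (rule comp_inj_on[OF inj_on_subset[OF inj Int_lower1] inj_on_subset[OF ei]]) blast
  have c\<theta>: "cinv \<theta> (snd \<theta> y) = y" if "y \<in> fst \<theta>" for y by (rule cinv_chart[OF \<theta>i that])
  have inv: "inv_into E T (cinv e (snd \<theta> y)) = y" if "y \<in> fst \<theta>" for y
  proof -
    have "y \<in> E" "T y \<in> fst e" using that by (simp_all add: \<theta>_def)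
    then show ?thesis using cinv_chart[OF ei] inv_into_f_f[OF inj] by (simp add: \<theta>_def)
  qed
  have op: "open (snd \<theta> ` fst \<theta>)"
  proof -
    have "snd \<theta> ` fst \<theta> = (snd c ` (fst c \<inter> U)) \<times> (snd d ` fst d)"
    proof (intro equalityI subsetI)
      fix z assume "z \<in> snd \<theta> ` fst \<theta>"
      then show "z \<in> (snd c ` (fst c \<inter> U)) \<times> (snd d ` fst d)"
        unfolding \<theta>_def E_def e_def T_def by auto
    next
      fix z assume "z \<in> (snd c ` (fst c \<inter> U)) \<times> (snd d ` fst d)"
      then obtain u v where uv: "u \<in> fst c" "u \<in> U" "v \<in> fst d" "z = (snd c u, snd d v)" by auto
      have "(u, v) \<in> T ` E" unfolding im using uv chart_subset_mpoints[OF d(1)] by blast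
      then obtain y where y: "y \<in> E" "(u, v) = T y" by blast
      have "y \<in> fst \<theta>" using y uv unfolding \<theta>_def e_def by (simp add: y(2)[symmetric])
      moreover have "z = snd \<theta> y" using uv(4) unfolding \<theta>_def e_def by (simp add: y(2)[symmetric])
      ultimately show "z \<in> snd \<theta> ` fst \<theta>" by blast
    qed
    moreover have "open (snd c ` (fst c \<inter> U))" using U(2) c(1) unfolding mopen_def by blast
    ultimately show ?thesis by (simp only: open_Times conjunct2[OF di])
  qed
  have t1: "smooth_on (snd a ` (fst a \<inter> fst \<theta>)) (snd \<theta> \<circ> cinv a)" if a: "a \<in> Y" for a
  proof -
    have "smooth_on (snd a ` (fst a \<inter> E \<inter> T -` fst e)) (snd e \<circ> T \<circ> cinv a)"
      using s1 a e unfolding smooth_map_on_def by blast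
    then show ?thesis by (simp add: \<theta>_def Int_assoc o_assoc)
  qed
  have t2: "smooth_on (snd \<theta> ` (fst \<theta> \<inter> fst a)) (snd a \<circ> cinv \<theta>)" if a: "a \<in> Y" for a
  proof -
    have s: "smooth_on (snd e ` (fst e \<inter> (U \<times> mpoints F) \<inter> inv_into E T -` fst a)) (snd a \<circ> inv_into E T \<circ> cinv e)"
      using s2 a e unfolding smooth_map_on_def by blast
    have "snd e ` (fst e \<inter> (U \<times> mpoints F) \<inter> inv_into E T -` fst a) = snd \<theta> ` (fst \<theta> \<inter> fst a)"
    proof (intro equalityI subsetI)
      fix z assume "z \<in> snd e ` (fst e \<inter> (U \<times> mpoints F) \<inter> inv_into E T -` fst a)"
      then obtain w where w: "w \<in> fst e" "w \<in> T ` E" "inv_into E T w \<in> fst a" "z = snd e w" unfolding im by blast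
      then obtain y where y: "y \<in> E" "w = T y" by blast
      have "inv_into E T w = y" unfolding y(2) by (rule inv_into_f_f[OF inj y(1)])
      then have "y \<in> fst \<theta> \<inter> fst a" "z = snd \<theta> y" using w y by (simp_all add: \<theta>_def)
      then show "z \<in> snd \<theta> ` (fst \<theta> \<inter> fst a)" by blast
    next
      fix z assume "z \<in> snd \<theta> ` (fst \<theta> \<inter> fst a)"
      then obtain y where y: "y \<in> E" "T y \<in> fst e" "y \<in> fst a" "z = snd e (T y)" by (auto simp: \<theta>_def)
      have "T y \<in> U \<times> mpoints F" using im y(1) by blast
      moreover have "inv_into E T (T y) \<in> fst a" using inv_into_f_f[OF inj y(1)] y(3) by simp
      ultimately have "T y \<in> fst e \<inter> (U \<times> mpoints F) \<inter> inv_into E T -` fst a" using y(2) by blast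
      then show "z \<in> snd e ` (fst e \<inter> (U \<times> mpoints F) \<inter> inv_into E T -` fst a)" unfolding y(4) by (rule imageI)
    qed
    with s have s: "smooth_on (snd \<theta> ` (fst \<theta> \<inter> fst a)) (snd a \<circ> inv_into E T \<circ> cinv e)" by simp
    \<comment> \<open>The representative from the trivialization agrees with the transition map on
      this domain only, which is why smoothness is transferred by
      \<open>smooth_on_cong\<close>.\<close>
    show ?thesis
    proof (rule smooth_on_cong[OF tvs_normed s])
      fix z assume "z \<in> snd \<theta> ` (fst \<theta> \<inter> fst a)"
      then obtain y where "y \<in> fst \<theta>" "z = snd \<theta> y" by blast
      then show "(snd a \<circ> inv_into E T \<circ> cinv e) z = (snd a \<circ> cinv \<theta>) z" using c\<theta> inv by simp
    qed
  qed
  \<comment> \<open>\<open>smooth_atlas\<close> also compares the new chart with itself; the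
    transition is the identity on the image of the chart.\<close>
  have t3: "smooth_on (snd \<theta> ` (fst \<theta> \<inter> fst \<theta>)) (snd \<theta> \<circ> cinv \<theta>)"
  proof -
    have "smooth_on (snd \<theta> ` (fst \<theta> \<inter> fst \<theta>)) (\<lambda>z. z)" using smooth_on_id[OF op] by simp
    then show ?thesis
      by (rule smooth_on_cong[OF tvs_normed]) (auto simp: c\<theta>)
  qed
  have "smooth_atlas (insert \<theta> Y)"
    unfolding smooth_atlas_def
  proof (intro conjI ballI)
    fix a assume "a \<in> insert \<theta> Y"
    then show "inj_on (snd a) (fst a)" "open (snd a ` fst a)" using \<theta>i op smooth_atlas_chart[OF Y] by auto
    fix a' assume "a' \<in> insert \<theta> Y"
    with \<open>a \<in> insert \<theta> Y\<close> show "smooth_on (snd a ` (fst a \<inter> fst a')) (snd a' \<circ> cinv a)"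
      using t1 t2 t3 smooth_atlas_transition[OF Y] by blast
  qed
  moreover have "fst \<theta> \<subseteq> mpoints Y" by (auto simp: \<theta>_def E_def)
  ultimately have "\<theta> \<in> max_atlas Y" unfolding max_atlas_def by simp
  moreover have "\<pi> ` fst \<theta> \<subseteq> fst c"
  proof (rule image_subsetI)
    fix y assume "y \<in> fst \<theta>"
    then have "T y \<in> fst e" by (simp add: \<theta>_def)
    then show "\<pi> y \<in> fst c" unfolding fe by (rule conjunct1)
  qed
  moreover have "\<forall>y\<in>fst \<theta>. fst (snd \<theta> y) = snd c (\<pi> y)" by (simp add: \<theta>_def e_def T_def)
  ultimately have "(c, \<theta>) \<in> fib_charts X Y \<pi>"
    unfolding fib_charts_def using atlas_max_atlas[OF X c(1)] by simp
  moreover have "y0 \<in> fst \<theta>" using y0E c(2) d(2) by (simp add: \<theta>_def fe)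
  ultimately show ?thesis by blast
qed

section \<open>The divergence identity in coordinates\<close>

lemma bounded_linear_axis: "bounded_linear (axis i :: 'f::real_normed_vector \<Rightarrow> 'f ^ 'n::finite)"
proof (rule bounded_linear_intro[where K = 1])
  fix x :: 'f
  have "norm (axis i x :: 'f ^ 'n) \<le> (\<Sum>j\<in>UNIV. norm ((axis i x :: 'f ^ 'n) $ j))"
    unfolding norm_vec_def by (rule L2_set_le_sum) simp
  also have "\<dots> = (\<Sum>j\<in>UNIV. if j = i then norm x else 0)"
    by (rule sum.cong) (simp_all add: axis_def)
  finally show "norm (axis i x :: 'f ^ 'n) \<le> norm x * 1" by simp
qed (simp_all add: vec_eq_iff axis_def)

lemma vec_eq_sum_axis: "(\<chi> i. g i) = (\<Sum>i\<in>UNIV. axis i (g i :: 'f::real_normed_vector))"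
  by (simp add: vec_eq_iff axis_def if_distrib sum.delta cong: if_cong)

lemma has_derivative_vec_lambda:
  fixes g :: "'n::finite \<Rightarrow> 'a::real_normed_vector \<Rightarrow> 'f::real_normed_vector"
  assumes "\<And>i. (g i has_derivative g' i) F"
  shows "((\<lambda>x. \<chi> i. g i x) has_derivative (\<lambda>h. \<chi> i. g' i h)) F"
  unfolding vec_eq_sum_axis
  by (intro has_derivative_sum bounded_linear.has_derivative[OF bounded_linear_axis] assms)

lemma C2on_dirderiv_has_derivative:
  fixes f :: "'a::real_normed_vector \<Rightarrow> 'b::real_normed_vector"
  assumes fd: "findim TYPE('a)" and f: "C2on S f" and x: "g x \<in> S"
    and g: "(g has_derivative g') (at x)" and u: "(u has_derivative u') (at x)"
  shows "((\<lambda>y. dirderiv f (g y) (u y)) has_derivative (\<lambda>h. d2 f (g x) (u x) (g' h) + dirderiv f (g x) (u' h))) (at x)"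
  using has_derivative_compose[OF has_derivative_Pair[OF g u] C2on_has_derivative(2)[OF fd f x]] by simp

lemma C2on_dirderiv_const_has_derivative:
  fixes f :: "'a::real_normed_vector \<Rightarrow> 'b::real_normed_vector"
  assumes fd: "findim TYPE('a)" and f: "C2on S f" and x: "g x \<in> S" and g: "(g has_derivative g') (at x)"
  shows "((\<lambda>y. dirderiv f (g y) v) has_derivative (\<lambda>h. d2 f (g x) v (g' h))) (at x)"
  using C2on_dirderiv_has_derivative[OF fd f x g has_derivative_const[of v]]
    linear_0[OF has_derivative_linear[OF C2on_has_derivative(1)[OF fd f x]]] by simp

definition jet_coord :: "(real^'m::finite \<Rightarrow> 'f::real_normed_vector) \<Rightarrow> real^'m \<Rightarrow> (real^'m) \<times> 'f \<times> ('f^'m)" where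
  "jet_coord f x = (x, f x, \<chi> \<mu>. dirderiv f x (axis \<mu> 1))"

lemma jet_coord_has_derivative:
  fixes f :: "real^'m::finite \<Rightarrow> 'f::real_normed_vector"
  assumes f: "C2on U f" and x: "x \<in> U"
  shows "(jet_coord f has_derivative (\<lambda>h. (h, dirderiv f x h, \<chi> \<mu>. d2 f x (axis \<mu> 1) h))) (at x)"
proof -
  have fdm: "findim TYPE(real^'m)" by (rule findim_euclidean)
  have f1: "(f has_derivative dirderiv f x) (at x)" by (rule C2on_has_derivative(1)[OF fdm f x])
  have f2: "((\<lambda>y. dirderiv f y v) has_derivative (\<lambda>h. d2 f x v h)) (at x)" for v
    by (rule C2on_dirderiv_const_has_derivative[OF fdm f x has_derivative_ident])
  show ?thesis unfolding jet_coord_def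
    by (intro has_derivative_Pair has_derivative_ident f1 has_derivative_vec_lambda f2)
qed

text \<open>The coordinate form of Noether's theorem: \<open>inv\<close> is the infinitesimal equivariance of the Lagrangian \<open>\<Lambda>\<close> under
  \<open>\<xi>\<close>, and \<open>P\<close> is the vector field whose contraction with \<open>d\<^sup>n\<^sup>+\<^sup>1x\<close> is the current; its divergence is minus the
  Euler-Lagrange expression paired with the characteristic \<open>w\<close>.\<close>

lemma divergence_identity:
  fixes f :: "real^'m::finite \<Rightarrow> 'f::real_normed_vector" and \<Lambda> :: "(real^'m) \<times> 'f \<times> ('f^'m) \<Rightarrow> real"
    and \<xi> :: "(real^'m) \<times> 'f \<Rightarrow> (real^'m) \<times> 'f"
  assumes fd: "findim TYPE('f)" and f: "C2on U f" and x: "x \<in> U"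
    and \<Lambda>: "C2on V \<Lambda>" and s: "jet_coord f x \<in> V"
    and \<xi>: "(\<xi> has_derivative \<xi>') (at (x, f x))"
    and inv: "dirderiv \<Lambda> (jet_coord f x) (fst (\<xi> (x, f x)), snd (\<xi> (x, f x)),
        \<chi> \<mu>. snd (\<xi>' (axis \<mu> 1, dirderiv f x (axis \<mu> 1))) - dirderiv f x (fst (\<xi>' (axis \<mu> 1, dirderiv f x (axis \<mu> 1)))))
      = - (\<Lambda> (jet_coord f x) * tr (\<lambda>v. fst (\<xi>' (v, dirderiv f x v))))"
  defines "w \<equiv> \<lambda>y. snd (\<xi> (y, f y)) - dirderiv f y (fst (\<xi> (y, f y)))"
  defines "P \<equiv> \<lambda>y. \<Lambda> (jet_coord f y) *\<^sub>R fst (\<xi> (y, f y)) +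
      (\<chi> \<mu>. dirderiv \<Lambda> (jet_coord f y) (0, 0, axis \<mu> (w y)))"
  obtains P' where "(P has_derivative P') (at x)"
    "tr P' = - (dirderiv \<Lambda> (jet_coord f x) (0, w x, 0) -
      (\<Sum>\<mu>\<in>UNIV. dirderiv (\<lambda>y. dirderiv \<Lambda> (jet_coord f y) (0, 0, axis \<mu> (w x))) x (axis \<mu> 1)))"
proof -
  let ?s = "jet_coord f" let ?D = "dirderiv f x" let ?L = "dirderiv \<Lambda> (?s x)"
  have fdm: "findim TYPE(real^'m)" by (rule findim_euclidean)
  have fdj: "findim TYPE((real^'m) \<times> 'f \<times> ('f^'m))" by (intro findim_prod findim_vec fd fdm)
  have f1: "(f has_derivative ?D) (at x)" by (rule C2on_has_derivative(1)[OF fdm f x])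
  have linD: "linear ?D" by (rule has_derivative_linear[OF f1])
  note s' = jet_coord_has_derivative[OF f x]
  let ?s' = "\<lambda>h. (h, ?D h, \<chi> \<mu>. d2 f x (axis \<mu> 1) h)"
  have L1: "(\<Lambda> has_derivative ?L) (at (?s x))" by (rule C2on_has_derivative(1)[OF fdj \<Lambda> s])
  have linL: "linear ?L" by (rule has_derivative_linear[OF L1])
  define \<eta> where "\<eta> y = \<xi> (y, f y)" for y
  define \<eta>' where "\<eta>' h = \<xi>' (h, ?D h)" for h
  have \<eta>: "(\<eta> has_derivative \<eta>') (at x)"
    unfolding \<eta>_def \<eta>'_def by (rule has_derivative_compose[OF has_derivative_Pair[OF has_derivative_ident f1] \<xi>])
  note \<eta>1 = has_derivative_fst[OF \<eta>] and \<eta>2 = has_derivative_snd[OF \<eta>]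
  define w' where "w' h = snd (\<eta>' h) - (d2 f x (fst (\<eta> x)) h + ?D (fst (\<eta>' h)))" for h
  have "((\<lambda>y. dirderiv f y (fst (\<eta> y))) has_derivative (\<lambda>h. d2 f x (fst (\<eta> x)) h + ?D (fst (\<eta>' h)))) (at x)"
    by (rule C2on_dirderiv_has_derivative[OF fdm f x has_derivative_ident \<eta>1])
  then have w: "(w has_derivative w') (at x)"
    unfolding w_def w'_def \<eta>_def[symmetric] by (intro has_derivative_diff \<eta>2)
  have Q: "((\<lambda>y. dirderiv \<Lambda> (?s y) (u y)) has_derivative (\<lambda>h. d2 \<Lambda> (?s x) (u x) (?s' h) + ?L (u' h))) (at x)"
    if "(u has_derivative u') (at x)" for u u'
    by (rule C2on_dirderiv_has_derivative[OF fdj \<Lambda> s s' that])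
  let ?a = "\<lambda>\<mu> v. (0::real^'m, 0::'f, axis \<mu> v :: 'f^'m)"
  have ax: "((\<lambda>y. ?a \<mu> (w y)) has_derivative (\<lambda>h. ?a \<mu> (w' h))) (at x)" for \<mu>
    by (intro has_derivative_Pair has_derivative_const bounded_linear.has_derivative[OF bounded_linear_axis] w)
  define P' where "P' h = (\<Lambda> (?s x) *\<^sub>R fst (\<eta>' h) + ?L (?s' h) *\<^sub>R fst (\<eta> x)) +
    (\<chi> \<mu>. d2 \<Lambda> (?s x) (?a \<mu> (w x)) (?s' h) + ?L (?a \<mu> (w' h)))" for h
  have "((\<lambda>y. \<Lambda> (?s y)) has_derivative (\<lambda>h. ?L (?s' h))) (at x)"
    by (rule has_derivative_compose[OF s' L1])
  then have P': "(P has_derivative P') (at x)"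
    unfolding P_def P'_def \<eta>_def[symmetric]
    by (intro has_derivative_add has_derivative_scaleR \<eta>1 has_derivative_vec_lambda Q ax)
  have EL: "dirderiv (\<lambda>y. dirderiv \<Lambda> (?s y) (?a \<mu> (w x))) x (axis \<mu> 1) = d2 \<Lambda> (?s x) (?a \<mu> (w x)) (?s' (axis \<mu> 1))" for \<mu>
    by (rule dirderiv_eq_has_derivative[OF C2on_dirderiv_const_has_derivative[OF fdj \<Lambda> s s']])
  let ?X = "fst (\<eta> x)"
  \<comment> \<open>The velocity component of the prolonged generator, formed with total derivatives
    along the section, as in \<open>inv\<close>.\<close>
  define A where "A = (\<chi> \<mu>. snd (\<eta>' (axis \<mu> 1)) - ?D (fst (\<eta>' (axis \<mu> 1))))"
  have 1: "(\<Sum>\<mu>\<in>UNIV. ?L (?s' (axis \<mu> 1)) * ?X $ \<mu>) = ?L (?s' ?X)"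
  proof -
    have lin: "linear (\<lambda>h. ?L (?s' h))"
      by (rule has_derivative_linear[OF has_derivative_compose[OF s' L1]])
    have "?L (?s' (\<Sum>\<mu>\<in>UNIV. ?X $ \<mu> *\<^sub>R axis \<mu> 1)) = (\<Sum>\<mu>\<in>UNIV. ?X $ \<mu> * ?L (?s' (axis \<mu> 1)))"
      using linear_sum[OF lin, of "\<lambda>\<mu>. ?X $ \<mu> *\<^sub>R axis \<mu> 1" UNIV] linear_cmul[OF lin] by simp
    then show ?thesis by (simp add: axis_expansion mult.commute)
  qed
  have 2: "(\<Sum>\<mu>\<in>UNIV. ?L (?a \<mu> (w' (axis \<mu> 1)))) = ?L (0, 0, A - (\<chi> \<mu>. d2 f x (axis \<mu> 1) ?X))"
  proof -
    have "(\<Sum>\<mu>\<in>UNIV. ?a \<mu> (w' (axis \<mu> 1))) = (0, 0, \<chi> \<mu>. w' (axis \<mu> 1))"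
      by (simp add: vec_eq_sum_axis sum_prod fst_sum snd_sum prod_eq_iff)
    \<comment> \<open>Second derivatives of the section commute here, so that the remaining ones
      assemble to the derivative of the jet along \<open>?X\<close>.\<close>
    moreover have "(\<chi> \<mu>. w' (axis \<mu> 1)) = A - (\<chi> \<mu>. d2 f x (axis \<mu> 1) ?X)"
      using d2_commute[OF tvs_normed f x, of ?X] by (simp add: vec_eq_iff A_def w'_def)
    ultimately show ?thesis using linear_sum[OF linL, of "\<lambda>\<mu>. ?a \<mu> (w' (axis \<mu> 1))" UNIV] by simp
  qed
  have 3: "\<Lambda> (?s x) * tr (\<lambda>v. fst (\<eta>' v)) = - ?L (?X, snd (\<eta> x), A)"
    using inv by (simp add: \<eta>_def \<eta>'_def A_def)
  have "tr P' = \<Lambda> (?s x) * tr (\<lambda>v. fst (\<eta>' v)) + (\<Sum>\<mu>\<in>UNIV. ?L (?s' (axis \<mu> 1)) * ?X $ \<mu>)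
      + ((\<Sum>\<mu>\<in>UNIV. d2 \<Lambda> (?s x) (?a \<mu> (w x)) (?s' (axis \<mu> 1))) + (\<Sum>\<mu>\<in>UNIV. ?L (?a \<mu> (w' (axis \<mu> 1)))))"
    by (simp add: tr_def P'_def sum.distrib sum_distrib_left)
  also have "\<dots> = (- ?L (?X, snd (\<eta> x), A) + ?L (?s' ?X) + ?L (0, 0, A - (\<chi> \<mu>. d2 f x (axis \<mu> 1) ?X)))
      + (\<Sum>\<mu>\<in>UNIV. d2 \<Lambda> (?s x) (?a \<mu> (w x)) (?s' (axis \<mu> 1)))"
    unfolding 1 2 3 by simp
  \<comment> \<open>The base and velocity components of the three arguments cancel; what is left is
    the vertical direction \<open>- w x\<close>.\<close>
  also have "- ?L (?X, snd (\<eta> x), A) + ?L (?s' ?X) + ?L (0, 0, A - (\<chi> \<mu>. d2 f x (axis \<mu> 1) ?X)) = - ?L (0, w x, 0)"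
  proof -
    have "- (?X, snd (\<eta> x), A) + ?s' ?X + (0, 0, A - (\<chi> \<mu>. d2 f x (axis \<mu> 1) ?X)) = - (0, w x, 0)"
      by (simp add: w_def \<eta>_def)
    then have "?L (- (?X, snd (\<eta> x), A) + ?s' ?X + (0, 0, A - (\<chi> \<mu>. d2 f x (axis \<mu> 1) ?X))) = ?L (- (0, w x, 0))"
      by (rule arg_cong)
    then show ?thesis by (simp only: linear_add[OF linL] linear_neg[OF linL])
  qed
  finally have "tr P' = - (?L (0, w x, 0) -
      (\<Sum>\<mu>\<in>UNIV. dirderiv (\<lambda>y. dirderiv \<Lambda> (?s y) (?a \<mu> (w x))) x (axis \<mu> 1)))"
    by (simp add: EL)
  with P' that show ?thesis by blast
qed

text \<open>Writing \<open>(-1)\<^sup>i vol (P, v\<^sub>0, \<dots>, v\<^sub>i\<^sub>-\<^sub>1, v\<^sub>i\<^sub>+\<^sub>1, \<dots>)\<close> as \<open>vol\<close> with the \<open>i\<close>-th entry replaced by \<open>P\<close> makes the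
  terms with second derivatives of the coordinate change \<open>\<tau>\<close> antisymmetric in two indices.\<close>

lemma extd_contracted_vol:
  fixes \<tau> :: "real^'m::finite \<Rightarrow> real^'m" and P :: "real^'m \<Rightarrow> real^'m"
  assumes \<tau>: "C2on T \<tau>" and x: "x \<in> T" and P: "(P has_derivative P') (at (\<tau> x))" and l: "length vs = CARD('m)"
    and N: "\<And>us. Suc (length us) = CARD('m) \<Longrightarrow> \<forall>\<^sub>F p in nhds x. N p us = vol (P (\<tau> p) # map (dirderiv \<tau> p) us)"
  shows "(\<Sum>i<length vs. (-1) ^ i * dirderiv (\<lambda>p. N p (take i vs @ drop (Suc i) vs)) x (vs ! i))
    = tr P' * vol (map (dirderiv \<tau> x) vs)"
proof -
  have fdm: "findim TYPE(real^'m)" by (rule findim_euclidean)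
  let ?D = "dirderiv \<tau> x" let ?M = "map ?D vs"
  have t1: "(\<tau> has_derivative ?D) (at x)" by (rule C2on_has_derivative(1)[OF fdm \<tau> x])
  have P1: "((\<lambda>p. P (\<tau> p)) has_derivative (\<lambda>h. P' (?D h))) (at x)" by (rule has_derivative_compose[OF t1 P])
  have t2: "((\<lambda>y. dirderiv \<tau> y v) has_derivative (\<lambda>h. d2 \<tau> x v h)) (at x)" for v
    by (rule C2on_dirderiv_const_has_derivative[OF fdm \<tau> x has_derivative_ident])
  define u where "u i k p = (if k = i then P (\<tau> p) else dirderiv \<tau> p (vs ! k))" for i k p
  define u' where "u' i k h = (if k = i then P' (?D h) else d2 \<tau> x (vs ! k) h)" for i k h
  have u: "(u i k has_derivative u' i k) (at x)" for i k
    by (cases "k = i") (simp_all add: u_def[abs_def] u'_def[abs_def] P1 t2)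
  have um: "map (\<lambda>k. u i k p) [0..<CARD('m)] = (map (dirderiv \<tau> p) vs)[i := P (\<tau> p)]" for i p
    by (rule nth_equalityI) (simp_all add: u_def l nth_list_update)
  have main: "(-1) ^ i * dirderiv (\<lambda>p. N p (take i vs @ drop (Suc i) vs)) x (vs ! i) =
      (\<Sum>k<CARD('m). vol (?M[i := P (\<tau> x), k := u' i k (vs ! i)]))" if i: "i < CARD('m)" for i
  proof -
    let ?us = "take i vs @ drop (Suc i) vs"
    have "\<forall>\<^sub>F p in nhds x. N p ?us = (-1) ^ i * vol ((map (dirderiv \<tau> p) vs)[i := P (\<tau> p)])"
    proof -
      have "Suc (length ?us) = CARD('m)" using i l by simp
      from N[OF this] show ?thesis
      proof eventually_elim
        case (elim p)
        have "(-1) ^ i * vol (P (\<tau> p) # take i (map (dirderiv \<tau> p) vs) @ drop (Suc i) (map (dirderiv \<tau> p) vs)) =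
            vol ((map (dirderiv \<tau> p) vs)[i := P (\<tau> p)])"
          by (rule alt_form_insert[OF vol_alt_form]) (simp add: i l)
        moreover have "(-1::real) ^ i * ((-1) ^ i * z) = z" for z
          by (simp add: power_mult_distrib[symmetric] flip: mult.assoc)
        ultimately have "vol (P (\<tau> p) # take i (map (dirderiv \<tau> p) vs) @ drop (Suc i) (map (dirderiv \<tau> p) vs)) =
            (-1) ^ i * vol ((map (dirderiv \<tau> p) vs)[i := P (\<tau> p)])" by metis
        with elim show ?case by (simp add: take_map drop_map)
      qed
    qed
    then have "dirderiv (\<lambda>p. N p ?us) x (vs ! i) =
        dirderiv (\<lambda>p. (-1) ^ i * vol ((map (dirderiv \<tau> p) vs)[i := P (\<tau> p)])) x (vs ! i)"
      by (rule dirderiv_cong_ev[OF tvs_normed])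
    also have "\<dots> = (-1) ^ i * (\<Sum>k<CARD('m). vol (?M[i := P (\<tau> x), k := u' i k (vs ! i)]))"
    proof (rule dirderiv_eq_has_derivative)
      show "((\<lambda>p. (-1) ^ i * vol ((map (dirderiv \<tau> p) vs)[i := P (\<tau> p)])) has_derivative
          (\<lambda>h. (-1) ^ i * (\<Sum>k<CARD('m). vol (?M[i := P (\<tau> x), k := u' i k h])))) (at x)"
        using alt_form_has_derivative[where u = "u i" and u' = "u' i", OF fdm vol_alt_form u] unfolding um
        by (rule has_derivative_mult_right)
    qed
    finally show ?thesis by (simp add: power_mult_distrib[symmetric] flip: mult.assoc)
  qed
  \<comment> \<open>The off-diagonal terms: slot \<open>i\<close> holds the current and slot
    \<open>k\<close> a second derivative of \<open>\<tau>\<close>. The diagonal terms carry the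
    derivative of the current and make up the divergence.\<close>
  define S where "S i k = (if k = i then 0 else vol (?M[i := P (\<tau> x), k := d2 \<tau> x (vs ! k) (vs ! i)]))" for i k
  have anti: "S k i = - S i k" if "i < CARD('m)" "k < CARD('m)" for i k
  proof (cases "k = i")
    case False
    have "d2 \<tau> x (vs ! i) (vs ! k) = d2 \<tau> x (vs ! k) (vs ! i)" by (rule d2_commute[OF tvs_normed \<tau> x])
    then have "S k i = vol (?M[k := P (\<tau> x), i := d2 \<tau> x (vs ! k) (vs ! i)])" using False[symmetric] by (simp only: S_def if_False)
    also have "\<dots> = - vol (?M[k := d2 \<tau> x (vs ! k) (vs ! i), i := P (\<tau> x)])"
      by (rule alt_form_swap[OF vol_alt_form]) (use False that l in simp_all)
    also have "?M[k := d2 \<tau> x (vs ! k) (vs ! i), i := P (\<tau> x)] = ?M[i := P (\<tau> x), k := d2 \<tau> x (vs ! k) (vs ! i)]"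
      by (rule list_update_swap[OF False])
    also have "vol \<dots> = S i k" by (simp only: S_def False if_False)
    finally show ?thesis .
  qed (simp add: S_def)
  have "(\<Sum>i<CARD('m). \<Sum>k<CARD('m). S i k) = (\<Sum>k<CARD('m). \<Sum>i<CARD('m). S i k)" by (rule sum.swap)
  also have "\<dots> = - (\<Sum>k<CARD('m). \<Sum>i<CARD('m). S k i)"
    unfolding sum_negf[symmetric] by (intro sum.cong refl anti) simp_all
  finally have S0: "(\<Sum>i<CARD('m). \<Sum>k<CARD('m). S i k) = 0" by simp
  have "(\<Sum>i<length vs. (-1) ^ i * dirderiv (\<lambda>p. N p (take i vs @ drop (Suc i) vs)) x (vs ! i)) =
      (\<Sum>i<CARD('m). \<Sum>k<CARD('m). vol (?M[i := P (\<tau> x), k := u' i k (vs ! i)]))"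
    unfolding l by (intro sum.cong refl main) simp
  also have "\<dots> = (\<Sum>i<CARD('m). \<Sum>k<CARD('m). (if k = i then vol (?M[i := P' (?M ! i)]) else 0) + S i k)"
    by (intro sum.cong refl) (auto simp: S_def u'_def l)
  also have "\<dots> = (\<Sum>i<CARD('m). vol (?M[i := P' (?M ! i)]))"
    using S0 by (simp add: sum.distrib)
  also have "\<dots> = tr P' * vol ?M"
    by (rule vol_trace[OF has_derivative_linear[OF P]]) (simp add: l)
  finally show ?thesis .
qed

section \<open>Jets and the Legendre transformation in fibered coordinates\<close>

lemma has_dirderiv_vector_0:
  fixes f :: "'a::real_vector \<Rightarrow> 'b::real_normed_vector"
  assumes "has_dirderiv f x v l"
  shows "((\<lambda>s::real. f (x + s *\<^sub>R v)) has_vector_derivative l) (at 0)"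
  by (rule has_dirderiv_vector) (simp add: assms)

definition vlin :: "('f::real_vector)^'m::finite \<Rightarrow> real^'m \<Rightarrow> 'f" where
  "vlin v a = (\<Sum>\<mu>\<in>UNIV. a $ \<mu> *\<^sub>R v $ \<mu>)"

lemma linear_vlin: "linear (vlin v)"
  by (rule linearI) (simp_all add: vlin_def scaleR_add_left sum.distrib scaleR_sum_right)

lemma vlin_axis: "vlin v (axis \<mu> 1) = v $ \<mu>"
proof -
  have "vlin v (axis \<mu> 1) = (\<Sum>\<nu>\<in>UNIV. if \<nu> = \<mu> then v $ \<nu> else 0)"
    unfolding vlin_def by (rule sum.cong) (simp_all add: axis_def)
  then show ?thesis by simp
qed

lemma vlin_eq:
  fixes f :: "real^'m::finite \<Rightarrow> 'f::real_vector"
  assumes f: "linear f" shows "vlin (\<chi> \<mu>. f (axis \<mu> 1)) = f"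
proof
  fix a :: "real^'m"
  have "f a = f (\<Sum>\<mu>\<in>UNIV. a $ \<mu> *\<^sub>R axis \<mu> 1)" by (simp add: axis_expansion)
  also have "\<dots> = (\<Sum>\<mu>\<in>UNIV. a $ \<mu> *\<^sub>R f (axis \<mu> 1))"
    using linear_sum[OF f, of "\<lambda>\<mu>. a $ \<mu> *\<^sub>R axis \<mu> 1" UNIV] linear_cmul[OF f] by simp
  finally show "vlin (\<chi> \<mu>. f (axis \<mu> 1)) a = f a" by (simp add: vlin_def)
qed

lemma alt_form_frame:
  assumes "\<omega> \<in> alt_form CARD('m)" "linear K" "\<And>v. K (K' v) = v"
  shows "\<omega> vs = \<omega> (map K axes) * vol (map K' vs :: (real^'m::finite) list)"
proof -
  have "\<omega> vs = pull K \<omega> (map K' vs)" using assms(3) by (simp add: pull_def o_def)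
  also have "\<dots> = pull K \<omega> axes * vol (map K' vs)" by (rule top_form_eq[OF alt_form_pull[OF assms(1,2)]])
  finally show ?thesis by (simp add: pull_def)
qed

text \<open>Local triviality is condensed into the existence of fibered charts, the form in which
  the coordinate computations use it.\<close>

locale fibred =
  fixes X :: "('x, real^'m::finite) atlas" and Y :: "('y, (real^'m) \<times> 'f::real_normed_vector) atlas" and \<pi> :: "'y \<Rightarrow> 'x"
  assumes X: "smooth_atlas X" and Y: "smooth_atlas Y" and fdf: "findim TYPE('f)"
    and fib: "\<And>y. y \<in> mpoints Y \<Longrightarrow> \<exists>c \<psi>. (c, \<psi>) \<in> fib_charts X Y \<pi> \<and> y \<in> fst \<psi>"
begin

lemma fdm: "findim TYPE(real^'m)" by (rule findim_euclidean)
lemma fdE: "findim TYPE((real^'m) \<times> 'f)" by (rule findim_prod[OF fdm fdf])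
lemma fdj: "findim TYPE((real^'m) \<times> 'f \<times> ('f^'m))" by (intro findim_prod findim_vec fdf fdm)

lemma fib_chartsD:
  assumes "(c, \<psi>) \<in> fib_charts X Y \<pi>"
  shows "c \<in> max_atlas X" "\<psi> \<in> max_atlas Y" "y \<in> fst \<psi> \<Longrightarrow> \<pi> y \<in> fst c"
    "y \<in> fst \<psi> \<Longrightarrow> fst (snd \<psi> y) = snd c (\<pi> y)" "y \<in> fst \<psi> \<Longrightarrow> y \<in> mpoints Y"
proof -
  have *: "c \<in> max_atlas X \<and> \<psi> \<in> max_atlas Y \<and> \<pi> ` fst \<psi> \<subseteq> fst c \<and> (\<forall>y\<in>fst \<psi>. fst (snd \<psi> y) = snd c (\<pi> y))"
    using assms unfolding fib_charts_def by simp
  show "c \<in> max_atlas X" "\<psi> \<in> max_atlas Y" using * by simp_all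
  show "\<pi> y \<in> fst c" if "y \<in> fst \<psi>" using * that by blast
  show "fst (snd \<psi> y) = snd c (\<pi> y)" if "y \<in> fst \<psi>" using * that by blast
  show "y \<in> mpoints Y" if "y \<in> fst \<psi>" using max_atlasD(3)[of \<psi> Y] * that by blast
qed

lemma fib_inj: "(c, \<psi>) \<in> fib_charts X Y \<pi> \<Longrightarrow> y \<in> fst \<psi> \<Longrightarrow> cinv \<psi> (snd \<psi> y) = y"
  by (rule cinv_chart[OF max_atlasD(1)[OF fib_chartsD(2)]])

text \<open>In fibered charts the projection is represented by \<open>fst\<close>, so verticality
  and the jet condition become conditions on \<open>fst\<close> of the coframe components.\<close>

lemma tmap_proj:
  assumes k: "(c, \<psi>) \<in> fib_charts X Y \<pi>" and y: "y \<in> fst \<psi>"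
  shows "tmap Y X \<pi> y = (\<lambda>v. frame X c (\<pi> y) (fst (coframe Y \<psi> y v)))"
proof -
  note D = fib_chartsD[OF k]
  have ev: "\<forall>\<^sub>F q in nhds (snd \<psi> y). q \<in> snd \<psi> ` fst \<psi>"
    using y by (intro eventually_nhds_in_open max_atlasD(2)[OF D(2)] imageI)
  show ?thesis
  proof (rule tmap_coord[where f = \<pi>, OF fdE fdm Y X D(2) y D(1) D(3)[OF y]])
    have "\<forall>\<^sub>F q in nhds (snd \<psi> y). fst q = (snd c \<circ> \<pi> \<circ> cinv \<psi>) q"
      using ev
    proof eventually_elim
      case (elim q)
      with D(4)[OF chart_cinv(2)[OF elim]] show ?case by (simp add: chart_cinv(1))
    qed
    then show "((snd c \<circ> \<pi> \<circ> cinv \<psi>) has_derivative fst) (at (snd \<psi> y))"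
      by (rule has_derivative_cong_nhds[rotated]) (rule bounded_linear_imp_has_derivative[OF bounded_linear_fst])
    show "\<forall>\<^sub>F q in nhds (snd \<psi> y). \<pi> (cinv \<psi> q) \<in> fst c"
      using ev by eventually_elim (rule D(3)[OF chart_cinv(2)])
  qed
qed

section \<open>Jet coordinates\<close>

context
  fixes c \<psi> assumes k: "(c, \<psi>) \<in> fib_charts X Y \<pi>"
begin

lemmas D = fib_chartsD[OF k]

lemma frX: assumes "y \<in> fst \<psi>"
  shows "linear (frame X c (\<pi> y))" "linear (coframe X c (\<pi> y))"
    "coframe X c (\<pi> y) (frame X c (\<pi> y) u) = u" "frame X c (\<pi> y) (coframe X c (\<pi> y) u) = u"
  using frame_linear[OF fdm X D(1) D(3)[OF assms]] coframe_linear[OF fdm X D(1) D(3)[OF assms]]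
    coframe_frame[OF fdm X D(1) D(3)[OF assms]] frame_coframe[OF fdm X D(1) D(3)[OF assms]] by simp_all

lemma frY: assumes "y \<in> fst \<psi>"
  shows "linear (frame Y \<psi> y)" "linear (coframe Y \<psi> y)"
    "coframe Y \<psi> y (frame Y \<psi> y v) = v" "frame Y \<psi> y (coframe Y \<psi> y v) = v"
  using frame_linear[OF fdE Y D(2) assms] coframe_linear[OF fdE Y D(2) assms]
    coframe_frame[OF fdE Y D(2) assms] frame_coframe[OF fdE Y D(2) assms] by simp_all

lemma vertical_iff: "y \<in> fst \<psi> \<Longrightarrow> v \<in> vertical X Y \<pi> y \<longleftrightarrow> fst (coframe Y \<psi> y v) = 0"
  unfolding vertical_def tmap_proj[OF k] mem_Collect_eq
  using frX(3) linear_0[OF frX(1)] by metis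

lemma jets_iff:
  assumes y: "y \<in> fst \<psi>"
  shows "(y, \<gamma>) \<in> jets X Y \<pi> \<longleftrightarrow> linear \<gamma> \<and> (\<forall>u. fst (coframe Y \<psi> y (\<gamma> u)) = coframe X c (\<pi> y) u)"
proof -
  have "tmap Y X \<pi> y \<circ> \<gamma> = id \<longleftrightarrow> (\<forall>u. frame X c (\<pi> y) (fst (coframe Y \<psi> y (\<gamma> u))) = u)"
    unfolding tmap_proj[OF k y] by (simp add: fun_eq_iff)
  also have "\<dots> \<longleftrightarrow> (\<forall>u. fst (coframe Y \<psi> y (\<gamma> u)) = coframe X c (\<pi> y) u)"
    using frX(3,4)[OF y] by metis
  finally show ?thesis using D(5)[OF y] by (simp add: jets_def)
qed

text \<open>The image of the jet chart: a condition on base and fiber coordinates, none on the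
  velocities.\<close>

definition "jdom = {q :: (real^'m) \<times> 'f \<times> ('f^'m). (fst q, fst (snd q)) \<in> snd \<psi> ` fst \<psi>}"

definition "jc = snd (jet_chart X Y \<pi> (c, \<psi>))"

text \<open>An explicit inverse of the jet chart on \<open>jdom\<close>; \<open>cinv\<close>, being
  an \<open>inv_into\<close>, gives no formula.\<close>

definition "mkjet q = (let y = cinv \<psi> (fst q, fst (snd q)) in
  (y, \<lambda>u. frame Y \<psi> y (coframe X c (\<pi> y) u, vlin (snd (snd q)) (coframe X c (\<pi> y) u))))"

lemma jc_eq: "jc (y, \<gamma>) = (fst (snd \<psi> y), snd (snd \<psi> y), \<chi> \<mu>. snd (coframe Y \<psi> y (\<gamma> (frame X c (\<pi> y) (axis \<mu> 1)))))"
  by (simp add: jc_def jet_chart_def coframe_def frame_def)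

lemma fst_jet_chart: "j \<in> fst (jet_chart X Y \<pi> (c, \<psi>)) \<longleftrightarrow> j \<in> jets X Y \<pi> \<and> fst j \<in> fst \<psi>"
  by (cases j) (simp add: jet_chart_def)

lemma mkjet_in: "q \<in> jdom \<Longrightarrow> mkjet q \<in> jets X Y \<pi> \<and> fst (mkjet q) \<in> fst \<psi> \<and> snd \<psi> (fst (mkjet q)) = (fst q, fst (snd q))"
  and jc_mkjet: "q \<in> jdom \<Longrightarrow> jc (mkjet q) = q"
proof -
  assume q: "q \<in> jdom"
  define y where "y = cinv \<psi> (fst q, fst (snd q))"
  have y: "y \<in> fst \<psi>" "snd \<psi> y = (fst q, fst (snd q))"
    using q chart_cinv[of "(fst q, fst (snd q))" \<psi>] by (simp_all add: jdom_def y_def)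
  have m: "mkjet q = (y, \<lambda>u. frame Y \<psi> y (coframe X c (\<pi> y) u, vlin (snd (snd q)) (coframe X c (\<pi> y) u)))"
    by (simp add: mkjet_def y_def Let_def)
  have "linear (\<lambda>u. (coframe X c (\<pi> y) u, vlin (snd (snd q)) (coframe X c (\<pi> y) u)))"
    by (rule linearI) (simp_all add: linear_add[OF frX(2)[OF y(1)]] linear_cmul[OF frX(2)[OF y(1)]] linear_add[OF linear_vlin] linear_cmul[OF linear_vlin])
  from linear_compose[OF this frY(1)[OF y(1)]]
  have "linear (\<lambda>u. frame Y \<psi> y (coframe X c (\<pi> y) u, vlin (snd (snd q)) (coframe X c (\<pi> y) u)))" by (simp add: o_def)
  then show "mkjet q \<in> jets X Y \<pi> \<and> fst (mkjet q) \<in> fst \<psi> \<and> snd \<psi> (fst (mkjet q)) = (fst q, fst (snd q))"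
    unfolding m using jets_iff[OF y(1)] y by (simp add: frY(3)[OF y(1)])
  show "jc (mkjet q) = q"
    unfolding m jc_eq y(2) by (simp add: frY(3)[OF y(1)] frX(3)[OF y(1)] vlin_axis)
qed

lemma jc_in: "y \<in> fst \<psi> \<Longrightarrow> jc (y, \<gamma>) \<in> jdom"
  unfolding jdom_def jc_eq by simp

text \<open>A jet is the graph of its velocity matrix once both tangent spaces are written in the
  frames of the fibered chart.\<close>

lemma jet_eq:
  assumes j: "(y, \<gamma>) \<in> jets X Y \<pi>" and y: "y \<in> fst \<psi>"
  shows "\<gamma> u = frame Y \<psi> y (coframe X c (\<pi> y) u, vlin (snd (snd (jc (y, \<gamma>)))) (coframe X c (\<pi> y) u))"
proof -
  have \<gamma>: "linear \<gamma>" "\<And>u. fst (coframe Y \<psi> y (\<gamma> u)) = coframe X c (\<pi> y) u"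
    using j jets_iff[OF y] by simp_all
  let ?f = "\<lambda>a. snd (coframe Y \<psi> y (\<gamma> (frame X c (\<pi> y) a)))"
  have lin: "linear ?f"
    by (rule linearI) (simp_all add: linear_add[OF \<gamma>(1)] linear_cmul[OF \<gamma>(1)] linear_add[OF frX(1)[OF y]] linear_cmul[OF frX(1)[OF y]]
        linear_add[OF frY(2)[OF y]] linear_cmul[OF frY(2)[OF y]])
  have vl: "vlin (snd (snd (jc (y, \<gamma>)))) a = ?f a" for a
    by (simp only: jc_eq snd_conv vlin_eq[OF lin])
  have "(coframe X c (\<pi> y) u, vlin (snd (snd (jc (y, \<gamma>)))) (coframe X c (\<pi> y) u)) = coframe Y \<psi> y (\<gamma> u)"
    by (simp only: vl frX(4)[OF y] prod_eq_iff \<gamma>(2) fst_conv snd_conv)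
  then show ?thesis by (simp add: frY(4)[OF y])
qed

lemma mkjet_jc:
  assumes j: "j \<in> jets X Y \<pi>" and y: "fst j \<in> fst \<psi>"
  shows "mkjet (jc j) = j"
proof -
  obtain y \<gamma> where jy: "j = (y, \<gamma>)" by (cases j)
  have "(fst (jc (y, \<gamma>)), fst (snd (jc (y, \<gamma>)))) = snd \<psi> y" by (simp add: jc_eq)
  then have "cinv \<psi> (fst (jc (y, \<gamma>)), fst (snd (jc (y, \<gamma>)))) = y" using fib_inj[OF k, of y] y jy by simp
  then show ?thesis using jet_eq[of y \<gamma>] j y unfolding jy mkjet_def Let_def by auto
qed

lemma inj_jet_chart: "inj_on (snd (jet_chart X Y \<pi> (c, \<psi>))) (fst (jet_chart X Y \<pi> (c, \<psi>)))"
  by (rule inj_on_inverseI[where g = mkjet]) (use mkjet_jc fst_jet_chart jc_def in auto)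

lemma cinv_jet_chart: "q \<in> jdom \<Longrightarrow> cinv (jet_chart X Y \<pi> (c, \<psi>)) q = mkjet q"
  unfolding cinv_def by (rule inv_into_f_eq[OF inj_jet_chart]) (simp_all add: fst_jet_chart mkjet_in jc_mkjet jc_def[symmetric])

end

end

section \<open>The Lagrangian and its momenta\<close>

locale lagrangian = fibred X Y \<pi>
  for X :: "('x, real^'m::finite) atlas" and Y :: "('y, (real^'m) \<times> 'f::real_normed_vector) atlas" and \<pi> :: "'y \<Rightarrow> 'x" +
  fixes L :: "('m, 'y, 'f) jet \<Rightarrow> (real^'m) list \<Rightarrow> real"
  assumes L: "lagrangian_density X Y \<pi> L"
begin

lemma L_alt_form: assumes "j \<in> jets X Y \<pi>" shows "L j \<in> alt_form CARD('m)"
proof -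
  have "(\<lambda>j. (\<pi> (fst j), L j)) ` jets X Y \<pi> \<subseteq> mpoints (top_atlas X)"
    using L unfolding lagrangian_density_def smooth_map_on_def by blast
  with assms have "(\<pi> (fst j), L j) \<in> mpoints (top_atlas X)" by blast
  then show ?thesis unfolding mpoints_def top_atlas_def top_chart_def by auto
qed

context
  fixes c \<psi> assumes k: "(c, \<psi>) \<in> fib_charts X Y \<pi>"
begin

definition "Lc = lagrangian_coord X Y \<pi> L (c, \<psi>)"

lemma Lc_jc:
  assumes j: "(y, \<gamma>) \<in> jets X Y \<pi>" and y: "y \<in> fst \<psi>"
  shows "Lc (jc c \<psi> (y, \<gamma>)) = L (y, \<gamma>) (map (frame X c (\<pi> y)) axes)"
    and "L (y, \<gamma>) vs = Lc (jc c \<psi> (y, \<gamma>)) * vol (map (coframe X c (\<pi> y)) vs)"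
proof -
  have "cinv (jet_chart X Y \<pi> (c, \<psi>)) (jc c \<psi> (y, \<gamma>)) = (y, \<gamma>)"
    using cinv_jet_chart[OF k jc_in[OF k y]] mkjet_jc[OF k, of "(y, \<gamma>)"] j y by simp
  then show *: "Lc (jc c \<psi> (y, \<gamma>)) = L (y, \<gamma>) (map (frame X c (\<pi> y)) axes)"
    by (simp add: Lc_def lagrangian_coord_def Let_def top_chart_def axes_def frame_def o_def)
  show "L (y, \<gamma>) vs = Lc (jc c \<psi> (y, \<gamma>)) * vol (map (coframe X c (\<pi> y)) vs)"
    unfolding * by (rule alt_form_frame[OF L_alt_form[OF j] frX(1)[OF k y] frX(4)[OF k y]])
qed

lemma C2_Lc: "C2on (jdom \<psi>) Lc"
proof -
  let ?J = "jet_chart X Y \<pi> (c, \<psi>)" and ?T = "top_chart X c" let ?F = "\<lambda>j. (\<pi> (fst j), L j)"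
  have "?J \<in> jet_atlas X Y \<pi>" unfolding jet_atlas_def using k by (rule imageI)
  moreover have "?T \<in> top_atlas X" unfolding top_atlas_def by (rule imageI[OF fib_chartsD(1)[OF k]])
  ultimately have s: "smooth_on (snd ?J ` (fst ?J \<inter> jets X Y \<pi> \<inter> ?F -` fst ?T)) (snd ?T \<circ> ?F \<circ> cinv ?J)"
    using L unfolding lagrangian_density_def smooth_map_on_def by blast
  have "j \<in> fst ?J \<inter> jets X Y \<pi> \<inter> ?F -` fst ?T \<longleftrightarrow> j \<in> jets X Y \<pi> \<and> fst j \<in> fst \<psi>" for j
    using fst_jet_chart[OF k, of j] fib_chartsD(3)[OF k, of "fst j"] L_alt_form[of j] by (auto simp: top_chart_def)
  then have "fst ?J \<inter> jets X Y \<pi> \<inter> ?F -` fst ?T = {j \<in> jets X Y \<pi>. fst j \<in> fst \<psi>}" by blast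
  moreover have "snd ?J ` {j \<in> jets X Y \<pi>. fst j \<in> fst \<psi>} = jdom \<psi>"
  proof (intro equalityI subsetI)
    fix q assume "q \<in> snd ?J ` {j \<in> jets X Y \<pi>. fst j \<in> fst \<psi>}"
    then obtain j where "fst j \<in> fst \<psi>" "q = jc c \<psi> j" using jc_def[OF k] by auto
    then show "q \<in> jdom \<psi>" using jc_in[OF k, of "fst j" "snd j"] by simp
  next
    fix q assume "q \<in> jdom \<psi>"
    from mkjet_in[OF k this] jc_mkjet[OF k this] show "q \<in> snd ?J ` {j \<in> jets X Y \<pi>. fst j \<in> fst \<psi>}"
      unfolding jc_def[OF k] by (intro image_eqI[of _ _ "mkjet c \<psi> q"]) simp_all
  qed
  ultimately have "smooth_on (jdom \<psi>) (snd ?T \<circ> ?F \<circ> cinv ?J)" using s by simp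
  then have 1: "C2on (jdom \<psi>) (snd ?T \<circ> ?F \<circ> cinv ?J)" by (rule smooth_on_C2on[OF tvs_normed])
  have 2: "C2on UNIV (snd :: (real^'m) \<times> real \<Rightarrow> real)"
    by (rule C2on_linear[OF tvs_normed linear_snd' continuous_on_snd_UNIV open_UNIV])
  have "C2on (jdom \<psi>) (\<lambda>q. snd ((snd ?T \<circ> ?F \<circ> cinv ?J) q))"
    by (rule C2on_compose[OF tvs_normed tvs_normed 2 1]) simp
  moreover have "(\<lambda>q. snd ((snd ?T \<circ> ?F \<circ> cinv ?J) q)) = Lc"
    by (simp add: fun_eq_iff Lc_def lagrangian_coord_def Let_def)
  ultimately show ?thesis by simp
qed

text \<open>The momenta \<open>p\<^sub>A\<^sup>\<mu> = \<partial>L/\<partial>v\<^sup>A\<^sub>\<mu>\<close> and \<open>p = L - v\<^sup>A\<^sub>\<mu> \<partial>L/\<partial>v\<^sup>A\<^sub>\<mu>\<close>.\<close>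

definition "PL q b = (\<chi> \<mu>. dirderiv Lc q (0, 0, axis \<mu> b))"
definition "pL q = Lc q - dirderiv Lc q (0, 0, snd (snd q))"

lemma linear_DL: "q \<in> jdom \<psi> \<Longrightarrow> linear (dirderiv Lc q)"
  using C2on_has_derivative(1)[OF fdj C2_Lc] has_derivative_linear by blast

lemma linear_axis: "linear (axis \<mu> :: 'f \<Rightarrow> 'f^'m)"
  by (rule linearI) (simp_all add: vec_eq_iff axis_def)

lemma linear_PL: assumes q: "q \<in> jdom \<psi>" shows "linear (PL q)"
proof -
  have l: "linear (\<lambda>b. (0::real^'m, 0::'f, axis \<mu> b :: 'f^'m))" for \<mu>
    by (rule linearI) (simp_all add: linear_add[OF linear_axis] linear_cmul[OF linear_axis])
  show ?thesis unfolding PL_def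
    by (rule linearI) (simp_all only: vec_eq_iff linear_add[OF l] linear_cmul[OF l] linear_add[OF linear_DL[OF q]]
        linear_cmul[OF linear_DL[OF q]] vec_lambda_beta vector_add_component vector_scaleR_component, simp_all)
qed

lemma tr_PL:
  assumes q: "q \<in> jdom \<psi>"
  shows "(\<Sum>\<mu>\<in>UNIV. PL q (v $ \<mu>) $ \<mu>) = dirderiv Lc q (0, 0, v)"
    and "tr (\<lambda>a. PL q (vlin v a)) = dirderiv Lc q (0, 0, v)"
proof -
  have "(\<Sum>\<mu>\<in>UNIV. (0::real^'m, 0::'f, axis \<mu> (v $ \<mu>))) = (0, 0, v)"
    by (simp add: prod_eq_iff fst_sum snd_sum vec_eq_iff axis_def if_distrib sum.delta cong: if_cong)
  then show *: "(\<Sum>\<mu>\<in>UNIV. PL q (v $ \<mu>) $ \<mu>) = dirderiv Lc q (0, 0, v)"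
    using linear_sum[OF linear_DL[OF q], of "\<lambda>\<mu>. (0, 0, axis \<mu> (v $ \<mu>))" UNIV] by (simp add: PL_def)
  then show "tr (\<lambda>a. PL q (vlin v a)) = dirderiv Lc q (0, 0, v)" by (simp add: tr_def vlin_axis)
qed

lemma mom_points_iff:
  assumes y: "y \<in> fst \<psi>"
  shows "(y, z) \<in> mom_points X Y \<pi> \<longleftrightarrow> z \<in> alt_form CARD('m) \<and>
    (\<forall>b b' us. pull (frame Y \<psi> y) z ((0, b) # (0, b') # us) = 0)"
proof -
  have V: "v \<in> vertical X Y \<pi> y \<longleftrightarrow> (\<exists>b. v = frame Y \<psi> y (0, b))" for v
    unfolding vertical_iff[OF k y] using frY(3,4)[OF k y] by (metis fst_conv prod.collapse)
  have "(\<forall>v \<in> vertical X Y \<pi> y. \<forall>w \<in> vertical X Y \<pi> y. iprod v (iprod w z) = (\<lambda>_. 0)) \<longleftrightarrow>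
      (\<forall>b' b. iprod (frame Y \<psi> y (0, b')) (iprod (frame Y \<psi> y (0, b)) z) = (\<lambda>_. 0))"
    unfolding Ball_def V by blast
  also have "\<dots> \<longleftrightarrow> (\<forall>b' b vs. z (frame Y \<psi> y (0, b) # frame Y \<psi> y (0, b') # vs) = 0)"
    by (simp add: iprod_def fun_eq_iff)
  also have "\<dots> \<longleftrightarrow> (\<forall>b b' us. pull (frame Y \<psi> y) z ((0, b) # (0, b') # us) = 0)"
  proof safe
    fix b b' us assume *: "\<forall>b' b vs. z (frame Y \<psi> y (0, b) # frame Y \<psi> y (0, b') # vs) = 0"
    then show "pull (frame Y \<psi> y) z ((0, b) # (0, b') # us) = 0" by (simp add: pull_def)
  next
    fix b' b vs assume *: "\<forall>b b' us. pull (frame Y \<psi> y) z ((0, b) # (0, b') # us) = 0"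
    have "pull (frame Y \<psi> y) z ((0, b) # (0, b') # map (coframe Y \<psi> y) vs) = 0" using * by blast
    then show "z (frame Y \<psi> y (0, b) # frame Y \<psi> y (0, b') # vs) = 0"
      by (simp add: pull_def o_def frY(4)[OF k y])
  qed
  finally show ?thesis using fib_chartsD(5)[OF k y] by (simp add: mom_points_def)
qed

lemma mkmom_in:
  assumes y: "y \<in> fst \<psi>" and P: "linear P"
  shows "(y, pull (coframe Y \<psi> y) (zform p P)) \<in> mom_points X Y \<pi>"
    and "pull (frame Y \<psi> y) (pull (coframe Y \<psi> y) (zform p P)) = zform p P"
proof -
  show *: "pull (frame Y \<psi> y) (pull (coframe Y \<psi> y) (zform p P)) = zform p P"
    by (simp add: pull_def fun_eq_iff o_def frY(3)[OF k y])
  show "(y, pull (coframe Y \<psi> y) (zform p P)) \<in> mom_points X Y \<pi>"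
    unfolding mom_points_iff[OF y] * using alt_form_pull[OF zform_alt_form[OF P] frY(2)[OF k y]]
    by (simp add: zform_semibasic)
qed

lemma mom_zform:
  assumes y: "y \<in> fst \<psi>" and z: "(y, z) \<in> mom_points X Y \<pi>"
  defines "z' \<equiv> pull (frame Y \<psi> y) z"
  shows "linear (\<lambda>b. \<chi> \<mu>. zmom z' b \<mu>)" "z' = zform (zbase z') (\<lambda>b. \<chi> \<mu>. zmom z' b \<mu>)"
    "z = pull (coframe Y \<psi> y) z'"
proof -
  have a: "z' \<in> alt_form CARD('m)" "\<And>b b' us. z' ((0, b) # (0, b') # us) = 0"
    using z alt_form_pull[OF _ frY(1)[OF k y]] unfolding mom_points_iff[OF y] z'_def by blast+
  show "linear (\<lambda>b. \<chi> \<mu>. zmom z' b \<mu>)" "z' = zform (zbase z') (\<lambda>b. \<chi> \<mu>. zmom z' b \<mu>)"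
    by (rule zform_representation[OF a])+
  show "z = pull (coframe Y \<psi> y) z'" by (simp add: z'_def pull_def fun_eq_iff o_def frY(4)[OF k y])
qed

text \<open>Both sides of the defining condition are multiples of the volume form that are affine in
  the velocity matrix of \<open>\<gamma>'\<close>. Matching coefficients gives the momenta, and
  \<open>zform_eq_on_graphs\<close> provides the uniqueness that \<open>THE\<close> asks
  for.\<close>

lemma legendre_coord:
  assumes j: "(y, \<gamma>) \<in> jets X Y \<pi>" and y: "y \<in> fst \<psi>"
  shows "legendre X Y \<pi> L (y, \<gamma>) = (y, pull (coframe Y \<psi> y) (zform (pL (jc c \<psi> (y, \<gamma>))) (PL (jc c \<psi> (y, \<gamma>)))))"
proof -
  define q where "q = jc c \<psi> (y, \<gamma>)"
  have q: "q \<in> jdom \<psi>" unfolding q_def by (rule jc_in[OF k y])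
  note lP = linear_PL[OF q]
  let ?R = "\<lambda>\<gamma>' vs. L (y, \<gamma>) vs + deriv (\<lambda>\<epsilon>. L (y, \<lambda>u. \<gamma> u + \<epsilon> *\<^sub>R (\<gamma>' u - \<gamma> u)) vs) 0"
  have R: "?R \<gamma>' vs = (Lc q + dirderiv Lc q (0, 0, snd (snd (jc c \<psi> (y, \<gamma>'))) - snd (snd q))) * vol (map (coframe X c (\<pi> y)) vs)"
    if j': "(y, \<gamma>') \<in> jets X Y \<pi>" for \<gamma>' vs
  proof -
    define q' where "q' = jc c \<psi> (y, \<gamma>')"
    let ?d = "(0, 0, snd (snd q') - snd (snd q)) :: (real^'m) \<times> 'f \<times> ('f^'m)"
    let ?g = "\<lambda>\<epsilon> u. \<gamma> u + \<epsilon> *\<^sub>R (\<gamma>' u - \<gamma> u)"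
    have l: "linear \<gamma>" "linear \<gamma>'" and f: "\<And>u. fst (coframe Y \<psi> y (\<gamma> u)) = coframe X c (\<pi> y) u"
      "\<And>u. fst (coframe Y \<psi> y (\<gamma>' u)) = coframe X c (\<pi> y) u"
      using j j' unfolding jets_iff[OF k y] by blast+
    note lc = linear_add[OF frY(2)[OF k y]] linear_cmul[OF frY(2)[OF k y]] linear_diff[OF frY(2)[OF k y]]
    have je: "(y, ?g \<epsilon>) \<in> jets X Y \<pi>" for \<epsilon>
      unfolding jets_iff[OF k y]
    proof
      show "linear (?g \<epsilon>)"
        by (rule linearI) (simp_all add: linear_add[OF l(1)] linear_add[OF l(2)] linear_cmul[OF l(1)] linear_cmul[OF l(2)] algebra_simps)
      show "\<forall>u. fst (coframe Y \<psi> y (?g \<epsilon> u)) = coframe X c (\<pi> y) u" by (simp add: lc f)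
    qed
    \<comment> \<open>The line of jets through \<open>\<gamma>\<close> and \<open>\<gamma>'\<close>
      is straight in the jet chart, so the derivative along it is a directional derivative of
      \<open>Lc\<close>.\<close>
    have qe: "jc c \<psi> (y, ?g \<epsilon>) = q + \<epsilon> *\<^sub>R ?d" for \<epsilon>
      unfolding q_def q'_def jc_eq[OF k] by (simp add: lc vec_eq_iff)
    have "BC1 (jdom \<psi>) Lc" using C2_Lc unfolding C2on_def by (rule conjunct1)
    from has_dirderiv_vector_0[OF BC1_dirderiv[OF this q, of ?d]]
    have "((\<lambda>\<epsilon>. Lc (q + \<epsilon> *\<^sub>R ?d)) has_vector_derivative dirderiv Lc q ?d) (at 0)" .
    then have "((\<lambda>\<epsilon>. Lc (q + \<epsilon> *\<^sub>R ?d)) has_field_derivative dirderiv Lc q ?d) (at 0)"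
      by (simp add: has_real_derivative_iff_has_vector_derivative)
    then have "((\<lambda>\<epsilon>. Lc (q + \<epsilon> *\<^sub>R ?d) * vol (map (coframe X c (\<pi> y)) vs)) has_field_derivative
        dirderiv Lc q ?d * vol (map (coframe X c (\<pi> y)) vs)) (at 0)"
      by (rule DERIV_cmult_right)
    then have "deriv (\<lambda>\<epsilon>. L (y, ?g \<epsilon>) vs) 0 = dirderiv Lc q ?d * vol (map (coframe X c (\<pi> y)) vs)"
      unfolding Lc_jc(2)[OF je y] qe by (rule DERIV_imp_deriv)
    moreover have "L (y, \<gamma>) vs = Lc q * vol (map (coframe X c (\<pi> y)) vs)" unfolding Lc_jc(2)[OF j y] q_def ..
    ultimately show ?thesis by (simp add: distrib_right q'_def)
  qed
  have G: "pull \<gamma>' (pull (coframe Y \<psi> y) (zform p P)) vs =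
      (p + (\<Sum>\<mu>\<in>UNIV. P (snd (snd (jc c \<psi> (y, \<gamma>'))) $ \<mu>) $ \<mu>)) * vol (map (coframe X c (\<pi> y)) vs)"
    if j': "(y, \<gamma>') \<in> jets X Y \<pi>" and P: "linear P" for \<gamma>' p vs and P :: "'f \<Rightarrow> real^'m"
  proof -
    let ?v = "snd (snd (jc c \<psi> (y, \<gamma>')))"
    have "coframe Y \<psi> y (\<gamma>' u) = (coframe X c (\<pi> y) u, vlin ?v (coframe X c (\<pi> y) u))" for u
      using jet_eq[OF k j' y, of u] by (simp add: frY(3)[OF k y])
    then have "pull \<gamma>' (pull (coframe Y \<psi> y) (zform p P)) vs = zform p P (map (\<lambda>a. (a, vlin ?v a)) (map (coframe X c (\<pi> y)) vs))"
      by (simp add: pull_def o_def)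
    also have "\<dots> = (p + tr (\<lambda>a. P (vlin ?v a))) * vol (map (coframe X c (\<pi> y)) vs)"
      by (rule zform_graph[OF P linear_vlin])
    finally show ?thesis by (simp add: tr_def vlin_axis)
  qed
  have "(THE z. (y, z) \<in> mom_points X Y \<pi> \<and> (\<forall>\<gamma>'. (y, \<gamma>') \<in> jets X Y \<pi> \<longrightarrow> pull \<gamma>' z = ?R \<gamma>')) =
      pull (coframe Y \<psi> y) (zform (pL q) (PL q))"
  proof (rule the_equality)
    have "pull \<gamma>' (pull (coframe Y \<psi> y) (zform (pL q) (PL q))) vs = ?R \<gamma>' vs" if "(y, \<gamma>') \<in> jets X Y \<pi>" for \<gamma>' vs
    proof -
      let ?v' = "snd (snd (jc c \<psi> (y, \<gamma>')))"
      have "(0::real^'m, 0::'f, ?v' - snd (snd q)) = (0, 0, ?v') - (0, 0, snd (snd q))" by simp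
      then have "dirderiv Lc q (0, 0, ?v' - snd (snd q)) = dirderiv Lc q (0, 0, ?v') - dirderiv Lc q (0, 0, snd (snd q))"
        using linear_diff[OF linear_DL[OF q]] by metis
      then show ?thesis unfolding G[OF that lP] R[OF that] tr_PL(1)[OF q] by (simp add: pL_def)
    qed
    then show "(y, pull (coframe Y \<psi> y) (zform (pL q) (PL q))) \<in> mom_points X Y \<pi> \<and>
        (\<forall>\<gamma>'. (y, \<gamma>') \<in> jets X Y \<pi> \<longrightarrow> pull \<gamma>' (pull (coframe Y \<psi> y) (zform (pL q) (PL q))) = ?R \<gamma>')"
      using mkmom_in(1)[OF y lP] by blast
  next
    fix z assume z: "(y, z) \<in> mom_points X Y \<pi> \<and> (\<forall>\<gamma>'. (y, \<gamma>') \<in> jets X Y \<pi> \<longrightarrow> pull \<gamma>' z = ?R \<gamma>')"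
    define z' where "z' = pull (frame Y \<psi> y) z"
    define P where "P = (\<lambda>b. \<chi> \<mu>. zmom z' b \<mu>)"
    have P: "linear P" unfolding P_def z'_def by (rule mom_zform(1)[OF y conjunct1[OF z]])
    have z1: "z' = zform (zbase z') P" unfolding P_def z'_def by (rule mom_zform(2)[OF y conjunct1[OF z]])
    have z2: "z = pull (coframe Y \<psi> y) z'" unfolding z'_def by (rule mom_zform(3)[OF y conjunct1[OF z]])
    have zz: "z = pull (coframe Y \<psi> y) (zform (zbase z') P)" by (subst z1[symmetric]) (rule z2)
    \<comment> \<open>Every velocity matrix belongs to some jet at \<open>y\<close>, so the two
      affine functions agree on all of \<open>'f^'m\<close>.\<close>
    have eq: "zbase z' + (\<Sum>\<mu>\<in>UNIV. P (v $ \<mu>) $ \<mu>) = pL q + (\<Sum>\<mu>\<in>UNIV. PL q (v $ \<mu>) $ \<mu>)" for v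
    proof -
      have "(fst q, fst (snd q), v) \<in> jdom \<psi>" using q by (simp add: jdom_def[OF k])
      note m = mkjet_in[OF k this] jc_mkjet[OF k this]
      let ?g = "snd (mkjet c \<psi> (fst q, fst (snd q), v))"
      have sq: "snd \<psi> y = (fst q, fst (snd q))" by (simp add: q_def jc_eq[OF k])
      have "fst (mkjet c \<psi> (fst q, fst (snd q), v)) = y"
        using m(1) sq fib_inj[OF k y] fib_inj[OF k, of "fst (mkjet c \<psi> (fst q, fst (snd q), v))"] by simp
      then have e: "mkjet c \<psi> (fst q, fst (snd q), v) = (y, ?g)" by (simp add: prod_eq_iff)
      have jg: "(y, ?g) \<in> jets X Y \<pi>" "snd (snd (jc c \<psi> (y, ?g))) = v" using m e by simp_all
      have 1: "vol (map (coframe X c (\<pi> y)) (map (frame X c (\<pi> y)) axes)) = 1" by (simp add: o_def frX(3)[OF k y])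
      have "pull ?g z = ?R ?g" using z jg(1) by blast
      then have "pull ?g z (map (frame X c (\<pi> y)) axes) = ?R ?g (map (frame X c (\<pi> y)) axes)"
        by (rule fun_cong)
      then have "zbase z' + (\<Sum>\<mu>\<in>UNIV. P (v $ \<mu>) $ \<mu>) = Lc q + dirderiv Lc q (0, 0, v - snd (snd q))"
        unfolding zz G[OF jg(1) P] R[OF jg(1)] 1 jg(2) by simp
      moreover have "(0::real^'m, 0::'f, v - snd (snd q)) = (0, 0, v) - (0, 0, snd (snd q))" by simp
      then have "dirderiv Lc q (0, 0, v - snd (snd q)) = dirderiv Lc q (0, 0, v) - dirderiv Lc q (0, 0, snd (snd q))"
        using linear_diff[OF linear_DL[OF q]] by metis
      ultimately show ?thesis unfolding tr_PL(1)[OF q] by (simp add: pL_def)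
    qed
    show "z = pull (coframe Y \<psi> y) (zform (pL q) (PL q))"
      unfolding zz zform_eq_on_graphs[OF P lP eq] ..
  qed
  then show ?thesis by (simp add: legendre_def q_def)
qed

end

end

section \<open>Differentiability of the Legendre transformation\<close>

definition mdiff :: "('x, 'e::real_normed_vector) atlas \<Rightarrow> ('y, 'h::real_normed_vector) atlas
    \<Rightarrow> ('x \<Rightarrow> 'y) \<Rightarrow> 'x \<Rightarrow> bool" where
  "mdiff A B f p \<longleftrightarrow> (\<exists>f'. has_mderiv A B f f' p)"

lemma mdiffI: "has_mderiv A B f f' p \<Longrightarrow> mdiff A B f p"
  unfolding mdiff_def by (rule exI)

lemma mdiff_has_mderiv: "mdiff A B f p \<Longrightarrow> has_mderiv A B f (tmap A B f p) p"
  unfolding mdiff_def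
proof (elim exE)
  fix f' assume h: "has_mderiv A B f f' p"
  show "has_mderiv A B f (tmap A B f p) p" unfolding has_mderiv_tmap[OF h] by (rule h)
qed

lemma mdiff_compose:
  assumes "inj_atlas A" "inj_atlas B" "mdiff A B f p" "mdiff B C g (f p)"
  shows "mdiff A C (\<lambda>x. g (f x)) p" "tmap A C (\<lambda>x. g (f x)) p = (\<lambda>v. tmap B C g (f p) (tmap A B f p v))"
proof -
  have *: "has_mderiv A C (\<lambda>x. g (f x)) (\<lambda>v. tmap B C g (f p) (tmap A B f p v)) p"
    by (rule has_mderiv_compose[OF assms(1,2) mdiff_has_mderiv[OF assms(3)] mdiff_has_mderiv[OF assms(4)]])
  show "mdiff A C (\<lambda>x. g (f x)) p" by (rule mdiffI[OF *])
  show "tmap A C (\<lambda>x. g (f x)) p = (\<lambda>v. tmap B C g (f p) (tmap A B f p v))" by (rule has_mderiv_tmap[OF *])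
qed

lemma differentiable_cong_nhds:
  assumes "f differentiable (at x)" "\<forall>\<^sub>F y in nhds x. f y = g y"
  shows "g differentiable (at x)"
proof -
  from assms(1) obtain f' where "(f has_derivative f') (at x)" unfolding differentiable_def by (elim exE)
  from has_derivative_cong_nhds[OF this assms(2)] show ?thesis by (rule differentiableI)
qed

lemma mdiff_intro:
  assumes "p \<in> mpoints A" "f p \<in> mpoints B"
    and "\<forall>\<^sub>F q in nhds (snd (chart_at A p) p). f (cinv (chart_at A p) q) \<in> fst (chart_at B (f p)) \<and>
      snd (chart_at B (f p)) (f (cinv (chart_at A p) q)) = g q"
    and "g differentiable (at (snd (chart_at A p) p))"
  shows "mdiff A B f p"
proof -
  from assms(4) obtain g' where g': "(g has_derivative g') (at (snd (chart_at A p) p))"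
    unfolding differentiable_def by blast
  have "\<forall>\<^sub>F q in nhds (snd (chart_at A p) p). g q = (snd (chart_at B (f p)) \<circ> f \<circ> cinv (chart_at A p)) q"
    using assms(3) by eventually_elim simp
  from has_derivative_cong_nhds[OF g' this]
  have "has_mderiv A B f g' p"
    using assms(1,2) eventually_mono[OF assms(3) conjunct1] unfolding has_mderiv_def by (intro conjI)
  then show ?thesis by (rule mdiffI)
qed

lemma differentiable_vec_lambda:
  fixes g :: "'n::finite \<Rightarrow> 'a::real_normed_vector \<Rightarrow> 'f::real_normed_vector"
  assumes "\<And>i. g i differentiable (at x)"
  shows "(\<lambda>x. \<chi> i. g i x) differentiable (at x)"
proof -
  have "\<forall>i. \<exists>D. (g i has_derivative D) (at x)" using assms by (simp add: differentiable_def)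
  from choice[OF this] obtain D where "\<forall>i. (g i has_derivative D i) (at x)" by (elim exE)
  then have "(g i has_derivative D i) (at x)" for i by simp
  from has_derivative_vec_lambda[where g = g and g' = D, OF this] show ?thesis by (rule differentiableI)
qed

lemma differentiable_PairI:
  assumes "f differentiable (at x)" "g differentiable (at x)" shows "(\<lambda>x. (f x, g x)) differentiable (at x)"
proof -
  from assms obtain f' g' where "(f has_derivative f') (at x)" "(g has_derivative g') (at x)"
    unfolding differentiable_def by (elim exE)
  from has_derivative_Pair[OF this] show ?thesis by (rule differentiableI)
qed

lemma differentiable_blinear:
  assumes "bounded_linear h" "f differentiable (at x)" shows "(\<lambda>x. h (f x)) differentiable (at x)"
proof -
  from assms(2) obtain f' where "(f has_derivative f') (at x)" unfolding differentiable_def by (elim exE)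
  from bounded_linear.has_derivative[OF assms(1) this] show ?thesis by (rule differentiableI)
qed

lemmas differentiable_fstI = differentiable_blinear[OF bounded_linear_fst]
lemmas differentiable_sndI = differentiable_blinear[OF bounded_linear_snd]

lemma alt_form_differentiable:
  fixes \<omega> :: "'v::real_normed_vector list \<Rightarrow> real" and u :: "nat \<Rightarrow> 'a::real_normed_vector \<Rightarrow> 'v"
  assumes fd: "findim TYPE('v)" and w: "\<omega> \<in> alt_form k"
    and u: "\<And>i. i < k \<Longrightarrow> u i differentiable (at x)"
  shows "(\<lambda>x. \<omega> (map (\<lambda>i. u i x) [0..<k])) differentiable (at x)"
proof -
  have "\<forall>i. \<exists>D. i < k \<longrightarrow> (u i has_derivative D) (at x)" using u by (simp add: differentiable_def)
  from choice[OF this] obtain D where "\<forall>i. i < k \<longrightarrow> (u i has_derivative D i) (at x)" by (elim exE)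
  then have D: "i < k \<Longrightarrow> (u i has_derivative D i) (at x)" for i by simp
  from alt_form_has_derivative[where u = u and u' = D, OF fd w D] show ?thesis by (rule differentiableI)
qed

lemma zform_differentiable:
  fixes P :: "'a::real_normed_vector \<Rightarrow> 'f::real_normed_vector \<Rightarrow> real^'m::finite"
  assumes p: "p differentiable (at x)"
    and P: "\<And>u. u differentiable (at x) \<Longrightarrow> (\<lambda>x. P x (u x)) differentiable (at x)"
    and u: "\<And>i. u i differentiable (at x)"
  shows "(\<lambda>x. zform (p x) (P x) (map (\<lambda>i. u i x) [0..<CARD('m)])) differentiable (at x)"
proof -
  have fdm: "findim TYPE(real^'m)" by (rule findim_euclidean)
  have 1: "(\<lambda>x. vol (map (\<lambda>i. fst (u i x)) [0..<CARD('m)])) differentiable (at x)"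
    by (rule alt_form_differentiable[OF fdm vol_alt_form differentiable_fstI[OF u]])
  have 2: "(\<lambda>x. vol (map (\<lambda>j. if j = i then P x (snd (u i x)) else fst (u j x)) [0..<CARD('m)])) differentiable (at x)" for i
  proof (rule alt_form_differentiable[where u = "\<lambda>j x. if j = i then P x (snd (u i x)) else fst (u j x)", OF fdm vol_alt_form])
    fix j show "(\<lambda>x. if j = i then P x (snd (u i x)) else fst (u j x)) differentiable (at x)"
      by (cases "j = i") (simp_all add: P[OF differentiable_sndI[OF u]] differentiable_fstI[OF u])
  qed
  have "(map (\<lambda>i. fst (u i x)) [0..<CARD('m)])[i := P x (snd (u i x))] =
      map (\<lambda>j. if j = i then P x (snd (u i x)) else fst (u j x)) [0..<CARD('m)]" for i x
    by (rule nth_equalityI) (simp_all add: nth_list_update)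
  then have "(\<lambda>x. zform (p x) (P x) (map (\<lambda>i. u i x) [0..<CARD('m)])) =
    (\<lambda>x. p x * vol (map (\<lambda>i. fst (u i x)) [0..<CARD('m)]) +
      (\<Sum>i<CARD('m). vol (map (\<lambda>j. if j = i then P x (snd (u i x)) else fst (u j x)) [0..<CARD('m)])))"
    by (simp add: zform_def o_def)
  moreover have "(\<lambda>x. p x * vol (map (\<lambda>i. fst (u i x)) [0..<CARD('m)]) +
      (\<Sum>i<CARD('m). vol (map (\<lambda>j. if j = i then P x (snd (u i x)) else fst (u j x)) [0..<CARD('m)]))) differentiable (at x)"
    by (intro differentiable_add differentiable_mult p 1 differentiable_sum ballI 2) simp
  ultimately show ?thesis by (simp only:)
qed

text \<open>In a finite basis a functional is the sum of its basis values times coordinate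
  functionals, so differentiability in operator norm reduces to that of the values.
  \<open>Blinfun\<close> is meaningful for bounded linear arguments, hence the condition near
  \<open>x\<close>.\<close>

lemma Blinfun_differentiable:
  fixes g :: "'a::real_normed_vector \<Rightarrow> 'f::real_normed_vector \<Rightarrow> real"
  assumes fd: "findim TYPE('f)" and lin: "\<forall>\<^sub>F y in nhds x. linear (g y)"
    and g: "\<And>b. (\<lambda>y. g y b) differentiable (at x)"
  shows "(\<lambda>y. Blinfun (g y)) differentiable (at x)"
proof -
  obtain B :: "'f set" where B: "finite B" "independent B" "span B = UNIV" using findim_basis[OF fd] .
  note br = bounded_linear_representation[OF B]
  have "(\<lambda>y. \<Sum>b\<in>B. g y b *\<^sub>R Blinfun (\<lambda>v. representation B v b)) differentiable (at x)"
    by (intro differentiable_sum ballI B(1) differentiable_blinear[OF bounded_linear_scaleR_left] g)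
  moreover have "\<forall>\<^sub>F y in nhds x. (\<Sum>b\<in>B. g y b *\<^sub>R Blinfun (\<lambda>v. representation B v b)) = Blinfun (g y)"
    using lin
  proof eventually_elim
    case (elim y)
    have eq: "g y v = (\<Sum>b\<in>B. g y b * representation B v b)" for v
    proof -
      have "g y v = g y (\<Sum>b\<in>B. representation B v b *\<^sub>R b)"
        using sum_representation_eq[OF B(2) _ B(1), of v] B(3) by simp
      also have "\<dots> = (\<Sum>b\<in>B. representation B v b * g y b)"
        using linear_sum[OF elim, of "\<lambda>b. representation B v b *\<^sub>R b" B] linear_cmul[OF elim] by simp
      finally show ?thesis by (simp add: mult.commute)
    qed
    show ?case
    proof (rule blinfun_eqI)
      fix v
      have "blinfun_apply (\<Sum>b\<in>B. g y b *\<^sub>R Blinfun (\<lambda>v. representation B v b)) v = (\<Sum>b\<in>B. g y b * representation B v b)"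
        by (simp add: blinfun.sum_left blinfun.scaleR_left bounded_linear_Blinfun_apply[OF br])
      also have "\<dots> = g y v" by (rule eq[symmetric])
      finally show "blinfun_apply (\<Sum>b\<in>B. g y b *\<^sub>R Blinfun (\<lambda>v. representation B v b)) v = blinfun_apply (Blinfun (g y)) v"
        by (simp add: bounded_linear_Blinfun_apply[OF findim_linear_bounded[OF fd elim]])
    qed
  qed
  ultimately show ?thesis by (rule differentiable_cong_nhds)
qed

lemma C2on_dirderiv_differentiable:
  fixes f :: "'a::real_normed_vector \<Rightarrow> 'b::real_normed_vector"
  assumes "findim TYPE('a)" "C2on S f" "g x \<in> S" "g differentiable (at x)" "u differentiable (at x)"
  shows "(\<lambda>y. dirderiv f (g y) (u y)) differentiable (at x)"
proof -
  obtain g' u' where "(g has_derivative g') (at x)" "(u has_derivative u') (at x)"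
    using assms(4,5) unfolding differentiable_def by (elim exE)
  from C2on_dirderiv_has_derivative[OF assms(1-3) this] show ?thesis by (rule differentiableI)
qed

lemma C2on_differentiable:
  fixes f :: "'a::real_normed_vector \<Rightarrow> 'b::real_normed_vector"
  assumes "findim TYPE('a)" "C2on S f" "g x \<in> S" "g differentiable (at x)"
  shows "(\<lambda>y. f (g y)) differentiable (at x)"
proof -
  obtain g' where "(g has_derivative g') (at x)" using assms(4) unfolding differentiable_def by (elim exE)
  from has_derivative_compose[OF this C2on_has_derivative(1)[OF assms(1-3)]] show ?thesis by (rule differentiableI)
qed

lemma coframe_frame_transition:
  fixes A :: "('x, 'e::real_normed_vector) atlas"
  assumes fd: "findim TYPE('e)" and A: "smooth_atlas A" and c: "c \<in> max_atlas A" "p \<in> fst c" and d: "d \<in> max_atlas A" "p \<in> fst d"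
  shows "coframe A c p (frame A d p v) = dirderiv (snd c \<circ> cinv d) (snd d p) v"
proof -
  have dp: "cinv d (snd d p) = p" by (rule cinv_chart[OF max_atlasD(1)[OF d(1)] d(2)])
  have "has_mderiv euc euc (\<lambda>q. snd c (cinv d q)) (\<lambda>v. coframe A c p (frame A d p v)) (snd d p)"
    unfolding frame_def coframe_def
    by (rule has_mderiv_compose[OF euc_simps(4) smooth_inj_atlas[OF A] has_mderiv_cinv(1)[OF fd A d]])
      (simp only: dp has_mderiv_cinv(2)[OF fd A c])
  then have "((\<lambda>q. snd c (cinv d q)) has_derivative (\<lambda>v. coframe A c p (frame A d p v))) (at (snd d p))"
    by (simp only: has_mderiv_euc)
  from dirderiv_eq_has_derivative[OF this] show ?thesis by (simp add: o_def)
qed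

lemma map_coord_indices: "map f coord_indices = map (\<lambda>i. f (coord_indices ! i)) [0..<CARD('m)]" for f :: "'m::finite \<Rightarrow> 'a"
  by (rule nth_equalityI) simp_all

section \<open>Coordinates on Z and the Legendre map\<close>

context lagrangian
begin

definition "zdom \<psi> = {q :: (real^'m) \<times> 'f \<times> (('f \<Rightarrow>\<^sub>L real)^'m) \<times> real. (fst q, fst (snd q)) \<in> snd \<psi> ` fst (\<psi> :: ('y, (real^'m) \<times> 'f) chart)}"

text \<open>An explicit inverse of the momentum chart on \<open>zdom\<close>, in the same role as
  \<open>mkjet\<close>.\<close>

definition "mkmom \<psi> q = (let y = cinv \<psi> (fst q, fst (snd q)) in
  (y, pull (coframe Y \<psi> y) (zform (snd (snd (snd q))) (\<lambda>b. \<chi> \<mu>. blinfun_apply (fst (snd (snd q)) $ \<mu>) b))))"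

lemma mc_eq: "snd (mom_chart X Y \<pi> \<psi>) (y, z) = (fst (snd \<psi> y), snd (snd \<psi> y),
    \<chi> \<mu>. Blinfun (\<lambda>b. zmom (pull (frame Y \<psi> y) z) b \<mu>), zbase (pull (frame Y \<psi> y) z))"
  by (simp add: mom_chart_def Let_def frame_def zmom_def zbase_def)

lemma fst_mom_chart: "j \<in> fst (mom_chart X Y \<pi> \<psi>) \<longleftrightarrow> j \<in> mom_points X Y \<pi> \<and> fst j \<in> fst \<psi>"
  by (cases j) (simp add: mom_chart_def)

lemma linear_blinfuns: "linear (\<lambda>b. \<chi> \<mu>. blinfun_apply (P $ \<mu>) b)"
  by (rule linearI) (simp_all add: vec_eq_iff blinfun.add_right blinfun.scaleR_right)

lemma mkmom_mc:
  assumes k: "(c, \<psi>) \<in> fib_charts X Y \<pi>" and j: "j \<in> mom_points X Y \<pi>" "fst j \<in> fst \<psi>"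
  shows "mkmom \<psi> (snd (mom_chart X Y \<pi> \<psi>) j) = j"
proof -
  obtain y z where jy: "j = (y, z)" by (cases j)
  with j have y: "y \<in> fst \<psi>" and z: "(y, z) \<in> mom_points X Y \<pi>" by simp_all
  let ?z = "pull (frame Y \<psi> y) z"
  note mz = mom_zform[OF k y z]
  have lin: "linear (\<lambda>b. zmom ?z b \<mu>)" for \<mu>
    using linear_compose[OF mz(1) bounded_linear.linear[OF bounded_linear_vec_nth[of \<mu>]]] by (simp add: o_def)
  have b: "blinfun_apply (Blinfun (\<lambda>b. zmom ?z b \<mu>)) = (\<lambda>b. zmom ?z b \<mu>)" for \<mu>
    by (rule bounded_linear_Blinfun_apply[OF findim_linear_bounded[OF fdf lin]])
  show ?thesis
    unfolding jy mkmom_def mc_eq Let_def fst_conv snd_conv prod.collapse fib_inj[OF k y] vec_lambda_beta b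
      mz(2)[symmetric] mz(3)[symmetric] ..
qed

lemma mkmom_zdom:
  assumes k: "(c, \<psi>) \<in> fib_charts X Y \<pi>" and q: "q \<in> zdom \<psi>"
  shows "mkmom \<psi> q \<in> mom_points X Y \<pi>" "fst (mkmom \<psi> q) = cinv \<psi> (fst q, fst (snd q))" "fst (mkmom \<psi> q) \<in> fst \<psi>"
    "snd (mom_chart X Y \<pi> \<psi>) (mkmom \<psi> q) = q"
proof -
  define y where "y = cinv \<psi> (fst q, fst (snd q))"
  have qi: "(fst q, fst (snd q)) \<in> snd \<psi> ` fst \<psi>" using q unfolding zdom_def by (rule CollectD)
  have y: "y \<in> fst \<psi>" "snd \<psi> y = (fst q, fst (snd q))"
    unfolding y_def by (rule chart_cinv(2)[OF qi], rule chart_cinv(1)[OF qi])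
  have m: "mkmom \<psi> q = (y, pull (coframe Y \<psi> y) (zform (snd (snd (snd q))) (\<lambda>b. \<chi> \<mu>. blinfun_apply (fst (snd (snd q)) $ \<mu>) b)))"
    by (simp add: mkmom_def y_def Let_def)
  note mk = mkmom_in[OF k y(1) linear_blinfuns]
  show "mkmom \<psi> q \<in> mom_points X Y \<pi>" unfolding m by (rule mk(1))
  show "fst (mkmom \<psi> q) \<in> fst \<psi>" unfolding m fst_conv by (rule y(1))
  show "fst (mkmom \<psi> q) = cinv \<psi> (fst q, fst (snd q))" by (simp add: m y_def)
  show "snd (mom_chart X Y \<pi> \<psi>) (mkmom \<psi> q) = q"
    unfolding m mc_eq mk(2) zmom_zform[OF linear_blinfuns] zbase_zform[OF linear_blinfuns] y(2) vec_lambda_beta fst_conv snd_conv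
    by (simp add: blinfun_apply_inverse prod_eq_iff vec_eq_iff)
qed

lemma inj_mom_chart:
  assumes k: "(c, \<psi>) \<in> fib_charts X Y \<pi>"
  shows "inj_on (snd (mom_chart X Y \<pi> \<psi>)) (fst (mom_chart X Y \<pi> \<psi>))"
proof (rule inj_on_inverseI[where g = "mkmom \<psi>"])
  fix j assume "j \<in> fst (mom_chart X Y \<pi> \<psi>)"
  then have "j \<in> mom_points X Y \<pi> \<and> fst j \<in> fst \<psi>" unfolding fst_mom_chart .
  then show "mkmom \<psi> (snd (mom_chart X Y \<pi> \<psi>) j) = j" by (elim conjE) (rule mkmom_mc[OF k])
qed

lemma cinv_mom_chart:
  assumes k: "(c, \<psi>) \<in> fib_charts X Y \<pi>" and q: "q \<in> zdom \<psi>"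
  shows "cinv (mom_chart X Y \<pi> \<psi>) q = mkmom \<psi> q"
  unfolding cinv_def
proof (rule inv_into_f_eq[OF inj_mom_chart[OF k] _ mkmom_zdom(4)[OF k q]])
  show "mkmom \<psi> q \<in> fst (mom_chart X Y \<pi> \<psi>)"
    unfolding fst_mom_chart by (rule conjI[OF mkmom_zdom(1)[OF k q] mkmom_zdom(3)[OF k q]])
qed

lemma inj_jet_atlas: "inj_atlas (jet_atlas X Y \<pi>)"
  unfolding inj_atlas_def jet_atlas_def
proof (rule ballI, elim imageE)
  fix a k assume "a = jet_chart X Y \<pi> k" "k \<in> fib_charts X Y \<pi>"
  then show "inj_on (snd a) (fst a)" using inj_jet_chart[of "fst k" "snd k"] by simp
qed

lemma inj_mom_atlas: "inj_atlas (mom_atlas X Y \<pi>)"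
  unfolding inj_atlas_def mom_atlas_def
proof (rule ballI, elim imageE)
  fix a b k assume "a = mom_chart X Y \<pi> b" "b = snd k" "k \<in> fib_charts X Y \<pi>"
  then show "inj_on (snd a) (fst a)" using inj_mom_chart[of "fst k" "snd k"] by simp
qed

lemma jet_chart_at:
  assumes j: "j \<in> jets X Y \<pi>"
  obtains c \<psi> where "(c, \<psi>) \<in> fib_charts X Y \<pi>" "chart_at (jet_atlas X Y \<pi>) j = jet_chart X Y \<pi> (c, \<psi>)" "fst j \<in> fst \<psi>"
    "j \<in> mpoints (jet_atlas X Y \<pi>)"
proof -
  have "fst j \<in> mpoints Y" using j by (cases j) (simp add: jets_def)
  from fib[OF this] obtain c \<psi> where k: "(c, \<psi>) \<in> fib_charts X Y \<pi>" "fst j \<in> fst \<psi>" by blast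
  have "j \<in> fst (jet_chart X Y \<pi> (c, \<psi>))" using fst_jet_chart[OF k(1)] j k(2) by simp
  moreover have "jet_chart X Y \<pi> (c, \<psi>) \<in> jet_atlas X Y \<pi>" unfolding jet_atlas_def using k(1) by (rule imageI)
  ultimately have m: "j \<in> mpoints (jet_atlas X Y \<pi>)" using chart_subset_mpoints by blast
  note ca = chart_at[OF m]
  then obtain k' where k': "k' \<in> fib_charts X Y \<pi>" "chart_at (jet_atlas X Y \<pi>) j = jet_chart X Y \<pi> k'"
    unfolding jet_atlas_def by blast
  obtain c' \<psi>' where "k' = (c', \<psi>')" by (cases k')
  with k' ca m fst_jet_chart[of c' \<psi>' j] that show ?thesis by simp
qed

lemma mom_chart_at:
  assumes j: "j \<in> mom_points X Y \<pi>"
  obtains c \<psi> where "(c, \<psi>) \<in> fib_charts X Y \<pi>" "chart_at (mom_atlas X Y \<pi>) j = mom_chart X Y \<pi> \<psi>" "fst j \<in> fst \<psi>"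
    "j \<in> mpoints (mom_atlas X Y \<pi>)"
proof -
  have "fst j \<in> mpoints Y" using j by (cases j) (simp add: mom_points_def)
  from fib[OF this] obtain c \<psi> where k: "(c, \<psi>) \<in> fib_charts X Y \<pi>" "fst j \<in> fst \<psi>" by blast
  have "j \<in> fst (mom_chart X Y \<pi> \<psi>)" using fst_mom_chart j k(2) by simp
  moreover have "mom_chart X Y \<pi> \<psi> \<in> mom_atlas X Y \<pi>" unfolding mom_atlas_def
    using imageI[OF imageI[OF k(1), of snd], of "mom_chart X Y \<pi>"] by simp
  ultimately have m: "j \<in> mpoints (mom_atlas X Y \<pi>)" using chart_subset_mpoints by blast
  note ca = chart_at[OF m]
  then obtain k' where k': "k' \<in> fib_charts X Y \<pi>" "chart_at (mom_atlas X Y \<pi>) j = mom_chart X Y \<pi> (snd k')"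
    unfolding mom_atlas_def by blast
  obtain c' \<psi>' where "k' = (c', \<psi>')" by (cases k')
  with k' ca m fst_mom_chart[of j \<psi>'] that show ?thesis by simp
qed

lemma differentiable_base: "(\<lambda>q. (fst q, fst (snd q))) differentiable (at x)"
  by (intro differentiable_PairI differentiable_fstI differentiable_sndI differentiable_ident)

lemma eventually_base:
  fixes x :: "'a::topological_space \<times> 'b::topological_space \<times> 'c::topological_space"
  assumes "open T" "(fst x, fst (snd x)) \<in> T"
  shows "\<forall>\<^sub>F q in nhds x. (fst q, fst (snd q)) \<in> T"
proof -
  have "open ((\<lambda>q :: 'a \<times> 'b \<times> 'c. (fst q, fst (snd q))) -` T)" by (intro open_vimage assms(1) continuous_intros)
  from eventually_nhds_in_open[OF this, of x] assms(2) show ?thesis by simp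
qed

text \<open>The preferred chart of \<open>Y\<close> need not be the fibered chart underlying the
  momentum chart, so the representative of the projection is a transition map of the base and fiber
  coordinates.\<close>

lemma mdiff_fst:
  assumes j: "j \<in> mom_points X Y \<pi>"
  shows "mdiff (mom_atlas X Y \<pi>) Y fst j"
proof -
  obtain c \<psi> where k: "(c, \<psi>) \<in> fib_charts X Y \<pi>" and ca: "chart_at (mom_atlas X Y \<pi>) j = mom_chart X Y \<pi> \<psi>"
    and y: "fst j \<in> fst \<psi>" and m: "j \<in> mpoints (mom_atlas X Y \<pi>)" using mom_chart_at[OF j] .
  note D = fib_chartsD[OF k]
  define a where "a = chart_at Y (fst j)"
  have yY: "fst j \<in> mpoints Y" by (rule D(5)[OF y])
  have a: "a \<in> max_atlas Y" "fst j \<in> fst a" unfolding a_def by (rule chart_at_max[OF Y yY]) (rule conjunct2[OF chart_at[OF yY]])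
  let ?T = "snd \<psi> ` (fst \<psi> \<inter> fst a)"
  note C = C2on_transition[OF Y D(2) a(1)]
  let ?q = "snd (mom_chart X Y \<pi> \<psi>) j"
  have q: "(fst ?q, fst (snd ?q)) = snd \<psi> (fst j)" using mc_eq[of \<psi> "fst j" "snd j"] by simp
  then have qT: "(fst ?q, fst (snd ?q)) \<in> ?T" using y a(2) by simp
  have ev: "\<forall>\<^sub>F q in nhds ?q. (fst q, fst (snd q)) \<in> ?T" by (rule eventually_base[OF C2on_open[OF C] qT])
  show ?thesis
  proof (rule mdiff_intro[where f = fst, OF m yY])
    show "\<forall>\<^sub>F q in nhds (snd (chart_at (mom_atlas X Y \<pi>) j) j). fst (cinv (chart_at (mom_atlas X Y \<pi>) j) q) \<in> fst (chart_at Y (fst j)) \<and>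
        snd (chart_at Y (fst j)) (fst (cinv (chart_at (mom_atlas X Y \<pi>) j) q)) = (snd a \<circ> cinv \<psi>) (fst q, fst (snd q))"
      unfolding ca a_def[symmetric] using ev
    proof eventually_elim
      case (elim q)
      then have "q \<in> zdom \<psi>" unfolding zdom_def by blast
      from cinv_mom_chart[OF k this] mkmom_zdom(2)[OF k this]
      have "fst (cinv (mom_chart X Y \<pi> \<psi>) q) = cinv \<psi> (fst q, fst (snd q))" by simp
      moreover from elim obtain y' where y': "(fst q, fst (snd q)) = snd \<psi> y'" "y' \<in> fst \<psi>" "y' \<in> fst a" by (elim imageE IntE)
      then have "cinv \<psi> (fst q, fst (snd q)) \<in> fst a" using fib_inj[OF k y'(2)] by simp
      ultimately show ?case by simp
    qed
    show "(\<lambda>q. (snd a \<circ> cinv \<psi>) (fst q, fst (snd q))) differentiable (at (snd (chart_at (mom_atlas X Y \<pi>) j) j))"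
      unfolding ca
      by (rule C2on_differentiable[where g = "\<lambda>q. (fst q, fst (snd q))", OF fdE C qT differentiable_base])
  qed
qed

text \<open>The preferred momentum chart at the image may lie over another fibered chart
  \<open>\<psi>2\<close> than the jet chart. Its coefficients are those of the known
  \<open>zform\<close> evaluated on vectors moved by the transition map, and every ingredient is
  differentiable since \<open>Lc\<close> is \<open>C2on\<close>.\<close>

lemma mdiff_legendre:
  assumes j: "j \<in> jets X Y \<pi>"
  shows "legendre X Y \<pi> L j \<in> mom_points X Y \<pi>" "fst (legendre X Y \<pi> L j) = fst j"
    "mdiff (jet_atlas X Y \<pi>) (mom_atlas X Y \<pi>) (legendre X Y \<pi> L) j"
proof -
  obtain c \<psi> where k: "(c, \<psi>) \<in> fib_charts X Y \<pi>" and ca: "chart_at (jet_atlas X Y \<pi>) j = jet_chart X Y \<pi> (c, \<psi>)"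
    and y: "fst j \<in> fst \<psi>" and m: "j \<in> mpoints (jet_atlas X Y \<pi>)" using jet_chart_at[OF j] .
  note D = fib_chartsD[OF k]
  let ?q = "jc c \<psi> j" and ?pL = "pL c \<psi>" and ?PL = "PL c \<psi>"
  have leg: "legendre X Y \<pi> L j' = (fst j', pull (coframe Y \<psi> (fst j')) (zform (?pL (jc c \<psi> j')) (?PL (jc c \<psi> j'))))"
    if "j' \<in> jets X Y \<pi>" "fst j' \<in> fst \<psi>" for j'
    using legendre_coord[OF k, of "fst j'" "snd j'"] that by simp
  have jq: "jc c \<psi> j' \<in> jdom \<psi>" if "fst j' \<in> fst \<psi>" for j'
    using jc_in[OF k, of "fst j'" "snd j'"] that by simp
  have lm: "legendre X Y \<pi> L j' \<in> mom_points X Y \<pi>" if "j' \<in> jets X Y \<pi>" "fst j' \<in> fst \<psi>" for j'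
    unfolding leg[OF that] by (rule mkmom_in(1)[OF k that(2) linear_PL[OF k jq[OF that(2)]]])
  show LM: "legendre X Y \<pi> L j \<in> mom_points X Y \<pi>" by (rule lm[OF j y])
  show fl: "fst (legendre X Y \<pi> L j) = fst j" using leg[OF j y] by simp
  obtain c2 \<psi>2 where k2: "(c2, \<psi>2) \<in> fib_charts X Y \<pi>" and ca2: "chart_at (mom_atlas X Y \<pi>) (legendre X Y \<pi> L j) = mom_chart X Y \<pi> \<psi>2"
    and y2: "fst j \<in> fst \<psi>2" and m2: "legendre X Y \<pi> L j \<in> mpoints (mom_atlas X Y \<pi>)"
    using mom_chart_at[OF LM] unfolding fl .
  note D2 = fib_chartsD[OF k2]
  \<comment> \<open>\<open>\<rho>\<close> passes to the base and fiber coordinates of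
    \<open>\<psi>2\<close>; \<open>\<theta>\<close> is the change of coordinates back to
    \<open>\<psi>\<close>.\<close>
  define \<rho> where "\<rho> q = (snd \<psi>2 \<circ> cinv \<psi>) (fst q, fst (snd q))" for q :: "(real^'m) \<times> 'f \<times> ('f^'m)"
  define \<theta> where "\<theta> = snd \<psi> \<circ> cinv \<psi>2"
  let ?T = "snd \<psi> ` (fst \<psi> \<inter> fst \<psi>2)" and ?T2 = "snd \<psi>2 ` (fst \<psi>2 \<inter> fst \<psi>)"
  note C = C2on_transition[OF Y D(2) D2(2)]
  have C\<theta>: "C2on ?T2 \<theta>" unfolding \<theta>_def by (rule C2on_transition[OF Y D2(2) D(2)])
  have q: "(fst ?q, fst (snd ?q)) = snd \<psi> (fst j)" using jc_eq[OF k, of "fst j" "snd j"] by simp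
  then have qT: "(fst ?q, fst (snd ?q)) \<in> ?T" using y y2 by simp
  have q\<rho>: "\<rho> ?q \<in> ?T2" unfolding \<rho>_def q using y y2 by (simp add: fib_inj[OF k y])
  have d\<rho>: "\<rho> differentiable (at ?q)" unfolding \<rho>_def
    by (rule C2on_differentiable[where g = "\<lambda>q. (fst q, fst (snd q))", OF fdE C qT differentiable_base])
  have ev: "\<forall>\<^sub>F q in nhds ?q. (fst q, fst (snd q)) \<in> ?T" by (rule eventually_base[OF C2on_open[OF C] qT])
  \<comment> \<open>The image form evaluated on vectors given by their components in
    \<open>\<psi>2\<close>.\<close>
  define \<zeta> where "\<zeta> q v = zform (?pL q) (?PL q) (map (\<lambda>i. dirderiv \<theta> (\<rho> q) (v i)) [0..<CARD('m)])" for q and v :: "nat \<Rightarrow> (real^'m) \<times> 'f"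
  \<comment> \<open>\<open>e\<close> and \<open>g b \<mu>\<close> are the argument lists of
    \<open>zbase\<close> and \<open>zmom\<close>, indexed by position.\<close>
  define e :: "nat \<Rightarrow> (real^'m) \<times> 'f" where "e i = (axis (coord_indices ! i) 1, 0)" for i
  define g where "g b \<mu> i = (if coord_indices ! i = \<mu> then (0, b) else (axis (coord_indices ! i) 1, 0) :: (real^'m) \<times> 'f)" for b and \<mu> :: 'm and i
  have jqj: "?q \<in> jdom \<psi>" by (rule jq[OF y])
  have d\<zeta>: "(\<lambda>q. \<zeta> q v) differentiable (at ?q)" for v
    unfolding \<zeta>_def
  proof (rule zform_differentiable)
    show "?pL differentiable (at ?q)"
      unfolding pL_def[OF k, abs_def]
      by (intro differentiable_diff C2on_differentiable[where g = "\<lambda>q. q", OF fdj C2_Lc[OF k] jqj differentiable_ident]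
          C2on_dirderiv_differentiable[where g = "\<lambda>q. q", OF fdj C2_Lc[OF k] jqj differentiable_ident]
          differentiable_PairI differentiable_const differentiable_sndI differentiable_ident)
    show "(\<lambda>q. ?PL q (u q)) differentiable (at ?q)" if u: "u differentiable (at ?q)" for u
      unfolding PL_def[OF k]
      by (intro differentiable_vec_lambda C2on_dirderiv_differentiable[where g = "\<lambda>q. q", OF fdj C2_Lc[OF k] jqj differentiable_ident]
          differentiable_PairI differentiable_const differentiable_blinear[OF bounded_linear_axis] u)
    show "(\<lambda>q. dirderiv \<theta> (\<rho> q) (v i)) differentiable (at ?q)" for i
      by (rule C2on_dirderiv_differentiable[where g = \<rho>, OF fdE C\<theta> q\<rho> d\<rho> differentiable_const])
  qed
  have ev2: "\<forall>\<^sub>F q in nhds ?q. let l = legendre X Y \<pi> L (cinv (jet_chart X Y \<pi> (c, \<psi>)) q) in l \<in> fst (mom_chart X Y \<pi> \<psi>2) \<and>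
      snd (mom_chart X Y \<pi> \<psi>2) l = (fst (\<rho> q), snd (\<rho> q), (\<chi> \<mu>. Blinfun (\<lambda>b. \<zeta> q (g b \<mu>))), \<zeta> q e) \<and>
      (\<forall>\<mu>. linear (\<lambda>b. \<zeta> q (g b \<mu>)))"
    using ev
  proof eventually_elim
    case (elim q)
    then obtain y' where y': "(fst q, fst (snd q)) = snd \<psi> y'" "y' \<in> fst \<psi>" "y' \<in> fst \<psi>2" by (elim imageE IntE)
    have qd: "q \<in> jdom \<psi>" unfolding jdom_def[OF k] using y' by simp
    note mk = mkjet_in[OF k qd] jc_mkjet[OF k qd] cinv_jet_chart[OF k qd]
    have fy: "fst (mkjet c \<psi> q) = y'" using mk(1) y' fib_inj[OF k y'(2)] fib_inj[OF k, of "fst (mkjet c \<psi> q)"] by simp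
    have mj: "mkjet c \<psi> q \<in> jets X Y \<pi>" "fst (mkjet c \<psi> q) \<in> fst \<psi>" using mk(1) by simp_all
    let ?z = "pull (coframe Y \<psi> y') (zform (?pL q) (?PL q))"
    have l: "legendre X Y \<pi> L (cinv (jet_chart X Y \<pi> (c, \<psi>)) q) = (y', ?z)"
      unfolding mk(3) leg[OF mj] mk(2) fy ..
    have lz: "(y', ?z) \<in> mom_points X Y \<pi>" using lm[OF mj] unfolding leg[OF mj] mk(2) fy .
    have r: "\<rho> q = snd \<psi>2 y'" unfolding \<rho>_def y'(1) by (simp add: fib_inj[OF k y'(2)])
    have cf: "coframe Y \<psi> y' (frame Y \<psi>2 y' v) = dirderiv \<theta> (\<rho> q) v" for v
      unfolding r \<theta>_def by (rule coframe_frame_transition[OF fdE Y D(2) y'(2) D2(2) y'(3)])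
    have zz: "pull (frame Y \<psi>2 y') ?z (map f coord_indices) = \<zeta> q (\<lambda>i. f (coord_indices ! i))" for f :: "'m \<Rightarrow> (real^'m) \<times> 'f"
      unfolding \<zeta>_def pull_def map_map o_def cf by (subst map_coord_indices) simp
    have zm: "zmom (pull (frame Y \<psi>2 y') ?z) b \<mu> = \<zeta> q (g b \<mu>)" for b \<mu>
      unfolding zmom_def zz g_def ..
    have zb: "zbase (pull (frame Y \<psi>2 y') ?z) = \<zeta> q e"
      unfolding zbase_def zz e_def ..
    have "linear (\<lambda>b. zmom (pull (frame Y \<psi>2 y') ?z) b \<mu>)" for \<mu>
      using linear_compose[OF mom_zform(1)[OF k2 y'(3) lz] bounded_linear.linear[OF bounded_linear_vec_nth[of \<mu>]]] by (simp add: o_def)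
    then have lin: "linear (\<lambda>b. \<zeta> q (g b \<mu>))" for \<mu> unfolding zm .
    show ?case unfolding Let_def l mc_eq zm zb r fst_mom_chart using lz y'(3) lin by simp
  qed
  show "mdiff (jet_atlas X Y \<pi>) (mom_atlas X Y \<pi>) (legendre X Y \<pi> L) j"
  proof (rule mdiff_intro[where f = "legendre X Y \<pi> L", OF m m2])
    show "\<forall>\<^sub>F q in nhds (snd (chart_at (jet_atlas X Y \<pi>) j) j).
       legendre X Y \<pi> L (cinv (chart_at (jet_atlas X Y \<pi>) j) q) \<in> fst (chart_at (mom_atlas X Y \<pi>) (legendre X Y \<pi> L j)) \<and>
       snd (chart_at (mom_atlas X Y \<pi>) (legendre X Y \<pi> L j)) (legendre X Y \<pi> L (cinv (chart_at (jet_atlas X Y \<pi>) j) q)) =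
         (fst (\<rho> q), snd (\<rho> q), (\<chi> \<mu>. Blinfun (\<lambda>b. \<zeta> q (g b \<mu>))), \<zeta> q e)"
      unfolding ca ca2 jc_def[OF k, symmetric] using ev2 by eventually_elim (simp add: Let_def)
    have lin: "\<forall>\<^sub>F q in nhds ?q. linear (\<lambda>b. \<zeta> q (g b \<mu>))" for \<mu>
      using ev2 by eventually_elim (simp add: Let_def)
    show "(\<lambda>q. (fst (\<rho> q), snd (\<rho> q), (\<chi> \<mu>. Blinfun (\<lambda>b. \<zeta> q (g b \<mu>))), \<zeta> q e)) differentiable (at (snd (chart_at (jet_atlas X Y \<pi>) j) j))"
      unfolding ca jc_def[OF k, symmetric]
      by (intro differentiable_PairI differentiable_fstI differentiable_sndI d\<rho> differentiable_vec_lambda d\<zeta>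
          Blinfun_differentiable[OF fdf lin])
  qed
qed

end

section \<open>The flow of a one-parameter subgroup\<close>

lemma smooth_map_onD:
  assumes "smooth_map_on A B W f" "c \<in> A" "d \<in> B"
  shows "smooth_on (snd c ` (fst c \<inter> W \<inter> f -` fst d)) (snd d \<circ> f \<circ> cinv c)"
  by (rule bspec[OF bspec[OF assms(1)[unfolded smooth_map_on_def, THEN conjunct2, THEN conjunct2] assms(2)] assms(3)])

locale noether = lagrangian X Y \<pi> L
  for X :: "('x, real^'m::finite) atlas" and Y :: "('y, (real^'m) \<times> 'f::real_normed_vector) atlas" and \<pi> :: "'y \<Rightarrow> 'x"
    and L :: "('m, 'y, 'f) jet \<Rightarrow> (real^'m) list \<Rightarrow> real" +
  fixes G :: "('g, 'z) monoid_scheme" and A :: "('g, 'k::{real_vector,topological_ab_group_add,t2_space}) atlas"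
    and Exp :: "'k \<Rightarrow> 'g" and actX :: "'g \<Rightarrow> 'x \<Rightarrow> 'x" and actY :: "'g \<Rightarrow> 'y \<Rightarrow> 'y"
  assumes surj: "\<pi> ` mpoints Y = mpoints X"
    and lie: "lie_group G A" and exp: "exponential_map G A Exp" and act: "bundle_action X Y \<pi> G A actX actY"
begin

lemma groupG: "group G" and mpA: "mpoints A = carrier G" and smA: "smooth_atlas A" and tvsk: "tvs TYPE('k)"
proof -
  have *: "locally_convex_tvs TYPE('k) \<and> group G \<and> hausdorff_manifold A \<and> mpoints A = carrier G"
    using lie unfolding lie_group_def by (elim conjE) (intro conjI)
  show "group G" "mpoints A = carrier G" using * by simp_all
  show "smooth_atlas A" using * unfolding hausdorff_manifold_def by simp
  show "tvs TYPE('k)" by (rule locally_convex_tvs_imp_tvs[OF conjunct1[OF *]])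
qed

lemma exp_add: "Exp ((s + t) *\<^sub>R \<xi>) = Exp (s *\<^sub>R \<xi>) \<otimes>\<^bsub>G\<^esub> Exp (t *\<^sub>R \<xi>)"
  and exp_smooth: "smooth_map_on euc A UNIV (\<lambda>t::real. Exp (t *\<^sub>R \<xi>))"
  using exp unfolding exponential_map_def by simp_all

lemma exp_carrier: "Exp (t *\<^sub>R \<xi>) \<in> carrier G"
proof -
  have "(\<lambda>t::real. Exp (t *\<^sub>R \<xi>)) ` UNIV \<subseteq> mpoints A"
    using exp_smooth[of \<xi>] unfolding smooth_map_on_def by (elim conjE)
  then show ?thesis unfolding mpA by blast
qed

lemma exp_zero: "Exp (0 *\<^sub>R \<xi>) = \<one>\<^bsub>G\<^esub>"
proof -
  have "Exp (0 *\<^sub>R \<xi>) \<otimes>\<^bsub>G\<^esub> Exp (0 *\<^sub>R \<xi>) = Exp (0 *\<^sub>R \<xi>)" using exp_add[of 0 0 \<xi>] by simp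
  then show ?thesis using group.l_cancel_one[OF groupG exp_carrier exp_carrier] by blast
qed

lemma gact: "group_action G (mpoints Y) actY"
  and act_smooth: "smooth_map_on (prod_atlas A Y) Y (carrier G \<times> mpoints Y) (\<lambda>(g, y). actY g y)"
  and act_proj: "g \<in> carrier G \<Longrightarrow> y \<in> mpoints Y \<Longrightarrow> \<pi> (actY g y) = actX g (\<pi> y)"
  using act unfolding bundle_action_def by simp_all

section \<open>The flows on Y and X\<close>

definition "fl \<xi> t = actY (Exp (t *\<^sub>R \<xi>))"
definition "flX \<xi> t = actX (Exp (t *\<^sub>R \<xi>))"

lemma fl_in: "y \<in> mpoints Y \<Longrightarrow> fl \<xi> t y \<in> mpoints Y"
  unfolding fl_def by (rule group_action.element_image[OF gact exp_carrier _ refl])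

lemma fl_zero: assumes "y \<in> mpoints Y" shows "fl \<xi> 0 y = y"
proof -
  have "fl \<xi> 0 y = (\<lambda>y\<in>mpoints Y. y) y" unfolding fl_def exp_zero group_action.id_eq_one[OF gact] ..
  then show ?thesis using assms by simp
qed

lemma fl_add: "y \<in> mpoints Y \<Longrightarrow> fl \<xi> (s + t) y = fl \<xi> s (fl \<xi> t y)"
  unfolding fl_def exp_add by (rule group_action.composition_rule[OF gact _ exp_carrier exp_carrier])

lemma fl_inverse: "y \<in> mpoints Y \<Longrightarrow> fl \<xi> (- t) (fl \<xi> t y) = y"
  using fl_add[of y \<xi> "- t" t] fl_zero by simp

lemma fl_inverse': "y \<in> mpoints Y \<Longrightarrow> fl \<xi> t (fl \<xi> (- t) y) = y"
  using fl_add[of y \<xi> t "- t"] fl_zero by simp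

lemma fl_proj: "y \<in> mpoints Y \<Longrightarrow> \<pi> (fl \<xi> t y) = flX \<xi> t (\<pi> y)"
  unfolding fl_def flX_def by (rule act_proj[OF exp_carrier])

lemma flX_in: assumes "x \<in> mpoints X" shows "flX \<xi> t x \<in> mpoints X"
proof -
  from assms obtain y where "y \<in> mpoints Y" "x = \<pi> y" unfolding surj[symmetric] by blast
  then show ?thesis using fl_proj[of y] fl_in[of y] surj by (metis imageI)
qed

text \<open>\<open>bundle_action\<close> states the group laws on \<open>Y\<close>; surjectivity of
  \<open>\<pi>\<close> brings them down to \<open>X\<close>.\<close>

lemma flX_inverse: assumes "x \<in> mpoints X" shows "flX \<xi> (- t) (flX \<xi> t x) = x"
proof -
  from assms obtain y where y: "y \<in> mpoints Y" "x = \<pi> y" unfolding surj[symmetric] by blast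
  have "flX \<xi> (- t) (flX \<xi> t x) = \<pi> (fl \<xi> (- t) (fl \<xi> t y))"
    unfolding y(2) fl_proj[OF fl_in[OF y(1)]] fl_proj[OF y(1)] ..
  then show ?thesis unfolding fl_inverse[OF y(1)] y(2) .
qed

lemma flX_inverse': "x \<in> mpoints X \<Longrightarrow> flX \<xi> t (flX \<xi> (- t) x) = x"
  using flX_inverse[of x \<xi> "- t"] by simp

lemma inv_fl: assumes "y \<in> mpoints Y" shows "inv_into (mpoints Y) (fl \<xi> t) y = fl \<xi> (- t) y"
proof (rule inv_into_f_eq)
  show "inj_on (fl \<xi> t) (mpoints Y)" by (rule inj_on_inverseI[where g = "fl \<xi> (- t)"]) (rule fl_inverse)
qed (use fl_in fl_inverse' assms in auto)

lemma inv_flX: assumes "x \<in> mpoints X" shows "inv_into (mpoints X) (flX \<xi> t) x = flX \<xi> (- t) x"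
proof (rule inv_into_f_eq)
  show "inj_on (flX \<xi> t) (mpoints X)" by (rule inj_on_inverseI[where g = "flX \<xi> (- t)"]) (rule flX_inverse)
qed (use flX_in flX_inverse' assms in auto)

text \<open>The action is smooth in charts of the given atlases. Near the identity and
  \<open>y0\<close>, transition maps replace the charts of \<open>Y\<close> by charts of the maximal
  atlas, and \<open>S\<close> is cut down until every composite is defined. The group variable keeps
  its atlas chart.\<close>

lemma action_chart:
  assumes p1: "\<psi>1 \<in> max_atlas Y" "y0 \<in> fst \<psi>1" and p2: "\<psi>2 \<in> max_atlas Y" "y0 \<in> fst \<psi>2"
    and a: "a \<in> A" "\<one>\<^bsub>G\<^esub> \<in> fst a"
  obtains S F where "C2on S F" "(snd a \<one>\<^bsub>G\<^esub>, snd \<psi>1 y0) \<in> S"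
    "\<And>h q. h \<in> fst a \<Longrightarrow> (snd a h, q) \<in> S \<Longrightarrow> q \<in> snd \<psi>1 ` fst \<psi>1 \<and> actY h (cinv \<psi>1 q) \<in> fst \<psi>2 \<and>
      F (snd a h, q) = snd \<psi>2 (actY h (cinv \<psi>1 q))"
proof -
  have y0: "y0 \<in> mpoints Y" using max_atlasD(3)[OF p1(1)] p1(2) by blast
  define b where "b = chart_at Y y0"
  have b: "b \<in> Y" "y0 \<in> fst b" using chart_at[OF y0] by (simp_all add: b_def)
  have bm: "b \<in> max_atlas Y" by (rule atlas_max_atlas[OF Y b(1)])
  note ia = conjunct1[OF smooth_atlas_chart[OF smA a(1)]] and ib = conjunct1[OF smooth_atlas_chart[OF Y b(1)]]
  note i1 = max_atlasD(1)[OF p1(1)] and i2 = max_atlasD(1)[OF p2(1)]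
  let ?act = "\<lambda>(g, y). actY g y"
  define ab where "ab = (fst a \<times> fst b, map_prod (snd a) (snd b))"
  have ab: "ab \<in> prod_atlas A Y" unfolding ab_def prod_atlas_def using a(1) b(1) by blast
  have iab: "inj_on (snd ab) (fst ab)" unfolding ab_def fst_conv snd_conv by (rule map_prod_inj_on[OF ia ib])
  define S0 where "S0 = snd ab ` (fst ab \<inter> (carrier G \<times> mpoints Y) \<inter> ?act -` fst b)"
  define F0 where "F0 = snd b \<circ> ?act \<circ> cinv ab"
  have "smooth_on S0 F0"
    using act_smooth ab b(1) unfolding smooth_map_on_def S0_def F0_def by blast
  then have C0: "C2on S0 F0" by (rule smooth_on_C2on[OF tvs_prod[OF tvsk tvs_normed]])
  have S0D: "F0 (snd a h, snd b y) = snd b (actY h y) \<and> actY h y \<in> fst b"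
    if "h \<in> fst a" "y \<in> fst b" "(snd a h, snd b y) \<in> S0" for h y
  proof -
    have hy: "(h, y) \<in> fst ab" "(snd a h, snd b y) = snd ab (h, y)" using that(1,2) by (simp_all add: ab_def)
    have "(h, y) \<in> fst ab \<inter> (carrier G \<times> mpoints Y) \<inter> ?act -` fst b"
      using that(3) unfolding S0_def hy(2) by (subst (asm) inj_on_image_mem_iff[OF iab hy(1)]) auto
    then have "actY h y \<in> fst b" by simp
    moreover have "F0 (snd a h, snd b y) = snd b (actY h y)"
      unfolding F0_def o_def hy(2) cinv_chart[OF iab hy(1)] by simp
    ultimately show ?thesis by simp
  qed
  let ?T1 = "snd \<psi>1 ` (fst \<psi>1 \<inter> fst b)" and ?T2 = "snd b ` (fst b \<inter> fst \<psi>2)"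
  let ?h1 = "snd b \<circ> cinv \<psi>1" and ?h2 = "snd \<psi>2 \<circ> cinv b"
  have C1: "C2on ?T1 ?h1" by (rule C2on_transition[OF Y p1(1) bm])
  have C2: "C2on ?T2 ?h2" by (rule C2on_transition[OF Y bm p2(1)])
  define u where "u z = (fst z, ?h1 (snd z))" for z :: "'k \<times> ((real^'m) \<times> 'f)"
  have oT: "open (UNIV \<times> ?T1 :: ('k \<times> ((real^'m) \<times> 'f)) set)" by (rule open_Times[OF open_UNIV C2on_open[OF C1]])
  have tvskE: "tvs TYPE('k \<times> ((real^'m) \<times> 'f))" by (rule tvs_prod[OF tvsk tvs_normed])
  have Cu: "C2on (UNIV \<times> ?T1) u" unfolding u_def
  proof (rule C2on_Pair[OF tvskE])
    show "C2on (UNIV \<times> ?T1) (fst :: 'k \<times> ((real^'m) \<times> 'f) \<Rightarrow> 'k)"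
      by (rule C2on_linear[OF tvskE linear_fst' continuous_on_fst_UNIV oT])
    show "C2on (UNIV \<times> ?T1) (\<lambda>z :: 'k \<times> ((real^'m) \<times> 'f). ?h1 (snd z))"
      by (rule C2on_compose_linear[OF tvskE C1 linear_snd' continuous_on_snd_UNIV oT]) (simp add: image_subset_iff)
  qed
  define S1 where "S1 = u -` S0 \<inter> (UNIV \<times> ?T1)"
  have oS1: "open S1" unfolding S1_def by (rule C2on_preimage[OF Cu C2on_open[OF C0]])
  have Cv: "C2on S1 (\<lambda>z. F0 (u z))"
    by (rule C2on_compose[OF tvskE tvskE C0 C2on_subset[OF Cu oS1]]) (simp_all add: S1_def image_subset_iff)
  define S where "S = (\<lambda>z. F0 (u z)) -` ?T2 \<inter> S1"
  have oS: "open S" unfolding S_def by (rule C2on_preimage[OF Cv C2on_open[OF C2]])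
  define F where "F z = ?h2 (F0 (u z))" for z
  have "C2on S F" unfolding F_def
    by (rule C2on_compose[OF tvs_normed tvskE C2 C2on_subset[OF Cv oS]]) (simp_all add: S_def image_subset_iff)
  moreover have "(snd a \<one>\<^bsub>G\<^esub>, snd \<psi>1 y0) \<in> S"
  proof -
    have a1: "actY \<one>\<^bsub>G\<^esub> y0 = y0" using fl_zero[OF y0] unfolding fl_def exp_zero .
    have u0: "u (snd a \<one>\<^bsub>G\<^esub>, snd \<psi>1 y0) = (snd a \<one>\<^bsub>G\<^esub>, snd b y0)"
      by (simp add: u_def cinv_chart[OF i1 p1(2)])
    have "(\<one>\<^bsub>G\<^esub>, y0) \<in> fst ab \<inter> (carrier G \<times> mpoints Y) \<inter> ?act -` fst b"
      using a(2) b(2) y0 a1 group.is_monoid[OF groupG, THEN monoid.one_closed] by (simp add: ab_def)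
    from imageI[OF this, of "snd ab"] have s0: "(snd a \<one>\<^bsub>G\<^esub>, snd b y0) \<in> S0" by (simp add: S0_def ab_def)
    have "F0 (snd a \<one>\<^bsub>G\<^esub>, snd b y0) = snd b y0" using S0D[OF a(2) b(2) s0] a1 by simp
    moreover have "snd b y0 \<in> ?T2" "snd \<psi>1 y0 \<in> ?T1" using b p1 p2 by simp_all
    ultimately show ?thesis unfolding S_def S1_def using u0 s0 by simp
  qed
  moreover have "q \<in> snd \<psi>1 ` fst \<psi>1 \<and> actY h (cinv \<psi>1 q) \<in> fst \<psi>2 \<and> F (snd a h, q) = snd \<psi>2 (actY h (cinv \<psi>1 q))"
    if h: "h \<in> fst a" and q: "(snd a h, q) \<in> S" for h q
  proof -
    from q have q1: "q \<in> ?T1" and q2: "u (snd a h, q) \<in> S0" and q3: "F0 (u (snd a h, q)) \<in> ?T2"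
      unfolding S_def S1_def by simp_all
    from q1 obtain y where y: "q = snd \<psi>1 y" "y \<in> fst \<psi>1" "y \<in> fst b" by (elim imageE IntE)
    have cy: "cinv \<psi>1 q = y" using y cinv_chart[OF i1] by simp
    have uy: "u (snd a h, q) = (snd a h, snd b y)" by (simp add: u_def cy)
    note s = S0D[OF h y(3) q2[unfolded uy]]
    have "snd b (actY h y) \<in> ?T2" using q3 s unfolding uy by simp
    then have "actY h y \<in> fst b \<inter> fst \<psi>2"
      using s by (subst (asm) inj_on_image_mem_iff[OF ib]) auto
    moreover have "F (snd a h, q) = snd \<psi>2 (actY h y)"
      unfolding F_def uy using s cinv_chart[OF ib] by simp
    ultimately show ?thesis unfolding cy using y by simp
  qed
  ultimately show ?thesis by (rule that)
qed

text \<open>In charts the flow is \<open>\<Psi> t q = F (e t, q)\<close>, with \<open>F\<close> the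
  action and \<open>e\<close> the one-parameter subgroup. The curve \<open>e\<close> takes values in
  a space without norm and is used as a \<open>BC1\<close> map; second derivatives are taken of
  \<open>F\<close> alone.\<close>

lemma flow_chart:
  fixes \<xi> :: 'k
  assumes p1: "\<psi>1 \<in> max_atlas Y" "y0 \<in> fst \<psi>1" and p2: "\<psi>2 \<in> max_atlas Y" "y0 \<in> fst \<psi>2"
  defines "\<Psi> \<equiv> \<lambda>t q. snd \<psi>2 (fl \<xi> t (cinv \<psi>1 q))"
  obtains N X0 X0' where "open N" "(0::real, snd \<psi>1 y0) \<in> N"
    "\<And>t q. (t, q) \<in> N \<Longrightarrow> q \<in> snd \<psi>1 ` fst \<psi>1 \<and> fl \<xi> t (cinv \<psi>1 q) \<in> fst \<psi>2"
    "BC1 N (\<lambda>z. \<Psi> (fst z) (snd z))"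
    "BC1 (N \<times> UNIV) (\<lambda>z. dirderiv (\<Psi> (fst (fst z))) (snd (fst z)) (snd z))"
    "\<And>q. (0, q) \<in> N \<Longrightarrow> ((\<lambda>t. \<Psi> t q) has_vector_derivative X0 q) (at 0)"
    "\<And>q. (0, q) \<in> N \<Longrightarrow> (X0 has_derivative X0' q) (at q)"
    "\<And>q v. (0, q) \<in> N \<Longrightarrow> ((\<lambda>t. dirderiv (\<Psi> t) q v) has_vector_derivative X0' q v) (at 0)"
proof -
  have "\<one>\<^bsub>G\<^esub> \<in> mpoints A" unfolding mpA by (rule monoid.one_closed[OF group.is_monoid[OF groupG]])
  from chart_at[OF this] have a: "chart_at A \<one>\<^bsub>G\<^esub> \<in> A" "\<one>\<^bsub>G\<^esub> \<in> fst (chart_at A \<one>\<^bsub>G\<^esub>)" by simp_all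
  define a where "a = chart_at A \<one>\<^bsub>G\<^esub>"
  note a = a[folded a_def]
  obtain S F where F: "C2on S F" and S1: "(snd a \<one>\<^bsub>G\<^esub>, snd \<psi>1 y0) \<in> S"
    and SF: "\<And>h q. h \<in> fst a \<Longrightarrow> (snd a h, q) \<in> S \<Longrightarrow> q \<in> snd \<psi>1 ` fst \<psi>1 \<and> actY h (cinv \<psi>1 q) \<in> fst \<psi>2 \<and>
      F (snd a h, q) = snd \<psi>2 (actY h (cinv \<psi>1 q))"
    by (rule action_chart[OF p1 p2 a]) (rule that)
  have tvskE: "tvs TYPE('k \<times> ((real^'m) \<times> 'f))" by (rule tvs_prod[OF tvsk tvs_normed])
  define g where "g t = Exp (t *\<^sub>R \<xi>)" for t :: real
  define E0 where "E0 = {t. g t \<in> fst a}"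
  define e where "e t = snd a (g t)" for t
  define uc where "uc = ((UNIV, id) :: (real, real) chart)"
  have ce: "uc \<in> euc" by (simp add: euc_def uc_def)
  from smooth_map_onD[OF exp_smooth[of \<xi>] ce a(1)]
  have "smooth_on (snd uc ` (fst uc \<inter> UNIV \<inter> g -` fst a)) (snd a \<circ> g \<circ> cinv uc)"
    unfolding g_def[abs_def] .
  moreover have "snd uc ` (fst uc \<inter> UNIV \<inter> g -` fst a) = E0" by (simp add: E0_def vimage_def uc_def)
  moreover have "snd a \<circ> g \<circ> cinv uc = e" by (simp add: fun_eq_iff e_def uc_def)
  ultimately have e1: "BC1 E0 e" using smooth_on_BC1 by simp
  have g0: "g 0 = \<one>\<^bsub>G\<^esub>" unfolding g_def by (rule exp_zero)
  have E00: "0 \<in> E0" using a(2) by (simp add: E0_def g0)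
  define w where "w z = (e (fst z), snd z)" for z :: "real \<times> ((real^'m) \<times> 'f)"
  have oE: "open (E0 \<times> (UNIV :: ((real^'m) \<times> 'f) set))" by (rule open_Times[OF BC1_open[OF e1] open_UNIV])
  have efst: "BC1 (E0 \<times> UNIV) (\<lambda>z :: real \<times> ((real^'m) \<times> 'f). e (fst z))"
    "\<And>z v. z \<in> E0 \<times> UNIV \<Longrightarrow> dirderiv (\<lambda>z :: real \<times> ((real^'m) \<times> 'f). e (fst z)) z v = dirderiv e (fst z) (fst v)"
    by (rule BC1_compose_linear[OF e1 linear_fst' continuous_on_fst_UNIV oE], simp add: image_subset_iff)
       (rule BC1_compose_linear[OF e1 linear_fst' continuous_on_fst_UNIV oE], simp_all add: image_subset_iff)
  note sndB = BC1_linear_map[OF linear_snd' continuous_on_snd_UNIV oE]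
  have w1: "BC1 (E0 \<times> UNIV) w" unfolding w_def by (rule BC1_Pair(1)[OF efst(1) sndB(1)])
  have w2: "dirderiv w z v = (dirderiv e (fst z) (fst v), snd v)" if "z \<in> E0 \<times> UNIV" for z v
    using BC1_Pair(2)[OF efst(1) sndB(1) that, of v] efst(2)[OF that, of v] sndB(2)[of z v] by (simp add: w_def[abs_def])
  define N where "N = w -` S \<inter> (E0 \<times> UNIV)"
  have oS: "open S" by (rule C2on_open[OF F])
  have oO: "open N" unfolding N_def
    using continuous_on_open_vimage[OF oE, THEN iffD1, OF BC1_cont[OF w1]] oS by blast
  have OD: "t \<in> E0 \<and> (e t, q) \<in> S" if "(t, q) \<in> N" for t q using that by (simp add: N_def w_def)
  have wO: "BC1 N w" by (rule BC1_subset[OF w1 oO]) (simp add: N_def)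
  have wOS: "w ` N \<subseteq> S" by (auto simp: N_def)
  have O0: "(0, snd \<psi>1 y0) \<in> N" using S1 E00 by (simp add: N_def w_def e_def g0)
  have F1: "BC1 S F" and F2: "BC1 (S \<times> UNIV) (\<lambda>(x, v). dirderiv F x v)" using F by (simp_all add: C2on_def)
  have \<Psi>: "\<Psi> t q = F (e t, q) \<and> q \<in> snd \<psi>1 ` fst \<psi>1 \<and> fl \<xi> t (cinv \<psi>1 q) \<in> fst \<psi>2" if "(t, q) \<in> N" for t q
    using SF[of "g t" q] OD[OF that] by (simp add: \<Psi>_def fl_def g_def[symmetric] E0_def e_def)
  have \<Psi>': "F (w z) = \<Psi> (fst z) (snd z)" if "z \<in> N" for z
    using \<Psi>[of "fst z" "snd z"] that by (simp add: w_def)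
  have B1: "BC1 N (\<lambda>z. \<Psi> (fst z) (snd z))"
    by (rule BC1_cong[OF tvs_normed BC1_compose(1)[OF tvskE F1 wO wOS] \<Psi>'])
  have dq: "dirderiv (\<Psi> t) q v = dirderiv F (e t, q) (0, v)" if tq: "(t, q) \<in> N" for t q v
  proof -
    have "open (Pair t -` N)" by (intro open_vimage oO continuous_intros)
    from eventually_nhds_in_open[OF this] tq have "\<forall>\<^sub>F q' in nhds q. (t, q') \<in> N" by simp
    then have "\<forall>\<^sub>F q' in nhds q. \<Psi> t q' = F (e t, q')" by eventually_elim (simp add: \<Psi>)
    then have "dirderiv (\<Psi> t) q v = dirderiv (\<lambda>q'. F (e t, q')) q v" by (rule dirderiv_cong_ev[OF tvs_normed])
    also have "\<dots> = dirderiv F (e t, q) (0, v)"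
    proof (rule has_dirderivD)
      have "(e t, q) \<in> S" using OD[OF tq] by simp
      from BC1_dirderiv[OF F1 this, of "(0, v)"]
      show "has_dirderiv (\<lambda>q'. F (e t, q')) q v (dirderiv F (e t, q) (0, v))" by (simp add: has_dirderiv_def)
    qed
    finally show ?thesis .
  qed
  \<comment> \<open>Spatial derivatives of \<open>\<Psi>\<close> are derivatives of \<open>F\<close>
    in directions \<open>(0, v)\<close>, so joint regularity in time, point and vector is that of
    the tangent map of \<open>F\<close> after \<open>W\<close>.\<close>
  define W where "W z = (w (fst z), (0::'k, snd z))" for z :: "(real \<times> ((real^'m) \<times> 'f)) \<times> ((real^'m) \<times> 'f)"
  have oOU: "open (N \<times> (UNIV :: ((real^'m) \<times> 'f) set))" by (rule open_Times[OF oO open_UNIV])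
  have wf: "BC1 (N \<times> UNIV) (\<lambda>z :: (real \<times> ((real^'m) \<times> 'f)) \<times> ((real^'m) \<times> 'f). w (fst z))"
    "\<And>z v. z \<in> N \<times> UNIV \<Longrightarrow> dirderiv (\<lambda>z :: (real \<times> ((real^'m) \<times> 'f)) \<times> ((real^'m) \<times> 'f). w (fst z)) z v = dirderiv w (fst z) (fst v)"
    by (rule BC1_compose_linear[OF wO linear_fst' continuous_on_fst_UNIV oOU], simp add: image_subset_iff)
       (rule BC1_compose_linear[OF wO linear_fst' continuous_on_fst_UNIV oOU], simp_all add: image_subset_iff)
  have l0: "linear (\<lambda>z :: (real \<times> ((real^'m) \<times> 'f)) \<times> ((real^'m) \<times> 'f). (0::'k, snd z))" by (rule linearI) simp_all
  have c0: "continuous_on UNIV (\<lambda>z :: (real \<times> ((real^'m) \<times> 'f)) \<times> ((real^'m) \<times> 'f). (0::'k, snd z))"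
    by (intro continuous_on_Pair continuous_on_const continuous_on_snd_UNIV)
  note s0 = BC1_linear_map[OF l0 c0 oOU]
  have W1: "BC1 (N \<times> UNIV) W" unfolding W_def by (rule BC1_Pair(1)[OF wf(1) s0(1)])
  have W2: "dirderiv W z v = (dirderiv w (fst z) (fst v), (0, snd v))" if "z \<in> N \<times> UNIV" for z v
    using BC1_Pair(2)[OF wf(1) s0(1) that, of v] wf(2)[OF that, of v] s0(2)[of z v] by (simp add: W_def[abs_def])
  have WS: "W ` (N \<times> UNIV) \<subseteq> S \<times> UNIV" using wOS by (auto simp: W_def)
  note tvs2 = tvs_prod[OF tvskE tvskE]
  note G1 = BC1_compose[OF tvs2 F2 W1 WS]
  have Geq: "(\<lambda>(x, v). dirderiv F x v) (W z) = dirderiv (\<Psi> (fst (fst z))) (snd (fst z)) (snd z)" if "z \<in> N \<times> UNIV" for z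
    using dq[of "fst (fst z)" "snd (fst z)" "snd z"] that by (auto simp: W_def w_def)
  have B2: "BC1 (N \<times> UNIV) (\<lambda>z. dirderiv (\<Psi> (fst (fst z))) (snd (fst z)) (snd z))"
    by (rule BC1_cong[OF tvs_normed G1(1) Geq])
  define \<epsilon> where "\<epsilon> = dirderiv e 0 1"
  \<comment> \<open>The generator is the derivative of the action in the group variable, in the
    direction of the subgroup.\<close>
  define X0 where "X0 q = dirderiv F (e 0, q) (\<epsilon>, 0)" for q
  have V1: "((\<lambda>t. \<Psi> t q) has_vector_derivative X0 q) (at 0)" if q: "(0, q) \<in> N" for q
  proof -
    have "dirderiv (\<lambda>z. \<Psi> (fst z) (snd z)) (0, q) (1, 0) = dirderiv (\<lambda>z. F (w z)) (0, q) (1, 0)"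
      by (rule dirderiv_cong_open[OF tvs_normed oO q, symmetric]) (rule \<Psi>')
    also have "\<dots> = dirderiv F (w (0, q)) (dirderiv w (0, q) (1, 0))"
      by (rule BC1_compose(2)[OF tvskE F1 wO wOS q])
    also have "\<dots> = X0 q" using w2[of "(0, q)" "(1, 0)"] E00 by (simp add: X0_def \<epsilon>_def w_def)
    finally have "has_dirderiv (\<lambda>z. \<Psi> (fst z) (snd z)) (0, q) (1, 0) (X0 q)"
      using BC1_dirderiv[OF B1 q, of "(1, 0)"] by simp
    from has_dirderiv_vector_0[OF this] show ?thesis by simp
  qed
  have X0d: "(X0 has_derivative (\<lambda>v. d2 F (e 0, q) (\<epsilon>, 0) (0, v))) (at q)" if q: "(0, q) \<in> N" for q
  proof -
    define Q where "Q = Pair (0::real) -` N"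
    have oQ: "open Q" unfolding Q_def by (intro open_vimage oO continuous_intros)
    define U where "U q' = ((e 0, q'), (\<epsilon>, 0::(real^'m) \<times> 'f))" for q' :: "(real^'m) \<times> 'f"
    note cB = BC1_const[OF oQ, of "e 0"] and idB = BC1_linear_map[OF linear_ident continuous_on_id oQ]
      and c2B = BC1_const[OF oQ, of "(\<epsilon>, 0::(real^'m) \<times> 'f)"]
    note p1B = BC1_Pair[OF cB(1) idB(1)]
    note p2B = BC1_Pair[OF p1B(1) c2B(1)]
    have qQ: "q \<in> Q" using q by (simp add: Q_def)
    have U1: "BC1 Q U" unfolding U_def by (rule p2B(1))
    have U2: "dirderiv U q v = ((0, v), (0, 0))" for v
      using p2B(2)[OF qQ, of v] p1B(2)[OF qQ, of v] cB(2)[of q v] c2B(2)[of q v] idB(2)[of q v]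
      by (simp add: U_def[abs_def] zero_prod_def)
    have US: "U ` Q \<subseteq> S \<times> UNIV" using OD by (auto simp: U_def Q_def)
    note C = BC1_compose[OF tvs2 F2 U1 US]
    have X0U: "(\<lambda>q. (\<lambda>(x, v). dirderiv F x v) (U q)) = X0" by (simp add: fun_eq_iff U_def X0_def)
    have eS: "(e 0, q) \<in> S" using OD[OF q] by simp
    have "dirderiv X0 q v = d2 F (e 0, q) (\<epsilon>, 0) (0, v)" for v
    proof -
      have "dirderiv X0 q v = dirderiv (\<lambda>(x, v). dirderiv F x v) (U q) (dirderiv U q v)"
        using C(2)[OF qQ, of v] unfolding X0U .
      also have "\<dots> = d2 F (e 0, q) (\<epsilon>, 0) (0, v) + dirderiv F (e 0, q) (0, 0)"
        unfolding U2 unfolding U_def by (rule C2on_d2(2)[OF tvskE F eS])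
      also have "dirderiv F (e 0, q) (0, 0) = 0"
        using linear_0[OF BC1_linear[OF tvskE F1 eS]] by (simp add: zero_prod_def)
      finally show ?thesis by simp
    qed
    then have "dirderiv X0 q = (\<lambda>v. d2 F (e 0, q) (\<epsilon>, 0) (0, v))" by (rule ext)
    with BC1_has_derivative[OF fdE C(1)[unfolded X0U] qQ] show ?thesis by simp
  qed
  have V2: "((\<lambda>t. dirderiv (\<Psi> t) q v) has_vector_derivative d2 F (e 0, q) (\<epsilon>, 0) (0, v)) (at 0)" if q: "(0, q) \<in> N" for q v
  proof -
    let ?z = "((0::real, q), v)" let ?d = "((1::real, 0::(real^'m) \<times> 'f), 0::(real^'m) \<times> 'f)"
    have z: "?z \<in> N \<times> UNIV" using q by simp
    have eS: "(e 0, q) \<in> S" using OD[OF q] by simp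
    have "dirderiv (\<lambda>z. dirderiv (\<Psi> (fst (fst z))) (snd (fst z)) (snd z)) ?z ?d = dirderiv (\<lambda>z. (\<lambda>(x, v). dirderiv F x v) (W z)) ?z ?d"
      by (rule dirderiv_cong_open[OF tvs_normed oOU z, symmetric]) (rule Geq)
    also have "\<dots> = dirderiv (\<lambda>(x, v). dirderiv F x v) (W ?z) (dirderiv W ?z ?d)" by (rule G1(2)[OF z])
    also have "\<dots> = dirderiv (\<lambda>(x, v). dirderiv F x v) ((e 0, q), (0, v)) ((\<epsilon>, 0), (0, 0))"
      using W2[OF z, of ?d] w2[of "(0, q)" "(1, 0)"] E00 by (simp add: W_def w_def \<epsilon>_def)
    also have "\<dots> = d2 F (e 0, q) (0, v) (\<epsilon>, 0) + dirderiv F (e 0, q) (0, 0)"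
      by (rule C2on_d2(2)[OF tvskE F eS])
    also have "dirderiv F (e 0, q) (0, 0) = 0"
      using linear_0[OF BC1_linear[OF tvskE F1 eS]] by (simp add: zero_prod_def)
    \<comment> \<open>Exchanging the group direction with the spatial direction identifies the time
      derivative of the tangent flow with the spatial derivative of the generator.\<close>
    also have "d2 F (e 0, q) (0, v) (\<epsilon>, 0) + 0 = d2 F (e 0, q) (\<epsilon>, 0) (0, v)"
      using d2_commute[OF tvskE F eS] by simp
    finally have "has_dirderiv (\<lambda>z. dirderiv (\<Psi> (fst (fst z))) (snd (fst z)) (snd z)) ?z ?d (d2 F (e 0, q) (\<epsilon>, 0) (0, v))"
      using BC1_dirderiv[OF B2 z, of ?d] by simp
    from has_dirderiv_vector_0[OF this] show ?thesis by simp
  qed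
  show ?thesis
    by (rule that[OF oO O0 _ B1 B2 V1 X0d V2]) (use \<Psi> in blast)
qed

end

section \<open>The flow in one fibered chart\<close>

context noether
begin

definition "flc \<xi> \<psi> t q = snd \<psi> (fl \<xi> t (cinv (\<psi> :: ('y, (real^'m) \<times> 'f) chart) q))"

text \<open>\<open>N\<close> is a neighbourhood of \<open>(0, \<psi> y\<^sub>0)\<close> on which the flow stays in the chart \<open>\<psi>\<close>, \<open>\<Xi>\<close> is the infinitesimal
  generator in this chart and \<open>\<Xi>'\<close> is its derivative.\<close>

definition "flow_data \<xi> \<psi> y0 N \<Xi> \<Xi>' \<longleftrightarrow> open N \<and> (0::real, snd \<psi> y0) \<in> N \<and>
    (\<forall>t q. (t, q) \<in> N \<longrightarrow> q \<in> snd \<psi> ` fst \<psi> \<and> fl \<xi> t (cinv \<psi> q) \<in> fst \<psi>) \<and>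
    BC1 N (\<lambda>z. flc \<xi> \<psi> (fst z) (snd z)) \<and>
    BC1 (N \<times> UNIV) (\<lambda>z. dirderiv (flc \<xi> \<psi> (fst (fst z))) (snd (fst z)) (snd z)) \<and>
    (\<forall>q. (0, q) \<in> N \<longrightarrow> ((\<lambda>t. flc \<xi> \<psi> t q) has_vector_derivative \<Xi> q) (at 0)) \<and>
    (\<forall>q. (0, q) \<in> N \<longrightarrow> (\<Xi> has_derivative \<Xi>' q) (at q)) \<and>
    (\<forall>q v. (0, q) \<in> N \<longrightarrow> ((\<lambda>t. dirderiv (flc \<xi> \<psi> t) q v) has_vector_derivative \<Xi>' q v) (at 0))"

lemma flow_data_exists:
  fixes \<xi> :: 'k
  assumes "\<psi> \<in> max_atlas Y" "y0 \<in> fst \<psi>"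
  obtains N \<Xi> \<Xi>' where "flow_data \<xi> \<psi> y0 N \<Xi> \<Xi>'"
proof -
  obtain N \<Xi> \<Xi>' where N: "open N" "(0::real, snd \<psi> y0) \<in> N"
    "\<And>t q. (t, q) \<in> N \<Longrightarrow> q \<in> snd \<psi> ` fst \<psi> \<and> fl \<xi> t (cinv \<psi> q) \<in> fst \<psi>"
    "BC1 N (\<lambda>z. (\<lambda>t q. snd \<psi> (fl \<xi> t (cinv \<psi> q))) (fst z) (snd z))"
    "BC1 (N \<times> UNIV) (\<lambda>z. dirderiv ((\<lambda>t q. snd \<psi> (fl \<xi> t (cinv \<psi> q))) (fst (fst z))) (snd (fst z)) (snd z))"
    "\<And>q. (0, q) \<in> N \<Longrightarrow> ((\<lambda>t. (\<lambda>t q. snd \<psi> (fl \<xi> t (cinv \<psi> q))) t q) has_vector_derivative \<Xi> q) (at 0)"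
    "\<And>q. (0, q) \<in> N \<Longrightarrow> (\<Xi> has_derivative \<Xi>' q) (at q)"
    "\<And>q v. (0, q) \<in> N \<Longrightarrow> ((\<lambda>t. dirderiv ((\<lambda>t q. snd \<psi> (fl \<xi> t (cinv \<psi> q))) t) q v) has_vector_derivative \<Xi>' q v) (at 0)"
    by (rule flow_chart[OF assms assms, of \<xi>]) (rule that)
  have "flow_data \<xi> \<psi> y0 N \<Xi> \<Xi>'"
    unfolding flow_data_def flc_def[abs_def] by (intro conjI allI impI N(1,2,4-8)) (rule conjunct1[OF N(3)], assumption, rule conjunct2[OF N(3)], assumption+)
  then show ?thesis by (rule that)
qed

context
  fixes \<xi> c \<psi> y0 N \<Xi> \<Xi>'
  assumes k: "(c, \<psi>) \<in> fib_charts X Y \<pi>" and y0: "y0 \<in> fst \<psi>" and fd: "flow_data \<xi> \<psi> y0 N \<Xi> \<Xi>'"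
begin

lemma flN: "open N" "(0, snd \<psi> y0) \<in> N"
  "(t, q) \<in> N \<Longrightarrow> q \<in> snd \<psi> ` fst \<psi>" "(t, q) \<in> N \<Longrightarrow> cinv \<psi> q \<in> fst \<psi>" "(t, q) \<in> N \<Longrightarrow> snd \<psi> (cinv \<psi> q) = q"
  "(t, q) \<in> N \<Longrightarrow> fl \<xi> t (cinv \<psi> q) \<in> fst \<psi>"
  "(t, q) \<in> N \<Longrightarrow> cinv \<psi> (flc \<xi> \<psi> t q) = fl \<xi> t (cinv \<psi> q)"
  "(t, q) \<in> N \<Longrightarrow> cinv \<psi> q \<in> mpoints Y"
  "(0, q) \<in> N \<Longrightarrow> ((\<lambda>t. flc \<xi> \<psi> t q) has_vector_derivative \<Xi> q) (at 0)"
  "(0, q) \<in> N \<Longrightarrow> (\<Xi> has_derivative \<Xi>' q) (at q)"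
  "(0, q) \<in> N \<Longrightarrow> ((\<lambda>t. dirderiv (flc \<xi> \<psi> t) q v) has_vector_derivative \<Xi>' q v) (at 0)"
proof -
  have F: "open N" "(0, snd \<psi> y0) \<in> N"
    "\<forall>t q. (t, q) \<in> N \<longrightarrow> q \<in> snd \<psi> ` fst \<psi> \<and> fl \<xi> t (cinv \<psi> q) \<in> fst \<psi>"
    "\<forall>q. (0, q) \<in> N \<longrightarrow> ((\<lambda>t. flc \<xi> \<psi> t q) has_vector_derivative \<Xi> q) (at 0)"
    "\<forall>q. (0, q) \<in> N \<longrightarrow> (\<Xi> has_derivative \<Xi>' q) (at q)"
    "\<forall>q v. (0, q) \<in> N \<longrightarrow> ((\<lambda>t. dirderiv (flc \<xi> \<psi> t) q v) has_vector_derivative \<Xi>' q v) (at 0)"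
    using fd unfolding flow_data_def by - (elim conjE, assumption)+
  show "open N" "(0, snd \<psi> y0) \<in> N" by (rule F(1), rule F(2))
  have F3: "q \<in> snd \<psi> ` fst \<psi> \<and> fl \<xi> t (cinv \<psi> q) \<in> fst \<psi>" if "(t, q) \<in> N" for t q
    by (rule F(3)[rule_format, OF that])
  show i: "q \<in> snd \<psi> ` fst \<psi>" if "(t, q) \<in> N" for t q by (rule conjunct1[OF F3[OF that]])
  show f: "fl \<xi> t (cinv \<psi> q) \<in> fst \<psi>" if "(t, q) \<in> N" for t q by (rule conjunct2[OF F3[OF that]])
  show c: "cinv \<psi> q \<in> fst \<psi>" if "(t, q) \<in> N" for t q by (rule chart_cinv(2)[OF i[OF that]])
  show "snd \<psi> (cinv \<psi> q) = q" if "(t, q) \<in> N" for t q by (rule chart_cinv(1)[OF i[OF that]])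
  show "cinv \<psi> (flc \<xi> \<psi> t q) = fl \<xi> t (cinv \<psi> q)" if "(t, q) \<in> N" for t q
    unfolding flc_def by (rule fib_inj[OF k f[OF that]])
  show "cinv \<psi> q \<in> mpoints Y" if "(t, q) \<in> N" for t q by (rule fib_chartsD(5)[OF k c[OF that]])
  show "((\<lambda>t. flc \<xi> \<psi> t q) has_vector_derivative \<Xi> q) (at 0)" if "(0, q) \<in> N" for q
    by (rule F(4)[rule_format, OF that])
  show "(\<Xi> has_derivative \<Xi>' q) (at q)" if "(0, q) \<in> N" for q
    by (rule F(5)[rule_format, OF that])
  show "((\<lambda>t. dirderiv (flc \<xi> \<psi> t) q v) has_vector_derivative \<Xi>' q v) (at 0)" if "(0, q) \<in> N" for q v
    by (rule F(6)[rule_format, OF that])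
qed

lemma flc_zero: "(0, q) \<in> N \<Longrightarrow> flc \<xi> \<psi> 0 q = q"
  unfolding flc_def using fl_zero[OF flN(8)] flN(5) by simp

lemma eventually_N: "(t, q) \<in> N \<Longrightarrow> \<forall>\<^sub>F q' in nhds q. (t, q') \<in> N"
proof -
  assume "(t, q) \<in> N"
  have "open (Pair t -` N)" by (intro open_vimage flN(1) continuous_intros)
  from eventually_nhds_in_open[OF this, of q] \<open>(t, q) \<in> N\<close> show ?thesis by simp
qed

lemma fdRE: "findim TYPE(real \<times> ((real^'m) \<times> 'f))" by (rule findim_prod[OF findim_euclidean fdE])

lemma flc_joint: "(t, q) \<in> N \<Longrightarrow> ((\<lambda>z. flc \<xi> \<psi> (fst z) (snd z)) has_derivative dirderiv (\<lambda>z. flc \<xi> \<psi> (fst z) (snd z)) (t, q)) (at (t, q))"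
  using fd unfolding flow_data_def by (intro BC1_has_derivative[OF fdRE, of N]) simp_all

lemma flc_has_derivative:
  assumes "(t, q) \<in> N" shows "(flc \<xi> \<psi> t has_derivative dirderiv (flc \<xi> \<psi> t) q) (at q)"
proof -
  have "((\<lambda>q'. (\<lambda>z. flc \<xi> \<psi> (fst z) (snd z)) (t, q')) has_derivative
      (\<lambda>v. dirderiv (\<lambda>z. flc \<xi> \<psi> (fst z) (snd z)) (t, q) (0, v))) (at q)"
    by (rule has_derivative_compose[OF has_derivative_Pair[OF has_derivative_const has_derivative_ident] flc_joint[OF assms]])
  then have h: "(flc \<xi> \<psi> t has_derivative (\<lambda>v. dirderiv (\<lambda>z. flc \<xi> \<psi> (fst z) (snd z)) (t, q) (0, v))) (at q)" by simp
  have "dirderiv (flc \<xi> \<psi> t) q = (\<lambda>v. dirderiv (\<lambda>z. flc \<xi> \<psi> (fst z) (snd z)) (t, q) (0, v))"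
    by (rule ext) (rule dirderiv_eq_has_derivative[OF h])
  with h show ?thesis by simp
qed

lemma Dflc_zero: assumes "(0, q) \<in> N" shows "dirderiv (flc \<xi> \<psi> 0) q v = v"
proof -
  have "\<forall>\<^sub>F q' in nhds q. flc \<xi> \<psi> 0 q' = q'" using eventually_N[OF assms] by eventually_elim (rule flc_zero)
  from has_derivative_cong_nhds[OF flc_has_derivative[OF assms] this]
  have "((\<lambda>q'. q') has_derivative dirderiv (flc \<xi> \<psi> 0) q) (at q)" .
  from has_derivative_unique[OF this has_derivative_ident] show ?thesis by (rule fun_cong)
qed

lemma fst_flc:
  assumes "(t, q) \<in> N" shows "fst (flc \<xi> \<psi> t q) = snd c (flX \<xi> t (cinv c (fst q)))"
    and "cinv c (fst q) = \<pi> (cinv \<psi> q)" "flX \<xi> t (cinv c (fst q)) \<in> fst c"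
proof -
  have "fst q = snd c (\<pi> (cinv \<psi> q))" using fib_chartsD(4)[OF k flN(4)[OF assms]] flN(5)[OF assms] by simp
  then show 1: "cinv c (fst q) = \<pi> (cinv \<psi> q)"
    using cinv_chart[OF max_atlasD(1)[OF fib_chartsD(1)[OF k]] fib_chartsD(3)[OF k flN(4)[OF assms]]] by simp
  have 2: "\<pi> (fl \<xi> t (cinv \<psi> q)) = flX \<xi> t (cinv c (fst q))" unfolding 1 by (rule fl_proj[OF flN(8)[OF assms]])
  show "fst (flc \<xi> \<psi> t q) = snd c (flX \<xi> t (cinv c (fst q)))"
    unfolding flc_def fib_chartsD(4)[OF k flN(6)[OF assms]] 2 ..
  show "flX \<xi> t (cinv c (fst q)) \<in> fst c" using fib_chartsD(3)[OF k flN(6)[OF assms]] unfolding 2 .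
qed

text \<open>The flow covers a map of \<open>X\<close>, so its base component does not change along a
  fiber.\<close>

lemma Dflc_vertical: assumes "(t, q) \<in> N" shows "fst (dirderiv (flc \<xi> \<psi> t) q (0, b)) = 0"
proof -
  have "((\<lambda>s. fst (flc \<xi> \<psi> t (fst q, s))) has_derivative (\<lambda>b. fst (dirderiv (flc \<xi> \<psi> t) q (0, b)))) (at (snd q))"
  proof (rule has_derivative_fst)
    have "(flc \<xi> \<psi> t has_derivative dirderiv (flc \<xi> \<psi> t) q) (at (fst q, snd q))" using flc_has_derivative[OF assms] by simp
    from has_derivative_compose[OF has_derivative_Pair[OF has_derivative_const has_derivative_ident] this]
    show "((\<lambda>s. flc \<xi> \<psi> t (fst q, s)) has_derivative (\<lambda>b. dirderiv (flc \<xi> \<psi> t) q (0, b))) (at (snd q))" .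
  qed
  moreover have "\<forall>\<^sub>F s in nhds (snd q). fst (flc \<xi> \<psi> t (fst q, s)) = snd c (flX \<xi> t (cinv c (fst q)))"
  proof -
    have "open ((\<lambda>s. (t, (fst q, s))) -` N)" by (intro open_vimage flN(1) continuous_intros)
    from eventually_nhds_in_open[OF this, of "snd q"] assms have "\<forall>\<^sub>F s in nhds (snd q). (t, (fst q, s)) \<in> N" by simp
    then show ?thesis by eventually_elim (use fst_flc(1) in simp)
  qed
  ultimately have "((\<lambda>s. snd c (flX \<xi> t (cinv c (fst q)))) has_derivative (\<lambda>b. fst (dirderiv (flc \<xi> \<psi> t) q (0, b)))) (at (snd q))"
    by (rule has_derivative_cong_nhds)
  from has_derivative_unique[OF this has_derivative_const] show ?thesis by (rule fun_cong)
qed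

lemma flc_inverse:
  assumes "(t, q) \<in> N" shows "flc \<xi> \<psi> (- t) (flc \<xi> \<psi> t q) = q"
  unfolding flc_def[of \<xi> \<psi> "- t"] flN(7)[OF assms] fl_inverse[OF flN(8)[OF assms]] by (rule flN(5)[OF assms])

lemma Dflc_inverse:
  assumes tq: "(t, q) \<in> N" and tq': "(- t, flc \<xi> \<psi> t q) \<in> N"
  shows "dirderiv (flc \<xi> \<psi> t) q (dirderiv (flc \<xi> \<psi> (- t)) (flc \<xi> \<psi> t q) v) = v"
proof -
  let ?r = "flc \<xi> \<psi> t q"
  have "(flc \<xi> \<psi> t has_derivative dirderiv (flc \<xi> \<psi> t) q) (at (flc \<xi> \<psi> (- t) ?r))"
    unfolding flc_inverse[OF tq] by (rule flc_has_derivative[OF tq])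
  from has_derivative_compose[OF flc_has_derivative[OF tq'] this]
  have 1: "((\<lambda>r. flc \<xi> \<psi> t (flc \<xi> \<psi> (- t) r)) has_derivative (\<lambda>v. dirderiv (flc \<xi> \<psi> t) q (dirderiv (flc \<xi> \<psi> (- t)) ?r v))) (at ?r)" .
  have 2: "\<forall>\<^sub>F r in nhds ?r. flc \<xi> \<psi> t (flc \<xi> \<psi> (- t) r) = r"
    using eventually_N[OF tq']
  proof eventually_elim
    case (elim r)
    from flc_inverse[OF this] show ?case by simp
  qed
  from has_derivative_unique[OF has_derivative_cong_nhds[OF 1 2] has_derivative_ident] show ?thesis by (rule fun_cong)
qed

abbreviation "q0 \<equiv> snd \<psi> y0"

text \<open>The second condition makes the inverse flow at the moved point available in the same
  chart.\<close>

lemma curve_N: "\<forall>\<^sub>F t in nhds (0::real). (t, q0) \<in> N \<and> (- t, flc \<xi> \<psi> t q0) \<in> N"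
proof -
  have "isCont (\<lambda>t. flc \<xi> \<psi> t q0) 0" using flN(9)[OF flN(2)] by (rule has_vector_derivative_continuous)
  define g where "g t = (- t, flc \<xi> \<psi> t q0)" for t
  have "isCont g 0" unfolding g_def[abs_def] using \<open>isCont (\<lambda>t. flc \<xi> \<psi> t q0) 0\<close> by (intro continuous_intros)
  then have "(g \<longlongrightarrow> g 0) (nhds 0)" unfolding isCont_def tendsto_at_iff_tendsto_nhds .
  moreover have "g 0 = (0, q0)" using flc_zero[OF flN(2)] by (simp add: g_def)
  ultimately have 1: "\<forall>\<^sub>F t in nhds 0. (- t, flc \<xi> \<psi> t q0) \<in> N"
    using topological_tendstoD[of g "(0, q0)" "nhds 0" N] flN(1,2) by (simp add: g_def)
  have "open ((\<lambda>t. (t, q0)) -` N)" by (intro open_vimage flN(1) continuous_intros)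
  from eventually_nhds_in_open[OF this, of 0] flN(2) have "\<forall>\<^sub>F t in nhds 0. (t, q0) \<in> N" by simp
  from eventually_conj[OF this 1] show ?thesis .
qed

abbreviation "GD \<equiv> \<lambda>z. dirderiv (flc \<xi> \<psi> (fst (fst z))) (snd (fst z)) (snd z)"

text \<open>At time \<open>0\<close> the tangent flow is the identity at every point: its partial
  derivative in the point vanishes and the one in the vector is the identity. The time derivative is
  part of \<open>flow_data\<close>.\<close>

lemma GD_derivative:
  "(GD has_derivative dirderiv GD ((0, q0), w)) (at ((0, q0), w))"
  "dirderiv GD ((0, q0), w) ((1, 0), 0) = \<Xi>' q0 w"
  "dirderiv GD ((0, q0), w) ((0, r), 0) = 0"
  "dirderiv GD ((0, q0), w) ((0, 0), u) = u"
proof -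
  have fd2: "findim TYPE((real \<times> ((real^'m) \<times> 'f)) \<times> ((real^'m) \<times> 'f))" by (rule findim_prod[OF fdRE fdE])
  have B: "BC1 (N \<times> UNIV) GD" using fd unfolding flow_data_def by (elim conjE)
  show D: "(GD has_derivative dirderiv GD ((0, q0), w)) (at ((0, q0), w))"
    by (rule BC1_has_derivative[OF fd2 B]) (simp add: flN(2))
  let ?D = "dirderiv GD ((0, q0), w)"
  have "((\<lambda>t. GD ((t, q0), w)) has_derivative (\<lambda>h. ?D ((h, 0), 0))) (at 0)"
    by (rule has_derivative_compose[OF has_derivative_Pair[OF has_derivative_Pair[OF has_derivative_ident has_derivative_const] has_derivative_const] D])
  moreover have "((\<lambda>t. GD ((t, q0), w)) has_derivative (\<lambda>h. h *\<^sub>R \<Xi>' q0 w)) (at 0)"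
    using flN(11)[OF flN(2), of w] by (simp add: has_vector_derivative_def)
  ultimately have "(\<lambda>h. ?D ((h, 0), 0)) = (\<lambda>h. h *\<^sub>R \<Xi>' q0 w)" by (rule has_derivative_unique)
  from fun_cong[OF this, of 1] show "?D ((1, 0), 0) = \<Xi>' q0 w" by simp
  have 1: "((\<lambda>q. GD ((0, q), w)) has_derivative (\<lambda>h. ?D ((0, h), 0))) (at q0)"
    by (rule has_derivative_compose[OF has_derivative_Pair[OF has_derivative_Pair[OF has_derivative_const has_derivative_ident] has_derivative_const] D])
  have "\<forall>\<^sub>F q in nhds q0. GD ((0, q), w) = w"
    using eventually_N[OF flN(2)] by eventually_elim (simp add: Dflc_zero)
  from has_derivative_unique[OF has_derivative_cong_nhds[OF 1 this] has_derivative_const]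
  show "?D ((0, r), 0) = 0" by (rule fun_cong)
  have 2: "((\<lambda>v. GD ((0, q0), v)) has_derivative (\<lambda>h. ?D ((0, 0), h))) (at w)"
    by (rule has_derivative_compose[OF has_derivative_Pair[OF has_derivative_Pair[OF has_derivative_const has_derivative_const] has_derivative_ident] D])
  have "\<forall>\<^sub>F v in nhds w. GD ((0, q0), v) = v" by (rule always_eventually) (simp add: Dflc_zero[OF flN(2)])
  from has_derivative_unique[OF has_derivative_cong_nhds[OF 2 this] has_derivative_ident]
  show "?D ((0, 0), u) = u" by (rule fun_cong)
qed

text \<open>The three partial derivatives added up along a curve; the velocity of \<open>r\<close>
  drops out because the partial derivative in the point is \<open>0\<close>. The sign
  \<open>\<sigma> = -1\<close> serves the inverse flow.\<close>

lemma GD_curve: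
  assumes r: "(r has_vector_derivative r') (at 0)" "r 0 = q0" and u: "(u has_vector_derivative u') (at 0)"
    and \<sigma>: "\<sigma> = 1 \<or> \<sigma> = -1"
  shows "((\<lambda>t. dirderiv (flc \<xi> \<psi> (\<sigma> * t)) (r t) (u t)) has_vector_derivative \<sigma> *\<^sub>R \<Xi>' q0 (u 0) + u') (at 0)"
proof -
  let ?D = "dirderiv GD ((0, q0), u 0)"
  have c: "((\<lambda>t. ((\<sigma> * t, r t), u t)) has_derivative (\<lambda>h. ((\<sigma> * h, h *\<^sub>R r'), h *\<^sub>R u'))) (at 0)"
    using r(1) u unfolding has_vector_derivative_def
    by (intro has_derivative_Pair has_derivative_mult_right has_derivative_ident)
  have "((\<sigma> * 0, r 0), u 0) = ((0, q0), u 0)" using r(2) by simp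
  then have D: "(GD has_derivative ?D) (at ((\<sigma> * 0, r 0), u 0))" using GD_derivative(1)[of "u 0"] by simp
  note lin = has_derivative_linear[OF GD_derivative(1)[of "u 0"]]
  have "?D ((\<sigma> * h, h *\<^sub>R r'), h *\<^sub>R u') = h *\<^sub>R (\<sigma> *\<^sub>R \<Xi>' q0 (u 0) + u')" for h
  proof -
    have "((\<sigma> * h, h *\<^sub>R r'), h *\<^sub>R u') = (h * \<sigma>) *\<^sub>R ((1, 0), 0) + h *\<^sub>R ((0, r'), 0) + h *\<^sub>R ((0, 0), u')" by simp
    then have "?D ((\<sigma> * h, h *\<^sub>R r'), h *\<^sub>R u') = (h * \<sigma>) *\<^sub>R ?D ((1, 0), 0) + h *\<^sub>R ?D ((0, r'), 0) + h *\<^sub>R ?D ((0, 0), u')"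
      by (simp only: linear_add[OF lin] linear_cmul[OF lin])
    then show ?thesis unfolding GD_derivative(2-4) by (simp add: scaleR_add_right)
  qed
  with has_derivative_compose[OF c D] show ?thesis unfolding has_vector_derivative_def by simp
qed

lemma fst_\<Xi>'_vertical: "fst (\<Xi>' q0 (0, b)) = 0"
proof -
  have "((\<lambda>t. dirderiv (flc \<xi> \<psi> t) q0 (0, b)) has_derivative (\<lambda>h. h *\<^sub>R \<Xi>' q0 (0, b))) (at 0)"
    using flN(11)[OF flN(2)] by (simp add: has_vector_derivative_def)
  from has_derivative_fst[OF this]
  have 1: "((\<lambda>t. fst (dirderiv (flc \<xi> \<psi> t) q0 (0, b))) has_derivative (\<lambda>h. fst (h *\<^sub>R \<Xi>' q0 (0, b)))) (at 0)" .
  have "\<forall>\<^sub>F t in nhds 0. fst (dirderiv (flc \<xi> \<psi> t) q0 (0, b)) = 0"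
    using curve_N by eventually_elim (simp add: Dflc_vertical)
  from has_derivative_unique[OF has_derivative_cong_nhds[OF 1 this] has_derivative_const]
  have "(\<lambda>h. fst (h *\<^sub>R \<Xi>' q0 (0, b))) = (\<lambda>h. 0)" .
  from fun_cong[OF this, of 1] show ?thesis by simp
qed

lemma generators:
  assumes "y \<in> fst \<psi>" "(0, snd \<psi> y) \<in> N"
  shows "generator Y Exp actY \<xi> y = frame Y \<psi> y (\<Xi> (snd \<psi> y))"
    and "generator X Exp actX \<xi> (\<pi> y) = frame X c (\<pi> y) (fst (\<Xi> (snd \<psi> y)))"
proof -
  let ?q = "snd \<psi> y"
  note D = fib_chartsD[OF k]
  have cy: "cinv \<psi> ?q = y" by (rule fib_inj[OF k assms(1)])
  have "open ((\<lambda>t. (t, ?q)) -` N)" by (intro open_vimage flN(1) continuous_intros)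
  from eventually_nhds_in_open[OF this, of 0] assms(2) have ev: "\<forall>\<^sub>F t in nhds 0. (t, ?q) \<in> N" by simp
  note V = flN(9)[OF assms(2), unfolded has_vector_derivative_def]
  have "has_mderiv euc euc (\<lambda>t. flc \<xi> \<psi> t ?q) (\<lambda>h. h *\<^sub>R \<Xi> ?q) 0" unfolding has_mderiv_euc by (rule V)
  moreover have "has_mderiv euc Y (cinv \<psi>) (frame Y \<psi> y) (flc \<xi> \<psi> 0 ?q)"
    unfolding flc_zero[OF assms(2)] frame_def by (rule has_mderiv_cinv(1)[OF fdE Y D(2) assms(1)])
  ultimately have h1: "has_mderiv euc Y (\<lambda>t. cinv \<psi> (flc \<xi> \<psi> t ?q)) (\<lambda>h. frame Y \<psi> y (h *\<^sub>R \<Xi> ?q)) 0"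
    by (rule has_mderiv_compose[OF euc_simps(4) euc_simps(4)])
  have e1: "\<forall>\<^sub>F t in nhds 0. cinv \<psi> (flc \<xi> \<psi> t ?q) = fl \<xi> t y"
    using ev
  proof eventually_elim
    case (elim t)
    show ?case using flN(7)[OF elim] unfolding cy .
  qed
  have h: "has_mderiv euc Y (\<lambda>t. fl \<xi> t y) (\<lambda>h. frame Y \<psi> y (h *\<^sub>R \<Xi> ?q)) 0"
  proof (rule has_mderiv_cong[OF euc_simps(4) h1])
    show "\<forall>\<^sub>F t in nhds (snd (chart_at euc (0::real)) 0). cinv \<psi> (flc \<xi> \<psi> (cinv (chart_at euc (0::real)) t) ?q) = fl \<xi> (cinv (chart_at euc (0::real)) t) y"
      unfolding euc_simps snd_conv id_apply by (rule e1)
  qed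
  from has_mderiv_tmap[OF h] show "generator Y Exp actY \<xi> y = frame Y \<psi> y (\<Xi> (snd \<psi> y))"
    by (simp add: generator_def velocity_def fl_def)
  have "has_mderiv euc euc (\<lambda>t. fst (flc \<xi> \<psi> t ?q)) (\<lambda>h. fst (h *\<^sub>R \<Xi> ?q)) 0"
    unfolding has_mderiv_euc by (rule has_derivative_fst[OF V])
  moreover have "fst (flc \<xi> \<psi> 0 ?q) = snd c (\<pi> y)" unfolding flc_zero[OF assms(2)] by (rule D(4)[OF assms(1)])
  then have "has_mderiv euc X (cinv c) (frame X c (\<pi> y)) (fst (flc \<xi> \<psi> 0 ?q))"
    unfolding frame_def by (simp only: has_mderiv_cinv(1)[OF fdm X D(1) D(3)[OF assms(1)]])
  ultimately have h2: "has_mderiv euc X (\<lambda>t. cinv c (fst (flc \<xi> \<psi> t ?q))) (\<lambda>h. frame X c (\<pi> y) (fst (h *\<^sub>R \<Xi> ?q))) 0"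
    by (rule has_mderiv_compose[OF euc_simps(4) euc_simps(4)])
  have e2: "\<forall>\<^sub>F t in nhds 0. cinv c (fst (flc \<xi> \<psi> t ?q)) = flX \<xi> t (\<pi> y)"
    using ev
  proof eventually_elim
    case (elim t)
    note f = fst_flc[OF elim, unfolded cy]
    show ?case unfolding f(1) using cinv_chart[OF max_atlasD(1)[OF D(1)] f(3)] unfolding f(2) .
  qed
  have h: "has_mderiv euc X (\<lambda>t. flX \<xi> t (\<pi> y)) (\<lambda>h. frame X c (\<pi> y) (fst (h *\<^sub>R \<Xi> ?q))) 0"
  proof (rule has_mderiv_cong[OF euc_simps(4) h2])
    show "\<forall>\<^sub>F t in nhds (snd (chart_at euc (0::real)) 0). cinv c (fst (flc \<xi> \<psi> (cinv (chart_at euc (0::real)) t) ?q)) = flX \<xi> (cinv (chart_at euc (0::real)) t) (\<pi> y)"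
      unfolding euc_simps snd_conv id_apply by (rule e2)
  qed
  from has_mderiv_tmap[OF h] show "generator X Exp actX \<xi> (\<pi> y) = frame X c (\<pi> y) (fst (\<Xi> (snd \<psi> y)))"
    by (simp add: generator_def velocity_def flX_def)
qed

lemma tmap_fl:
  assumes "(t, q) \<in> N"
  shows "tmap Y Y (fl \<xi> t) (cinv \<psi> q) = (\<lambda>v. frame Y \<psi> (fl \<xi> t (cinv \<psi> q)) (dirderiv (flc \<xi> \<psi> t) q (coframe Y \<psi> (cinv \<psi> q) v)))"
proof (rule tmap_coord[where f = "fl \<xi> t", OF fdE fdE Y Y fib_chartsD(2)[OF k] flN(4)[OF assms] fib_chartsD(2)[OF k] flN(6)[OF assms]])
  show "((snd \<psi> \<circ> fl \<xi> t \<circ> cinv \<psi>) has_derivative dirderiv (flc \<xi> \<psi> t) q) (at (snd \<psi> (cinv \<psi> q)))"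
    using flc_has_derivative[OF assms] unfolding flN(5)[OF assms] flc_def[abs_def] o_def .
  show "\<forall>\<^sub>F r in nhds (snd \<psi> (cinv \<psi> q)). fl \<xi> t (cinv \<psi> r) \<in> fst \<psi>"
    unfolding flN(5)[OF assms] using eventually_N[OF assms] by eventually_elim (rule flN(6))
qed

lemma tmap_flX:
  assumes "(t, q) \<in> N"
  defines "x \<equiv> \<pi> (cinv \<psi> q)"
  shows "tmap X X (flX \<xi> t) x = (\<lambda>v. frame X c (flX \<xi> t x) (fst (dirderiv (flc \<xi> \<psi> t) q (coframe X c x v, 0))))"
proof -
  note D = fib_chartsD[OF k]
  have x: "x \<in> fst c" unfolding x_def by (rule D(3)[OF flN(4)[OF assms(1)]])
  have cx: "snd c x = fst q" unfolding x_def using D(4)[OF flN(4)[OF assms(1)]] flN(5)[OF assms(1)] by simp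
  have fx: "flX \<xi> t x \<in> fst c" using fst_flc(3)[OF assms(1)] unfolding fst_flc(2)[OF assms(1)] x_def .
  have ev: "\<forall>\<^sub>F p in nhds (fst q). (t, (p, snd q)) \<in> N"
  proof -
    have "open ((\<lambda>p. (t, (p, snd q))) -` N)" by (intro open_vimage flN(1) continuous_intros)
    from eventually_nhds_in_open[OF this, of "fst q"] assms(1) show ?thesis by simp
  qed
  show ?thesis
  proof (rule tmap_coord[where f = "flX \<xi> t", OF fdm fdm X X D(1) x D(1) fx])
    have d: "(flc \<xi> \<psi> t has_derivative dirderiv (flc \<xi> \<psi> t) q) (at (fst q, snd q))" using flc_has_derivative[OF assms(1)] by simp
    have "((\<lambda>p. fst (flc \<xi> \<psi> t (p, snd q))) has_derivative (\<lambda>h. fst (dirderiv (flc \<xi> \<psi> t) q (h, 0)))) (at (fst q))"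
      by (rule has_derivative_fst[OF has_derivative_compose[OF has_derivative_Pair[OF has_derivative_ident has_derivative_const] d]])
    moreover have "\<forall>\<^sub>F p in nhds (fst q). fst (flc \<xi> \<psi> t (p, snd q)) = (snd c \<circ> flX \<xi> t \<circ> cinv c) p"
      using ev
    proof eventually_elim
      case (elim p)
      from fst_flc(1)[OF elim] show ?case by simp
    qed
    ultimately show "((snd c \<circ> flX \<xi> t \<circ> cinv c) has_derivative (\<lambda>h. fst (dirderiv (flc \<xi> \<psi> t) q (h, 0)))) (at (snd c x))"
      unfolding cx by (rule has_derivative_cong_nhds)
    show "\<forall>\<^sub>F p in nhds (snd c x). flX \<xi> t (cinv c p) \<in> fst c"
      unfolding cx using ev
    proof eventually_elim
      case (elim p)
      from fst_flc(3)[OF elim] show ?case by simp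
    qed
  qed
qed

end

end

text \<open>Bridges the lifts, defined through \<open>inv_into\<close>, and the flow at time
  \<open>- t\<close>: the two are known to agree on manifold points, and charts see no
  others.\<close>

lemma tmap_cong_mpoints:
  fixes A :: "('x, 'e::real_normed_vector) atlas" and B :: "('y, 'h::real_normed_vector) atlas"
  assumes A: "smooth_atlas A" and p: "p \<in> mpoints A" and eq: "\<And>q. q \<in> mpoints A \<Longrightarrow> f q = g q"
  shows "tmap A B f p = tmap A B g p"
proof -
  let ?c = "chart_at A p"
  have c: "?c \<in> A" "p \<in> fst ?c" using chart_at[OF p] by simp_all
  have "\<forall>\<^sub>F q in nhds (snd ?c p). q \<in> snd ?c ` fst ?c"
    by (rule eventually_nhds_in_open[OF conjunct2[OF smooth_atlas_chart[OF A c(1)]] imageI[OF c(2)]])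
  then have "\<forall>\<^sub>F q in nhds (snd ?c p). (snd (chart_at B (g p)) \<circ> f \<circ> cinv ?c) q = (snd (chart_at B (g p)) \<circ> g \<circ> cinv ?c) q"
  proof eventually_elim
    case (elim q)
    then have "cinv ?c q \<in> mpoints A" using chart_cinv(2)[OF elim] chart_subset_mpoints[OF c(1)] by blast
    from eq[OF this] show ?case by simp
  qed
  from dirderiv_cong_ev[OF tvs_normed this] show ?thesis
    unfolding tmap_def eq[OF p] by (rule ext)
qed

lemma has_vector_derivative_differentiable: "(f has_vector_derivative f') (at x) \<Longrightarrow> f differentiable (at x)"
  unfolding has_vector_derivative_def by (rule differentiableI)

section \<open>The flow on Z\<close>

context noether
begin

lemma flc_q0:
  assumes k: "(c, \<psi>) \<in> fib_charts X Y \<pi>" and y0: "y0 \<in> fst \<psi>" and fd: "flow_data \<xi> \<psi> y0 N \<Xi> \<Xi>'"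
    and t: "(t, snd \<psi> y0) \<in> N" "(- t, flc \<xi> \<psi> t (snd \<psi> y0)) \<in> N"
  shows "fl \<xi> t y0 \<in> fst \<psi>" "snd \<psi> (fl \<xi> t y0) = flc \<xi> \<psi> t (snd \<psi> y0)"
    "cinv \<psi> (flc \<xi> \<psi> t (snd \<psi> y0)) = fl \<xi> t y0" "fl \<xi> (- t) (fl \<xi> t y0) = y0"
    "tmap Y Y (inv_into (mpoints Y) (fl \<xi> t)) (fl \<xi> t y0) =
      (\<lambda>v. frame Y \<psi> y0 (dirderiv (flc \<xi> \<psi> (- t)) (flc \<xi> \<psi> t (snd \<psi> y0)) (coframe Y \<psi> (fl \<xi> t y0) v)))"
proof -
  have cy: "cinv \<psi> (snd \<psi> y0) = y0" by (rule fib_inj[OF k y0])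
  note F = flN[OF k y0 fd]
  show 1: "fl \<xi> t y0 \<in> fst \<psi>" using F(6)[OF t(1)] unfolding cy .
  show "snd \<psi> (fl \<xi> t y0) = flc \<xi> \<psi> t (snd \<psi> y0)" by (simp add: flc_def cy)
  show 2: "cinv \<psi> (flc \<xi> \<psi> t (snd \<psi> y0)) = fl \<xi> t y0" using F(7)[OF t(1)] unfolding cy .
  have yY: "y0 \<in> mpoints Y" by (rule fib_chartsD(5)[OF k y0])
  show 3: "fl \<xi> (- t) (fl \<xi> t y0) = y0" by (rule fl_inverse[OF yY])
  have "tmap Y Y (inv_into (mpoints Y) (fl \<xi> t)) (fl \<xi> t y0) = tmap Y Y (fl \<xi> (- t)) (fl \<xi> t y0)"
    by (rule tmap_cong_mpoints[OF Y fl_in[OF yY] inv_fl])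
  then show "tmap Y Y (inv_into (mpoints Y) (fl \<xi> t)) (fl \<xi> t y0) =
      (\<lambda>v. frame Y \<psi> y0 (dirderiv (flc \<xi> \<psi> (- t)) (flc \<xi> \<psi> t (snd \<psi> y0)) (coframe Y \<psi> (fl \<xi> t y0) v)))"
    using tmap_fl[OF k y0 fd t(2)] unfolding 2 3 by simp
qed

text \<open>Differentiability at time \<open>0\<close> makes the generator on \<open>Z\<close> a
  genuine derivative, so the chain rule can compute its projection to \<open>Y\<close>.\<close>

lemma mom_flow:
  assumes j: "(y0, z) \<in> mom_points X Y \<pi>"
  shows "mom_lift Y (fl \<xi> 0) (y0, z) = (y0, z)" "mdiff euc (mom_atlas X Y \<pi>) (\<lambda>t. mom_lift Y (fl \<xi> t) (y0, z)) 0"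
proof -
  obtain c \<psi> where k: "(c, \<psi>) \<in> fib_charts X Y \<pi>" and ca: "chart_at (mom_atlas X Y \<pi>) (y0, z) = mom_chart X Y \<pi> \<psi>"
    and y0': "fst (y0, z) \<in> fst \<psi>" and m: "(y0, z) \<in> mpoints (mom_atlas X Y \<pi>)" using mom_chart_at[OF j] .
  have y0: "y0 \<in> fst \<psi>" using y0' by simp
  note D = fib_chartsD[OF k]
  obtain N \<Xi> \<Xi>' where fd: "flow_data \<xi> \<psi> y0 N \<Xi> \<Xi>'" using flow_data_exists[OF D(2) y0] .
  note F = flN[OF k y0 fd] and Q = flc_q0[OF k y0 fd]
  let ?q = "snd \<psi> y0"
  \<comment> \<open>The tangent map of the inverse flow at the moved point, in chart components; the
    lift to \<open>Z\<close> is pullback by it.\<close>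
  define Dm where "Dm t = dirderiv (flc \<xi> \<psi> (- t)) (flc \<xi> \<psi> t ?q)" for t
  define z0 where "z0 = pull (frame Y \<psi> y0) z"
  have za: "z \<in> alt_form CARD('m)" and zs: "z0 ((0, b) # (0, b') # us) = 0" for b b' us
    using j unfolding mom_points_iff[OF k y0] z0_def by simp_all
  have z0a: "z0 \<in> alt_form CARD('m)" unfolding z0_def by (rule alt_form_pull[OF za frY(1)[OF k y0]])
  define zt where "zt t = pull (\<lambda>v. frame Y \<psi> y0 (Dm t (coframe Y \<psi> (fl \<xi> t y0) v))) z" for t
  have Z: "mom_lift Y (fl \<xi> t) (y0, z) = (fl \<xi> t y0, zt t)"
    if "(t, ?q) \<in> N" "(- t, flc \<xi> \<psi> t ?q) \<in> N" for t
    unfolding mom_lift_def using Q(5)[OF that] by (simp add: zt_def Dm_def)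
  have pz: "pull (frame Y \<psi> (fl \<xi> t y0)) (zt t) us = z0 (map (Dm t) us)"
    if "(t, ?q) \<in> N" "(- t, flc \<xi> \<psi> t ?q) \<in> N" for t us
    using frY(3)[OF k Q(1)[OF that]] by (simp add: zt_def z0_def pull_def o_def)
  have zero: "(0, ?q) \<in> N" "(- 0, flc \<xi> \<psi> 0 ?q) \<in> N" using F(2) flc_zero[OF k y0 fd F(2)] by simp_all
  have f0: "fl \<xi> 0 y0 = y0" by (rule fl_zero[OF D(5)[OF y0]])
  have "Dm 0 v = v" for v unfolding Dm_def using flc_zero[OF k y0 fd F(2)] Dflc_zero[OF k y0 fd F(2)] by simp
  then have "zt 0 = z" by (simp add: zt_def f0 frY(4)[OF k y0] pull_def)
  with Z[OF zero] f0 show Z0: "mom_lift Y (fl \<xi> 0) (y0, z) = (y0, z)" by simp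
  have lD: "linear (Dm t)" if "(- t, flc \<xi> \<psi> t ?q) \<in> N" for t
    unfolding Dm_def by (rule has_derivative_linear[OF flc_has_derivative[OF k y0 fd that]])
  have Zm: "(fl \<xi> t y0, zt t) \<in> mom_points X Y \<pi>" if t: "(t, ?q) \<in> N" "(- t, flc \<xi> \<psi> t ?q) \<in> N" for t
    unfolding mom_points_iff[OF k Q(1)[OF t]]
  proof (intro conjI allI)
    have "linear (\<lambda>v. frame Y \<psi> y0 (Dm t (coframe Y \<psi> (fl \<xi> t y0) v)))"
      using linear_compose[OF linear_compose[OF frY(2)[OF k Q(1)[OF t]] lD[OF t(2)]] frY(1)[OF k y0]] by (simp add: o_def)
    from alt_form_pull[OF za this] show "zt t \<in> alt_form CARD('m)" unfolding zt_def .
    fix b b' us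
    \<comment> \<open>The inverse flow keeps vertical vectors vertical, so the pulled-back form is
      again semibasic.\<close>
    have v: "Dm t (0, b) = (0, snd (Dm t (0, b)))" for b
      using Dflc_vertical[OF k y0 fd t(2), of b] by (simp add: Dm_def prod_eq_iff)
    have "pull (frame Y \<psi> (fl \<xi> t y0)) (zt t) ((0, b) # (0, b') # us) = z0 (Dm t (0, b) # Dm t (0, b') # map (Dm t) us)"
      unfolding pz[OF t] by simp
    also have "\<dots> = 0" by (subst v[of b], subst v[of b']) (rule zs)
    finally show "pull (frame Y \<psi> (fl \<xi> t y0)) (zt t) ((0, b) # (0, b') # us) = 0" .
  qed
  define \<zeta> where "\<zeta> t v = z0 (map (\<lambda>i. Dm t (v i)) [0..<CARD('m)])" for t and v :: "nat \<Rightarrow> (real^'m) \<times> 'f"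
  define e :: "nat \<Rightarrow> (real^'m) \<times> 'f" where "e i = (axis (coord_indices ! i) 1, 0)" for i
  define g where "g b \<mu> i = (if coord_indices ! i = \<mu> then (0, b) else (axis (coord_indices ! i) 1, 0) :: (real^'m) \<times> 'f)" for b and \<mu> :: 'm and i
  have dq: "((\<lambda>t. flc \<xi> \<psi> t ?q) has_vector_derivative \<Xi> ?q) (at 0)" by (rule F(9)[OF F(2)])
  have d\<zeta>: "(\<lambda>t. \<zeta> t v) differentiable (at 0)" for v
    unfolding \<zeta>_def
  proof (rule alt_form_differentiable[where u = "\<lambda>i t. Dm t (v i)", OF fdE z0a])
    fix i
    have "((\<lambda>t. dirderiv (flc \<xi> \<psi> (-1 * t)) (flc \<xi> \<psi> t ?q) (v i)) has_vector_derivative -1 *\<^sub>R \<Xi>' ?q (v i) + 0) (at 0)"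
      by (rule GD_curve[OF k y0 fd dq flc_zero[OF k y0 fd F(2)] has_vector_derivative_const]) simp
    then show "(\<lambda>t. Dm t (v i)) differentiable (at 0)"
      unfolding Dm_def by (intro has_vector_derivative_differentiable) simp
  qed
  have ev: "\<forall>\<^sub>F t in nhds 0. let l = mom_lift Y (fl \<xi> t) (y0, z) in l \<in> fst (mom_chart X Y \<pi> \<psi>) \<and>
      snd (mom_chart X Y \<pi> \<psi>) l = (fst (flc \<xi> \<psi> t ?q), snd (flc \<xi> \<psi> t ?q), (\<chi> \<mu>. Blinfun (\<lambda>b. \<zeta> t (g b \<mu>))), \<zeta> t e) \<and>
      (\<forall>\<mu>. linear (\<lambda>b. \<zeta> t (g b \<mu>)))"
    using curve_N[OF k y0 fd]
  proof eventually_elim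
    case (elim t)
    then have t: "(t, ?q) \<in> N" "(- t, flc \<xi> \<psi> t ?q) \<in> N" by simp_all
    have zz: "pull (frame Y \<psi> (fl \<xi> t y0)) (zt t) (map f coord_indices) = \<zeta> t (\<lambda>i. f (coord_indices ! i))" for f :: "'m \<Rightarrow> (real^'m) \<times> 'f"
      unfolding \<zeta>_def pz[OF t] map_map o_def by (subst map_coord_indices) simp
    have zm: "zmom (pull (frame Y \<psi> (fl \<xi> t y0)) (zt t)) b \<mu> = \<zeta> t (g b \<mu>)" for b \<mu>
      unfolding zmom_def zz g_def ..
    have zb: "zbase (pull (frame Y \<psi> (fl \<xi> t y0)) (zt t)) = \<zeta> t e"
      unfolding zbase_def zz e_def ..
    have "linear (\<lambda>b. zmom (pull (frame Y \<psi> (fl \<xi> t y0)) (zt t)) b \<mu>)" for \<mu>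
      using linear_compose[OF mom_zform(1)[OF k Q(1)[OF t] Zm[OF t]] bounded_linear.linear[OF bounded_linear_vec_nth[of \<mu>]]] by (simp add: o_def)
    then have lin: "linear (\<lambda>b. \<zeta> t (g b \<mu>))" for \<mu> unfolding zm .
    show ?case unfolding Let_def Z[OF t] mc_eq zm zb Q(2)[OF t] fst_mom_chart using Zm[OF t] Q(1)[OF t] lin by simp
  qed
  show "mdiff euc (mom_atlas X Y \<pi>) (\<lambda>t. mom_lift Y (fl \<xi> t) (y0, z)) 0"
  proof (rule mdiff_intro[where f = "\<lambda>t. mom_lift Y (fl \<xi> t) (y0, z)" and
        g = "\<lambda>t. (fst (flc \<xi> \<psi> t ?q), snd (flc \<xi> \<psi> t ?q), (\<chi> \<mu>. Blinfun (\<lambda>b. \<zeta> t (g b \<mu>))), \<zeta> t e)"])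
    show "(0::real) \<in> mpoints euc" by simp
    show "mom_lift Y (fl \<xi> 0) (y0, z) \<in> mpoints (mom_atlas X Y \<pi>)" unfolding Z0 by (rule m)
    show "\<forall>\<^sub>F q in nhds (snd (chart_at euc (0::real)) 0).
       mom_lift Y (fl \<xi> (cinv (chart_at euc (0::real)) q)) (y0, z) \<in> fst (chart_at (mom_atlas X Y \<pi>) (mom_lift Y (fl \<xi> 0) (y0, z))) \<and>
       snd (chart_at (mom_atlas X Y \<pi>) (mom_lift Y (fl \<xi> 0) (y0, z))) (mom_lift Y (fl \<xi> (cinv (chart_at euc (0::real)) q)) (y0, z)) =
        (fst (flc \<xi> \<psi> q ?q), snd (flc \<xi> \<psi> q ?q), (\<chi> \<mu>. Blinfun (\<lambda>b. \<zeta> q (g b \<mu>))), \<zeta> q e)"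
      unfolding Z0 ca euc_simps snd_conv id_apply using ev by eventually_elim (simp add: Let_def)
    have lin: "\<forall>\<^sub>F t in nhds 0. linear (\<lambda>b. \<zeta> t (g b \<mu>))" for \<mu>
      using ev by eventually_elim (simp add: Let_def)
    have d0: "(\<lambda>t. flc \<xi> \<psi> t ?q) differentiable (at 0)" by (rule has_vector_derivative_differentiable[OF dq])
    show "(\<lambda>t. (fst (flc \<xi> \<psi> t ?q), snd (flc \<xi> \<psi> t ?q), (\<chi> \<mu>. Blinfun (\<lambda>b. \<zeta> t (g b \<mu>))), \<zeta> t e)) differentiable (at (snd (chart_at euc (0::real)) 0))"
      unfolding euc_simps snd_conv id_apply
      by (intro differentiable_PairI differentiable_fstI[OF d0] differentiable_sndI[OF d0] differentiable_vec_lambda d\<zeta>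
          Blinfun_differentiable[OF fdf lin])
  qed
qed

section \<open>Local sections, their prolongations and the current\<close>

context
  fixes W \<phi> assumes sec: "local_section X Y \<pi> W \<phi>"
begin

lemma secD: assumes "x \<in> W" shows "x \<in> mpoints X" "\<phi> x \<in> mpoints Y" "\<pi> (\<phi> x) = x"
proof -
  have s: "smooth_map_on X Y W \<phi>" "\<forall>x\<in>W. \<pi> (\<phi> x) = x" using sec unfolding local_section_def by simp_all
  then show "x \<in> mpoints X" "\<phi> x \<in> mpoints Y" "\<pi> (\<phi> x) = x"
    using assms unfolding smooth_map_on_def mopen_def by blast+
qed

definition "secU c \<psi> = snd (c :: ('x, real^'m) chart) ` (fst c \<inter> W \<inter> \<phi> -` fst (\<psi> :: ('y, (real^'m) \<times> 'f) chart))"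
definition "secf c \<psi> p = snd (snd (\<psi> :: ('y, (real^'m) \<times> 'f) chart) (\<phi> (cinv (c :: ('x, real^'m) chart) p)))"

lemma C2_sec: "c \<in> max_atlas X \<Longrightarrow> \<psi> \<in> max_atlas Y \<Longrightarrow> C2on (secU c \<psi>) (snd \<psi> \<circ> \<phi> \<circ> cinv c)"
  unfolding secU_def using sec unfolding local_section_def by (intro C2on_smooth_map[OF X Y]) simp_all

context
  fixes c \<psi> assumes k: "(c, \<psi>) \<in> fib_charts X Y \<pi>"
begin

lemma sec_fst: "x \<in> W \<Longrightarrow> \<phi> x \<in> fst \<psi> \<Longrightarrow> x \<in> fst c"
  using fib_chartsD(3)[OF k, of "\<phi> x"] secD(3)[of x] by simp

lemma sec_coord:
  assumes x: "x \<in> W" "\<phi> x \<in> fst \<psi>"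
  shows "snd c x \<in> secU c \<psi>" "cinv c (snd c x) = x" "snd \<psi> (\<phi> x) = (snd c x, secf c \<psi> (snd c x))"
proof -
  note xc = sec_fst[OF x]
  show 1: "cinv c (snd c x) = x" by (rule cinv_chart[OF max_atlasD(1)[OF fib_chartsD(1)[OF k]] xc])
  show "snd c x \<in> secU c \<psi>" unfolding secU_def using x xc by simp
  show "snd \<psi> (\<phi> x) = (snd c x, secf c \<psi> (snd c x))"
    using fib_chartsD(4)[OF k x(2)] secD(3)[OF x(1)] by (simp add: secf_def 1 prod_eq_iff)
qed

lemma secU_point: assumes "p \<in> secU c \<psi>" obtains x where "x \<in> W" "\<phi> x \<in> fst \<psi>" "p = snd c x"
  using assms unfolding secU_def by (elim imageE IntE) (simp add: that)

lemma open_secU: "open (secU c \<psi>)" by (rule C2on_open[OF C2_sec[OF fib_chartsD(1,2)[OF k]]])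

lemma sec_graph: assumes "p \<in> secU c \<psi>" shows "(snd \<psi> \<circ> \<phi> \<circ> cinv c) p = (p, secf c \<psi> p)"
proof -
  obtain x where x: "x \<in> W" "\<phi> x \<in> fst \<psi>" "p = snd c x" using secU_point[OF assms] .
  from sec_coord[OF x(1,2)] show ?thesis unfolding x(3) by simp
qed

lemma C2_secf: "C2on (secU c \<psi>) (secf c \<psi>)"
proof -
  have "C2on (secU c \<psi>) (\<lambda>p. snd ((snd \<psi> \<circ> \<phi> \<circ> cinv c) p))"
    by (rule C2on_compose[OF tvs_normed tvs_normed C2on_linear[OF tvs_normed linear_snd' continuous_on_snd_UNIV open_UNIV] C2_sec[OF fib_chartsD(1,2)[OF k]]]) simp
  then show ?thesis by (simp add: secf_def[abs_def])
qed

lemma sec_has_mderiv: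
  assumes x: "x \<in> W" "\<phi> x \<in> fst \<psi>"
  shows "has_mderiv X Y \<phi> (\<lambda>v. frame Y \<psi> (\<phi> x) (coframe X c x v, dirderiv (secf c \<psi>) (snd c x) (coframe X c x v))) x"
proof (rule has_mderiv_coord[where f = \<phi>, OF fdm fdE X Y fib_chartsD(1)[OF k] sec_fst[OF x] fib_chartsD(2)[OF k] x(2)])
  let ?p = "snd c x"
  have ev: "\<forall>\<^sub>F p in nhds ?p. p \<in> secU c \<psi>" by (rule eventually_nhds_in_open[OF open_secU sec_coord(1)[OF x]])
  have "((\<lambda>p. (p, secf c \<psi> p)) has_derivative (\<lambda>h. (h, dirderiv (secf c \<psi>) ?p h))) (at ?p)"
    by (intro has_derivative_Pair has_derivative_ident C2on_has_derivative(1)[OF fdm C2_secf sec_coord(1)[OF x]])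
  moreover have "\<forall>\<^sub>F p in nhds ?p. (p, secf c \<psi> p) = (snd \<psi> \<circ> \<phi> \<circ> cinv c) p"
    using ev by eventually_elim (rule sec_graph[symmetric])
  ultimately show "((snd \<psi> \<circ> \<phi> \<circ> cinv c) has_derivative (\<lambda>h. (h, dirderiv (secf c \<psi>) ?p h))) (at ?p)"
    by (rule has_derivative_cong_nhds)
  show "\<forall>\<^sub>F p in nhds ?p. \<phi> (cinv c p) \<in> fst \<psi>"
    using ev
  proof eventually_elim
    case (elim p)
    then obtain x' where x': "x' \<in> W" "\<phi> x' \<in> fst \<psi>" "p = snd c x'" by (rule secU_point)
    show ?case unfolding x'(3) sec_coord(2)[OF x'(1,2)] by (rule x'(2))
  qed
qed

lemmas sec_tmap = has_mderiv_tmap[OF sec_has_mderiv]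

lemma sec_jet:
  assumes x: "x \<in> W" "\<phi> x \<in> fst \<psi>"
  shows "jet_prolong X Y \<phi> x \<in> jets X Y \<pi>" "jc c \<psi> (jet_prolong X Y \<phi> x) = jet_coord (secf c \<psi>) (snd c x)"
proof -
  have px: "\<pi> (\<phi> x) = x" by (rule secD(3)[OF x(1)])
  have cf: "coframe Y \<psi> (\<phi> x) (tmap X Y \<phi> x v) = (coframe X c x v, dirderiv (secf c \<psi>) (snd c x) (coframe X c x v))" for v
    unfolding sec_tmap[OF x] by (rule frY(3)[OF k x(2)])
  show "jet_prolong X Y \<phi> x \<in> jets X Y \<pi>"
    unfolding jet_prolong_def jets_iff[OF k x(2)] cf px
    using has_mderiv_linear[OF sec_has_mderiv[OF x]] unfolding sec_tmap[OF x] by simp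
  have "coframe X c x (frame X c x u) = u" for u using frX(3)[OF k x(2)] unfolding px .
  then show "jc c \<psi> (jet_prolong X Y \<phi> x) = jet_coord (secf c \<psi>) (snd c x)"
    unfolding jet_prolong_def jc_eq[OF k] cf px sec_coord(3)[OF x] jet_coord_def by simp
qed

end

lemma sec_eventually:
  assumes x: "x \<in> W" "\<phi> x \<in> fst \<psi>" and k: "(c, \<psi>) \<in> fib_charts X Y \<pi>"
  shows "\<forall>\<^sub>F q in nhds (snd (chart_at X x) x). cinv (chart_at X x) q \<in> W \<and> \<phi> (cinv (chart_at X x) q) \<in> fst \<psi> \<and>
      q \<in> snd (chart_at X x) ` (fst (chart_at X x) \<inter> fst c) \<and> snd c (cinv (chart_at X x) q) \<in> secU c \<psi>"
proof -
  let ?a = "chart_at X x"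
  have xX: "x \<in> mpoints X" by (rule secD(1)[OF x(1)])
  have ev: "\<forall>\<^sub>F p in nhds (snd c x). cinv c p \<in> W \<and> \<phi> (cinv c p) \<in> fst \<psi>"
    using eventually_nhds_in_open[OF open_secU[OF k] sec_coord(1)[OF k x]]
  proof eventually_elim
    case (elim p)
    obtain x' where x': "x' \<in> W" "\<phi> x' \<in> fst \<psi>" "p = snd c x'" using secU_point[OF k elim] .
    show ?case unfolding x'(3) sec_coord(2)[OF k x'(1,2)] using x'(1,2) by simp
  qed
  have a: "?a \<in> max_atlas X" "x \<in> fst ?a" by (rule chart_at_max[OF X xX], rule conjunct2[OF chart_at[OF xX]])
  note e1 = eventually_chart[OF X xX fib_chartsD(1)[OF k] sec_fst[OF k x] ev]
  have e2: "\<forall>\<^sub>F q in nhds (snd ?a x). q \<in> snd ?a ` fst ?a"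
    by (rule eventually_nhds_in_open[OF max_atlasD(2)[OF a(1)] imageI[OF a(2)]])
  from e1 e2 show ?thesis
  proof eventually_elim
    case (elim q)
    then obtain r where r: "q = snd ?a r" "r \<in> fst ?a" by (elim imageE)
    have cr: "cinv ?a q = r" unfolding r(1) by (rule cinv_chart[OF max_atlasD(1)[OF a(1)] r(2)])
    show ?case using elim(1) r sec_coord(1)[OF k, of r] unfolding cr by simp
  qed
qed

text \<open>The representative is \<open>jet_coord\<close> of the section after the transition from
  the preferred chart of \<open>X\<close> to \<open>c\<close>; \<open>jet_coord\<close> is
  differentiable since the section is \<open>C2on\<close>.\<close>

lemma mdiff_jet_prolong:
  assumes x: "x \<in> W"
  shows "mdiff X (jet_atlas X Y \<pi>) (jet_prolong X Y \<phi>) x"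
proof -
  let ?a = "chart_at X x"
  obtain c' \<psi>' where k': "(c', \<psi>') \<in> fib_charts X Y \<pi>" "\<phi> x \<in> fst \<psi>'" using fib[OF secD(2)[OF x]] by blast
  have j: "jet_prolong X Y \<phi> x \<in> jets X Y \<pi>" by (rule sec_jet(1)[OF k'(1) x k'(2)])
  obtain c \<psi> where k: "(c, \<psi>) \<in> fib_charts X Y \<pi>" and ca: "chart_at (jet_atlas X Y \<pi>) (jet_prolong X Y \<phi> x) = jet_chart X Y \<pi> (c, \<psi>)"
    and y: "fst (jet_prolong X Y \<phi> x) \<in> fst \<psi>" and m: "jet_prolong X Y \<phi> x \<in> mpoints (jet_atlas X Y \<pi>)" using jet_chart_at[OF j] .
  have y: "\<phi> x \<in> fst \<psi>" using y by (simp add: jet_prolong_def)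
  have xX: "x \<in> mpoints X" by (rule secD(1)[OF x])
  have a: "?a \<in> max_atlas X" "x \<in> fst ?a" by (rule chart_at_max[OF X xX], rule conjunct2[OF chart_at[OF xX]])
  let ?\<tau> = "snd c \<circ> cinv ?a"
  note C = C2on_transition[OF X a(1) fib_chartsD(1)[OF k]]
  have xT: "snd ?a x \<in> snd ?a ` (fst ?a \<inter> fst c)" using a(2) sec_fst[OF k x y] by simp
  have cx: "cinv ?a (snd ?a x) = x" by (rule cinv_chart[OF max_atlasD(1)[OF a(1)] a(2)])
  show ?thesis
  proof (rule mdiff_intro[where f = "jet_prolong X Y \<phi>", OF xX m])
    show "\<forall>\<^sub>F q in nhds (snd ?a x). jet_prolong X Y \<phi> (cinv ?a q) \<in> fst (chart_at (jet_atlas X Y \<pi>) (jet_prolong X Y \<phi> x)) \<and>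
        snd (chart_at (jet_atlas X Y \<pi>) (jet_prolong X Y \<phi> x)) (jet_prolong X Y \<phi> (cinv ?a q)) = jet_coord (secf c \<psi>) (?\<tau> q)"
      unfolding ca fst_jet_chart[OF k] jc_def[OF k, symmetric] using sec_eventually[OF x y k]
    proof eventually_elim
      case (elim q)
      then have e: "cinv ?a q \<in> W" "\<phi> (cinv ?a q) \<in> fst \<psi>" by simp_all
      from sec_jet[OF k e] e(2) show ?case by (simp add: jet_prolong_def)
    qed
    have d\<tau>: "?\<tau> differentiable (at (snd ?a x))"
      using C2on_has_derivative(1)[OF fdm C xT] by (rule differentiableI)
    then obtain \<tau>' where \<tau>': "(?\<tau> has_derivative \<tau>') (at (snd ?a x))" unfolding differentiable_def by (elim exE)
    have "?\<tau> (snd ?a x) \<in> secU c \<psi>" using sec_coord(1)[OF k x y] by (simp add: cx)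
    from has_derivative_compose[OF \<tau>' jet_coord_has_derivative[OF C2_secf[OF k] this]]
    show "(\<lambda>q. jet_coord (secf c \<psi>) (?\<tau> q)) differentiable (at (snd ?a x))" by (rule differentiableI)
  qed
qed

text \<open>The canonical form sees only projections to \<open>Y\<close>, so the pullbacks along the
  Legendre map and the prolongation collapse and \<open>zform_contract\<close> applies. The chart
  \<open>c0\<close> is the one in which \<open>extd\<close> differentiates; it stays fixed while
  \<open>x\<close> varies.\<close>

lemma momentum_coord:
  assumes k: "(c, \<psi>) \<in> fib_charts X Y \<pi>" and y0: "y0 \<in> fst \<psi>" and fd: "flow_data \<xi> \<psi> y0 N \<Xi> \<Xi>'"
    and c0: "c0 \<in> max_atlas X" "x \<in> fst c0" and x: "x \<in> W" "\<phi> x \<in> fst \<psi>" and xN: "(0, snd \<psi> (\<phi> x)) \<in> N"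
    and us: "Suc (length us) = CARD('m)"
  defines "p \<equiv> snd c x" and "f \<equiv> secf c \<psi>"
  shows "pullback_form euc X (cinv c0) (pullback_form X (jet_atlas X Y \<pi>) (jet_prolong X Y \<phi>)
      (lagrangian_momentum X Y \<pi> L Exp actY \<xi>)) (snd c0 x) us =
    vol ((Lc c \<psi> (jet_coord f p) *\<^sub>R fst (\<Xi> (p, f p)) +
       (\<chi> \<mu>. dirderiv (Lc c \<psi>) (jet_coord f p) (0, 0, axis \<mu> (snd (\<Xi> (p, f p)) - dirderiv f p (fst (\<Xi> (p, f p)))))))
      # map (dirderiv (snd c \<circ> cinv c0) (snd c0 x)) us)"
proof -
  let ?J = "jet_atlas X Y \<pi>" and ?M = "mom_atlas X Y \<pi>" and ?j = "jet_prolong X Y \<phi>" and ?leg = "legendre X Y \<pi> L"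
  let ?l = "?leg (?j x)"
  have cx: "cinv c0 (snd c0 x) = x" by (rule cinv_chart[OF max_atlasD(1)[OF c0(1)] c0(2)])
  have jx: "?j x \<in> jets X Y \<pi>" and jcx: "jc c \<psi> (?j x) = jet_coord f p" using sec_jet[OF k x] by (simp_all add: f_def p_def)
  note lm = mdiff_legendre[OF jx]
  have fl: "fst ?l = \<phi> x" using lm(2) by (simp add: jet_prolong_def)
  have l: "?l = (\<phi> x, snd ?l)" using fl by (simp add: prod_eq_iff)
  have lmp: "(\<phi> x, snd ?l) \<in> mom_points X Y \<pi>" using lm(1) l by simp
  note iX = smooth_inj_atlas[OF X] and iY = smooth_inj_atlas[OF Y]
  \<comment> \<open>The projection of the Legendre image of \<open>j\<^sup>1\<phi>\<close> is
    \<open>\<phi>\<close> itself, so the composite tangent map is that of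
    \<open>\<phi>\<close>.\<close>
  have T1: "tmap ?M Y fst ?l (tmap ?J ?M ?leg (?j x) (tmap X ?J ?j x v)) = tmap X Y \<phi> x v" for v
  proof -
    note m1 = mdiff_compose[OF iX inj_jet_atlas mdiff_jet_prolong[OF x(1)] lm(3)]
    note m2 = mdiff_compose[OF iX inj_mom_atlas m1(1) mdiff_fst[OF lm(1)]]
    have "has_mderiv X Y (\<lambda>x. fst (?leg (?j x))) (tmap X Y (\<lambda>x. fst (?leg (?j x))) x) x" by (rule mdiff_has_mderiv[OF m2(1)])
    moreover have "\<forall>\<^sub>F q in nhds (snd (chart_at X x) x). fst (?leg (?j (cinv (chart_at X x) q))) = \<phi> (cinv (chart_at X x) q)"
      using sec_eventually[OF x k]
    proof eventually_elim
      case (elim q)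
      then have "cinv (chart_at X x) q \<in> W" "\<phi> (cinv (chart_at X x) q) \<in> fst \<psi>" by simp_all
      from mdiff_legendre(2)[OF sec_jet(1)[OF k this]] show ?case by (simp add: jet_prolong_def)
    qed
    ultimately have "has_mderiv X Y \<phi> (tmap X Y (\<lambda>x. fst (?leg (?j x))) x) x" by (rule has_mderiv_cong[OF iX])
    from has_mderiv_tmap[OF this] show ?thesis unfolding m2(2) m1(2) by (rule fun_cong[symmetric])
  qed
  \<comment> \<open>The lifted flow covers the flow on \<open>Y\<close>, so the generator on
    \<open>Z\<close> projects to the generator on \<open>Y\<close>.\<close>
  have T2: "tmap ?M Y fst ?l (generator ?M Exp (\<lambda>g. mom_lift Y (actY g)) \<xi> ?l) = generator Y Exp actY \<xi> (\<phi> x)"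
  proof -
    let ?Z = "\<lambda>t. mom_lift Y (fl \<xi> t) (\<phi> x, snd ?l)"
    note mf = mom_flow[OF lmp, of \<xi>]
    have "mdiff ?M Y fst (?Z 0)" unfolding mf(1) by (rule mdiff_fst[OF lmp])
    note m = mdiff_compose(2)[OF euc_simps(4) inj_mom_atlas mf(2) this]
    have "(\<lambda>t. fst (?Z t)) = (\<lambda>t. fl \<xi> t (\<phi> x))" by (simp add: mom_lift_def)
    then have "tmap euc Y (\<lambda>t. fl \<xi> t (\<phi> x)) 0 1 = tmap ?M Y fst (\<phi> x, snd ?l) (tmap euc ?M ?Z 0 1)"
      using fun_cong[OF m, of 1] unfolding mf(1) by simp
    then show ?thesis unfolding generator_def velocity_def l[symmetric] fl_def[symmetric] by simp
  qed
  let ?s = "jet_coord f p"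
  have sq: "?s \<in> jdom \<psi>" using jc_in[OF k x(2), of "snd (?j x)"] jcx by (simp add: jet_prolong_def)
  have sl: "snd ?l = pull (coframe Y \<psi> (\<phi> x)) (zform (pL c \<psi> ?s) (PL c \<psi> ?s))"
    using legendre_coord[OF k, of "\<phi> x" "snd (?j x)"] jx x(2) jcx by (simp add: jet_prolong_def)
  have gen: "coframe Y \<psi> (\<phi> x) (generator Y Exp actY \<xi> (\<phi> x)) = \<Xi> (p, f p)"
    unfolding generators(1)[OF k y0 fd x(2) xN] frY(3)[OF k x(2)] sec_coord(3)[OF k x] p_def f_def ..
  have tm: "coframe Y \<psi> (\<phi> x) (tmap X Y \<phi> x (frame X c0 x u)) =
      (dirderiv (snd c \<circ> cinv c0) (snd c0 x) u, dirderiv f p (dirderiv (snd c \<circ> cinv c0) (snd c0 x) u))" for u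
    unfolding sec_tmap[OF k x] frY(3)[OF k x(2)]
      coframe_frame_transition[OF fdm X fib_chartsD(1)[OF k] sec_fst[OF k x] c0] f_def p_def ..
  let ?us = "map (dirderiv (snd c \<circ> cinv c0) (snd c0 x)) us"
  have fp: "linear (dirderiv f p)"
    unfolding f_def p_def by (rule has_derivative_linear[OF C2on_has_derivative(1)[OF fdm C2_secf[OF k] sec_coord(1)[OF k x]]])
  have "pullback_form euc X (cinv c0) (pullback_form X ?J ?j (lagrangian_momentum X Y \<pi> L Exp actY \<xi>)) (snd c0 x) us =
      snd ?l (tmap ?M Y fst ?l (generator ?M Exp (\<lambda>g. mom_lift Y (actY g)) \<xi> ?l) #
        map (\<lambda>u. tmap ?M Y fst ?l (tmap ?J ?M ?leg (?j x) (tmap X ?J ?j x (frame X c0 x u)))) us)"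
    by (simp add: pullback_form_def lagrangian_momentum_def cov_momentum_def canonical_form_def iprod_def pull_def cx frame_def o_def)
  also have "\<dots> = snd ?l (generator Y Exp actY \<xi> (\<phi> x) # map (\<lambda>u. tmap X Y \<phi> x (frame X c0 x u)) us)"
    unfolding T1 T2 ..
  also have "\<dots> = zform (pL c \<psi> ?s) (PL c \<psi> ?s) (\<Xi> (p, f p) # map (\<lambda>a. (a, dirderiv f p a)) ?us)"
    unfolding sl by (simp add: pull_def gen tm o_def)
  also have "\<dots> = zform (pL c \<psi> ?s) (PL c \<psi> ?s) ((fst (\<Xi> (p, f p)), snd (\<Xi> (p, f p))) # map (\<lambda>a. (a, dirderiv f p a)) ?us)"
    by simp
  also have "\<dots> = vol (((pL c \<psi> ?s + tr (\<lambda>a. PL c \<psi> ?s (dirderiv f p a))) *\<^sub>R fst (\<Xi> (p, f p)) +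
      PL c \<psi> ?s (snd (\<Xi> (p, f p)) - dirderiv f p (fst (\<Xi> (p, f p))))) # ?us)"
    by (rule zform_contract[OF linear_PL[OF k sq] fp]) (simp add: us)
  \<comment> \<open>The term subtracted from \<open>Lc\<close> in the momentum \<open>p\<close> is
    exactly the contraction of the momenta with the velocities.\<close>
  also have "pL c \<psi> ?s + tr (\<lambda>a. PL c \<psi> ?s (dirderiv f p a)) = Lc c \<psi> ?s"
  proof -
    have "vlin (\<chi> \<mu>. dirderiv f p (axis \<mu> 1)) = dirderiv f p" by (rule vlin_eq[OF fp])
    then show ?thesis using tr_PL(2)[OF k sq, of "\<chi> \<mu>. dirderiv f p (axis \<mu> 1)"]
      by (simp add: pL_def[OF k] jet_coord_def)
  qed
  finally show ?thesis unfolding PL_def[OF k] .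
qed

end

end

section \<open>Equivariance and the conservation law\<close>

context noether
begin

text \<open>Along the flow, equivariance reads \<open>L (j t) = det (M t) * L (j 0)\<close> for a curve \<open>j\<close> in jet coordinates, where \<open>M t\<close>
  is the tangent map of the inverse flow on the base; the claim is its derivative at \<open>t = 0\<close>.\<close>

lemma infinitesimal_equivariance:
  assumes eqv: "equivariant X Y \<pi> G actX actY L" and sec: "local_section X Y \<pi> W \<phi>"
    and k: "(c, \<psi>) \<in> fib_charts X Y \<pi>" and x: "x0 \<in> W" "\<phi> x0 \<in> fst \<psi>" and fd: "flow_data \<xi> \<psi> (\<phi> x0) N \<Xi> \<Xi>'"
  defines "p \<equiv> snd c x0" and "f \<equiv> secf \<phi> c \<psi>"
  shows "dirderiv (Lc c \<psi>) (jet_coord f p) (fst (\<Xi> (p, f p)), snd (\<Xi> (p, f p)),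
      \<chi> \<mu>. snd (\<Xi>' (p, f p) (axis \<mu> 1, dirderiv f p (axis \<mu> 1))) - dirderiv f p (fst (\<Xi>' (p, f p) (axis \<mu> 1, dirderiv f p (axis \<mu> 1)))))
    = - (Lc c \<psi> (jet_coord f p) * tr (\<lambda>v. fst (\<Xi>' (p, f p) (v, dirderiv f p v))))"
proof -
  let ?y = "\<phi> x0" let ?q = "snd \<psi> ?y" let ?D = "dirderiv f p"
  have px: "\<pi> ?y = x0" by (rule secD(3)[OF sec x(1)])
  have q: "?q = (p, f p)" unfolding p_def f_def by (rule sec_coord(3)[OF sec k x])
  note F = flN[OF k x(2) fd] and Q = flc_q0[OF k x(2) fd]
  have dD: "(f has_derivative ?D) (at p)" unfolding f_def p_def by (rule C2on_has_derivative(1)[OF fdm C2_secf[OF sec k] sec_coord(1)[OF sec k x]])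
  note linD = has_derivative_linear[OF dD] and blD = has_derivative_bounded_linear[OF dD]
  define \<gamma>0 where "\<gamma>0 = tmap X Y \<phi> x0"
  have j0: "(?y, \<gamma>0) \<in> jets X Y \<pi>" "jc c \<psi> (?y, \<gamma>0) = jet_coord f p"
    using sec_jet[OF sec k x] unfolding jet_prolong_def \<gamma>0_def f_def p_def by simp_all
  have c\<gamma>0: "coframe Y \<psi> ?y (\<gamma>0 v) = (coframe X c x0 v, ?D (coframe X c x0 v))" for v
    unfolding \<gamma>0_def sec_tmap[OF sec k x] frY(3)[OF k x(2)] f_def p_def ..
  have yY: "?y \<in> mpoints Y" by (rule secD(2)[OF sec x(1)])
  have xX: "x0 \<in> mpoints X" by (rule secD(1)[OF sec x(1)])
  define r where "r t = flc \<xi> \<psi> t ?q" for t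
  \<comment> \<open>The tangent map of the inverse flow on the base, read off from the first
    component of the flow on \<open>Y\<close>.\<close>
  define M where "M t v = fst (dirderiv (flc \<xi> \<psi> (- t)) (r t) (v, 0))" for t v
  define A' where "A' t = dirderiv (flc \<xi> \<psi> t) ?q" for t
  \<comment> \<open>The jet coordinates of the lifted jet: a base vector goes back by
    \<open>M t\<close>, is lifted to the tangent space of the section and is carried forward by
    \<open>A' t\<close>.\<close>
  define \<kappa> where "\<kappa> t = (fst (r t), snd (r t), \<chi> \<mu>. snd (A' t (M t (axis \<mu> 1), ?D (M t (axis \<mu> 1)))))" for t
  have main: "Lc c \<psi> (\<kappa> t) = Lc c \<psi> (jet_coord f p) * vol (map (M t) axes)"
    if t: "(t, ?q) \<in> N" "(- t, flc \<xi> \<psi> t ?q) \<in> N" for t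
  proof -
    let ?yt = "fl \<xi> t ?y" and ?xt = "flX \<xi> t x0"
    note Qt = Q[OF t]
    have pyt: "\<pi> ?yt = ?xt" unfolding fl_proj[OF yY] px ..
    let ?T = "tmap X X (inv_into (mpoints X) (flX \<xi> t)) ?xt"
    have "?T = tmap X X (flX \<xi> (- t)) ?xt" by (rule tmap_cong_mpoints[OF X flX_in[OF xX] inv_flX])
    also have "\<dots> = (\<lambda>v. frame X c x0 (M t (coframe X c ?xt v)))"
      using tmap_flX[OF k x(2) fd t(2)] unfolding Qt(3) pyt flX_inverse[OF xX] M_def r_def .
    finally have T': "?T = (\<lambda>v. frame X c x0 (M t (coframe X c ?xt v)))" .
    have cX: "coframe X c ?xt (frame X c ?xt v) = v" for v using frX(3)[OF k Qt(1)] unfolding pyt .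
    have cX0: "coframe X c x0 (frame X c x0 v) = v" for v using frX(3)[OF k x(2)] unfolding px .
    have cT: "coframe X c x0 (?T v) = M t (coframe X c ?xt v)" for v unfolding T' cX0 ..
    define \<gamma> where "\<gamma> u = tmap Y Y (fl \<xi> t) ?y (\<gamma>0 (?T u))" for u
    have cy: "cinv \<psi> ?q = ?y" by (rule fib_inj[OF k x(2)])
    have tf: "tmap Y Y (fl \<xi> t) ?y = (\<lambda>v. frame Y \<psi> ?yt (A' t (coframe Y \<psi> ?y v)))"
      using tmap_fl[OF k x(2) fd t(1)] unfolding cy A'_def .
    have c\<gamma>: "coframe Y \<psi> ?yt (\<gamma> u) = A' t (M t (coframe X c ?xt u), ?D (M t (coframe X c ?xt u)))" for u
      unfolding \<gamma>_def tf frY(3)[OF k Qt(1)] c\<gamma>0 cT ..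
    have lA: "linear (A' t)" unfolding A'_def by (rule has_derivative_linear[OF flc_has_derivative[OF k x(2) fd t(1)]])
    have lM: "linear (M t)"
    proof -
      have B: "linear (dirderiv (flc \<xi> \<psi> (- t)) (r t))"
        unfolding r_def by (rule has_derivative_linear[OF flc_has_derivative[OF k x(2) fd t(2)]])
      have "linear (\<lambda>v::real^'m. (v, 0::'f))" by (rule linearI) simp_all
      from linear_compose[OF linear_compose[OF this B] bounded_linear.linear[OF bounded_linear_fst]]
      show ?thesis unfolding M_def o_def .
    qed
    \<comment> \<open>The lift is again a jet: the base part of the tangent flow undoes
      \<open>M t\<close>, and a change of the fiber component adds a vector that stays
      vertical.\<close>
    have fA: "fst (A' t (M t a, b)) = a" for a b
    proof -
      let ?B = "dirderiv (flc \<xi> \<psi> (- t)) (r t) (a, 0)"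
      have e: "(M t a, b) = ?B + (0, b - snd ?B)" unfolding M_def by (simp add: prod_eq_iff)
      have AB: "A' t ?B = (a, 0)" unfolding A'_def r_def by (rule Dflc_inverse[OF k x(2) fd t])
      have V: "fst (A' t (0, b - snd ?B)) = 0" unfolding A'_def by (rule Dflc_vertical[OF k x(2) fd t(1)])
      show ?thesis unfolding e linear_add[OF lA] AB fst_add V by simp
    qed
    have jt: "(?yt, \<gamma>) \<in> jets X Y \<pi>"
      unfolding jets_iff[OF k Qt(1)] pyt
    proof (intro conjI allI)
      have lD: "linear (\<lambda>v. (v, ?D v))" by (rule linearI) (simp_all add: linear_add[OF linD] linear_cmul[OF linD])
      have lX: "linear (coframe X c ?xt)" using frX(2)[OF k Qt(1)] unfolding pyt .
      have e: "\<gamma> = frame Y \<psi> ?yt \<circ> (A' t \<circ> ((\<lambda>v. (v, ?D v)) \<circ> (M t \<circ> coframe X c ?xt)))"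
      proof
        fix u
        show "\<gamma> u = (frame Y \<psi> ?yt \<circ> (A' t \<circ> ((\<lambda>v. (v, ?D v)) \<circ> (M t \<circ> coframe X c ?xt)))) u"
          using frY(4)[OF k Qt(1), of "\<gamma> u"] unfolding c\<gamma> o_apply by (rule sym)
      qed
      show "linear \<gamma>" unfolding e by (intro linear_compose lX lM lD lA frY(1)[OF k Qt(1)])
      fix u show "fst (coframe Y \<psi> ?yt (\<gamma> u)) = coframe X c ?xt u" unfolding c\<gamma> by (rule fA)
    qed
    have jc: "jc c \<psi> (?yt, \<gamma>) = \<kappa> t" unfolding jc_eq[OF k] pyt Qt(2) c\<gamma> cX \<kappa>_def r_def ..
    have lift: "jet_lift X Y \<pi> (flX \<xi> t) (fl \<xi> t) (?y, \<gamma>0) = (?yt, \<gamma>)"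
      by (simp add: jet_lift_def \<gamma>_def px fun_eq_iff)
    have LT: "L (?yt, \<gamma>) = pull ?T (L (?y, \<gamma>0))"
      using bspec[OF bspec[OF eqv[unfolded equivariant_def] exp_carrier[of t \<xi>]] j0(1)]
      unfolding flX_def[symmetric] fl_def[symmetric] unfolding lift fst_conv px .
    have "Lc c \<psi> (\<kappa> t) = L (?yt, \<gamma>) (map (frame X c ?xt) axes)" using Lc_jc(1)[OF k jt Qt(1)] unfolding jc pyt .
    also have "\<dots> = L (?y, \<gamma>0) (map (\<lambda>v. ?T (frame X c ?xt v)) axes)" unfolding LT pull_def map_map o_def ..
    also have "\<dots> = Lc c \<psi> (jet_coord f p) * vol (map (\<lambda>v. coframe X c x0 (?T (frame X c ?xt v))) axes)"
      using Lc_jc(2)[OF k j0(1) x(2), where vs = "map (\<lambda>v. ?T (frame X c ?xt v)) axes"] unfolding j0(2) px map_map o_def .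
    also have "\<dots> = Lc c \<psi> (jet_coord f p) * vol (map (M t) axes)" unfolding cT cX ..
    finally show ?thesis .
  qed
  have fz: "flc \<xi> \<psi> 0 ?q = ?q" by (rule flc_zero[OF k x(2) fd F(2)])
  have r0: "r 0 = ?q" unfolding r_def by (rule fz)
  have M0: "M 0 v = v" for v unfolding M_def r0 minus_zero Dflc_zero[OF k x(2) fd F(2)] by simp
  have dr: "(r has_vector_derivative \<Xi> ?q) (at 0)" unfolding r_def[abs_def] by (rule F(9)[OF F(2)])
  \<comment> \<open>The derivative of \<open>M\<close> at time \<open>0\<close>; the sign is that of
    the inverse flow.\<close>
  define m where "m v = - fst (\<Xi>' ?q (v, ?D v))" for v
  have l\<Xi>: "linear (\<Xi>' ?q)" by (rule has_derivative_linear[OF F(10)[OF F(2)]])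
  have m: "m v = - fst (\<Xi>' ?q (v, 0))" for v
  proof -
    have "(v, ?D v) = (v, 0) + (0, ?D v)" by simp
    then have "\<Xi>' ?q (v, ?D v) = \<Xi>' ?q (v, 0) + \<Xi>' ?q (0, ?D v)" using linear_add[OF l\<Xi>] by metis
    then show ?thesis unfolding m_def using fst_\<Xi>'_vertical[OF k x(2) fd, of "?D v"] by simp
  qed
  have dM: "((\<lambda>t. M t v) has_vector_derivative m v) (at 0)" for v
  proof -
    have "((\<lambda>t. dirderiv (flc \<xi> \<psi> (-1 * t)) (r t) (v, 0)) has_vector_derivative -1 *\<^sub>R \<Xi>' ?q (v, 0) + 0) (at 0)"
      by (rule GD_curve[OF k x(2) fd dr r0 has_vector_derivative_const]) simp
    from bounded_linear.has_vector_derivative[OF bounded_linear_fst this]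
    show ?thesis unfolding M_def m by simp
  qed
  have dA: "((\<lambda>t. A' t (M t v, ?D (M t v))) has_vector_derivative \<Xi>' ?q (v, ?D v) + (m v, ?D (m v))) (at 0)" for v
  proof -
    have c: "((\<lambda>t::real. ?q) has_vector_derivative 0) (at 0)" by (rule has_vector_derivative_const)
    have "((\<lambda>t. (M t v, ?D (M t v))) has_vector_derivative (m v, ?D (m v))) (at 0)"
      by (rule has_vector_derivative_Pair[OF dM bounded_linear.has_vector_derivative[OF blD dM]])
    then have "((\<lambda>t. dirderiv (flc \<xi> \<psi> (1 * t)) ?q (M t v, ?D (M t v))) has_vector_derivative
        1 *\<^sub>R \<Xi>' ?q (M 0 v, ?D (M 0 v)) + (m v, ?D (m v))) (at 0)"
      by (rule GD_curve[OF k x(2) fd c refl]) simp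
    then show ?thesis unfolding A'_def M0 mult_1 scaleR_one .
  qed
  \<comment> \<open>The initial velocity of \<open>\<kappa>\<close>. The term with \<open>?D\<close>
    comes from the inverse base flow inside the lifted jet.\<close>
  define \<kappa>' where "\<kappa>' = (fst (\<Xi> ?q), snd (\<Xi> ?q),
      \<chi> \<mu>. snd (\<Xi>' ?q (axis \<mu> 1, ?D (axis \<mu> 1))) - ?D (fst (\<Xi>' ?q (axis \<mu> 1, ?D (axis \<mu> 1)))))"
  have d\<kappa>: "(\<kappa> has_derivative (\<lambda>h. h *\<^sub>R \<kappa>')) (at 0)"
  proof -
    have c: "((\<lambda>t. snd (A' t (M t (axis \<mu> 1), ?D (M t (axis \<mu> 1))))) has_derivative
        (\<lambda>h. h *\<^sub>R (snd (\<Xi>' ?q (axis \<mu> 1, ?D (axis \<mu> 1))) - ?D (fst (\<Xi>' ?q (axis \<mu> 1, ?D (axis \<mu> 1))))))) (at 0)" for \<mu>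
    proof -
      have e: "snd (\<Xi>' ?q (axis \<mu> 1, ?D (axis \<mu> 1)) + (m (axis \<mu> 1), ?D (m (axis \<mu> 1)))) =
          snd (\<Xi>' ?q (axis \<mu> 1, ?D (axis \<mu> 1))) - ?D (fst (\<Xi>' ?q (axis \<mu> 1, ?D (axis \<mu> 1))))"
        unfolding m_def linear_neg[OF linD] by simp
      from bounded_linear.has_vector_derivative[OF bounded_linear_snd dA[of "axis \<mu> 1"]]
      show ?thesis unfolding e has_vector_derivative_def .
    qed
    note dr' = dr[unfolded has_vector_derivative_def]
    have v: "((\<lambda>t. \<chi> \<mu>. snd (A' t (M t (axis \<mu> 1), ?D (M t (axis \<mu> 1))))) has_derivative
        (\<lambda>h. \<chi> \<mu>. h *\<^sub>R (snd (\<Xi>' ?q (axis \<mu> 1, ?D (axis \<mu> 1))) - ?D (fst (\<Xi>' ?q (axis \<mu> 1, ?D (axis \<mu> 1))))))) (at 0)"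
      by (rule has_derivative_vec_lambda) (rule c)
    have e: "(\<lambda>h. h *\<^sub>R \<kappa>') = (\<lambda>h. (fst (h *\<^sub>R \<Xi> ?q), snd (h *\<^sub>R \<Xi> ?q),
        \<chi> \<mu>. h *\<^sub>R (snd (\<Xi>' ?q (axis \<mu> 1, ?D (axis \<mu> 1))) - ?D (fst (\<Xi>' ?q (axis \<mu> 1, ?D (axis \<mu> 1)))))))"
      by (rule ext) (simp add: \<kappa>'_def prod_eq_iff vec_eq_iff)
    show ?thesis unfolding e \<kappa>_def[abs_def]
      by (rule has_derivative_Pair[OF has_derivative_fst[OF dr'] has_derivative_Pair[OF has_derivative_snd[OF dr'] v]])
  qed
  have \<kappa>0: "\<kappa> 0 = jet_coord f p"
    unfolding \<kappa>_def M0 r0 A'_def Dflc_zero[OF k x(2) fd F(2)] snd_conv unfolding q by (simp add: jet_coord_def)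
  have s: "jet_coord f p \<in> jdom \<psi>" using jc_in[OF k x(2), of \<gamma>0] unfolding j0(2) .
  have "(Lc c \<psi> has_derivative dirderiv (Lc c \<psi>) (jet_coord f p)) (at (\<kappa> 0))"
    unfolding \<kappa>0 by (rule C2on_has_derivative(1)[OF fdj C2_Lc[OF k] s])
  note d1 = has_derivative_compose[OF d\<kappa> this]
  have mx: "map (\<lambda>i. g (axes ! i)) [0..<CARD('m)] = map g (axes :: (real^'m) list)" for g :: "real^'m \<Rightarrow> real^'m"
    by (rule nth_equalityI) simp_all
  have mM: "map (M 0) axes = axes" by (rule map_idI) (rule M0)
  have "((\<lambda>t. vol (map (\<lambda>i. M t (axes ! i)) [0..<CARD('m)])) has_derivative
      (\<lambda>h. \<Sum>i<CARD('m). vol ((map (\<lambda>i. M 0 (axes ! i)) [0..<CARD('m)])[i := h *\<^sub>R m (axes ! i)]))) (at 0)"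
    by (rule alt_form_has_derivative[where u = "\<lambda>i t. M t (axes ! i)", OF fdm vol_alt_form]) (rule dM[unfolded has_vector_derivative_def])
  then have "((\<lambda>t. vol (map (M t) axes)) has_derivative
      (\<lambda>h. \<Sum>i<CARD('m). vol (axes[i := h *\<^sub>R m (axes ! i)]))) (at 0)"
    unfolding mx unfolding mM .
  note d2 = has_derivative_mult_right[OF this, of "Lc c \<psi> (jet_coord f p)"]
  have "\<forall>\<^sub>F t in nhds 0. Lc c \<psi> (\<kappa> t) = Lc c \<psi> (jet_coord f p) * vol (map (M t) axes)"
    using curve_N[OF k x(2) fd] by eventually_elim (rule main, simp_all)
  from has_derivative_unique[OF has_derivative_cong_nhds[OF d1 this] d2]
  have "dirderiv (Lc c \<psi>) (jet_coord f p) (1 *\<^sub>R \<kappa>') = Lc c \<psi> (jet_coord f p) * (\<Sum>i<CARD('m). vol (axes[i := 1 *\<^sub>R m (axes ! i)]))"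
    by (rule fun_cong)
  then have "dirderiv (Lc c \<psi>) (jet_coord f p) \<kappa>' = Lc c \<psi> (jet_coord f p) * tr m"
    unfolding scaleR_one vol_axes_trace .
  also have "tr m = - tr (\<lambda>v. fst (\<Xi>' ?q (v, ?D v)))" by (simp add: tr_def m_def sum_negf)
  finally show ?thesis unfolding \<kappa>'_def q by simp
qed

section \<open>The Euler-Lagrange expression and the exterior derivative of the current\<close>

definition "EL c \<psi> f p b = dirderiv (Lc c \<psi>) (jet_coord f p) (0, b, 0) -
  (\<Sum>\<mu>\<in>UNIV. dirderiv (\<lambda>y. dirderiv (Lc c \<psi>) (jet_coord f y) (0, 0, axis \<mu> b)) p (axis \<mu> 1))"

context
  fixes W \<phi> c \<psi> x
  assumes sec: "local_section X Y \<pi> W \<phi>" and k: "(c, \<psi>) \<in> fib_charts X Y \<pi>" and x: "x \<in> W" "\<phi> x \<in> fst \<psi>"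
begin

abbreviation "secp \<equiv> snd c x"
abbreviation "secg \<equiv> secf \<phi> c \<psi>"

lemma sec_jdom: "jet_coord secg secp \<in> jdom \<psi>"
  using jc_in[OF k x(2), of "snd (jet_prolong X Y \<phi> x)"] sec_jet(2)[OF sec k x] by (simp add: jet_prolong_def)

text \<open>Second derivatives are linear in the direction taken last; \<open>d2_commute\<close>
  moves \<open>b\<close> into that slot. Linearity is needed because \<open>euler_lagrange\<close>
  tests the basis vectors in \<open>B\<close>, whereas the conservation law involves arbitrary fiber
  vectors.\<close>

lemma linear_EL: "linear (EL c \<psi> secg secp)"
proof -
  let ?s = "jet_coord secg" let ?L = "Lc c \<psi>"
  note C = C2_Lc[OF k]
  note s' = jet_coord_has_derivative[OF C2_secf[OF sec k] sec_coord(1)[OF sec k x]]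
  define s' where "s' \<mu> = (axis \<mu> (1::real), dirderiv secg secp (axis \<mu> 1), \<chi> \<nu>. d2 secg secp (axis \<nu> 1) (axis \<mu> 1))" for \<mu> :: 'm
  have e: "dirderiv (\<lambda>y. dirderiv ?L (?s y) v) secp (axis \<mu> 1) = d2 ?L (?s secp) (s' \<mu>) v" for \<mu> v
    unfolding dirderiv_eq_has_derivative[OF C2on_dirderiv_const_has_derivative[OF fdj C sec_jdom s', of v]] s'_def
    by (rule d2_commute[OF tvs_normed C sec_jdom])
  have l: "linear (d2 ?L (?s secp) v)" for v
    by (rule has_derivative_linear[OF C2on_dirderiv_const_has_derivative[OF fdj C sec_jdom has_derivative_ident]])
  have i1: "linear (\<lambda>b. (0::real^'m, b::'f, 0::'f^'m))" by (rule linearI) simp_all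
  have i2: "linear (\<lambda>b. (0::real^'m, 0::'f, axis \<mu> b :: 'f^'m))" for \<mu>
    by (rule linearI) (simp_all add: linear_add[OF linear_axis[OF k]] linear_cmul[OF linear_axis[OF k]])
  have e1: "linear (\<lambda>b. dirderiv ?L (?s secp) (0, b, 0))"
    using linear_compose[OF i1 linear_DL[OF k sec_jdom]] unfolding o_def .
  have e2: "linear (\<lambda>b. d2 ?L (?s secp) (s' \<mu>) (0, 0, axis \<mu> b))" for \<mu>
    using linear_compose[OF i2 l] unfolding o_def .
  show ?thesis unfolding EL_def[abs_def] e
    by (intro linear_compose_sub[OF e1] linear_compose_sum ballI e2)
qed

lemma euler_lagrange_EL:
  "(let Lc = lagrangian_coord X Y \<pi> L (c, \<psi>); s = snd (jet_chart X Y \<pi> (c, \<psi>)) \<circ> jet_prolong X Y \<phi> \<circ> cinv c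
    in dirderiv Lc (s (snd c x)) (0, b, 0) -
      (\<Sum>\<mu>\<in>UNIV. dirderiv (\<lambda>p. dirderiv Lc (s p) (0, 0, axis \<mu> b)) (snd c x) (axis \<mu> 1)) = 0) \<longleftrightarrow> EL c \<psi> secg secp b = 0"
proof -
  let ?s = "jc c \<psi> \<circ> jet_prolong X Y \<phi> \<circ> cinv c"
  have s: "?s p = jet_coord secg p" if p: "p \<in> secU W \<phi> c \<psi>" for p
  proof -
    obtain x' where x': "x' \<in> W" "\<phi> x' \<in> fst \<psi>" "p = snd c x'" using secU_point[OF sec k p] .
    show ?thesis unfolding o_apply x'(3) sec_coord(2)[OF sec k x'(1,2)] by (rule sec_jet(2)[OF sec k x'(1,2)])
  qed
  have "\<forall>\<^sub>F p in nhds secp. p \<in> secU W \<phi> c \<psi>" by (rule eventually_nhds_in_open[OF open_secU[OF sec k] sec_coord(1)[OF sec k x]])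
  then have ev: "\<forall>\<^sub>F p in nhds secp. dirderiv (Lc c \<psi>) (?s p) v = dirderiv (Lc c \<psi>) (jet_coord secg p) v" for v
    by eventually_elim (simp only: s)
  have "dirderiv (\<lambda>p. dirderiv (Lc c \<psi>) (?s p) v) secp u = dirderiv (\<lambda>p. dirderiv (Lc c \<psi>) (jet_coord secg p) v) secp u" for u v
    by (rule dirderiv_cong_ev[OF tvs_normed ev])
  then show ?thesis
    unfolding EL_def Let_def Lc_def[OF k, symmetric] jc_def[OF k, symmetric] s[OF sec_coord(1)[OF sec k x]] by simp
qed

context
  fixes \<xi> N \<Xi> \<Xi>' assumes fd: "flow_data \<xi> \<psi> (\<phi> x) N \<Xi> \<Xi>'"
begin

lemma lie_deriv_coord:
  "lie_deriv_section X Y Exp actX actY \<xi> \<phi> x = frame Y \<psi> (\<phi> x)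
    (0, - (snd (\<Xi> (secp, secg secp)) - dirderiv secg secp (fst (\<Xi> (secp, secg secp)))))"
proof -
  let ?q = "(secp, secg secp)"
  have q: "snd \<psi> (\<phi> x) = ?q" by (rule sec_coord(3)[OF sec k x])
  have px: "\<pi> (\<phi> x) = x" by (rule secD(3)[OF sec x(1)])
  note F = flN[OF k x(2) fd]
  note g = generators(1,2)[OF k x(2) fd x(2) F(2), unfolded px q]
  have cf: "coframe X c x (frame X c x u) = u" for u using frX(3)[OF k x(2)] unfolding px .
  have "lie_deriv_section X Y Exp actX actY \<xi> \<phi> x =
      frame Y \<psi> (\<phi> x) (fst (\<Xi> ?q), dirderiv secg secp (fst (\<Xi> ?q))) - frame Y \<psi> (\<phi> x) (\<Xi> ?q)"
    unfolding lie_deriv_section_def g sec_tmap[OF sec k x] cf ..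
  also have "\<dots> = frame Y \<psi> (\<phi> x) ((fst (\<Xi> ?q), dirderiv secg secp (fst (\<Xi> ?q))) - \<Xi> ?q)"
    by (rule linear_diff[OF frY(1)[OF k x(2)], symmetric])
  also have "(fst (\<Xi> ?q), dirderiv secg secp (fst (\<Xi> ?q))) - \<Xi> ?q = (0, - (snd (\<Xi> ?q) - dirderiv secg secp (fst (\<Xi> ?q))))"
    by (simp add: prod_eq_iff)
  finally show ?thesis .
qed

text \<open>The flow data chosen at \<open>\<phi> x\<close> also serve nearby points of the section,
  so the coordinate formula for the current holds near \<open>x\<close> and may be differentiated;
  the result is its divergence times the volume form.\<close>

lemma extd_momentum:
  assumes eqv: "equivariant X Y \<pi> G actX actY L" and l: "length vs = CARD('m)"
  shows "extd X (pullback_form X (jet_atlas X Y \<pi>) (jet_prolong X Y \<phi>) (lagrangian_momentum X Y \<pi> L Exp actY \<xi>)) x vs =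
    - EL c \<psi> secg secp (snd (\<Xi> (secp, secg secp)) - dirderiv secg secp (fst (\<Xi> (secp, secg secp)))) *
      vol (map (dirderiv (snd c \<circ> cinv (chart_at X x)) (snd (chart_at X x) x)) vs)"
proof -
  let ?a = "chart_at X x" let ?\<tau> = "snd c \<circ> cinv ?a" let ?p = secp let ?f = secg
  have q: "snd \<psi> (\<phi> x) = (?p, ?f ?p)" by (rule sec_coord(3)[OF sec k x])
  have xX: "x \<in> mpoints X" by (rule secD(1)[OF sec x(1)])
  note F = flN[OF k x(2) fd]
  have a: "?a \<in> max_atlas X" "x \<in> fst ?a" by (rule chart_at_max[OF X xX], rule conjunct2[OF chart_at[OF xX]])
  note C = C2on_transition[OF X a(1) fib_chartsD(1)[OF k]]
  have xT: "snd ?a x \<in> snd ?a ` (fst ?a \<inter> fst c)" using a(2) sec_fst[OF sec k x] by simp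
  have cx: "cinv ?a (snd ?a x) = x" by (rule cinv_chart[OF max_atlasD(1)[OF a(1)] a(2)])
  have \<tau>x: "?\<tau> (snd ?a x) = ?p" by (simp add: cx)
  obtain P' where P': "((\<lambda>y. Lc c \<psi> (jet_coord ?f y) *\<^sub>R fst (\<Xi> (y, ?f y)) +
      (\<chi> \<mu>. dirderiv (Lc c \<psi>) (jet_coord ?f y) (0, 0, axis \<mu> (snd (\<Xi> (y, ?f y)) - dirderiv ?f y (fst (\<Xi> (y, ?f y))))))) has_derivative P') (at ?p)"
    "tr P' = - (dirderiv (Lc c \<psi>) (jet_coord ?f ?p) (0, snd (\<Xi> (?p, ?f ?p)) - dirderiv ?f ?p (fst (\<Xi> (?p, ?f ?p))), 0) -
      (\<Sum>\<mu>\<in>UNIV. dirderiv (\<lambda>y. dirderiv (Lc c \<psi>) (jet_coord ?f y) (0, 0, axis \<mu> (snd (\<Xi> (?p, ?f ?p)) - dirderiv ?f ?p (fst (\<Xi> (?p, ?f ?p)))))) ?p (axis \<mu> 1)))"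
    using divergence_identity[OF fdf C2_secf[OF sec k] sec_coord(1)[OF sec k x] C2_Lc[OF k] sec_jdom F(10)[OF F(2), unfolded q]
        infinitesimal_equivariance[OF eqv sec k x fd]] .
  \<comment> \<open>By continuity of the section, nearby points stay where \<open>\<Xi>\<close> is
    the generator.\<close>
  have ev0: "\<forall>\<^sub>F z in nhds ?p. (0, snd \<psi> (\<phi> (cinv c z))) \<in> N"
  proof -
    let ?g = "snd \<psi> \<circ> \<phi> \<circ> cinv c"
    have "isCont ?g ?p" by (rule C2on_isCont[OF C2_sec[OF sec fib_chartsD(1,2)[OF k]] sec_coord(1)[OF sec k x]])
    then have "(?g \<longlongrightarrow> ?g ?p) (nhds ?p)" unfolding isCont_def tendsto_at_iff_tendsto_nhds .
    from tendsto_Pair[OF tendsto_const this, of "0::real"]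
    have "((\<lambda>z. (0::real, ?g z)) \<longlongrightarrow> (0, ?g ?p)) (nhds ?p)" .
    from topological_tendstoD[OF this F(1)] show ?thesis
      using F(2) by (simp add: sec_coord(2)[OF sec k x])
  qed
  note e1 = eventually_chart[OF X xX fib_chartsD(1)[OF k] sec_fst[OF sec k x] ev0]
  have Nev: "\<forall>\<^sub>F z in nhds (snd ?a x). pullback_form euc X (cinv ?a) (pullback_form X (jet_atlas X Y \<pi>) (jet_prolong X Y \<phi>)
      (lagrangian_momentum X Y \<pi> L Exp actY \<xi>)) z us =
    vol ((Lc c \<psi> (jet_coord ?f (?\<tau> z)) *\<^sub>R fst (\<Xi> (?\<tau> z, ?f (?\<tau> z))) +
       (\<chi> \<mu>. dirderiv (Lc c \<psi>) (jet_coord ?f (?\<tau> z)) (0, 0, axis \<mu> (snd (\<Xi> (?\<tau> z, ?f (?\<tau> z))) - dirderiv ?f (?\<tau> z) (fst (\<Xi> (?\<tau> z, ?f (?\<tau> z))))))))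
      # map (dirderiv ?\<tau> z) us)" if us: "Suc (length us) = CARD('m)" for us
    using e1 sec_eventually[OF sec x k]
  proof eventually_elim
    case (elim z)
    then obtain x' where x': "x' \<in> fst ?a" "z = snd ?a x'" by (elim conjE imageE IntE) simp
    have cz: "cinv ?a z = x'" unfolding x'(2) by (rule cinv_chart[OF max_atlasD(1)[OF a(1)] x'(1)])
    have w: "x' \<in> W" "\<phi> x' \<in> fst \<psi>" "(0, snd \<psi> (\<phi> x')) \<in> N" using elim unfolding cz by simp_all
    show ?case
      using momentum_coord[OF sec k x(2) fd a(1) x'(1) w us] unfolding o_apply cz x'(2)[symmetric] .
  qed
  have "extd X (pullback_form X (jet_atlas X Y \<pi>) (jet_prolong X Y \<phi>) (lagrangian_momentum X Y \<pi> L Exp actY \<xi>)) x vs =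
      tr P' * vol (map (dirderiv ?\<tau> (snd ?a x)) vs)"
    unfolding extd_def Let_def
    by (rule extd_contracted_vol[OF C xT P'(1)[folded \<tau>x] l]) (rule Nev)
  then show ?thesis unfolding P'(2) EL_def .
qed

end

end

theorem euler_lagrange_iff_conservation:
  assumes eqv: "equivariant X Y \<pi> G actX actY L" and vt: "vertically_transitive X Y \<pi> Exp actX actY"
    and sec: "local_section X Y \<pi> W \<phi>" and B: "span B = UNIV"
  shows "euler_lagrange X Y \<pi> B L W \<phi> \<longleftrightarrow> (\<forall>\<xi>. \<forall>x\<in>W. \<forall>vs. length vs = CARD('m) \<longrightarrow>
    extd X (pullback_form X (jet_atlas X Y \<pi>) (jet_prolong X Y \<phi>) (lagrangian_momentum X Y \<pi> L Exp actY \<xi>)) x vs = 0)"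
    (is "_ \<longleftrightarrow> (\<forall>\<xi>. \<forall>x\<in>W. \<forall>vs. _ \<longrightarrow> ?d \<xi> x vs = 0)")
proof (intro iffI allI ballI impI)
  fix \<xi> x and vs :: "(real^'m) list"
  assume el: "euler_lagrange X Y \<pi> B L W \<phi>" and x: "x \<in> W" and l: "length vs = CARD('m)"
  obtain c \<psi> where k: "(c, \<psi>) \<in> fib_charts X Y \<pi>" "\<phi> x \<in> fst \<psi>" using fib[OF secD(2)[OF sec x]] by blast
  obtain N \<Xi> \<Xi>' where fd: "flow_data \<xi> \<psi> (\<phi> x) N \<Xi> \<Xi>'" using flow_data_exists[OF fib_chartsD(2)[OF k(1)] k(2)] .
  have "EL c \<psi> (secf \<phi> c \<psi>) (snd c x) b = 0" if "b \<in> B" for b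
    using mp[OF bspec[OF bspec[OF el[unfolded euler_lagrange_def] k(1), unfolded prod.case] x] k(2)] that
    unfolding euler_lagrange_EL[OF sec k(1) x k(2)] by (rule bspec)
  \<comment> \<open>From the basis to all fiber vectors by linearity.\<close>
  then have "EL c \<psi> (secf \<phi> c \<psi>) (snd c x) b = 0" for b
    using linear_eq_0_on_span[OF linear_EL[OF sec k(1) x k(2)], of B b] B by simp
  then show "?d \<xi> x vs = 0" unfolding extd_momentum[OF sec k(1) x k(2) fd eqv l] by simp
next
  assume d: "\<forall>\<xi>. \<forall>x\<in>W. \<forall>vs. length vs = CARD('m) \<longrightarrow> ?d \<xi> x vs = 0"
  show "euler_lagrange X Y \<pi> B L W \<phi>"
    unfolding euler_lagrange_def
  proof (intro ballI, unfold split_paired_all prod.case, intro ballI impI)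
    fix c \<psi> x b
    assume k: "(c, \<psi>) \<in> fib_charts X Y \<pi>" and x: "x \<in> W" "\<phi> x \<in> fst \<psi>"
    have px: "\<pi> (\<phi> x) = x" by (rule secD(3)[OF sec x(1)])
    \<comment> \<open>The sign compensates for the Lie derivative of the section being minus the
      characteristic.\<close>
    have "frame Y \<psi> (\<phi> x) (0, - b) \<in> vertical X Y \<pi> (\<phi> x)" unfolding vertical_iff[OF k x(2)] frY(3)[OF k x(2)] by simp
    moreover have "range (\<lambda>\<xi>. lie_deriv_section X Y Exp actX actY \<xi> \<phi> x) = vertical X Y \<pi> (\<phi> x)"
      using vt secD[OF sec x(1)] sec x(1) unfolding vertically_transitive_def by simp
    ultimately have "frame Y \<psi> (\<phi> x) (0, - b) \<in> range (\<lambda>\<xi>. lie_deriv_section X Y Exp actX actY \<xi> \<phi> x)" by simp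
    then obtain \<xi> where \<xi>: "frame Y \<psi> (\<phi> x) (0, - b) = lie_deriv_section X Y Exp actX actY \<xi> \<phi> x" by (rule rangeE)
    obtain N \<Xi> \<Xi>' where fd: "flow_data \<xi> \<psi> (\<phi> x) N \<Xi> \<Xi>'" using flow_data_exists[OF fib_chartsD(2)[OF k] x(2)] .
    let ?p = "snd c x" and ?f = "secf \<phi> c \<psi>" and ?a = "chart_at X x"
    have "coframe Y \<psi> (\<phi> x) (frame Y \<psi> (\<phi> x) (0, - b)) = coframe Y \<psi> (\<phi> x) (frame Y \<psi> (\<phi> x)
        (0, - (snd (\<Xi> (?p, ?f ?p)) - dirderiv ?f ?p (fst (\<Xi> (?p, ?f ?p))))))"
      unfolding \<xi> lie_deriv_coord[OF sec k x fd] ..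
    note e = this[unfolded frY(3)[OF k x(2)]]
    have b: "snd (\<Xi> (?p, ?f ?p)) - dirderiv ?f ?p (fst (\<Xi> (?p, ?f ?p))) = b"
      using arg_cong[OF e, of "\<lambda>z. - snd z", symmetric] unfolding snd_conv minus_minus .
    have xX: "x \<in> mpoints X" by (rule secD(1)[OF sec x(1)])
    have a: "?a \<in> max_atlas X" "x \<in> fst ?a" by (rule chart_at_max[OF X xX], rule conjunct2[OF chart_at[OF xX]])
    note c = fib_chartsD(1)[OF k] sec_fst[OF sec k x]
    \<comment> \<open>Chosen so that their components in the fibered chart are the coordinate axes,
      where \<open>vol\<close> is \<open>1\<close>.\<close>
    let ?vs = "map (\<lambda>v. coframe X ?a x (frame X c x v)) axes"
    have "dirderiv (snd c \<circ> cinv ?a) (snd ?a x) (coframe X ?a x (frame X c x v)) = v" for v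
      unfolding coframe_frame_transition[OF fdm X c a, symmetric] frame_coframe[OF fdm X a] by (rule coframe_frame[OF fdm X c])
    then have vs: "map (dirderiv (snd c \<circ> cinv ?a) (snd ?a x)) ?vs = axes" by (simp add: o_def)
    have "?d \<xi> x ?vs = 0" using d x(1) by simp
    then have "EL c \<psi> ?f ?p b = 0"
      unfolding extd_momentum[OF sec k x fd eqv, of ?vs, unfolded length_map, OF length_axes] vs b by simp
    then show "let Lc = lagrangian_coord X Y \<pi> L (c, \<psi>); s = snd (jet_chart X Y \<pi> (c, \<psi>)) \<circ> jet_prolong X Y \<phi> \<circ> cinv c
        in dirderiv Lc (s (snd c x)) (0, b, 0) -
          (\<Sum>\<mu>\<in>UNIV. dirderiv (\<lambda>p. dirderiv Lc (s p) (0, 0, axis \<mu> b)) (snd c x) (axis \<mu> 1)) = 0"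
      unfolding euler_lagrange_EL[OF sec k x] .
  qed
qed

end

theorem theorem4p8:
  fixes X :: "('x, real^'m::finite) atlas"
    and Y :: "('y, (real^'m) \<times> 'f::real_normed_vector) atlas"
    and F :: "('p, 'f) atlas"
    and \<pi> :: "'y \<Rightarrow> 'x"
    and B :: "'f set"
    and n :: nat
    and L :: "('m, 'y, 'f) jet \<Rightarrow> (real^'m) list \<Rightarrow> real"
    and G :: "('g, 'z) monoid_scheme"
    and A :: "('g, 'k::{real_vector,topological_ab_group_add,t2_space}) atlas"
    and Exp :: "'k \<Rightarrow> 'g"
    and actX :: "'g \<Rightarrow> 'x \<Rightarrow> 'x"
    and actY :: "'g \<Rightarrow> 'y \<Rightarrow> 'y"
    and W :: "'x set"
    and \<phi> :: "'x \<Rightarrow> 'y"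
  assumes "CARD('m) = n + 1"
    and "oriented_manifold X"
    and "finite B" and "independent B" and "span B = UNIV"
    and "fiber_bundle X Y F \<pi>"
    and "lagrangian_density X Y \<pi> L"
    and "lie_group G A"
    and "exponential_map G A Exp"
    and "bundle_action X Y \<pi> G A actX actY"
    and "vertically_transitive X Y \<pi> Exp actX actY"
    and "equivariant X Y \<pi> G actX actY L"
    and "local_section X Y \<pi> W \<phi>"
  shows "euler_lagrange X Y \<pi> B L W \<phi> \<longleftrightarrow>
    (\<forall>\<xi>. \<forall>x\<in>W. \<forall>vs. length vs = n + 1 \<longrightarrow>
       extd X (pullback_form X (jet_atlas X Y \<pi>) (jet_prolong X Y \<phi>)
         (lagrangian_momentum X Y \<pi> L Exp actY \<xi>)) x vs = 0)"
proof -
  have surj: "\<pi> ` mpoints Y = mpoints X" and X: "smooth_atlas X" and Y: "smooth_atlas Y"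
    using \<open>fiber_bundle X Y F \<pi>\<close> unfolding fiber_bundle_def manifold_def hausdorff_manifold_def by simp_all
  \<comment> \<open>The basis defining the coordinates \<open>y\<^sup>A\<close> also witnesses that
    the fiber is finite-dimensional.\<close>
  have fd: "findim TYPE('f)" unfolding findim_def using \<open>finite B\<close> \<open>span B = UNIV\<close> by blast
  interpret noether X Y \<pi> L G A Exp actX actY
    by unfold_locales (rule X Y fd fib_chart_exists[OF \<open>fiber_bundle X Y F \<pi>\<close>] surj
      \<open>lagrangian_density X Y \<pi> L\<close> \<open>lie_group G A\<close> \<open>exponential_map G A Exp\<close> \<open>bundle_action X Y \<pi> G A actX actY\<close> | assumption)+
  show ?thesis
    using euler_lagrange_iff_conservation[OF \<open>equivariant X Y \<pi> G actX actY L\<close> \<open>vertically_transitive X Y \<pi> Exp actX actY\<close>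
        \<open>local_section X Y \<pi> W \<phi>\<close> \<open>span B = UNIV\<close>]
    unfolding \<open>CARD('m) = n + 1\<close> .
qed

end
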